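(* Let $G=GL(m|n)$ over a field $K$ of characteristic $p>2$, let $l$ be an integer, and let $X(T)^+_l=\{\lambda\in X(T)^+\mid|\lambda|=l\}$. Let $\pi_l=\pi_{X(T)^+_l}:Dist(G)\to S_{X(T)^+_l}$ be the restriction morphism, and let $I_l$ be the superideal of $Dist(G)$ generated by $J_l=Dist(T)\cap\ker\pi_l$. Then $\ker\pi_l=I_l$.
   Context: $K$ is a field of characteristic $p>2$, $m,n\ge1$, $G=GL(m|n)$ with coordinate Hopf superalgebra $K[G]$; left $G$-supermodules are right $K[G]$-supercomodules, $\rho_r$ is the structure on $K[G]$ given by $\Delta_G$. $T$ is the diagonal torus, $X(T)=\mathbb Z^{m+n}$ with basis $\epsilon_i$, $|\lambda|=\sum_i\lambda_i$. $X(T)^+$ is the set of dominant weights ($\lambda_1\ge\dots\ge\lambda_m$, $\lambda_{m+1}\ge\dots\ge\lambda_{m+n}$), ordered by $\mu\unlhd\lambda$ iff $\lambda-\mu$ is a nonnegative integer combination of $\epsilon_i-\epsilon_j$, $i<j$; an ideal is a down-closed subset ($X(T)^+_l$ is an ideal). $L_-(\lambda)$ is the simple socle of $H^0_-(\lambda)=\mathrm{ind}^G_{B^-}K_\lambda$ ($B^-$ lower triangular Borel); irreducible $G$-supermodules are $L_-(\lambda)$, $\Pi L_-(\lambda)$ ($\Pi$ parity shift). For an ideal $\Gamma$, $C_\Gamma=O_\Gamma(K[G])$ is the largest subsupermodule of $(K[G],\rho_r)$ all of whose composition factors are $L_-(\lambda)$ or $\Pi L_-(\lambda)$ with $\lambda\in\Gamma$;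 it is a subsupercoalgebra, and $S_\Gamma=C_\Gamma^*$ is the generalized Schur superalgebra. $Dist(G)=\bigcup_{t\ge0}(K[G]/\mathfrak m^{t+1})^*\subseteq K[G]^*$, $\mathfrak m=\ker\epsilon_G$, is the distribution superalgebra with product $\phi\psi(f)=\sum(-1)^{|\psi||f_1|}\phi(f_1)\psi(f_2)$, $Dist(T)\subseteq Dist(G)$ is that of $T$, and $\pi_\Gamma:Dist(G)\to S_\Gamma$ is $\xi\mapsto\xi|_{C_\Gamma}$. *)

theory Defs
  imports
    Complex_Main
    "HOL-Library.Poly_Mapping"
    "HOL-Library.FuncSet"
    "HOL-Combinatorics.Permutations"
begin

section \<open>The coordinate superalgebra of GL(m|n)\<close>

text \<open>
  The numbers m and n are the cardinalities of two finite linearly ordered types \<open>'m\<close> and \<open>'n\<close>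
  (so m, n \<open>\<ge>\<close> 1).  The index set 1 < ... < m < m+1 < ... < m+n is \<open>'m + 'n\<close>, with every
  \<open>Inl i\<close> preceding every \<open>Inr j\<close>.  Parities are of type \<open>bool\<close>, \<open>True\<close> being odd; addition of
  parities is \<open>(\<noteq>)\<close>.
\<close>

fun idx_less :: "'m::linorder + 'n::linorder \<Rightarrow> 'm + 'n \<Rightarrow> bool" where
  "idx_less (Inl i) (Inl j) = (i < j)"
| "idx_less (Inl i) (Inr j) = True"
| "idx_less (Inr i) (Inl j) = False"
| "idx_less (Inr i) (Inr j) = (i < j)"

definition idx_list :: "('m::{finite,linorder} + 'n::{finite,linorder}) list" where
  "idx_list = map Inl (sorted_list_of_set UNIV) @ map Inr (sorted_list_of_set UNIV)"

definition koszul :: "bool \<Rightarrow> bool \<Rightarrow> 'k::ring_1" where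
  "koszul p q = (if p \<and> q then - 1 else 1)"

datatype ('m, 'n) gen = Coord "'m + 'n" "'m + 'n" | DetInv

fun gen_parity :: "('m, 'n) gen \<Rightarrow> bool" where
  "gen_parity (Coord i j) = (isl i \<noteq> isl j)"
| "gen_parity DetInv = False"

subsection \<open>The free associative algebra on the generators\<close>

datatype 'x word = Word (letters: "'x list")

instantiation word :: (type) monoid_add
begin
definition "0 = Word []"
definition "u + v = Word (letters u @ letters v)"
instance
  by standard (auto simp: zero_word_def plus_word_def)
end

type_synonym ('k, 'm, 'n) free_alg = "('m, 'n) gen word \<Rightarrow>\<^sub>0 'k"

definition free_gen :: "('m, 'n) gen \<Rightarrow> ('k::field, 'm, 'n) free_alg" where
  "free_gen x = Poly_Mapping.single (Word [x]) 1"

definition free_scalar :: "'k \<Rightarrow> ('k::field, 'm, 'n) free_alg" where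
  "free_scalar r = Poly_Mapping.single 0 r"

definition word_parity :: "('m, 'n) gen word \<Rightarrow> bool" where
  "word_parity w = odd (length (filter gen_parity (letters w)))"

lift_definition free_part :: "bool \<Rightarrow> ('k::field, 'm, 'n) free_alg \<Rightarrow> ('k, 'm, 'n) free_alg"
  is "\<lambda>p F w. if word_parity w = p then F w else 0"
  by (erule finite_subset[rotated]) auto

text \<open>
  The determinants of the two even diagonal blocks of the generic matrix.  Their entries commute
  modulo the relations imposed below, so the order of the factors does not matter.
\<close>

definition free_det0 :: "('k::field, 'm::{finite,linorder}, 'n) free_alg" where
  "free_det0 = (\<Sum>\<pi> | \<pi> permutes (UNIV :: 'm set). of_int (sign \<pi>) *
     prod_list (map (\<lambda>i. free_gen (Coord (Inl i) (Inl (\<pi> i)))) (sorted_list_of_set UNIV)))"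

definition free_det1 :: "('k::field, 'm, 'n::{finite,linorder}) free_alg" where
  "free_det1 = (\<Sum>\<pi> | \<pi> permutes (UNIV :: 'n set). of_int (sign \<pi>) *
     prod_list (map (\<lambda>i. free_gen (Coord (Inr i) (Inr (\<pi> i)))) (sorted_list_of_set UNIV)))"

text \<open>
  K[GL(m|n)] is the localization, at the product of the two determinants, of the free
  supercommutative superalgebra K[M(m|n)] on the entries of the generic matrix.  It is presented by
  the entries and an even generator \<open>DetInv\<close>.  In characteristic other than 2 the first relation
  makes the squares of odd generators vanish.
\<close>

inductive_set rel_ideal :: "('k::field, 'm::{finite,linorder}, 'n::{finite,linorder}) free_alg set"
where
  supercomm: "free_gen x * free_gen y -
     koszul (gen_parity x) (gen_parity y) * (free_gen y * free_gen x) \<in> rel_ideal"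
| localize: "free_gen DetInv * (free_det0 * free_det1) - 1 \<in> rel_ideal"
| zero: "0 \<in> rel_ideal"
| add: "F \<in> rel_ideal \<Longrightarrow> F' \<in> rel_ideal \<Longrightarrow> F + F' \<in> rel_ideal"
| left: "F \<in> rel_ideal \<Longrightarrow> H * F \<in> rel_ideal"
| right: "F \<in> rel_ideal \<Longrightarrow> F * H \<in> rel_ideal"

lemma rel_ideal_uminus: "F \<in> rel_ideal \<Longrightarrow> - F \<in> rel_ideal"
  using rel_ideal.left[of F "- 1"] by simp

lemma rel_ideal_diff: "F \<in> rel_ideal \<Longrightarrow> F' \<in> rel_ideal \<Longrightarrow> F - F' \<in> rel_ideal"
  using rel_ideal.add[of F "- F'"] rel_ideal_uminus[of F'] by simp

text \<open>The evaluation of noncommutative polynomials at the identity matrix.\<close>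

fun gen_at_one :: "('m, 'n) gen \<Rightarrow> 'k::field" where
  "gen_at_one (Coord i j) = (if i = j then 1 else 0)"
| "gen_at_one DetInv = 1"

definition free_counit :: "('k::field, 'm, 'n) free_alg \<Rightarrow> 'k" where
  "free_counit F = (\<Sum>w\<in>Poly_Mapping.keys F.
     Poly_Mapping.lookup F w * prod_list (map gen_at_one (letters w)))"

lemma free_counit_superset:
  assumes "finite A" "Poly_Mapping.keys F \<subseteq> A"
  shows "free_counit F = (\<Sum>w\<in>A. Poly_Mapping.lookup F w * prod_list (map gen_at_one (letters w)))"
  unfolding free_counit_def
  by (rule sum.mono_neutral_left) (use assms in \<open>auto simp: in_keys_iff\<close>)

lemma free_counit_add: "free_counit (F + H) = free_counit F + free_counit H"
proof -
  let ?A = "Poly_Mapping.keys F \<union> Poly_Mapping.keys H"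
  have "free_counit (F + H) = (\<Sum>w\<in>?A. Poly_Mapping.lookup (F + H) w * prod_list (map gen_at_one (letters w)))"
    by (rule free_counit_superset) (simp_all add: Poly_Mapping.keys_add)
  also have "\<dots> = free_counit F + free_counit H"
    by (simp add: free_counit_superset[of ?A] lookup_add distrib_right sum.distrib)
  finally show ?thesis .
qed

lemma free_counit_0 [simp]: "free_counit 0 = 0"
  by (simp add: free_counit_def)

lemma free_counit_sum: "free_counit (sum f A) = (\<Sum>a\<in>A. free_counit (f a))"
  by (induction A rule: infinite_finite_induct) (simp_all add: free_counit_add)

lemma free_counit_single:
  "free_counit (Poly_Mapping.single w r) = r * prod_list (map gen_at_one (letters w))"
  by (simp add: free_counit_def)

lemma free_counit_1 [simp]: "free_counit 1 = 1"
  unfolding single_one[symmetric] by (simp add: free_counit_single zero_word_def del: single_one)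

lemma free_counit_gen [simp]: "free_counit (free_gen x) = gen_at_one x"
  by (simp add: free_gen_def free_counit_single)

lemma sum_singles: "(\<Sum>u\<in>Poly_Mapping.keys F. Poly_Mapping.single u (Poly_Mapping.lookup F u)) = F"
proof (rule poly_mapping_eqI)
  fix w
  have "(\<Sum>u\<in>Poly_Mapping.keys F. Poly_Mapping.lookup (Poly_Mapping.single u (Poly_Mapping.lookup F u)) w)
      = (\<Sum>u\<in>Poly_Mapping.keys F. if u = w then Poly_Mapping.lookup F w else 0)"
    by (rule sum.cong) (auto simp: lookup_single when_def)
  then show "Poly_Mapping.lookup (\<Sum>u\<in>Poly_Mapping.keys F. Poly_Mapping.single u (Poly_Mapping.lookup F u)) w
      = Poly_Mapping.lookup F w"
    by (simp add: lookup_sum in_keys_iff)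
qed

lemma free_counit_mult: "free_counit (F * H) = free_counit F * free_counit H"
proof -
  have "F * H = (\<Sum>u\<in>Poly_Mapping.keys F. Poly_Mapping.single u (Poly_Mapping.lookup F u)) *
                (\<Sum>v\<in>Poly_Mapping.keys H. Poly_Mapping.single v (Poly_Mapping.lookup H v))"
    by (simp add: sum_singles)
  also have "free_counit \<dots> = free_counit F * free_counit H"
    by (simp add: sum_product free_counit_sum mult_single free_counit_single plus_word_def
        free_counit_def[of F] free_counit_def[of H] ac_simps)
  finally show ?thesis .
qed

lemma free_counit_uminus: "free_counit (- F) = - free_counit F"
  using free_counit_add[of F "- F"] by (simp add: eq_neg_iff_add_eq_0 add.commute)

lemma free_counit_diff: "free_counit (F - H) = free_counit F - free_counit H"
  using free_counit_add[of F "- H"] by (simp add: free_counit_uminus)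

lemma free_counit_of_int: "free_counit (of_int z) = of_int z"
proof -
  have "free_counit (of_nat n) = of_nat n" for n
    by (induction n) (simp_all add: free_counit_add)
  then show ?thesis
    by (cases z rule: int_cases2) (simp_all add: free_counit_uminus)
qed

lemma free_counit_prod_list: "free_counit (prod_list Fs) = prod_list (map free_counit Fs)"
  by (induction Fs) (simp_all add: free_counit_mult)

lemma det_at_one:
  fixes f :: "'m::{finite,linorder} \<Rightarrow> 'i"
  assumes "inj f"
  shows "(\<Sum>\<pi> | \<pi> permutes (UNIV :: 'm set). of_int (sign \<pi>) *
     prod_list (map (\<lambda>i. if f i = f (\<pi> i) then 1 else 0) (sorted_list_of_set UNIV))) = (1 :: 'k::field)"
proof -
  have "of_int (sign \<pi>) * prod_list (map (\<lambda>i. if f i = f (\<pi> i) then 1 else 0) (sorted_list_of_set UNIV))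
      = (if \<pi> = id then 1 else 0 :: 'k)" for \<pi> :: "'m \<Rightarrow> 'm"
  proof (cases "\<pi> = id")
    case False
    then obtain i where "i \<noteq> \<pi> i" by fastforce
    then have "f i \<noteq> f (\<pi> i)" using assms by (simp add: inj_eq)
    then have "0 \<in> set (map (\<lambda>i. if f i = f (\<pi> i) then 1 else (0::'k)) (sorted_list_of_set UNIV))"
      by force
    then show ?thesis using False by (simp add: prod_list_zero_iff)
  next
    case True
    have "prod_list (map (\<lambda>i. 1 :: 'k) xs) = 1" for xs :: "'m list"
      by (induction xs) auto
    then show ?thesis using True by simp
  qed
  then show ?thesis by (simp add: permutes_id id_def[symmetric])
qed

lemma free_counit_rel_ideal:
  fixes F :: "('k::field, 'm::{finite,linorder}, 'n::{finite,linorder}) free_alg"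
  shows "F \<in> rel_ideal \<Longrightarrow> free_counit F = 0"
proof (induction rule: rel_ideal.induct)
  case (supercomm x y)
  have "gen_parity z \<Longrightarrow> gen_at_one z = (0::'k)" for z :: "('m, 'n) gen"
    by (cases z) auto
  then show ?case
    by (auto simp: koszul_def free_counit_diff free_counit_mult free_counit_uminus)
next
  case localize
  have "free_counit (free_det0 :: ('k, 'm, 'n) free_alg) = 1"
    using det_at_one[of "Inl :: 'm \<Rightarrow> 'm + 'n", where 'k = 'k]
    by (simp add: free_det0_def free_counit_sum free_counit_mult free_counit_of_int
        free_counit_prod_list comp_def)
  moreover have "free_counit (free_det1 :: ('k, 'm, 'n) free_alg) = 1"
    using det_at_one[of "Inr :: 'n \<Rightarrow> 'm + 'n", where 'k = 'k]
    by (simp add: free_det1_def free_counit_sum free_counit_mult free_counit_of_int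
        free_counit_prod_list comp_def)
  ultimately show ?case
    by (simp add: free_counit_diff free_counit_mult)
qed (simp_all add: free_counit_add free_counit_mult)

text \<open>The relations are homogeneous, so the parity grading descends to the quotient.\<close>

definition free_homogeneous :: "bool \<Rightarrow> ('k::field, 'm, 'n) free_alg \<Rightarrow> bool" where
  "free_homogeneous p F \<longleftrightarrow> (\<forall>w\<in>Poly_Mapping.keys F. word_parity w = p)"

lemma word_parity_0 [simp]: "word_parity 0 = False"
  by (simp add: word_parity_def zero_word_def)

lemma word_parity_plus: "word_parity (u + v) = (word_parity u \<noteq> word_parity v)"
  by (auto simp: word_parity_def plus_word_def)

lemma free_homogeneous_0: "free_homogeneous p 0"
  by (simp add: free_homogeneous_def)

lemma free_homogeneous_add:
  "free_homogeneous p F \<Longrightarrow> free_homogeneous p H \<Longrightarrow> free_homogeneous p (F + H)"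
  unfolding free_homogeneous_def using Poly_Mapping.keys_add[of F H] by auto

lemma free_homogeneous_uminus: "free_homogeneous p F \<Longrightarrow> free_homogeneous p (- F)"
  by (simp add: free_homogeneous_def)

lemma free_homogeneous_diff:
  "free_homogeneous p F \<Longrightarrow> free_homogeneous p H \<Longrightarrow> free_homogeneous p (F - H)"
  using free_homogeneous_add[of p F "- H"] by (simp add: free_homogeneous_uminus)

lemma free_homogeneous_sum:
  "(\<And>a. a \<in> A \<Longrightarrow> free_homogeneous p (f a)) \<Longrightarrow> free_homogeneous p (sum f A)"
  by (induction A rule: infinite_finite_induct)
    (simp_all add: free_homogeneous_0 free_homogeneous_add)

lemma free_homogeneous_mult:
  "free_homogeneous p F \<Longrightarrow> free_homogeneous q H \<Longrightarrow> free_homogeneous (p \<noteq> q) (F * H)"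
  unfolding free_homogeneous_def using keys_mult[of F H] by (force simp: word_parity_plus)

lemma free_homogeneous_gen: "free_homogeneous (gen_parity x) (free_gen x)"
  by (simp add: free_homogeneous_def free_gen_def word_parity_def)

lemma free_homogeneous_1: "free_homogeneous False 1"
  unfolding free_homogeneous_def single_one[symmetric] by (simp del: single_one)

lemma free_homogeneous_of_nat: "free_homogeneous False (of_nat n)"
  by (induction n) (simp_all add: free_homogeneous_0 free_homogeneous_add free_homogeneous_1)

lemma free_homogeneous_of_int: "free_homogeneous False (of_int z)"
  by (cases z rule: int_cases2)
    (simp_all add: free_homogeneous_uminus free_homogeneous_of_nat)

lemma free_homogeneous_prod_list:
  "(\<And>F. F \<in> set Fs \<Longrightarrow> free_homogeneous False F) \<Longrightarrow> free_homogeneous False (prod_list Fs)"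
  by (induction Fs) (simp_all add: free_homogeneous_1 free_homogeneous_mult[of False _ False, simplified])

lemma free_homogeneous_det:
  "free_homogeneous False free_det0" "free_homogeneous False free_det1"
proof -
  have "free_homogeneous False (free_gen (Coord (Inl i) (Inl j)))"
       "free_homogeneous False (free_gen (Coord (Inr k) (Inr l)))" for i j k l
    using free_homogeneous_gen[of "Coord (Inl i) (Inl j)"]
          free_homogeneous_gen[of "Coord (Inr k) (Inr l)"] by simp_all
  then show "free_homogeneous False free_det0" "free_homogeneous False free_det1"
    unfolding free_det0_def free_det1_def
    by (auto intro!: free_homogeneous_sum free_homogeneous_prod_list
        free_homogeneous_mult[of False _ False, simplified] free_homogeneous_of_int)
qed

lemma free_part_lookup:
  "Poly_Mapping.lookup (free_part p F) w = (if word_parity w = p then Poly_Mapping.lookup F w else 0)"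
  by transfer simp

lemma free_part_add: "free_part p (F + H) = free_part p F + free_part p H"
  by (rule poly_mapping_eqI) (simp add: free_part_lookup lookup_add)

lemma free_part_diff: "free_part p (F - H) = free_part p F - free_part p H"
  by (rule poly_mapping_eqI) (simp add: free_part_lookup lookup_minus)

lemma free_part_split: "free_part True F + free_part False F = F"
  by (rule poly_mapping_eqI) (simp add: free_part_lookup lookup_add)

lemma free_part_homogeneous:
  "free_homogeneous q F \<Longrightarrow> free_part p F = (if p = q then F else 0)"
  by (rule poly_mapping_eqI) (auto simp: free_part_lookup free_homogeneous_def in_keys_iff)

lemma free_homogeneous_part: "free_homogeneous p (free_part p F)"
  by (auto simp: free_homogeneous_def in_keys_iff free_part_lookup split: if_splits)

lemma free_part_mult:
  "free_part p (F * H) = free_part True F * free_part (\<not> p) H + free_part False F * free_part p H"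
proof -
  have *: "free_part p (free_part q F * free_part r H) =
        (if p = (q \<noteq> r) then free_part q F * free_part r H else 0)" for q r
    by (rule free_part_homogeneous) (intro free_homogeneous_mult free_homogeneous_part)
  have "free_part p (F * H) =
      free_part p ((free_part True F + free_part False F) * (free_part True H + free_part False H))"
    by (simp only: free_part_split)
  then show ?thesis
    using *[of True True] *[of True False] *[of False True] *[of False False]
    by (cases p) (simp_all add: distrib_left distrib_right free_part_add)
qed

lemma free_part_rel_ideal: "F \<in> rel_ideal \<Longrightarrow> free_part p F \<in> rel_ideal"
proof (induction arbitrary: p rule: rel_ideal.induct)
  case (supercomm x y)
  have "free_homogeneous (gen_parity x \<noteq> gen_parity y) (free_gen y * free_gen x)"
    using free_homogeneous_mult[OF free_homogeneous_gen free_homogeneous_gen, of y x]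
    by (cases "gen_parity x"; cases "gen_parity y") simp_all
  then have "free_homogeneous (gen_parity x \<noteq> gen_parity y)
      (koszul (gen_parity x) (gen_parity y) * (free_gen y * free_gen x))"
    by (auto simp: koszul_def dest: free_homogeneous_uminus)
  then have "free_homogeneous (gen_parity x \<noteq> gen_parity y) (free_gen x * free_gen y -
      koszul (gen_parity x) (gen_parity y) * (free_gen y * free_gen x))"
    by (intro free_homogeneous_diff free_homogeneous_mult[OF free_homogeneous_gen free_homogeneous_gen])
  note eq = free_part_homogeneous[OF this]
  show ?case
    unfolding eq using rel_ideal.supercomm[of x y] rel_ideal.zero by metis
next
  case localize
  have "free_homogeneous False (free_det0 * free_det1)"
    using free_homogeneous_mult[OF free_homogeneous_det] by simp
  then have "free_homogeneous False (free_gen DetInv * (free_det0 * free_det1))"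
    using free_homogeneous_mult[OF free_homogeneous_gen[of DetInv]] by fastforce
  then have "free_homogeneous False (free_gen DetInv * (free_det0 * free_det1) - 1)"
    by (intro free_homogeneous_diff free_homogeneous_1)
  note eq = free_part_homogeneous[OF this]
  show ?case
    unfolding eq using rel_ideal.localize rel_ideal.zero by metis
next
  case zero
  show ?case by (simp add: free_part_homogeneous[OF free_homogeneous_0[of p]] rel_ideal.zero)
qed (auto simp: free_part_add free_part_mult intro: rel_ideal.intros)

quotient_type (overloaded) ('k, 'm, 'n) KG =
  "('k::field, 'm::{finite,linorder}, 'n::{finite,linorder}) free_alg"
  / "\<lambda>F F'. F - F' \<in> rel_ideal"
proof (rule equivpI)
  show "reflp (\<lambda>F F'. F - F' \<in> rel_ideal)"
    by (simp add: reflp_def rel_ideal.zero)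
  show "symp (\<lambda>F F'. F - F' \<in> rel_ideal)"
    unfolding symp_def using rel_ideal_uminus by fastforce
  show "transp (\<lambda>F F'. F - F' \<in> rel_ideal)"
    unfolding transp_def using rel_ideal.add by fastforce
qed

instantiation KG :: (field, "{finite,linorder}", "{finite,linorder}") ring_1
begin

lift_definition zero_KG :: "('a, 'b, 'c) KG" is 0 .
lift_definition one_KG :: "('a, 'b, 'c) KG" is 1 .
lift_definition plus_KG :: "('a, 'b, 'c) KG \<Rightarrow> ('a, 'b, 'c) KG \<Rightarrow> ('a, 'b, 'c) KG" is "(+)"
proof -
  fix F1 F2 H1 H2 :: "('a, 'b, 'c) free_alg"
  assume "F1 - F2 \<in> rel_ideal" "H1 - H2 \<in> rel_ideal"
  then have "(F1 - F2) + (H1 - H2) \<in> rel_ideal"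
    by (rule rel_ideal.add)
  then show "F1 + H1 - (F2 + H2) \<in> rel_ideal"
    by (simp only: add_diff_add)
qed
lift_definition uminus_KG :: "('a, 'b, 'c) KG \<Rightarrow> ('a, 'b, 'c) KG" is uminus
proof -
  fix F H :: "('a, 'b, 'c) free_alg"
  assume "F - H \<in> rel_ideal"
  then have "- (F - H) \<in> rel_ideal"
    by (rule rel_ideal_uminus)
  then show "- F - - H \<in> rel_ideal"
    by (simp only: minus_diff_minus)
qed
lift_definition minus_KG :: "('a, 'b, 'c) KG \<Rightarrow> ('a, 'b, 'c) KG \<Rightarrow> ('a, 'b, 'c) KG" is "(-)"
proof -
  fix F1 F2 H1 H2 :: "('a, 'b, 'c) free_alg"
  assume "F1 - F2 \<in> rel_ideal" "H1 - H2 \<in> rel_ideal"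
  then have "(F1 - F2) - (H1 - H2) \<in> rel_ideal"
    by (rule rel_ideal_diff)
  then show "F1 - H1 - (F2 - H2) \<in> rel_ideal"
    by (simp add: algebra_simps)
qed
lift_definition times_KG :: "('a, 'b, 'c) KG \<Rightarrow> ('a, 'b, 'c) KG \<Rightarrow> ('a, 'b, 'c) KG" is "(*)"
proof -
  fix F1 F2 H1 H2 :: "('a, 'b, 'c) free_alg"
  assume "F1 - F2 \<in> rel_ideal" "H1 - H2 \<in> rel_ideal"
  then have "F1 * (H1 - H2) + (F1 - F2) * H2 \<in> rel_ideal"
    by (intro rel_ideal.add rel_ideal.left rel_ideal.right)
  then show "F1 * H1 - F2 * H2 \<in> rel_ideal"
    by (simp add: algebra_simps)
qed

instance
proof
  fix a b c :: "('a, 'b, 'c) KG"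
  show "a + b + c = a + (b + c)" by transfer (simp add: add.assoc rel_ideal.zero)
  show "a + b = b + a" by transfer (simp add: add.commute rel_ideal.zero)
  show "0 + a = a" by transfer (simp add: rel_ideal.zero)
  show "- a + a = 0" by transfer (simp add: rel_ideal.zero)
  show "a - b = a + - b" by transfer (simp add: rel_ideal.zero)
  show "a * b * c = a * (b * c)" by transfer (simp add: mult.assoc rel_ideal.zero)
  show "1 * a = a" by transfer (simp add: rel_ideal.zero)
  show "a * 1 = a" by transfer (simp add: rel_ideal.zero)
  show "(a + b) * c = a * c + b * c" by transfer (simp add: distrib_right rel_ideal.zero)
  show "a * (b + c) = a * b + a * c" by transfer (simp add: distrib_left rel_ideal.zero)
  show "(0 :: ('a, 'b, 'c) KG) \<noteq> 1"
    by transfer (auto dest: free_counit_rel_ideal simp: free_counit_diff free_counit_uminus)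
qed

end

subsection \<open>Superspace structure\<close>

lift_definition kg_scale :: "'k::field \<Rightarrow> ('k, 'm::{finite,linorder}, 'n::{finite,linorder}) KG \<Rightarrow> ('k, 'm, 'n) KG"
  is "\<lambda>r F. free_scalar r * F"
  unfolding right_diff_distrib[symmetric] by (rule rel_ideal.left)

lift_definition coord :: "'m + 'n \<Rightarrow> 'm + 'n \<Rightarrow> ('k::field, 'm::{finite,linorder}, 'n::{finite,linorder}) KG"
  is "\<lambda>i j. free_gen (Coord i j)" .

lift_definition det_inv :: "('k::field, 'm::{finite,linorder}, 'n::{finite,linorder}) KG"
  is "free_gen DetInv" .

text \<open>\<open>part p f\<close> is the homogeneous component of \<open>f\<close> of parity \<open>p\<close>.\<close>

lift_definition part :: "bool \<Rightarrow> ('k::field, 'm::{finite,linorder}, 'n::{finite,linorder}) KG \<Rightarrow> ('k, 'm, 'n) KG"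
  is free_part
  unfolding free_part_diff[symmetric] by (rule free_part_rel_ideal)

lift_definition counit :: "('k::field, 'm::{finite,linorder}, 'n::{finite,linorder}) KG \<Rightarrow> 'k"
  is free_counit
  using free_counit_rel_ideal free_counit_diff by (metis eq_iff_diff_eq_0)

lemma vector_space_KG:
  "vector_space (kg_scale :: 'k::field \<Rightarrow> ('k, 'm::{finite,linorder}, 'n::{finite,linorder}) KG \<Rightarrow> _)"
proof
  fix r s :: 'k and f g :: "('k, 'm, 'n) KG"
  show "kg_scale r (f + g) = kg_scale r f + kg_scale r g"
    by transfer (simp add: distrib_left rel_ideal.zero)
  show "kg_scale (r + s) f = kg_scale r f + kg_scale s f"
    by transfer (simp add: free_scalar_def single_add distrib_right rel_ideal.zero)
  show "kg_scale r (kg_scale s f) = kg_scale (r * s) f"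
    by transfer (simp add: free_scalar_def mult.assoc[symmetric] mult_single rel_ideal.zero)
  show "kg_scale 1 f = f"
    by transfer (simp add: free_scalar_def rel_ideal.zero)
qed

interpretation KG: vector_space kg_scale
  by (rule vector_space_KG)

section \<open>The tensor square of the coordinate superalgebra\<close>

inductive_set bilinear_rel ::
  "(('k::field, 'm::{finite,linorder}, 'n::{finite,linorder}) KG \<times> ('k, 'm, 'n) KG \<Rightarrow>\<^sub>0 'k) set"
where
  add_left: "Poly_Mapping.single (f + f', g) r
     - Poly_Mapping.single (f, g) r - Poly_Mapping.single (f', g) r \<in> bilinear_rel"
| add_right: "Poly_Mapping.single (f, g + g') r
     - Poly_Mapping.single (f, g) r - Poly_Mapping.single (f, g') r \<in> bilinear_rel"
| scale_left: "Poly_Mapping.single (kg_scale s f, g) r - Poly_Mapping.single (f, g) (s * r) \<in> bilinear_rel"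
| scale_right: "Poly_Mapping.single (f, kg_scale s g) r - Poly_Mapping.single (f, g) (s * r) \<in> bilinear_rel"
| zero: "0 \<in> bilinear_rel"
| add: "x \<in> bilinear_rel \<Longrightarrow> y \<in> bilinear_rel \<Longrightarrow> x + y \<in> bilinear_rel"

lift_definition free_tensor_scale :: "'k::field \<Rightarrow> ('x \<Rightarrow>\<^sub>0 'k) \<Rightarrow> 'x \<Rightarrow>\<^sub>0 'k"
  is "\<lambda>s F x. s * F x"
  by (erule finite_subset[rotated]) auto

lemma free_tensor_scale_lookup:
  "Poly_Mapping.lookup (free_tensor_scale s F) x = s * Poly_Mapping.lookup F x"
  by transfer simp

lemma free_tensor_scale_add: "free_tensor_scale s (F + H) = free_tensor_scale s F + free_tensor_scale s H"
  by (rule poly_mapping_eqI) (simp add: free_tensor_scale_lookup lookup_add distrib_left)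

lemma free_tensor_scale_diff: "free_tensor_scale s (F - H) = free_tensor_scale s F - free_tensor_scale s H"
  by (rule poly_mapping_eqI) (simp add: free_tensor_scale_lookup lookup_minus right_diff_distrib)

lemma free_tensor_scale_single:
  "free_tensor_scale s (Poly_Mapping.single x r) = Poly_Mapping.single x (s * r)"
  by (rule poly_mapping_eqI) (simp add: free_tensor_scale_lookup lookup_single when_def)

lemma free_tensor_scale_minus_1: "free_tensor_scale (- 1) F = - F"
  by (rule poly_mapping_eqI) (simp add: free_tensor_scale_lookup)

lemma bilinear_rel_scale: "x \<in> bilinear_rel \<Longrightarrow> free_tensor_scale s x \<in> bilinear_rel"
proof (induction rule: bilinear_rel.induct)
  case (scale_left t f g r)
  then show ?case
    using bilinear_rel.scale_left[of t f g "s * r"]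
    by (simp add: free_tensor_scale_diff free_tensor_scale_single ac_simps)
next
  case (scale_right f t g r)
  then show ?case
    using bilinear_rel.scale_right[of f t g "s * r"]
    by (simp add: free_tensor_scale_diff free_tensor_scale_single ac_simps)
next
  case zero
  have "free_tensor_scale s 0 = (0 :: 'b \<Rightarrow>\<^sub>0 'a)" for s :: 'a
    by (rule poly_mapping_eqI) (simp add: free_tensor_scale_lookup)
  then show ?case by (simp add: free_tensor_scale_def bilinear_rel.zero)
qed (simp_all add: free_tensor_scale_diff free_tensor_scale_add free_tensor_scale_single
    bilinear_rel.add_left bilinear_rel.add_right bilinear_rel.add)

lemma bilinear_rel_uminus: "x \<in> bilinear_rel \<Longrightarrow> - x \<in> bilinear_rel"
  using bilinear_rel_scale[of x "- 1"] by (simp add: free_tensor_scale_minus_1)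

lemma bilinear_rel_diff: "x \<in> bilinear_rel \<Longrightarrow> y \<in> bilinear_rel \<Longrightarrow> x - y \<in> bilinear_rel"
  using bilinear_rel.add[of x "- y"] bilinear_rel_uminus[of y] by simp

quotient_type (overloaded) ('k, 'm, 'n) KG2 =
  "('k::field, 'm::{finite,linorder}, 'n::{finite,linorder}) KG \<times> ('k, 'm, 'n) KG \<Rightarrow>\<^sub>0 'k"
  / "\<lambda>x y. x - y \<in> bilinear_rel"
proof (rule equivpI)
  show "reflp (\<lambda>x y. x - y \<in> bilinear_rel)"
    by (simp add: reflp_def bilinear_rel.zero)
  show "symp (\<lambda>x y. x - y \<in> bilinear_rel)"
    unfolding symp_def using bilinear_rel_uminus by fastforce
  show "transp (\<lambda>x y. x - y \<in> bilinear_rel)"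
    unfolding transp_def using bilinear_rel.add by fastforce
qed

instantiation KG2 :: (field, "{finite,linorder}", "{finite,linorder}") ab_group_add
begin

lift_definition zero_KG2 :: "('a, 'b, 'c) KG2" is 0 .
lift_definition plus_KG2 :: "('a, 'b, 'c) KG2 \<Rightarrow> ('a, 'b, 'c) KG2 \<Rightarrow> ('a, 'b, 'c) KG2" is "(+)"
  unfolding add_diff_add by (rule bilinear_rel.add)
lift_definition uminus_KG2 :: "('a, 'b, 'c) KG2 \<Rightarrow> ('a, 'b, 'c) KG2" is uminus
  unfolding minus_diff_minus by (rule bilinear_rel_uminus)
lift_definition minus_KG2 :: "('a, 'b, 'c) KG2 \<Rightarrow> ('a, 'b, 'c) KG2 \<Rightarrow> ('a, 'b, 'c) KG2" is "(-)"
  by (drule (1) bilinear_rel_diff) (simp add: algebra_simps)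

instance
proof
  fix a b c :: "('a, 'b, 'c) KG2"
  show "a + b + c = a + (b + c)" by transfer (simp add: add.assoc bilinear_rel.zero)
  show "a + b = b + a" by transfer (simp add: add.commute bilinear_rel.zero)
  show "0 + a = a" by transfer (simp add: bilinear_rel.zero)
  show "- a + a = 0" by transfer (simp add: bilinear_rel.zero)
  show "a - b = a + - b" by transfer (simp add: bilinear_rel.zero)
qed

end

lift_definition tensor_scale :: "'k::field \<Rightarrow> ('k, 'm::{finite,linorder}, 'n::{finite,linorder}) KG2 \<Rightarrow> ('k, 'm, 'n) KG2"
  is free_tensor_scale
  unfolding free_tensor_scale_diff[symmetric] by (rule bilinear_rel_scale)

definition tensor :: "('k::field, 'm::{finite,linorder}, 'n::{finite,linorder}) KG \<Rightarrow> ('k, 'm, 'n) KG \<Rightarrow> ('k, 'm, 'n) KG2"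
  where "tensor f g = abs_KG2 (Poly_Mapping.single (f, g) 1)"

lemma vector_space_KG2:
  "vector_space (tensor_scale :: 'k::field \<Rightarrow> ('k, 'm::{finite,linorder}, 'n::{finite,linorder}) KG2 \<Rightarrow> _)"
proof
  fix r s :: 'k and x y :: "('k, 'm, 'n) KG2"
  show "tensor_scale r (x + y) = tensor_scale r x + tensor_scale r y"
    by transfer (simp add: free_tensor_scale_add bilinear_rel.zero)
  show "tensor_scale (r + s) x = tensor_scale r x + tensor_scale s x"
  proof transfer
    fix r s :: 'k and F :: "('k, 'm, 'n) KG \<times> ('k, 'm, 'n) KG \<Rightarrow>\<^sub>0 'k"
    have "free_tensor_scale (r + s) F = free_tensor_scale r F + free_tensor_scale s F"
      by (rule poly_mapping_eqI) (simp add: free_tensor_scale_lookup lookup_add distrib_right)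
    then show "free_tensor_scale (r + s) F - (free_tensor_scale r F + free_tensor_scale s F) \<in> bilinear_rel"
      by (simp add: bilinear_rel.zero)
  qed
  show "tensor_scale r (tensor_scale s x) = tensor_scale (r * s) x"
  proof transfer
    fix r s :: 'k and F :: "('k, 'm, 'n) KG \<times> ('k, 'm, 'n) KG \<Rightarrow>\<^sub>0 'k"
    have "free_tensor_scale r (free_tensor_scale s F) = free_tensor_scale (r * s) F"
      by (rule poly_mapping_eqI) (simp add: free_tensor_scale_lookup)
    then show "free_tensor_scale r (free_tensor_scale s F) - free_tensor_scale (r * s) F \<in> bilinear_rel"
      by (simp add: bilinear_rel.zero)
  qed
  show "tensor_scale 1 x = x"
  proof transfer
    fix F :: "('k, 'm, 'n) KG \<times> ('k, 'm, 'n) KG \<Rightarrow>\<^sub>0 'k"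
    have "free_tensor_scale 1 F = F"
      by (rule poly_mapping_eqI) (simp add: free_tensor_scale_lookup)
    then show "free_tensor_scale 1 F - F \<in> bilinear_rel"
      by (simp add: bilinear_rel.zero)
  qed
qed

interpretation KG2: vector_space tensor_scale
  by (rule vector_space_KG2)

text \<open>
  \<open>tensor_lift s B\<close> is the linear map \<open>f \<otimes> g \<mapsto> B f g\<close> induced by a bilinear map \<open>B\<close> into a vector
  space with scalar multiplication \<open>s\<close>; see \<open>linear_tensor_lift\<close> and \<open>tensor_lift_tensor\<close>.
\<close>

definition free_lift ::
  "('k::field \<Rightarrow> 'v \<Rightarrow> 'v) \<Rightarrow> ('x \<Rightarrow> 'x \<Rightarrow> 'v) \<Rightarrow> ('x \<times> 'x \<Rightarrow>\<^sub>0 'k) \<Rightarrow> 'v::ab_group_add" where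
  "free_lift s B F = (\<Sum>fg\<in>Poly_Mapping.keys F. s (Poly_Mapping.lookup F fg) (B (fst fg) (snd fg)))"

definition tensor_lift ::
  "('k::field \<Rightarrow> 'v \<Rightarrow> 'v) \<Rightarrow> (('k, 'm, 'n) KG \<Rightarrow> ('k, 'm, 'n) KG \<Rightarrow> 'v) \<Rightarrow>
     ('k, 'm::{finite,linorder}, 'n::{finite,linorder}) KG2 \<Rightarrow> 'v::ab_group_add" where
  "tensor_lift s B x = free_lift s B (rep_KG2 x)"

definition bilinear_map ::
  "('k::field \<Rightarrow> 'v \<Rightarrow> 'v) \<Rightarrow> (('k, 'm::{finite,linorder}, 'n::{finite,linorder}) KG \<Rightarrow> ('k, 'm, 'n) KG \<Rightarrow> 'v::ab_group_add) \<Rightarrow> bool"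
  where
  "bilinear_map s B \<longleftrightarrow> (\<forall>f. Vector_Spaces.linear kg_scale s (B f)) \<and>
     (\<forall>g. Vector_Spaces.linear kg_scale s (\<lambda>f. B f g))"

context
  fixes s :: "'k::field \<Rightarrow> 'v \<Rightarrow> 'v::ab_group_add"
  assumes vs: "vector_space s"
begin

interpretation V: vector_space s by (rule vs)

lemma free_lift_superset:
  assumes "finite A" "Poly_Mapping.keys F \<subseteq> A"
  shows "free_lift s B F = (\<Sum>fg\<in>A. s (Poly_Mapping.lookup F fg) (B (fst fg) (snd fg)))"
  unfolding free_lift_def
  by (rule sum.mono_neutral_left) (use assms in \<open>auto simp: in_keys_iff\<close>)

lemma free_lift_add: "free_lift s B (F + H) = free_lift s B F + free_lift s B H"
proof -
  let ?A = "Poly_Mapping.keys F \<union> Poly_Mapping.keys H"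
  have "free_lift s B (F + H) = (\<Sum>fg\<in>?A. s (Poly_Mapping.lookup (F + H) fg) (B (fst fg) (snd fg)))"
    by (rule free_lift_superset) (simp_all add: Poly_Mapping.keys_add)
  also have "\<dots> = free_lift s B F + free_lift s B H"
    by (simp add: free_lift_superset[of ?A] lookup_add V.scale_left_distrib sum.distrib)
  finally show ?thesis .
qed

lemma free_lift_scale: "free_lift s B (free_tensor_scale r F) = s r (free_lift s B F)"
proof -
  have "Poly_Mapping.keys (free_tensor_scale r F) \<subseteq> Poly_Mapping.keys F"
    by (auto simp: in_keys_iff free_tensor_scale_lookup)
  then have "free_lift s B (free_tensor_scale r F) =
      (\<Sum>fg\<in>Poly_Mapping.keys F. s (Poly_Mapping.lookup (free_tensor_scale r F) fg) (B (fst fg) (snd fg)))"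
    by (intro free_lift_superset) simp_all
  then show ?thesis
    by (simp add: free_lift_def free_tensor_scale_lookup V.scale_sum_right)
qed

lemma free_lift_diff: "free_lift s B (F - H) = free_lift s B F - free_lift s B H"
  using free_lift_add[of B "F - H" H] by simp

lemma free_lift_single: "free_lift s B (Poly_Mapping.single (f, g) r) = s r (B f g)"
  by (simp add: free_lift_def)

lemma free_lift_bilinear_rel:
  assumes "bilinear_map s B" "x \<in> bilinear_rel"
  shows "free_lift s B x = 0"
proof -
  have B: "B f (g + g') = B f g + B f g'" "B (f + f') g = B f g + B f' g"
     "B f (kg_scale r g) = s r (B f g)" "B (kg_scale r f) g = s r (B f g)" for f f' g g' r
    using assms(1) unfolding bilinear_map_def
    by (auto simp: Vector_Spaces.linear_iff)
  from assms(2) show ?thesis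
    by induction
      (simp_all add: free_lift_diff free_lift_add free_lift_single B V.scale_right_distrib
        free_lift_def[of _ _ 0] mult.commute)
qed

lemma free_lift_abs:
  assumes "bilinear_map s B"
  shows "tensor_lift s B (abs_KG2 x) = free_lift s B x"
proof -
  have "rep_KG2 (abs_KG2 x) - x \<in> bilinear_rel"
    by (simp add: KG2.abs_eq_iff[symmetric] Quotient3_abs_rep[OF Quotient3_KG2])
  from free_lift_bilinear_rel[OF assms this] show ?thesis
    by (simp add: tensor_lift_def free_lift_diff)
qed

lemma tensor_lift_tensor:
  "bilinear_map s B \<Longrightarrow> tensor_lift s B (tensor f g) = B f g"
  by (simp add: tensor_def free_lift_abs free_lift_single)

lemma linear_tensor_lift:
  assumes "bilinear_map s B"
  shows "Vector_Spaces.linear tensor_scale s (tensor_lift s B)"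
proof -
  have "tensor_lift s B (x + y) = tensor_lift s B x + tensor_lift s B y" for x y
  proof (induction x; induction y)
    fix x y show "tensor_lift s B (abs_KG2 x + abs_KG2 y) = tensor_lift s B (abs_KG2 x) + tensor_lift s B (abs_KG2 y)"
      by (simp add: plus_KG2.abs_eq free_lift_abs[OF assms] free_lift_add)
  qed
  moreover have "tensor_lift s B (tensor_scale r x) = s r (tensor_lift s B x)" for r x
  proof (induction x)
    fix x show "tensor_lift s B (tensor_scale r (abs_KG2 x)) = s r (tensor_lift s B (abs_KG2 x))"
      by (simp add: tensor_scale.abs_eq free_lift_abs[OF assms] free_lift_scale)
  qed
  ultimately show ?thesis
    using vs vector_space_KG2 by (simp add: Vector_Spaces.linear_iff)
qed

end

text \<open>
  The product of the superalgebra \<open>K[G] \<otimes> K[G]\<close>: for homogeneous b, c,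
  \<open>(a \<otimes> b) (c \<otimes> d) = (-1)\<^bsup>|b||c|\<^esup> ac \<otimes> bd\<close>.
\<close>

definition tensor_mult ::
  "('k::field, 'm::{finite,linorder}, 'n::{finite,linorder}) KG2 \<Rightarrow> ('k, 'm, 'n) KG2 \<Rightarrow> ('k, 'm, 'n) KG2" where
  "tensor_mult x y =
     tensor_lift tensor_scale (\<lambda>a b.
       tensor_lift tensor_scale (\<lambda>c d.
         \<Sum>p\<in>UNIV. \<Sum>q\<in>UNIV. tensor_scale (koszul p q) (tensor (a * part q c) (part p b * d))) y) x"

lemma part_add: "part p (f + g) = part p f + part p g"
  by transfer (simp add: free_part_add rel_ideal.zero)

lemma part_scale: "part p (kg_scale r f) = kg_scale r (part p f)"
proof transfer
  fix p :: bool and r :: 'a and F :: "('a, 'b, 'c) free_alg"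
  have hom: "free_homogeneous False (free_scalar r :: ('a, 'b, 'c) free_alg)"
    by (simp add: free_homogeneous_def free_scalar_def)
  have "free_part p (free_scalar r * F) = free_scalar r * free_part p F"
    using free_part_homogeneous[OF hom, of True] free_part_homogeneous[OF hom, of False]
    by (simp add: free_part_mult)
  then show "free_part p (free_scalar r * F) - free_scalar r * free_part p F \<in> rel_ideal"
    by (simp add: rel_ideal.zero)
qed

lemma kg_scale_mult:
  "kg_scale r f * g = kg_scale r (f * g)" "f * kg_scale r g = kg_scale r (f * g)"
proof -
  show "kg_scale r f * g = kg_scale r (f * g)"
    by transfer (simp add: mult.assoc rel_ideal.zero)
  show "f * kg_scale r g = kg_scale r (f * g)"
  proof transfer
    fix r :: 'a and F H :: "('a, 'b, 'c) free_alg"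
    have "Poly_Mapping.single u (Poly_Mapping.lookup F u) * free_scalar r =
        free_scalar r * Poly_Mapping.single u (Poly_Mapping.lookup F u)" for u
      by (simp add: free_scalar_def mult_single mult.commute)
    then have "(\<Sum>u\<in>Poly_Mapping.keys F. Poly_Mapping.single u (Poly_Mapping.lookup F u)) * free_scalar r =
        free_scalar r * (\<Sum>u\<in>Poly_Mapping.keys F. Poly_Mapping.single u (Poly_Mapping.lookup F u))"
      by (simp add: sum_distrib_left sum_distrib_right)
    then have "F * free_scalar r = free_scalar r * F"
      by (simp add: sum_singles)
    then show "F * (free_scalar r * H) - free_scalar r * (F * H) \<in> rel_ideal"
      by (simp add: mult.assoc[symmetric] rel_ideal.zero)
  qed
qed

lemma tensor_add_left: "tensor (f + f') g = tensor f g + tensor f' g"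
  unfolding tensor_def plus_KG2.abs_eq KG2.abs_eq_iff
  using bilinear_rel.add_left[of f f' g 1] by (simp add: diff_diff_eq)

lemma tensor_add_right: "tensor f (g + g') = tensor f g + tensor f g'"
  unfolding tensor_def plus_KG2.abs_eq KG2.abs_eq_iff
  using bilinear_rel.add_right[of f g g' 1] by (simp add: diff_diff_eq)

lemma tensor_scale_left: "tensor (kg_scale r f) g = tensor_scale r (tensor f g)"
  unfolding tensor_def tensor_scale.abs_eq KG2.abs_eq_iff
  using bilinear_rel.scale_left[of r f g 1] by (simp add: free_tensor_scale_single)

lemma tensor_scale_right: "tensor f (kg_scale r g) = tensor_scale r (tensor f g)"
  unfolding tensor_def tensor_scale.abs_eq KG2.abs_eq_iff
  using bilinear_rel.scale_right[of f r g 1] by (simp add: free_tensor_scale_single)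

lemma tensor_mult_tensor:
  "tensor_mult (tensor a b) (tensor c d) =
     (\<Sum>p\<in>UNIV. \<Sum>q\<in>UNIV. tensor_scale (koszul p q) (tensor (a * part q c) (part p b * d)))"
proof -
  let ?t = "\<lambda>a b c d. \<Sum>p\<in>UNIV. \<Sum>q\<in>UNIV. tensor_scale (koszul p q) (tensor (a * part q c) (part p b * d))"
  note lin = Vector_Spaces.linear_iff vector_space_KG vector_space_KG2 part_add part_scale
    kg_scale_mult distrib_left distrib_right tensor_add_left tensor_add_right tensor_scale_left
    tensor_scale_right sum.distrib KG2.scale_right_distrib KG2.scale_sum_right
  have inner: "bilinear_map tensor_scale (?t a b)" for a b
    unfolding bilinear_map_def by (simp add: lin mult.commute)
  have eq: "tensor_lift tensor_scale (?t a b) (tensor c d) = ?t a b c d" for a b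
    by (rule tensor_lift_tensor[OF vector_space_KG2 inner])
  have "bilinear_map tensor_scale (\<lambda>a b. ?t a b c d)"
    unfolding bilinear_map_def by (simp add: lin mult.commute)
  then show ?thesis
    unfolding tensor_mult_def eq by (rule tensor_lift_tensor[OF vector_space_KG2])
qed

text \<open>The subspace \<open>V \<otimes> W\<close>.\<close>

definition tensor_sub ::
  "('k::field, 'm::{finite,linorder}, 'n::{finite,linorder}) KG set \<Rightarrow> ('k, 'm, 'n) KG set \<Rightarrow> ('k, 'm, 'n) KG2 set" where
  "tensor_sub V W = KG2.span {tensor v w | v w. v \<in> V \<and> w \<in> W}"

text \<open>
  The comultiplication is the superalgebra morphism given by matrix multiplication.  It is unique,
  since \<open>K[G]\<close> is generated by the \<open>coord i j\<close> and the inverse \<open>det_inv\<close> of an element of the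
  subalgebra they generate.  It exists since modulo nilpotents the determinants of the diagonal
  blocks of the product matrix are \<open>det C\<^sub>0\<^sub>0 \<otimes> det C\<^sub>0\<^sub>0\<close> and \<open>det C\<^sub>1\<^sub>1 \<otimes> det C\<^sub>1\<^sub>1\<close>, hence invertible.
\<close>

definition comult ::
  "('k::field, 'm::{finite,linorder}, 'n::{finite,linorder}) KG \<Rightarrow> ('k, 'm, 'n) KG2" where
  "comult = (THE D. Vector_Spaces.linear kg_scale tensor_scale D \<and>
     D 1 = tensor 1 1 \<and>
     (\<forall>f g. D (f * g) = tensor_mult (D f) (D g)) \<and>
     (\<forall>i j. D (coord i j) = (\<Sum>k\<in>UNIV. tensor (coord i k) (coord k j))))"

section \<open>Supermodules\<close>

text \<open>
  All supermodules needed below are subquotients of the regular supermodule \<open>(K[G], \<rho>\<^sub>r)\<close>, whose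
  structure map is \<open>comult\<close>.
\<close>

definition subsupermodule ::
  "('k::field, 'm::{finite,linorder}, 'n::{finite,linorder}) KG set \<Rightarrow> bool" where
  "subsupermodule V \<longleftrightarrow> KG.subspace V \<and> (\<forall>f\<in>V. \<forall>p. part p f \<in> V) \<and>
     (\<forall>f\<in>V. comult f \<in> tensor_sub V UNIV)"

definition simple_supermodule ::
  "('k::field, 'm::{finite,linorder}, 'n::{finite,linorder}) KG set \<Rightarrow> bool" where
  "simple_supermodule V \<longleftrightarrow> subsupermodule V \<and> V \<noteq> {0} \<and>
     (\<forall>U. subsupermodule U \<and> U \<subseteq> V \<longrightarrow> U = {0} \<or> U = V)"

definition socle ::
  "('k::field, 'm::{finite,linorder}, 'n::{finite,linorder}) KG set \<Rightarrow> ('k, 'm, 'n) KG set" where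
  "socle M = KG.span (\<Union>{V. simple_supermodule V \<and> V \<subseteq> M})"

definition two_sided_ideal ::
  "('k::field, 'm::{finite,linorder}, 'n::{finite,linorder}) KG set \<Rightarrow> ('k, 'm, 'n) KG set" where
  "two_sided_ideal S = KG.span {a * f * b | a f b. f \<in> S}"

text \<open>The defining ideals of the lower triangular Borel subsupergroup and of the diagonal torus.\<close>

definition borel_ideal :: "('k::field, 'm::{finite,linorder}, 'n::{finite,linorder}) KG set" where
  "borel_ideal = two_sided_ideal {coord i j | i j. idx_less i j}"

definition torus_ideal :: "('k::field, 'm::{finite,linorder}, 'n::{finite,linorder}) KG set" where
  "torus_ideal = two_sided_ideal {coord i j | i j. i \<noteq> j}"

type_synonym ('m, 'n) weight = "'m + 'n \<Rightarrow> int"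

text \<open>
  \<open>character \<mu>\<close> is an element of \<open>K[G]\<close> whose image in \<open>K[B\<^sup>-]\<close> is the group-like element
  \<open>\<Prod>\<^sub>i c\<^sub>i\<^sub>i\<^bsup>\<mu>\<^sub>i\<^esup>\<close>: modulo \<open>borel_ideal\<close> the product of the two determinants is the product of all the
  diagonal entries, so \<open>diag_inv i\<close> becomes the inverse of \<open>coord i i\<close>.
\<close>

definition diag_inv :: "'m + 'n \<Rightarrow> ('k::field, 'm::{finite,linorder}, 'n::{finite,linorder}) KG" where
  "diag_inv i = det_inv * prod_list (map (\<lambda>j. coord j j) (filter (\<lambda>j. j \<noteq> i) idx_list))"

definition character :: "('m, 'n) weight \<Rightarrow> ('k::field, 'm::{finite,linorder}, 'n::{finite,linorder}) KG" where
  "character \<mu> = prod_list (map (\<lambda>i. if \<mu> i \<ge> 0 then coord i i ^ nat (\<mu> i) else diag_inv i ^ nat (- \<mu> i)) idx_list)"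

text \<open>
  The induced supermodule is the cotensor product of the even one-dimensional supermodule \<open>K\<^sub>\<mu>\<close> with
  \<open>K[G]\<close>, that is, the set of all \<open>f\<close> in \<open>K[G]\<close> with \<open>(\<pi> \<otimes> id) (\<Delta> f) = \<chi>\<^sub>\<mu> \<otimes> f\<close>, where
  \<open>\<pi> : K[G] \<rightarrow> K[B\<^sup>-]\<close> is the restriction; the kernel of \<open>\<pi> \<otimes> id\<close> is \<open>borel_ideal \<otimes> K[G]\<close>.
\<close>

definition H0_minus ::
  "('m, 'n) weight \<Rightarrow> ('k::field, 'm::{finite,linorder}, 'n::{finite,linorder}) KG set" where
  "H0_minus \<mu> = {f. comult f - tensor (character \<mu>) f \<in> tensor_sub borel_ideal UNIV}"

definition L_minus ::
  "('m, 'n) weight \<Rightarrow> ('k::field, 'm::{finite,linorder}, 'n::{finite,linorder}) KG set" where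
  "L_minus \<mu> = socle (H0_minus \<mu>)"

text \<open>
  \<open>quotient_iso W V L flip\<close>: the supermodule \<open>W / V\<close> is isomorphic to \<open>L\<close> (\<open>flip = False\<close>) or to its
  parity shift \<open>\<Pi>L\<close> (\<open>flip = True\<close>) by an even isomorphism.  The structure map of \<open>\<Pi>L\<close>, as a right
  supercomodule, is that of \<open>L\<close>.  An isomorphism is given by a map on \<open>W\<close> with kernel \<open>V\<close>, extended
  to a linear map on \<open>K[G]\<close> in an arbitrary way.
\<close>

definition quotient_iso ::
  "('k::field, 'm::{finite,linorder}, 'n::{finite,linorder}) KG set \<Rightarrow> ('k, 'm, 'n) KG set \<Rightarrow>
     ('k, 'm, 'n) KG set \<Rightarrow> bool \<Rightarrow> bool" where
  "quotient_iso W V L flip \<longleftrightarrow> (\<exists>\<phi>. Vector_Spaces.linear kg_scale kg_scale \<phi> \<and>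
     \<phi> ` W = L \<and> {w \<in> W. \<phi> w = 0} = V \<and>
     (\<forall>w\<in>W. comult (\<phi> w) = tensor_lift tensor_scale (\<lambda>a b. tensor (\<phi> a) b) (comult w)) \<and>
     (\<forall>w\<in>W. \<forall>p. part (p \<noteq> flip) (\<phi> w) = \<phi> (part p w)))"

definition composition_factor ::
  "('k::field, 'm::{finite,linorder}, 'n::{finite,linorder}) KG set \<Rightarrow> ('k, 'm, 'n) KG set \<Rightarrow>
     ('k, 'm, 'n) KG set \<Rightarrow> bool" where
  "composition_factor M W V \<longleftrightarrow> subsupermodule V \<and> subsupermodule W \<and> V \<subset> W \<and> W \<subseteq> M \<and>
     \<not> (\<exists>U. subsupermodule U \<and> V \<subset> U \<and> U \<subset> W)"

definition belongs_to ::
  "('k::field, 'm::{finite,linorder}, 'n::{finite,linorder}) KG set \<Rightarrow> ('m, 'n) weight set \<Rightarrow> bool" where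
  "belongs_to M \<Gamma> \<longleftrightarrow> (\<forall>W V. composition_factor M W V \<longrightarrow>
     (\<exists>\<mu>\<in>\<Gamma>. \<exists>flip. quotient_iso W V (L_minus \<mu>) flip))"

text \<open>\<open>C_Gamma \<Gamma> = O\<^sub>\<Gamma>(K[G])\<close>: the largest subsupermodule belonging to \<open>\<Gamma>\<close> is the sum of all of them.\<close>

definition C_Gamma ::
  "('m, 'n) weight set \<Rightarrow> ('k::field, 'm::{finite,linorder}, 'n::{finite,linorder}) KG set" where
  "C_Gamma \<Gamma> = KG.span (\<Union>{M. subsupermodule M \<and> belongs_to M \<Gamma>})"

definition dominant :: "('m::linorder, 'n::linorder) weight \<Rightarrow> bool" where
  "dominant \<mu> \<longleftrightarrow> (\<forall>i j. i \<le> j \<longrightarrow> \<mu> (Inl j) \<le> \<mu> (Inl i)) \<and> (\<forall>i j. i \<le> j \<longrightarrow> \<mu> (Inr j) \<le> \<mu> (Inr i))"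

definition dominant_weights :: "int \<Rightarrow> ('m::{finite,linorder}, 'n::{finite,linorder}) weight set" where
  "dominant_weights l = {\<mu>. dominant \<mu> \<and> (\<Sum>i\<in>UNIV. \<mu> i) = l}"

section \<open>Distributions and generalized Schur superalgebras\<close>

type_synonym ('k, 'm, 'n) functional = "('k, 'm, 'n) KG \<Rightarrow> 'k"

definition augmentation_ideal :: "('k::field, 'm::{finite,linorder}, 'n::{finite,linorder}) KG set" where
  "augmentation_ideal = {f. counit f = 0}"

primrec ideal_power ::
  "('k::field, 'm::{finite,linorder}, 'n::{finite,linorder}) KG set \<Rightarrow> nat \<Rightarrow> ('k, 'm, 'n) KG set" where
  "ideal_power I 0 = UNIV"
| "ideal_power I (Suc t) = KG.span {f * g | f g. f \<in> I \<and> g \<in> ideal_power I t}"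

text \<open>Functionals on \<open>K[G] / \<mm>\<^bsup>t+1\<^esup>\<close> and on \<open>K[T]\<close> are regarded as functionals on \<open>K[G]\<close>.\<close>

definition Dist_G :: "('k::field, 'm::{finite,linorder}, 'n::{finite,linorder}) functional set" where
  "Dist_G = {\<xi>. Vector_Spaces.linear kg_scale (*) \<xi> \<and>
     (\<exists>t. \<forall>f\<in>ideal_power augmentation_ideal (t + 1). \<xi> f = 0)}"

definition Dist_T :: "('k::field, 'm::{finite,linorder}, 'n::{finite,linorder}) functional set" where
  "Dist_T = {\<xi> \<in> Dist_G. \<forall>f\<in>torus_ideal. \<xi> f = 0}"

text \<open>
  \<open>(\<phi>\<psi>)(f) = \<Sum> (-1)\<^bsup>|\<psi>||f\<^sub>1|\<^esup> \<phi>(f\<^sub>1) \<psi>(f\<^sub>2)\<close>; the component of \<open>\<psi>\<close> of parity q is \<open>\<psi> \<circ> part q\<close>.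
\<close>

definition dist_mult ::
  "('k::field, 'm::{finite,linorder}, 'n::{finite,linorder}) functional \<Rightarrow> ('k, 'm, 'n) functional \<Rightarrow> ('k, 'm, 'n) functional" where
  "dist_mult \<phi> \<psi> f = tensor_lift (*) (\<lambda>a b.
     \<Sum>p\<in>UNIV. \<Sum>q\<in>UNIV. koszul q p * \<phi> (part p a) * \<psi> (part q b)) (comult f)"

definition superideal :: "('k::field, 'm::{finite,linorder}, 'n::{finite,linorder}) functional set \<Rightarrow> bool" where
  "superideal I \<longleftrightarrow> I \<subseteq> Dist_G \<and> (\<lambda>f. 0) \<in> I \<and>
     (\<forall>\<xi>\<in>I. \<forall>\<eta>\<in>I. (\<lambda>f. \<xi> f + \<eta> f) \<in> I) \<and> (\<forall>r. \<forall>\<xi>\<in>I. (\<lambda>f. r * \<xi> f) \<in> I) \<and>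
     (\<forall>\<xi>\<in>I. \<forall>p. (\<lambda>f. \<xi> (part p f)) \<in> I) \<and>
     (\<forall>\<xi>\<in>I. \<forall>\<eta>\<in>Dist_G. dist_mult \<eta> \<xi> \<in> I \<and> dist_mult \<xi> \<eta> \<in> I)"

definition superideal_generated ::
  "('k::field, 'm::{finite,linorder}, 'n::{finite,linorder}) functional set \<Rightarrow> ('k, 'm, 'n) functional set" where
  "superideal_generated J = \<Inter>{I. superideal I \<and> J \<subseteq> I}"

text \<open>
  Elements of \<open>S\<^sub>\<Gamma> = C\<^sub>\<Gamma>\<^sup>*\<close> are represented by functions that are \<open>undefined\<close> outside of \<open>C\<^sub>\<Gamma>\<close>.
\<close>

definition schur :: "('m, 'n) weight set \<Rightarrow> ('k::field, 'm::{finite,linorder}, 'n::{finite,linorder}) functional set" where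
  "schur \<Gamma> = {\<eta> \<in> extensional (C_Gamma \<Gamma>).
     (\<forall>f\<in>C_Gamma \<Gamma>. \<forall>g\<in>C_Gamma \<Gamma>. \<eta> (f + g) = \<eta> f + \<eta> g) \<and>
     (\<forall>r. \<forall>f\<in>C_Gamma \<Gamma>. \<eta> (kg_scale r f) = r * \<eta> f)}"

definition schur_zero :: "('m, 'n) weight set \<Rightarrow> ('k::field, 'm::{finite,linorder}, 'n::{finite,linorder}) functional" where
  "schur_zero \<Gamma> = (\<lambda>f\<in>C_Gamma \<Gamma>. 0)"

definition pi_Gamma ::
  "('m, 'n) weight set \<Rightarrow> ('k::field, 'm::{finite,linorder}, 'n::{finite,linorder}) functional \<Rightarrow> ('k, 'm, 'n) functional" where
  "pi_Gamma \<Gamma> \<xi> = restrict \<xi> (C_Gamma \<Gamma>)"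

lemma pi_Gamma_in_schur: "\<xi> \<in> Dist_G \<Longrightarrow> pi_Gamma \<Gamma> \<xi> \<in> schur \<Gamma>"
  by (auto simp: Dist_G_def pi_Gamma_def schur_def C_Gamma_def Vector_Spaces.linear_iff
      intro: KG.span_add KG.span_scale)

definition ker_pi :: "('m, 'n) weight set \<Rightarrow> ('k::field, 'm::{finite,linorder}, 'n::{finite,linorder}) functional set" where
  "ker_pi \<Gamma> = {\<xi> \<in> Dist_G. pi_Gamma \<Gamma> \<xi> = schur_zero \<Gamma>}"

end

theory Submission
  imports
    Defs
    "HOL-Analysis.Determinants"
    "HOL-Computational_Algebra.Primes"
    "HOL-Library.Function_Algebras"
begin

text \<open>
  The coordinate superalgebra is graded by the total degree of weights, and its largest subsupermodule all of
  whose composition factors have highest weight of degree \<open>l\<close> is its component of degree \<open>l\<close>.  Indeed, a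
  simple subquotient is generated by a highest weight vector, so it embeds, up to parity shift, into an induced
  supermodule; the socle of the latter is simple because functions on the supergroup are determined by their
  restriction to the big cell, and permutation matrices show that the highest weight is dominant.  Hence the
  kernel of \<open>\<pi>\<^sub>l\<close> consists of the distributions \<open>\<xi>\<close> that vanish in degree \<open>l\<close>.

  Let such a \<open>\<xi>\<close> vanish on the power \<open>q\<close> of the augmentation ideal, where \<open>q\<close> is a power of the
  characteristic.  For an even element \<open>y\<close> with \<open>y(1) = 1\<close> one has \<open>y\<^sup>q - 1 = (y - 1)\<^sup>q\<close>, so \<open>\<xi>\<close>
  is invariant under multiplication by \<open>y\<^sup>q\<close>.  Taking characters for \<open>y\<close> shows that \<open>\<xi>\<close> vanishes in
  every degree congruent to \<open>l\<close> modulo \<open>q\<close>.  The functional \<open>e\<close> that is the counit in the degrees not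
  congruent to \<open>l\<close> and 0 in the others is a distribution of the torus of scalar matrices, it lies in the kernel
  of \<open>\<pi>\<^sub>l\<close>, and \<open>\<xi> = \<xi> e\<close>.
\<close>

section \<open>Ring-theoretic preliminaries: determinants and powers of the characteristic\<close>

section \<open>Determinants over noncommutative rings\<close>

text \<open>The comultiplication is given by a definite description, so its existence has to be
  proved, and here lies the first obstacle: the product of the two block determinants is not
  group-like, because odd entries contribute to the diagonal blocks of a product matrix. Its power
  with exponent p, the characteristic, is group-like, since every odd contribution squares to zero.
  This yields an explicit inverse, and the group-like element \<open>dinv\<close> replaces
  \<open>det_inv\<close> in all inductions that involve \<open>comult\<close>. Comodules are handled
  through the contractions \<open>Rop\<close> and \<open>Lop\<close> of the comultiplication with
  linear functionals; tensors are determined by their contractions, so coassociativity becomes the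
  commutation of these operators. The dominance order is replaced by the integer
  \<open>height\<close>, which is linear and positive on positive roots. Restriction to the big cell
  is realised by operators on functions of exponent vectors, where a leading term argument, with the
  weight rk(i) rk(j) on the entry (i, j), proves injectivity.\<close>

definition pdet :: "('i::{finite,linorder} \<Rightarrow> 'i \<Rightarrow> 'r::ring_1) \<Rightarrow> 'r" where
  "pdet A = (\<Sum>\<pi> | \<pi> permutes (UNIV :: 'i set). of_int (sign \<pi>) *
     prod_list (map (\<lambda>i. A i (\<pi> i)) (sorted_list_of_set UNIV)))"

text \<open>The factors of each term of \<open>pdet\<close> keep the row order of
  \<open>free_det0\<close> and \<open>free_det1\<close>, so one formula serves the presentation of
  K[G], the tensor square and operator rings. For commuting entries this is the usual determinant,
  from which multiplicativity is inherited.\<close>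

lemma pdet_eq_det:
  fixes A :: "'i::{finite,linorder} \<Rightarrow> 'i \<Rightarrow> 'r::comm_ring_1"
  shows "pdet A = det (\<chi> i j. A i j)"
proof -
  have "prod_list (map f (sorted_list_of_set UNIV)) = prod f UNIV" for f :: "'i \<Rightarrow> 'r"
    using prod.distinct_set_conv_list[of "sorted_list_of_set (UNIV :: 'i set)" f] by simp
  then show ?thesis by (simp add: pdet_def det_def)
qed

lemma pdet_mult:
  fixes A B :: "'i::{finite,linorder} \<Rightarrow> 'i \<Rightarrow> 'r::comm_ring_1"
  shows "pdet (\<lambda>i j. \<Sum>k\<in>UNIV. A i k * B k j) = pdet A * pdet B"
  unfolding pdet_eq_det det_mul[symmetric] matrix_matrix_mult_def by simp

lemma prod_list_hom:
  fixes f :: "'r::ring_1 \<Rightarrow> 's::ring_1"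
  assumes "f 1 = 1" "\<And>x y. f (x * y) = f x * f y"
  shows "f (prod_list xs) = prod_list (map f xs)"
  by (induction xs) (simp_all add: assms)

lemma pdet_hom:
  fixes f :: "'r::ring_1 \<Rightarrow> 's::ring_1"
  assumes f: "f 1 = 1" "\<And>x y. f (x + y) = f x + f y" "\<And>x y. f (x * y) = f x * f y"
  shows "f (pdet A) = pdet (\<lambda>i j. f (A i j))"
proof -
  have 0: "f 0 = 0" using f(2)[of 0 0] by simp
  have m: "f (- x) = - f x" for x using f(2)[of x "- x"] 0 by (simp add: eq_neg_iff_add_eq_0 add.commute)
  have s: "f (sum g S) = (\<Sum>i\<in>S. f (g i))" for g and S :: "('b \<Rightarrow> 'b) set"
    by (induction S rule: infinite_finite_induct) (simp_all add: 0 f(2))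
  have i: "f (of_int (sign \<pi>)) = of_int (sign \<pi>)" for \<pi> :: "'b \<Rightarrow> 'b"
    by (cases \<pi> rule: sign_cases) (simp_all add: f(1) m)
  show ?thesis
    by (simp add: pdet_def s f(3) i prod_list_hom[of f, OF f(1) f(3)] comp_def)
qed

text \<open>In prime characteristic the Frobenius map is a ring endomorphism, so it passes inside
  the determinant.\<close>

lemma pdet_power_CHAR:
  fixes A :: "'i::{finite,linorder} \<Rightarrow> 'i \<Rightarrow> 'r::comm_ring_1"
  assumes "prime CHAR('r)"
  shows "pdet A ^ CHAR('r) = pdet (\<lambda>i j. A i j ^ CHAR('r))"
  using pdet_hom[of "\<lambda>x. x ^ CHAR('r)" A] freshmans_dream[OF assms refl]
  by (simp add: power_mult_distrib)

text \<open>The least point that is moved would go to a smaller, hence fixed, point, against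
  injectivity.\<close>

lemma permutes_UNIV_le_imp_id:
  fixes \<pi> :: "'i::{finite,linorder} \<Rightarrow> 'i"
  assumes p: "\<pi> permutes UNIV" and le: "\<And>i. \<pi> i \<le> i"
  shows "\<pi> = id"
proof (rule ccontr)
  assume "\<pi> \<noteq> id"
  then have ne: "{i. \<pi> i \<noteq> i} \<noteq> {}" by fastforce
  define i where "i = Min {i. \<pi> i \<noteq> i}"
  have i: "\<pi> i \<noteq> i" using Min_in[OF _ ne] by (simp add: i_def)
  have min: "\<pi> j = j" if "j < i" for j
  proof (rule ccontr)
    assume "\<pi> j \<noteq> j"
    then have "i \<le> j" unfolding i_def by (intro Min_le) simp_all
    then show False using that by simp
  qed
  have "\<pi> i < i" using i le[of i] by simp
  then have "\<pi> (\<pi> i) = \<pi> i" by (rule min)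
  then show False using i permutes_inj[OF p] by (metis injD)
qed

lemma permutes_UNIV_ge_imp_id:
  fixes \<pi> :: "'i::{finite,linorder} \<Rightarrow> 'i"
  assumes p: "\<pi> permutes UNIV" and ge: "\<And>i. i \<le> \<pi> i"
  shows "\<pi> = id"
proof -
  have "inv \<pi> i \<le> i" for i using ge[of "inv \<pi> i"] permutes_inverses(1)[OF p] by metis
  then have "inv \<pi> = id" by (intro permutes_UNIV_le_imp_id permutes_inv p)
  then show ?thesis using permutes_inv_inv[OF p] by (metis inv_id)
qed

text \<open>A permutation other than the identity sends some point up and some point down, so for
  either shape of triangularity its term contains a factor from \<open>I\<close>. With
  \<open>I\<close> = {0} this evaluates triangular determinants; with \<open>borel_ideal\<close> it
  evaluates the block determinants on the Borel subsupergroup.\<close>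

lemma pdet_triangular_mod:
  fixes A :: "'i::{finite,linorder} \<Rightarrow> 'i \<Rightarrow> 'r::ring_1"
  assumes I: "0 \<in> I" "\<And>x y. x \<in> I \<Longrightarrow> y \<in> I \<Longrightarrow> x + y \<in> I" "\<And>x y. x \<in> I \<Longrightarrow> y * x \<in> I" "\<And>x y. x \<in> I \<Longrightarrow> x * y \<in> I"
    and tri: "(\<forall>i j. i < j \<longrightarrow> A i j \<in> I) \<or> (\<forall>i j. j < i \<longrightarrow> A i j \<in> I)"
  shows "pdet A - prod_list (map (\<lambda>i. A i i) (sorted_list_of_set UNIV)) \<in> I"
proof -
  let ?t = "\<lambda>\<pi>. of_int (sign \<pi>) * prod_list (map (\<lambda>i. A i (\<pi> i)) (sorted_list_of_set UNIV))"
  have pl: "prod_list (map (\<lambda>i. A i (\<pi> i)) xs) \<in> I" if "i \<in> set xs" "A i (\<pi> i) \<in> I" for i \<pi> xs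
    using that by (induction xs) (auto simp: I(3,4))
  have "?t \<pi> \<in> I" if perm: "\<pi> permutes UNIV" and ne: "\<pi> \<noteq> id" for \<pi>
  proof -
    have "\<exists>i. i < \<pi> i" "\<exists>i. \<pi> i < i"
      using permutes_UNIV_le_imp_id[OF perm] permutes_UNIV_ge_imp_id[OF perm] ne
      by (auto simp: not_le[symmetric])
    then obtain i i' where "i < \<pi> i" "\<pi> i' < i'" by blast
    with tri have "A i (\<pi> i) \<in> I \<or> A i' (\<pi> i') \<in> I" by auto
    then obtain i where "A i (\<pi> i) \<in> I" by (elim disjE)
    then show ?thesis using pl[of i "sorted_list_of_set UNIV" \<pi>] I(3) by simp
  qed
  then have "?t \<pi> \<in> I" if "\<pi> \<in> {\<pi>. \<pi> permutes UNIV} - {id}" for \<pi>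
    using that by simp
  moreover have sum: "sum g S \<in> I" if "\<And>x. x \<in> S \<Longrightarrow> g x \<in> I" for g and S :: "('i \<Rightarrow> 'i) set"
    using that by (induction S rule: infinite_finite_induct) (simp_all add: I(1,2))
  ultimately have "sum ?t ({\<pi>. \<pi> permutes UNIV} - {id}) \<in> I" by (intro sum)
  moreover have "pdet A = ?t id + sum ?t ({\<pi>. \<pi> permutes UNIV} - {id})"
    unfolding pdet_def by (rule sum.remove) (auto simp: permutes_id)
  ultimately show ?thesis by simp
qed

lemma pdet_triangular:
  fixes A :: "'i::{finite,linorder} \<Rightarrow> 'i \<Rightarrow> 'r::ring_1"
  assumes "(\<forall>i j. i < j \<longrightarrow> A i j = 0) \<or> (\<forall>i j. j < i \<longrightarrow> A i j = 0)"
  shows "pdet A = prod_list (map (\<lambda>i. A i i) (sorted_list_of_set UNIV))"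
  using pdet_triangular_mod[of "{0}" A] assms by simp

text \<open>Every permutation other than \<sigma> disagrees with it somewhere and meets a zero entry
  there.\<close>

lemma pdet_permutation:
  fixes \<sigma> :: "'i::{finite,linorder} \<Rightarrow> 'i"
  assumes "\<sigma> permutes UNIV"
  shows "pdet (\<lambda>i j. if j = \<sigma> i then 1 else 0 :: 'r::idom) = of_int (sign \<sigma>)"
proof -
  have "prod_list (map (\<lambda>i. if \<pi> i = \<sigma> i then 1 else 0 :: 'r) (sorted_list_of_set UNIV)) = (if \<pi> = \<sigma> then 1 else 0)" for \<pi> :: "'i \<Rightarrow> 'i"
  proof (cases "\<pi> = \<sigma>")
    case False
    then obtain i where "\<pi> i \<noteq> \<sigma> i" by fastforce
    then have "\<exists>i. (if \<pi> i = \<sigma> i then 1 else 0 :: 'r) = 0" by (intro exI[of _ i]) simp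
    then show ?thesis using False by (auto simp: prod_list_zero_iff image_iff)
  next
    case True
    have "prod_list (map (\<lambda>i. 1 :: 'r) xs) = 1" for xs :: "'i list" by (induction xs) auto
    then show ?thesis using True by simp
  qed
  note pl = this
  have "pdet (\<lambda>i j. if j = \<sigma> i then 1 else 0 :: 'r) = (\<Sum>\<pi> | \<pi> permutes UNIV. if \<pi> = \<sigma> then of_int (sign \<pi>) else 0)"
    unfolding pdet_def by (intro sum.cong refl) (simp only: pl, simp)
  also have "\<dots> = of_int (sign \<sigma>)"
    using assms by (subst sum.delta) simp_all
  finally show ?thesis .
qed

section \<open>Frobenius for commuting elements\<close>

text \<open>The ring may be noncommutative, but x commutes with 1 and with the image of the
  integers.\<close>

lemma binomial_commuting:
  fixes x :: "'r::ring_1"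
  shows "(x + 1) ^ n = (\<Sum>k\<le>n. of_nat (n choose k) * x ^ k)"
proof (induction n)
  case (Suc n)
  have "(x + 1) ^ Suc n = (x + 1) * (\<Sum>k\<le>n. of_nat (n choose k) * x ^ k)"
    by (simp only: power_Suc Suc)
  also have "\<dots> = (\<Sum>k\<le>n. of_nat (n choose k) * x ^ Suc k) + (\<Sum>k\<le>n. of_nat (n choose k) * x ^ k)"
  proof -
    have "x * (of_nat c * x ^ k) = of_nat c * x ^ Suc k" for c k
      by (metis mult.assoc mult_of_nat_commute power_Suc)
    then show ?thesis by (simp add: distrib_right sum_distrib_left sum.distrib del: power_Suc)
  qed
  also have "(\<Sum>k\<le>n. of_nat (n choose k) * x ^ k) = 1 + (\<Sum>k\<le>n. of_nat (n choose Suc k) * x ^ Suc k)"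
    using sum.atMost_Suc_shift[of "\<lambda>k. of_nat (n choose k) * x ^ k" n]
    by (simp add: binomial_eq_0)
  finally have "(x + 1) ^ Suc n = 1 + (\<Sum>k\<le>n. of_nat (n choose k) * x ^ Suc k + of_nat (n choose Suc k) * x ^ Suc k)"
    by (simp only: sum.distrib add_ac)
  then show ?case
    using sum.atMost_Suc_shift[of "\<lambda>k. of_nat (Suc n choose k) * x ^ k" n]
    by (simp add: distrib_right del: power_Suc)
qed simp

text \<open>The inner binomial coefficients vanish, so (x + 1)^q = x^q + 1; substituting x - 1 for x
  gives the form with minus signs without any discussion of (-1)^q.\<close>

lemma frobenius_minus_1:
  fixes x :: "'r::ring_1"
  assumes p: "prime p" "of_nat p = (0 :: 'r)"
  shows "(x - 1) ^ (p ^ s) = x ^ (p ^ s) - 1"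
proof -
  have 1: "(x + 1) ^ p = x ^ p + 1" for x :: 'r
  proof -
    have "of_nat (p choose k) = (0 :: 'r)" if "0 < k" "k < p" for k
      using dvd_choose_prime[OF that(2) _ _ p(1)] that p(2) by (auto elim!: dvdE)
    then have "(\<Sum>k\<le>p. of_nat (p choose k) * x ^ k) = (\<Sum>k\<in>{0, p}. of_nat (p choose k) * x ^ k)"
      by (intro sum.mono_neutral_right) (auto simp: le_less)
    then show ?thesis using prime_gt_0_nat[OF p(1)] by (simp add: binomial_commuting[of x p])
  qed
  have "(x + 1) ^ (p ^ s) = x ^ (p ^ s) + 1" for x :: 'r
  proof (induction s arbitrary: x)
    case (Suc s)
    show ?case unfolding power_Suc power_mult 1 Suc ..
  qed simp
  from this[of "x - 1"] show ?thesis by (metis add_diff_cancel_right' diff_add_cancel)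
qed

section \<open>K[G] by generators and relations: universal property, parity and
  supercommutativity\<close>

section \<open>Generators of the coordinate superalgebra\<close>

lemma KG_cases [cases type: KG]:
  obtains (abs_KG) F where "f = abs_KG F"
  by (induction f) blast

lemma abs_KG_word_Cons:
  fixes r :: "'k::field" and x :: "('m::{finite,linorder},'n::{finite,linorder}) gen"
  shows "abs_KG (Poly_Mapping.single (Word (x # xs)) r) = abs_KG (free_gen x) * abs_KG (Poly_Mapping.single (Word xs) r)"
  by (simp add: times_KG.abs_eq free_gen_def mult_single plus_word_def)

lemma abs_KG_word_Nil: "abs_KG (Poly_Mapping.single (Word []) r) = kg_scale r 1"
  by (simp add: one_KG.abs_eq kg_scale.abs_eq free_scalar_def zero_word_def[symmetric])

lemma abs_KG_gen: "abs_KG (free_gen (Coord i j)) = coord i j" "abs_KG (free_gen DetInv) = det_inv"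
  by (simp_all add: coord_def det_inv_def)

text \<open>Words in the generators span K[G], and a word grows by one letter on the left; hence
  only left multiplication by generators has to be treated.\<close>

lemma KG_span_induct [consumes 0, case_names one add scale coord det_inv]:
  fixes f :: "('k::field, 'm::{finite,linorder}, 'n::{finite,linorder}) KG"
  assumes one: "P 1" and add: "\<And>f g. P f \<Longrightarrow> P g \<Longrightarrow> P (f + g)"
    and scale: "\<And>r f. P f \<Longrightarrow> P (kg_scale r f)"
    and coord: "\<And>i j f. P f \<Longrightarrow> P (coord i j * f)" and det_inv: "\<And>f. P f \<Longrightarrow> P (det_inv * f)"
  shows "P f"
proof (cases f)
  case (abs_KG F)
  have word: "P (abs_KG (Poly_Mapping.single (Word xs) r))" for xs :: "('m, 'n) gen list" and r :: 'k
  proof (induction xs)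
    case Nil
    show ?case by (simp add: abs_KG_word_Nil scale one)
  next
    case (Cons x xs)
    then show ?case by (cases x) (simp_all add: abs_KG_word_Cons abs_KG_gen coord det_inv)
  qed
  have zero: "P 0" using scale[OF one, of 0] by simp
  have "P (abs_KG (\<Sum>w\<in>A. Poly_Mapping.single w (Poly_Mapping.lookup F w)))" for A
  proof (induction A rule: infinite_finite_induct)
    case (insert w A)
    then show ?case using word[of "letters w" "Poly_Mapping.lookup F w"]
      by (simp add: plus_KG.abs_eq[symmetric] add)
  qed (simp_all add: zero_KG.abs_eq[symmetric] zero)
  then show ?thesis using sum_singles[of F] by (metis abs_KG)
qed

subsection \<open>Homomorphisms out of the coordinate superalgebra\<close>

context
  fixes s :: "'k::field \<Rightarrow> 'r::ring_1 \<Rightarrow> 'r"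
    and h :: "('m::{finite,linorder}, 'n::{finite,linorder}) gen \<Rightarrow> 'r"
  assumes vs: "vector_space s"
    and s_mult: "\<And>r a b. s r a * b = s r (a * b)" "\<And>r a b. a * s r b = s r (a * b)"
    and super: "\<And>x y. h x * h y = (if gen_parity x \<and> gen_parity y then - (h y * h x) else h y * h x)"
    and loc: "h DetInv * (pdet (\<lambda>i j. h (Coord (Inl i) (Inl j))) * pdet (\<lambda>i j. h (Coord (Inr i) (Inr j)))) = 1"
begin

interpretation V: vector_space s by (rule vs)

definition free_hom :: "('k, 'm, 'n) free_alg \<Rightarrow> 'r" where
  "free_hom F = (\<Sum>w\<in>Poly_Mapping.keys F. s (Poly_Mapping.lookup F w) (prod_list (map h (letters w))))"

lemma free_hom_superset:
  assumes "finite A" "Poly_Mapping.keys F \<subseteq> A"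
  shows "free_hom F = (\<Sum>w\<in>A. s (Poly_Mapping.lookup F w) (prod_list (map h (letters w))))"
  unfolding free_hom_def
  by (rule sum.mono_neutral_left) (use assms in \<open>auto simp: in_keys_iff\<close>)

lemma free_hom_add: "free_hom (F + H) = free_hom F + free_hom H"
proof -
  let ?A = "Poly_Mapping.keys F \<union> Poly_Mapping.keys H"
  have "free_hom (F + H) = (\<Sum>w\<in>?A. s (Poly_Mapping.lookup (F + H) w) (prod_list (map h (letters w))))"
    by (rule free_hom_superset) (simp_all add: Poly_Mapping.keys_add)
  also have "\<dots> = free_hom F + free_hom H"
    by (simp add: free_hom_superset[of ?A] lookup_add V.scale_left_distrib sum.distrib)
  finally show ?thesis .
qed

lemma free_hom_0: "free_hom 0 = 0" by (simp add: free_hom_def)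

lemma free_hom_sum: "free_hom (sum f A) = (\<Sum>a\<in>A. free_hom (f a))"
  by (induction A rule: infinite_finite_induct) (simp_all add: free_hom_add free_hom_0)

lemma free_hom_single: "free_hom (Poly_Mapping.single w r) = s r (prod_list (map h (letters w)))"
  by (simp add: free_hom_def)

lemma free_hom_1: "free_hom 1 = 1"
  unfolding single_one[symmetric] by (simp add: free_hom_single zero_word_def del: single_one)

lemma free_hom_gen: "free_hom (free_gen x) = h x"
  by (simp add: free_gen_def free_hom_single)

lemma free_hom_mult: "free_hom (F * H) = free_hom F * free_hom H"
proof -
  have "F * H = (\<Sum>u\<in>Poly_Mapping.keys F. Poly_Mapping.single u (Poly_Mapping.lookup F u)) *
                (\<Sum>v\<in>Poly_Mapping.keys H. Poly_Mapping.single v (Poly_Mapping.lookup H v))"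
    by (simp add: sum_singles)
  also have "free_hom \<dots> = free_hom F * free_hom H"
    by (simp add: sum_product free_hom_sum mult_single free_hom_single plus_word_def
        free_hom_def[of F] free_hom_def[of H] s_mult mult.commute)
  finally show ?thesis .
qed

lemma free_hom_uminus: "free_hom (- F) = - free_hom F"
  using free_hom_add[of F "- F"] by (simp add: eq_neg_iff_add_eq_0 add.commute free_hom_0)

lemma free_hom_diff: "free_hom (F - H) = free_hom F - free_hom H"
  using free_hom_add[of F "- H"] by (simp add: free_hom_uminus)

lemma free_hom_scalar: "free_hom (free_scalar r * F) = s r (free_hom F)"
  unfolding free_hom_mult by (simp add: free_scalar_def free_hom_single zero_word_def s_mult)

lemma free_hom_det:
  "free_hom free_det0 = pdet (\<lambda>i j. h (Coord (Inl i) (Inl j)))"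
  "free_hom free_det1 = pdet (\<lambda>i j. h (Coord (Inr i) (Inr j)))"
proof -
  have i: "free_hom (of_int (sign \<pi>)) = of_int (sign \<pi>)" for \<pi> :: "'i \<Rightarrow> 'i"
    by (cases \<pi> rule: sign_cases) (simp_all add: free_hom_1 free_hom_uminus)
  have p: "free_hom (prod_list xs) = prod_list (map free_hom xs)" for xs
    by (induction xs) (simp_all add: free_hom_1 free_hom_mult)
  show "free_hom free_det0 = pdet (\<lambda>i j. h (Coord (Inl i) (Inl j)))"
    "free_hom free_det1 = pdet (\<lambda>i j. h (Coord (Inr i) (Inr j)))"
    by (simp_all add: free_det0_def free_det1_def pdet_def free_hom_sum free_hom_mult i p free_hom_gen comp_def)
qed

lemma free_hom_rel_ideal: "F \<in> rel_ideal \<Longrightarrow> free_hom F = 0"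
proof (induction rule: rel_ideal.induct)
  case (supercomm x y)
  then show ?case
    using super[of x y] by (simp add: koszul_def free_hom_diff free_hom_mult free_hom_uminus free_hom_1 free_hom_gen)
next
  case localize
  show ?case by (simp add: free_hom_diff free_hom_mult free_hom_gen free_hom_det loc free_hom_1)
qed (simp_all add: free_hom_add free_hom_mult free_hom_0)

text \<open>The universal property of the presentation: the assumptions \<open>super\<close> and
  \<open>loc\<close> are the images of the two families of relations. It supplies the
  comultiplication and the restrictions to triangular, permutation and scalar matrices.\<close>

lemma KG_hom_exists:
  "\<exists>H :: ('k, 'm, 'n) KG \<Rightarrow> 'r. Vector_Spaces.linear kg_scale s H \<and> H 1 = 1 \<and> (\<forall>f g. H (f * g) = H f * H g) \<and>
     (\<forall>i j. H (coord i j) = h (Coord i j)) \<and> H det_inv = h DetInv"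
proof (intro exI conjI allI)
  let ?H = "\<lambda>f. free_hom (rep_KG f)"
  have H: "?H (abs_KG F) = free_hom F" for F
  proof -
    have "rep_KG (abs_KG F) - F \<in> rel_ideal"
      by (simp add: KG.abs_eq_iff[symmetric] Quotient3_abs_rep[OF Quotient3_KG])
    from free_hom_rel_ideal[OF this] show ?thesis by (simp add: free_hom_diff)
  qed
  have "?H (f + g) = ?H f + ?H g" for f g
    by (cases f; cases g) (simp add: plus_KG.abs_eq H free_hom_add)
  moreover have "?H (kg_scale r f) = s r (?H f)" for r f
    by (cases f) (simp add: kg_scale.abs_eq H free_hom_scalar)
  ultimately show "Vector_Spaces.linear kg_scale s ?H"
    using vector_space_KG vs by (simp add: Vector_Spaces.linear_iff)
  show "?H 1 = 1" by (simp add: one_KG.abs_eq H free_hom_1)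
  show "?H (f * g) = ?H f * ?H g" for f g
    by (cases f; cases g) (simp add: times_KG.abs_eq H free_hom_mult)
  show "?H (coord i j) = h (Coord i j)" "?H det_inv = h DetInv" for i j
    by (simp_all add: abs_KG_gen[symmetric] H free_hom_gen)
qed

end

lemma KG_linear_ext:
  fixes H H' :: "('k::field, 'm::{finite,linorder}, 'n::{finite,linorder}) KG \<Rightarrow> 'v::ab_group_add"
  assumes "Vector_Spaces.linear kg_scale s H" "Vector_Spaces.linear kg_scale s H'"
    and "H 1 = H' 1" "\<And>i j f. H f = H' f \<Longrightarrow> H (coord i j * f) = H' (coord i j * f)"
    "\<And>f. H f = H' f \<Longrightarrow> H (det_inv * f) = H' (det_inv * f)"
  shows "H = H'"
proof
  fix f show "H f = H' f"
    by (induction f rule: KG_span_induct) (use assms in \<open>simp_all add: Vector_Spaces.linear_iff\<close>)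
qed

subsection \<open>Parity\<close>

lemma part_0 [simp]: "part p 0 = 0" using part_scale[of p 0 0] by simp
lemma part_diff: "part p (f - g) = part p f - part p g"
  using part_add[of p "f - g" g] by simp
lemma part_uminus: "part p (- f) = - part p f"
  using part_diff[of p 0 f] by simp

lemma part_1: "part p 1 = (if p then 0 else 1)"
proof -
  have "part p (1 :: ('a, 'b, 'c) KG) = abs_KG (free_part p 1)" unfolding one_KG_def by (rule part.abs_eq)
  then show ?thesis by (simp add: free_part_homogeneous[OF free_homogeneous_1] one_KG_def zero_KG_def)
qed

lemma part_split: "part True f + part False f = f"
  by transfer (simp add: free_part_split rel_ideal.zero)

lemma part_part: "part p (part q f) = (if p = q then part q f else 0)"
proof (cases f)
  case (abs_KG F)
  then show ?thesis
    by (auto simp: part.abs_eq free_part_homogeneous[OF free_homogeneous_part] zero_KG_def)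
qed

lemma part_mult: "part p (f * g) = part True f * part (\<not> p) g + part False f * part p g"
  by transfer (simp add: free_part_mult rel_ideal.zero)

text \<open>With this encoding 0 is homogeneous of both parities, so vanishing products need no case
  distinction.\<close>

definition parity :: "bool \<Rightarrow> ('k::field, 'm::{finite,linorder}, 'n::{finite,linorder}) KG \<Rightarrow> bool" where
  "parity p f \<longleftrightarrow> part p f = f"

lemma parity_part: "parity p (part p f)" by (simp add: parity_def part_part)

lemma part_parity: "parity q f \<Longrightarrow> part p f = (if p = q then f else 0)"
  using part_part[of p q f] by (auto simp: parity_def)

lemma part_coord: "part p (coord i j) = (if p = (isl i \<noteq> isl j) then coord i j else 0)"
proof -
  have "part p (coord i j) = abs_KG (free_part p (free_gen (Coord i j)))" by (simp add: coord_def part.abs_eq)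
  then show ?thesis by (auto simp: free_part_homogeneous[OF free_homogeneous_gen] coord_def zero_KG_def)
qed

lemma part_det_inv: "part p det_inv = (if p then 0 else det_inv)"
proof -
  have "part p det_inv = abs_KG (free_part p (free_gen DetInv))" unfolding det_inv_def by (rule part.abs_eq)
  then show ?thesis unfolding free_part_homogeneous[OF free_homogeneous_gen]
    by (cases p) (simp_all add: det_inv_def zero_KG_def)
qed

lemma parity_coord: "parity (isl i \<noteq> isl j) (coord i j)" by (simp add: parity_def part_coord)
lemma parity_det_inv: "parity False det_inv" by (simp add: parity_def part_det_inv)
lemma parity_1: "parity False 1" by (simp add: parity_def part_1)
lemma parity_0: "parity p 0" by (simp add: parity_def)
lemma parity_add: "parity p f \<Longrightarrow> parity p g \<Longrightarrow> parity p (f + g)" by (simp add: parity_def part_add)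
lemma parity_mult: "parity p f \<Longrightarrow> parity q g \<Longrightarrow> parity (p \<noteq> q) (f * g)"
  using part_parity[of p f True] part_parity[of p f False] part_parity[of q g]
  by (auto simp: parity_def part_mult)

lemma parity_even_mult: "parity False f \<Longrightarrow> parity False g \<Longrightarrow> parity False (f * g)"
  using parity_mult[of False f False g] by simp

lemma part_mult_left: "parity q a \<Longrightarrow> part p (a * f) = a * part (p \<noteq> q) f"
  using part_parity[of q a] by (cases q) (auto simp: part_mult)

lemmas part_coord_mult = part_mult_left[OF parity_coord]
lemmas part_det_inv_mult = part_mult_left[OF parity_det_inv]

lemma parity_power: "parity False f \<Longrightarrow> parity False (f ^ n)"
  by (induction n) (simp_all add: parity_1 parity_even_mult)

lemma parity_prod_list: "(\<And>f. f \<in> set fs \<Longrightarrow> parity False f) \<Longrightarrow> parity False (prod_list fs)"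
  by (induction fs) (simp_all add: parity_1 parity_even_mult)

lemma coord_supercomm:
  fixes i j k l :: "'m::{finite,linorder} + 'n::{finite,linorder}"
  shows "coord i j * coord k l =
    (kg_scale (koszul (isl i \<noteq> isl j) (isl k \<noteq> isl l)) (coord k l * coord i j) :: ('k::field, 'm, 'n) KG)"
  and "coord i j * det_inv = (det_inv * coord i j :: ('k, 'm, 'n) KG)"
proof -
  have eq: "abs_KG (free_gen x) * abs_KG (free_gen y) =
      (kg_scale (koszul (gen_parity x) (gen_parity y)) (abs_KG (free_gen y) * abs_KG (free_gen x)) :: ('k, 'm, 'n) KG)"
    for x y :: "('m, 'n) gen"
  proof -
    have "koszul p q * F = free_scalar (koszul p q) * F" for p q and F :: "('k, 'm, 'n) free_alg"
      by (simp add: koszul_def free_scalar_def single_uminus)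
    then show ?thesis
      unfolding times_KG.abs_eq kg_scale.abs_eq KG.abs_eq_iff by (metis rel_ideal.supercomm)
  qed
  show "coord i j * coord k l =
      (kg_scale (koszul (isl i \<noteq> isl j) (isl k \<noteq> isl l)) (coord k l * coord i j) :: ('k, 'm, 'n) KG)"
    using eq[of "Coord i j" "Coord k l"] by (simp add: abs_KG_gen)
  show "coord i j * det_inv = (det_inv * coord i j :: ('k, 'm, 'n) KG)"
    using eq[of "Coord i j" "DetInv"] by (simp add: abs_KG_gen koszul_def)
qed

text \<open>Supercommutation with the generators propagates along words because Koszul signs
  multiply as parities add. It is applied first with a generator as \<open>x\<close>, and then,
  knowing that case, with an arbitrary homogeneous \<open>x\<close>.\<close>

lemma supercomm_generators:
  assumes step: "\<And>k l. x * coord k l = kg_scale (koszul p (isl k \<noteq> isl l)) (coord k l * x)" "x * det_inv = det_inv * x"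
    and "parity q g"
  shows "x * g = kg_scale (koszul p q) (g * x)"
proof -
  have "\<forall>q. x * part q g = kg_scale (koszul p q) (part q g * x)"
  proof (induction g rule: KG_span_induct)
    case one
    show ?case by (auto simp: part_1 koszul_def)
  next
    case (add f g)
    then show ?case by (simp add: part_add distrib_left distrib_right KG.scale_right_distrib)
  next
    case (scale r f)
    then show ?case by (simp add: part_scale kg_scale_mult mult.commute)
  next
    case (coord i j f)
    show ?case
    proof
      fix q
      let ?c = "coord i j" let ?p = "isl i \<noteq> isl j"
      have "x * part q (?c * f) = x * ?c * part (q \<noteq> ?p) f"
        by (simp add: part_coord_mult mult.assoc)
      also have "\<dots> = kg_scale (koszul p ?p) (?c * (x * part (q \<noteq> ?p) f))"
        by (simp add: step kg_scale_mult mult.assoc)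
      also have "\<dots> = kg_scale (koszul p ?p * koszul p (q \<noteq> ?p)) (?c * (part (q \<noteq> ?p) f * x))"
        using coord by (simp add: kg_scale_mult)
      also have "koszul p ?p * koszul p (q \<noteq> ?p) = koszul p q"
        by (auto simp: koszul_def)
      also have "?c * (part (q \<noteq> ?p) f * x) = part q (?c * f) * x"
        by (simp add: part_coord_mult mult.assoc)
      finally show "x * part q (?c * f) = kg_scale (koszul p q) (part q (?c * f) * x)" .
    qed
  next
    case (det_inv f)
    have "x * (det_inv * part q f) = det_inv * (x * part q f)" for q
      by (simp only: mult.assoc[symmetric] step)
    then show ?case using det_inv by (simp add: part_det_inv_mult kg_scale_mult mult.assoc)
  qed
  then show ?thesis using assms(3) by (metis parity_def)
qed

lemma supercomm:
  fixes f g :: "('k::field, 'm::{finite,linorder}, 'n::{finite,linorder}) KG"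
  assumes "parity p f" "parity q g"
  shows "f * g = kg_scale (koszul p q) (g * f)"
proof -
  have 1: "coord i j * f = kg_scale (koszul (isl i \<noteq> isl j) p) (f * coord i j)" for i j
    by (rule supercomm_generators[OF coord_supercomm(1) coord_supercomm(2) assms(1)])
  have 2: "det_inv * f = f * det_inv"
  proof -
    have "det_inv * f = kg_scale (koszul False p) (f * det_inv)"
    proof (rule supercomm_generators[OF _ refl assms(1)])
      show "det_inv * coord k l = kg_scale (koszul False (isl k \<noteq> isl l)) (coord k l * det_inv :: ('k, 'm, 'n) KG)" for k l
        by (simp add: coord_supercomm(2) koszul_def)
    qed
    then show ?thesis by (simp add: koszul_def)
  qed
  show ?thesis
  proof (rule supercomm_generators[OF _ _ assms(2)])
    show "f * coord k l = kg_scale (koszul p (isl k \<noteq> isl l)) (coord k l * f)" for k l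
      by (cases p; cases "isl k \<noteq> isl l") (simp_all add: 1 koszul_def)
  qed (simp add: 2)
qed

lemma even_central: "parity False f \<Longrightarrow> f * g = g * f"
proof -
  assume f: "parity False f"
  have "f * part q g = part q g * f" for q
    using supercomm[OF f parity_part[of q g]] by (simp add: koszul_def)
  then have "f * (part True g + part False g) = (part True g + part False g) * f"
    by (simp only: distrib_left distrib_right)
  then show ?thesis by (simp only: part_split)
qed

lemma char_ne_2: "CHAR('k::field) \<noteq> 2 \<Longrightarrow> (2 :: 'k) \<noteq> 0"
proof
  assume c: "CHAR('k) \<noteq> 2" "(2 :: 'k) = 0"
  then have "of_nat 2 = (0 :: 'k)" by simp
  then have "CHAR('k) dvd 2" by (simp only: of_nat_eq_0_iff_char_dvd)
  then have "CHAR('k) = 1 \<or> CHAR('k) = 2" using two_is_prime_nat by (auto simp: prime_nat_iff)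
  then show False using c(1) by simp
qed

text \<open>An odd element anticommutes with itself, so twice its square is zero, and 2 is
  invertible.\<close>

lemma odd_square:
  fixes f :: "('k::field, 'm::{finite,linorder}, 'n::{finite,linorder}) KG"
  assumes "CHAR('k) \<noteq> 2" "parity True f"
  shows "f * f = 0"
proof -
  have "f * f = - (f * f)" using supercomm[OF assms(2,2)] by (simp add: koszul_def)
  then have "f * f + f * f = 0" by (simp add: eq_neg_iff_add_eq_0)
  then have "kg_scale 2 (f * f) = 0" using KG.scale_left_distrib[of 1 1 "f * f"] by simp
  then show ?thesis using char_ne_2[OF assms(1)] by simp
qed

subsection \<open>The determinants and the counit\<close>

text \<open>The product of the determinants of the even diagonal blocks, that is, the element
  inverted by \<open>det_inv\<close>; it is not the Berezinian.\<close>

definition kdet :: "('k::field, 'm::{finite,linorder}, 'n::{finite,linorder}) KG" where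
  "kdet = pdet (\<lambda>i j. coord (Inl i) (Inl j)) * pdet (\<lambda>i j. coord (Inr i) (Inr j))"

lemma abs_KG_det:
  "abs_KG free_det0 = pdet (\<lambda>i j. coord (Inl i) (Inl j))"
  "abs_KG free_det1 = pdet (\<lambda>i j. coord (Inr i) (Inr j))"
proof -
  have s: "abs_KG (sum f S) = (\<Sum>x\<in>S. abs_KG (f x))" for f and S :: "('i \<Rightarrow> 'i) set"
    by (induction S rule: infinite_finite_induct) (simp_all add: zero_KG_def plus_KG.abs_eq[symmetric])
  have p: "abs_KG (prod_list xs) = prod_list (map abs_KG xs)" for xs
    by (induction xs) (simp_all add: one_KG_def times_KG.abs_eq[symmetric])
  have i: "abs_KG (of_int (sign \<pi>)) = of_int (sign \<pi>)" for \<pi> :: "'i \<Rightarrow> 'i"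
    by (cases \<pi> rule: sign_cases) (simp_all add: one_KG_def uminus_KG.abs_eq[symmetric])
  show "abs_KG free_det0 = pdet (\<lambda>i j. coord (Inl i) (Inl j))"
    "abs_KG free_det1 = pdet (\<lambda>i j. coord (Inr i) (Inr j))"
    by (simp_all add: free_det0_def free_det1_def pdet_def s times_KG.abs_eq[symmetric] i p abs_KG_gen comp_def)
qed

lemma det_inv_kdet: "det_inv * kdet = 1" 
proof -
  have "abs_KG (free_gen DetInv * (free_det0 * free_det1)) = abs_KG 1"
    unfolding KG.abs_eq_iff by (rule rel_ideal.localize)
  then show ?thesis by (simp add: times_KG.abs_eq[symmetric] abs_KG_gen abs_KG_det one_KG_def kdet_def)
qed

lemma parity_pdet:
  fixes A :: "'i::{finite,linorder} \<Rightarrow> 'i \<Rightarrow> ('k::field, 'm::{finite,linorder}, 'n::{finite,linorder}) KG"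
  assumes "\<And>i j. parity False (A i j)"
  shows "parity False (pdet A)"
proof -
  have sum: "parity False (sum f S)" if "\<And>x. x \<in> S \<Longrightarrow> parity False (f x)"
    for f :: "('i \<Rightarrow> 'i) \<Rightarrow> ('k, 'm, 'n) KG" and S
    using that by (induction S rule: infinite_finite_induct) (simp_all add: parity_0 parity_add)
  have sgn: "parity False (of_int (sign \<pi>) :: ('k, 'm, 'n) KG)" for \<pi> :: "'i \<Rightarrow> 'i"
    by (cases \<pi> rule: sign_cases) (simp_all add: parity_1 parity_def part_uminus part_1)
  show ?thesis unfolding pdet_def
    by (intro sum parity_even_mult sgn parity_prod_list) (auto simp: assms)
qed

lemma parity_kdet: "parity False kdet"
  unfolding kdet_def using parity_coord[of "Inl _" "Inl _"] parity_coord[of "Inr _" "Inr _"]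
  by (intro parity_even_mult parity_pdet) simp_all

lemma kdet_det_inv: "kdet * det_inv = 1"
  using det_inv_kdet even_central[OF parity_det_inv] by metis

lemma counit_simps [simp]:
  "counit (f + g) = counit f + counit g" "counit (f * g) = counit f * counit g" "counit 1 = 1" "counit 0 = 0"
  "counit (kg_scale r f) = r * counit f" "counit (coord i j) = (if i = j then 1 else 0)" "counit det_inv = 1"
  by (transfer, simp add: free_counit_add free_counit_mult free_scalar_def free_counit_single zero_word_def)+

lemma counit_minus [simp]: "counit (f - g) = counit f - counit g" "counit (- f) = - counit f"
  by (transfer, simp add: free_counit_diff free_counit_uminus)+

lemma counit_power [simp]: "counit (f ^ n) = counit f ^ n" by (induction n) simp_all

lemma counit_part: "counit (part p f) = (if p then 0 else counit f)"
proof -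
  have "\<forall>p. counit (part p f) = (if p then 0 else counit f)"
  proof (induction f rule: KG_span_induct)
    case (coord i j f)
    then show ?case by (auto simp: part_coord_mult)
  next
    case (det_inv f)
    then show ?case by (simp add: part_det_inv_mult)
  qed (simp_all add: part_add part_scale part_1)
  then show ?thesis by blast
qed

section \<open>The superalgebra structure on the tensor square and the existence of the
  comultiplication\<close>

section \<open>The tensor square as a superalgebra\<close>

lemma tensor_0 [simp]: "tensor 0 g = 0" "tensor f 0 = 0"
  using tensor_scale_left[of 0 0 g] tensor_scale_right[of f 0 0] by simp_all

lemma tensor_minus: "tensor (f - f') g = tensor f g - tensor f' g" "tensor f (g - g') = tensor f g - tensor f g'"
  using tensor_add_left[of "f - f'" f' g] tensor_add_right[of f "g - g'" g'] by (simp_all add: eq_diff_eq)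

lemma tensor_sum_right: "tensor f (\<Sum>x\<in>A. g x) = (\<Sum>x\<in>A. tensor f (g x))"
  by (induction A rule: infinite_finite_induct) (simp_all add: tensor_add_right)

text \<open>A scalar is absorbed into the left factor, so pure tensors and sums suffice.\<close>

lemma KG2_tensor_induct [consumes 0, case_names tensor add]:
  fixes x :: "('k::field, 'm::{finite,linorder}, 'n::{finite,linorder}) KG2"
  assumes tensor: "\<And>a b. P (tensor a b)" and add: "\<And>x y. P x \<Longrightarrow> P y \<Longrightarrow> P (x + y)"
  shows "P x"
proof (induction x)
  fix F :: "('k, 'm, 'n) KG \<times> ('k, 'm, 'n) KG \<Rightarrow>\<^sub>0 'k"
  have single: "P (abs_KG2 (Poly_Mapping.single (a, b) r))" for a b r
    using tensor[of "kg_scale r a" b]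
    by (simp add: tensor_scale_left) (simp add: tensor_def tensor_scale.abs_eq free_tensor_scale_single)
  have sum: "P (abs_KG2 (\<Sum>ab\<in>A. Poly_Mapping.single ab (Poly_Mapping.lookup F ab)))" for A
  proof (induction A rule: infinite_finite_induct)
    case (insert ab A)
    then show ?case using single[of "fst ab" "snd ab" "Poly_Mapping.lookup F ab"]
      by (simp add: plus_KG2.abs_eq[symmetric] add)
  qed (use single[of 0 0 0] in simp_all)
  have "(\<Sum>ab\<in>Poly_Mapping.keys F. Poly_Mapping.single ab (Poly_Mapping.lookup F ab)) = F"
    by (rule poly_mapping_eqI) (simp add: lookup_sum lookup_single when_def in_keys_iff)
  then show "P (abs_KG2 F)" using sum[of "Poly_Mapping.keys F"] by simp
qed

text \<open>Splitting both factors into homogeneous parts reduces the double sum in the product of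
  tensors to a single Koszul sign.\<close>

lemma KG2_induct [consumes 0, case_names tensor add]:
  fixes x :: "('k::field, 'm::{finite,linorder}, 'n::{finite,linorder}) KG2"
  assumes tensor: "\<And>a b p q. parity p a \<Longrightarrow> parity q b \<Longrightarrow> P (tensor a b)"
    and add: "\<And>x y. P x \<Longrightarrow> P y \<Longrightarrow> P (x + y)"
  shows "P x"
proof (induction x rule: KG2_tensor_induct)
  case (tensor a b)
  have "tensor a b = tensor (part True a) (part True b) + tensor (part True a) (part False b) +
      (tensor (part False a) (part True b) + tensor (part False a) (part False b))"
    by (simp add: tensor_add_left[symmetric] tensor_add_right[symmetric] part_split)
  moreover have "P (tensor (part p a) (part q b))" for p q by (rule assms(1)[OF parity_part parity_part])
  ultimately show ?case by (simp add: add)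
qed (rule add)

subsection \<open>Linear maps on the tensor square\<close>

lemma bilinear_mapI:
  assumes "vector_space s" "\<And>a a' b. B (a + a') b = B a b + B a' b" "\<And>a b b'. B a (b + b') = B a b + B a b'"
    "\<And>r a b. B (kg_scale r a) b = s r (B a b)" "\<And>r a b. B a (kg_scale r b) = s r (B a b)"
  shows "bilinear_map s B"
  unfolding bilinear_map_def Vector_Spaces.linear_iff using assms vector_space_KG by auto

lemma tensor_lift_add:
  assumes "vector_space s" "bilinear_map s B"
  shows "tensor_lift s B (x + y) = tensor_lift s B x + tensor_lift s B y"
  using linear_tensor_lift[OF assms] by (simp add: Vector_Spaces.linear_iff)

lemma tensor_lift_scale:
  assumes "vector_space s" "bilinear_map s B"
  shows "tensor_lift s B (tensor_scale r x) = s r (tensor_lift s B x)"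
  using linear_tensor_lift[OF assms] by (simp add: Vector_Spaces.linear_iff)

lemma tensor_lift_fun_add:
  assumes "vector_space s"
  shows "tensor_lift s (\<lambda>a b. B a b + C a b) x = tensor_lift s B x + tensor_lift s C x"
proof -
  interpret V: vector_space s by fact
  show ?thesis by (simp add: tensor_lift_def free_lift_def sum.distrib V.scale_right_distrib)
qed

lemma tensor_lift_fun_scale:
  assumes "vector_space s"
  shows "tensor_lift s (\<lambda>a b. s r (B a b)) x = s r (tensor_lift s B x)"
proof -
  interpret V: vector_space s by fact
  show ?thesis by (simp add: tensor_lift_def free_lift_def V.scale_sum_right mult.commute)
qed

abbreviation (input) "tm a b c d \<equiv>
  \<Sum>p\<in>UNIV. \<Sum>q\<in>UNIV. tensor_scale (koszul p q) (tensor (a * part q c) (part p b * d))"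

instantiation KG2 :: (field, "{finite,linorder}", "{finite,linorder}") ring_1
begin

definition "1 = tensor 1 1"
definition "x * y = tensor_mult x y"

lemma tm_bilinear: "bilinear_map tensor_scale (tm a b)" "bilinear_map tensor_scale (\<lambda>a b. tm a b c d)"
  by (intro bilinear_mapI vector_space_KG2;
      simp add: part_add part_scale kg_scale_mult distrib_left distrib_right tensor_add_left tensor_add_right
        tensor_scale_left tensor_scale_right sum.distrib KG2.scale_right_distrib KG2.scale_sum_right mult.commute)+

lemma tm_lift_bilinear:
  fixes y :: "('a::field, 'b::{finite,linorder}, 'c::{finite,linorder}) KG2"
  shows "bilinear_map tensor_scale (\<lambda>a b. tensor_lift tensor_scale (tm a b) y)"
proof (rule bilinear_mapI[OF vector_space_KG2])
  note bil = tm_bilinear(2)[unfolded bilinear_map_def Vector_Spaces.linear_iff]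
  have "tm (a + a') b = (\<lambda>c d. tm a b c d + tm a' b c d)" "tm a (b + b') = (\<lambda>c d. tm a b c d + tm a b' c d)"
    "tm (kg_scale r a) b = (\<lambda>c d. tensor_scale r (tm a b c d))" "tm a (kg_scale r b) = (\<lambda>c d. tensor_scale r (tm a b c d))"
    for a a' b b' :: "('a, 'b, 'c) KG" and r
    using bil by (intro ext, blast)+
  then show "tensor_lift tensor_scale (tm (a + a') b) y = tensor_lift tensor_scale (tm a b) y + tensor_lift tensor_scale (tm a' b) y"
    "tensor_lift tensor_scale (tm a (b + b')) y = tensor_lift tensor_scale (tm a b) y + tensor_lift tensor_scale (tm a b') y"
    "tensor_lift tensor_scale (tm (kg_scale r a) b) y = tensor_scale r (tensor_lift tensor_scale (tm a b) y)"
    "tensor_lift tensor_scale (tm a (kg_scale r b)) y = tensor_scale r (tensor_lift tensor_scale (tm a b) y)"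
    for a a' b b' :: "('a, 'b, 'c) KG" and r
    by (simp_all only: tensor_lift_fun_add[OF vector_space_KG2] tensor_lift_fun_scale[OF vector_space_KG2])
qed

lemma KG2_mult_linear:
  fixes x y z :: "('a::field, 'b::{finite,linorder}, 'c::{finite,linorder}) KG2"
  shows "(x + y) * z = x * z + y * z" "x * (y + z) = x * y + x * z"
    "tensor_scale r x * y = tensor_scale r (x * y)" "x * tensor_scale r y = tensor_scale r (x * y)"
  unfolding times_KG2_def tensor_mult_def
  by (simp_all only: tensor_lift_add[OF vector_space_KG2 tm_bilinear(1)] tensor_lift_scale[OF vector_space_KG2 tm_bilinear(1)]
      tensor_lift_add[OF vector_space_KG2 tm_lift_bilinear] tensor_lift_scale[OF vector_space_KG2 tm_lift_bilinear]
      tensor_lift_fun_add[OF vector_space_KG2] tensor_lift_fun_scale[OF vector_space_KG2])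

lemma tensor_times_tensor:
  assumes "parity p b" "parity q c"
  shows "tensor a b * tensor c d = tensor_scale (koszul p q) (tensor (a * c) (b * d))"
  unfolding times_KG2_def tensor_mult_tensor using assms
  by (cases p; cases q) (simp_all add: UNIV_bool part_parity)

instance
proof
  fix x y z :: "('a, 'b, 'c) KG2"
  show "x * y * z = x * (y * z)"
  proof (induction x rule: KG2_induct)
    case (tensor a b p q)
    note x = tensor
    show ?case
    proof (induction y rule: KG2_induct)
      case (tensor c d r s)
      note y = tensor
      show ?case
      proof (induction z rule: KG2_induct)
        case (tensor e f t u)
        show ?case
          using parity_mult[OF x(2) y(2)] parity_mult[OF y(1) tensor(1)]
          by (simp add: tensor_times_tensor[OF x(2) y(1)] tensor_times_tensor[OF y(2) tensor(1)]
              KG2_mult_linear tensor_times_tensor[of "q \<noteq> s" _ t] tensor_times_tensor[OF x(2), of "r \<noteq> t"]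
              tensor(1) mult.assoc) (simp add: koszul_def)
      qed (simp add: KG2_mult_linear)
    qed (simp add: KG2_mult_linear)
  qed (simp add: KG2_mult_linear)
  show "1 * x = x"
  proof (induction x rule: KG2_induct)
    case (tensor a b p q)
    then show ?case by (simp add: one_KG2_def tensor_times_tensor[OF parity_1] koszul_def)
  qed (simp add: KG2_mult_linear)
  show "x * 1 = x"
  proof (induction x rule: KG2_induct)
    case (tensor a b p q)
    then show ?case by (simp add: one_KG2_def tensor_times_tensor[OF _ parity_1] koszul_def)
  qed (simp add: KG2_mult_linear)
  show "(x + y) * z = x * z + y * z" "x * (y + z) = x * y + x * z" by (rule KG2_mult_linear)+
  \<comment> \<open>The tensor square of the counit separates 0 from 1.\<close>
  have bil: "bilinear_map (*) (\<lambda>a b. counit a * counit b :: 'a)"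
    by (rule bilinear_mapI) (simp_all add: vector_space_def algebra_simps)
  have vs: "vector_space ((*) :: 'a \<Rightarrow> _)" by (simp add: vector_space_def algebra_simps)
  have "tensor_lift (*) (\<lambda>a b. counit a * counit b) (1 :: ('a, 'b, 'c) KG2) = 1"
    by (simp add: one_KG2_def tensor_lift_tensor[OF vs bil])
  moreover have "tensor_lift (*) (\<lambda>a b. counit a * counit b) (0 :: ('a, 'b, 'c) KG2) = 0"
    using tensor_lift_scale[OF vs bil, of 0 0] by simp
  ultimately show "(0 :: ('a, 'b, 'c) KG2) \<noteq> 1" by force
qed

end

lemma vector_space_field: "vector_space ((*) :: 'k::field \<Rightarrow> _)"
  by (simp add: vector_space_def algebra_simps)

text \<open>A homogeneous component of the tensor square, described by spanning tensors instead of a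
  projection; closure and supercommutativity then follow by induction on the span.\<close>

definition parity2 :: "bool \<Rightarrow> ('k::field, 'm::{finite,linorder}, 'n::{finite,linorder}) KG2 set" where
  "parity2 p = KG2.span {tensor a b | a b q. parity q a \<and> parity (p \<noteq> q) b}"

lemma parity2_tensor: "parity q a \<Longrightarrow> parity r b \<Longrightarrow> p = (q \<noteq> r) \<Longrightarrow> tensor a b \<in> parity2 p"
  unfolding parity2_def by (intro KG2.span_base CollectI exI[of _ a] exI[of _ b] exI[of _ q]) auto

lemma parity2_induct [consumes 1, case_names tensor add scale]:
  assumes "x \<in> parity2 p" and tensor: "\<And>a b q. parity q a \<Longrightarrow> parity (p \<noteq> q) b \<Longrightarrow> P (tensor a b)"
    and add: "\<And>x y. P x \<Longrightarrow> P y \<Longrightarrow> P (x + y)" and scale: "\<And>r x. P x \<Longrightarrow> P (tensor_scale r x)"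
  shows "P x"
proof -
  have zero: "P 0" using scale[OF tensor[OF parity_0 parity_0], of 0] by simp
  show ?thesis using assms(1) unfolding parity2_def
    by (induction rule: KG2.span_induct_alt) (auto intro!: zero add scale tensor)
qed

lemma parity2_closed:
  "0 \<in> parity2 p" "x \<in> parity2 p \<Longrightarrow> y \<in> parity2 p \<Longrightarrow> x + y \<in> parity2 p"
  "x \<in> parity2 p \<Longrightarrow> tensor_scale r x \<in> parity2 p" "x \<in> parity2 p \<Longrightarrow> - x \<in> parity2 p" "1 \<in> parity2 False"
  using parity2_tensor[OF parity_1 parity_1, of False]
  by (auto simp: parity2_def KG2.span_zero KG2.span_add KG2.span_scale KG2.span_neg one_KG2_def)

lemma parity2_sum: "(\<And>i. i \<in> A \<Longrightarrow> f i \<in> parity2 p) \<Longrightarrow> sum f A \<in> parity2 p"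
  by (induction A rule: infinite_finite_induct) (simp_all add: parity2_closed)

lemma parity2_mult: "x \<in> parity2 p \<Longrightarrow> y \<in> parity2 q \<Longrightarrow> x * y \<in> parity2 (p \<noteq> q)"
proof (induction x rule: parity2_induct)
  case (tensor a b r)
  note x = tensor(1,2)
  from tensor(3) show ?case
  proof (induction y rule: parity2_induct)
    case (tensor c d s)
    show ?case unfolding tensor_times_tensor[OF x(2) tensor(1)]
      by (intro parity2_closed parity2_tensor[OF parity_mult[OF x(1) tensor(1)] parity_mult[OF x(2) tensor(2)]]) auto
  qed (simp_all add: KG2_mult_linear parity2_closed)
qed (simp_all add: KG2_mult_linear parity2_closed)

lemma parity2_supercomm:
  fixes x :: "('k::field, 'm::{finite,linorder}, 'n::{finite,linorder}) KG2"
  shows "x \<in> parity2 p \<Longrightarrow> y \<in> parity2 q \<Longrightarrow> x * y = tensor_scale (koszul p q) (y * x)"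
proof (induction x rule: parity2_induct)
  case (tensor a b r)
  note x = tensor(1,2)
  from tensor(3) show ?case
  proof (induction y rule: parity2_induct)
    case (tensor c d s)
    show ?case
      by (simp add: tensor_times_tensor[OF x(2) tensor(1)] tensor_times_tensor[OF tensor(2) x(1)]
          supercomm[OF x(1) tensor(1)] supercomm[OF x(2) tensor(2)] tensor_scale_left tensor_scale_right)
        (simp add: koszul_def)
  next
    case (scale r y)
    then show ?case by (simp add: KG2_mult_linear mult.commute)
  qed (simp_all add: KG2_mult_linear KG2.scale_right_distrib)
next
  case (scale r y)
  then show ?case by (simp add: KG2_mult_linear mult.commute)
qed (simp_all add: KG2_mult_linear KG2.scale_right_distrib)

subsection \<open>The even part of the tensor square\<close>

text \<open>Even tensors commute. As a type they form a commutative ring, to which the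
  multiplicativity of determinants and the Frobenius map apply.\<close>

typedef (overloaded) ('k, 'm, 'n) KG2_even =
  "parity2 False :: ('k::field, 'm::{finite,linorder}, 'n::{finite,linorder}) KG2 set"
  using parity2_closed(1) by blast

setup_lifting type_definition_KG2_even

instantiation KG2_even :: (field, "{finite,linorder}", "{finite,linorder}") comm_ring_1
begin

lift_definition zero_KG2_even :: "('a, 'b, 'c) KG2_even" is 0 by (rule parity2_closed)
lift_definition one_KG2_even :: "('a, 'b, 'c) KG2_even" is 1 by (rule parity2_closed)
lift_definition plus_KG2_even :: "('a, 'b, 'c) KG2_even \<Rightarrow> ('a, 'b, 'c) KG2_even \<Rightarrow> ('a, 'b, 'c) KG2_even" is "(+)"
  by (rule parity2_closed)
lift_definition uminus_KG2_even :: "('a, 'b, 'c) KG2_even \<Rightarrow> ('a, 'b, 'c) KG2_even" is uminus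
  by (rule parity2_closed)
lift_definition minus_KG2_even :: "('a, 'b, 'c) KG2_even \<Rightarrow> ('a, 'b, 'c) KG2_even \<Rightarrow> ('a, 'b, 'c) KG2_even" is "(-)"
  unfolding diff_conv_add_uminus by (intro parity2_closed)
lift_definition times_KG2_even :: "('a, 'b, 'c) KG2_even \<Rightarrow> ('a, 'b, 'c) KG2_even \<Rightarrow> ('a, 'b, 'c) KG2_even" is "(*)"
  using parity2_mult[of _ False _ False] by simp

instance
proof
  fix a b c :: "('a, 'b, 'c) KG2_even"
  show "a * b = b * a"
    by transfer (use parity2_supercomm[of _ False _ False] in \<open>simp add: koszul_def\<close>)
qed (transfer; simp add: algebra_simps)+

end

lemma tensor_power_even: "parity False a \<Longrightarrow> parity False b \<Longrightarrow> tensor a b ^ n = tensor (a ^ n) (b ^ n)"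
  by (induction n) (simp_all add: one_KG2_def tensor_times_tensor[OF _ parity_power] koszul_def)

lemma Rep_KG2_even_power: "Rep_KG2_even (x ^ n) = Rep_KG2_even x ^ n"
  by (induction n) (simp_all add: one_KG2_even.rep_eq times_KG2_even.rep_eq)

lemma Rep_KG2_even_sum: "Rep_KG2_even (sum f A) = (\<Sum>x\<in>A. Rep_KG2_even (f x))"
  by (induction A rule: infinite_finite_induct) (simp_all add: zero_KG2_even.rep_eq plus_KG2_even.rep_eq)

section \<open>The comultiplication\<close>

lemma tensor_times_even:
  assumes "parity False b \<or> parity False c"
  shows "tensor a b * tensor c d = tensor (a * c) (b * d)"
proof -
  have "tensor a (part p b) * tensor (part q c) d = tensor (a * part q c) (part p b * d)" for p q
    using assms part_parity[of False b p] part_parity[of False c q]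
    by (auto simp: tensor_times_tensor[OF parity_part parity_part] koszul_def)
  then have "tensor a (part True b + part False b) * tensor (part True c + part False c) d =
      tensor (a * (part True c + part False c)) ((part True b + part False b) * d)"
    by (simp only: tensor_add_left tensor_add_right distrib_left distrib_right add_ac)
  then show ?thesis by (simp only: part_split)
qed

text \<open>The entries of the product of two generic matrices: the intended values of
  \<open>comult\<close> on the coordinates, before \<open>comult\<close> is known to exist.\<close>

definition comat :: "'m + 'n \<Rightarrow> 'm + 'n \<Rightarrow> ('k::field, 'm::{finite,linorder}, 'n::{finite,linorder}) KG2" where
  "comat i j = (\<Sum>k\<in>UNIV. tensor (coord i k) (coord k j))"

lemma parity2_comat: "comat i j \<in> parity2 (isl i \<noteq> isl j)"
  unfolding comat_def by (intro parity2_sum parity2_tensor[OF parity_coord parity_coord]) auto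

lemma parity2_comat_same: "isl i = isl j \<Longrightarrow> comat i j \<in> parity2 False"
  using parity2_comat[of i j] by simp

lemma parity_coord_same: "isl i = isl j \<Longrightarrow> parity False (coord i j)"
  using parity_coord[of i j] by simp

lemma power_commuting_mult_distrib:
  fixes a b :: "'r::monoid_mult"
  assumes "a * b = b * a"
  shows "(a * b) ^ n = a ^ n * b ^ n"
proof (induction n)
  case (Suc n)
  have "a ^ n * b = b * a ^ n" by (rule power_commuting_commutes[OF assms])
  note comm = this
  have "(a * b) ^ Suc n = a * (b * a ^ n) * b ^ n" using Suc by (simp add: mult.assoc)
  then show ?case by (simp add: comm[symmetric] mult.assoc)
qed simp

lemma left_right_inverse_monoid:
  fixes x :: "'r::monoid_mult"
  assumes "x * y = 1" "y * z = 1"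
  shows "x = z"
proof -
  have "x * (y * z) = x * y * z" by (simp only: mult.assoc)
  then show ?thesis using assms by simp
qed

lemma of_nat_KG2: "of_nat c = tensor_scale (of_nat c) 1"
  by (induction c) (simp_all add: KG2.scale_left_distrib)

lemma of_nat_KG: "of_nat c = kg_scale (of_nat c) 1"
  by (induction c) (simp_all add: KG.scale_left_distrib)

text \<open>In characteristic p > 2 this power of \<open>det_inv\<close> turns out to be group-like,
  and together with the coordinates it still generates K[G].\<close>

definition dinv :: "('k::field, 'm::{finite,linorder}, 'n::{finite,linorder}) KG" where
  "dinv = det_inv ^ CHAR('k)"

definition comdet :: "('k::field, 'm::{finite,linorder}, 'n::{finite,linorder}) KG2" where
  "comdet = pdet (\<lambda>i j. comat (Inl i) (Inl j)) * pdet (\<lambda>i j. comat (Inr i) (Inr j))"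

context
  assumes char: "CHAR('k::field) > 2"
begin

lemma prime_char: "prime CHAR('k)"
  by (rule prime_CHAR_semidom) (use char in simp)

lemma CHAR_KG2_even: "CHAR(('k, 'm::{finite,linorder}, 'n::{finite,linorder}) KG2_even) = CHAR('k)"
proof -
  have "Rep_KG2_even (of_nat c :: ('k, 'm, 'n) KG2_even) = of_nat c" for c
    by (induction c) (simp_all add: zero_KG2_even.rep_eq one_KG2_even.rep_eq plus_KG2_even.rep_eq)
  then have "Rep_KG2_even (of_nat CHAR('k) :: ('k, 'm, 'n) KG2_even) = Rep_KG2_even 0"
    by (simp add: of_nat_KG2 zero_KG2_even.rep_eq)
  then have "of_nat CHAR('k) = (0 :: ('k, 'm, 'n) KG2_even)" by (simp only: Rep_KG2_even_inject)
  then have "CHAR(('k, 'm, 'n) KG2_even) dvd CHAR('k)" by (simp only: of_nat_eq_0_iff_char_dvd)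
  then show ?thesis using prime_char by (auto simp: prime_nat_iff)
qed

lemma odd_tensor_square:
  assumes "parity True a" "parity True b"
  shows "(tensor a b :: ('k, 'm::{finite,linorder}, 'n::{finite,linorder}) KG2) * tensor a b = 0"
  using odd_square[OF _ assms(1)] char by (simp add: tensor_times_tensor[OF assms(2,1)])

text \<open>Modulo its odd entries the generic matrix is group-like; raising to the power \<open>p\<close> kills the
  odd contributions, so the \<open>p\<close>-th powers of the block determinants are group-like.\<close>

lemma pdet_comat_power:
  fixes e :: "'i::{finite,linorder} \<Rightarrow> 'm::{finite,linorder} + 'n::{finite,linorder}"
  assumes e: "inj e" "range e = {k. isl k = b}"
  shows "pdet (\<lambda>i j. comat (e i) (e j) :: ('k, 'm, 'n) KG2) ^ CHAR('k) =
    tensor (pdet (\<lambda>i j. coord (e i) (e j)) ^ CHAR('k)) (pdet (\<lambda>i j. coord (e i) (e j)) ^ CHAR('k))"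
proof -
  let ?p = "CHAR('k)" and ?E = "Abs_KG2_even :: ('k, 'm, 'n) KG2 \<Rightarrow> _"
  have pr: "prime CHAR(('k, 'm, 'n) KG2_even)" by (simp add: prime_char CHAR_KG2_even)
  have isl: "isl (e i) = b" for i using e(2) by blast
  have RA: "Rep_KG2_even (?E x) = x" if "x \<in> parity2 False" for x
    using that by (rule Abs_KG2_even_inverse)
  have RAt: "Rep_KG2_even (?E (tensor a c)) = tensor a c" if "parity q a" "parity q c" for a c q
    by (rule RA) (use that in \<open>auto intro: parity2_tensor\<close>)
  \<comment> \<open>\<open>M\<close> is a diagonal block of the product matrix, while
    \<open>A\<close> and \<open>B\<close> are the block of the generic matrix placed in the left and
    in the right tensor factor. \<open>M\<close> differs from the product of \<open>A\<close> and
    \<open>B\<close> by products of two odd entries, and entrywise p-th powers remove this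
    difference.\<close>
  define M where "M i j = ?E (comat (e i) (e j))" for i j
  define A where "A i j = ?E (tensor (coord (e i) (e j)) 1)" for i j
  define B where "B i j = ?E (tensor 1 (coord (e i) (e j)))" for i j
  have par: "parity False (coord (e i) (e j) :: ('k, 'm, 'n) KG)" for i j
    using parity_coord[of "e i" "e j"] by (simp add: isl)
  have RM: "Rep_KG2_even (M i j) = comat (e i) (e j)" for i j
    unfolding M_def using parity2_comat[of "e i" "e j"] by (intro RA) (simp add: isl)
  have RAA: "Rep_KG2_even (A i j) = tensor (coord (e i) (e j)) 1" for i j
    unfolding A_def by (rule RAt[OF par parity_1])
  have RB: "Rep_KG2_even (B i j) = tensor 1 (coord (e i) (e j))" for i j
    unfolding B_def by (rule RAt[OF parity_1 par])
  have Mp: "M i j ^ ?p = (\<Sum>k\<in>UNIV. A i k ^ ?p * B k j ^ ?p)" for i j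
  proof -
    have tc: "tensor (coord (e i) k) (coord k (e j)) \<in> parity2 False" for k
      by (intro parity2_tensor[OF parity_coord parity_coord]) (auto simp: isl)
    have "M i j = (\<Sum>k\<in>UNIV. ?E (tensor (coord (e i) k) (coord k (e j))))"
      by (simp add: Rep_KG2_even_inject[symmetric] RM Rep_KG2_even_sum RA[OF tc] comat_def)
    then have "M i j ^ ?p = (\<Sum>k\<in>UNIV. ?E (tensor (coord (e i) k) (coord k (e j))) ^ ?p)"
      by (simp add: freshmans_dream_sum[OF pr CHAR_KG2_even[symmetric]])
    also have "\<dots> = (\<Sum>k\<in>range e. ?E (tensor (coord (e i) k) (coord k (e j))) ^ ?p)"
    proof (rule sum.mono_neutral_right)
      show "\<forall>k\<in>UNIV - range e. ?E (tensor (coord (e i) k) (coord k (e j))) ^ ?p = 0"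
      proof
        fix k assume "k \<in> UNIV - range e"
        then have k: "isl k \<noteq> b" using e(2) by auto
        have "parity True (coord (e i) k :: ('k, 'm, 'n) KG)" "parity True (coord k (e j) :: ('k, 'm, 'n) KG)"
          using parity_coord[of "e i" k] parity_coord[of k "e j"] k by (auto simp: isl)
        from odd_tensor_square[OF this]
        have "Rep_KG2_even (?E (tensor (coord (e i) k) (coord k (e j))) * ?E (tensor (coord (e i) k) (coord k (e j)))) = Rep_KG2_even 0"
          by (simp add: times_KG2_even.rep_eq RA[OF tc] zero_KG2_even.rep_eq)
        then have z: "?E (tensor (coord (e i) k) (coord k (e j))) * ?E (tensor (coord (e i) k) (coord k (e j))) = 0"
          by (simp only: Rep_KG2_even_inject)
        obtain c where c: "?p = Suc (Suc c)" using char by (intro that[of "?p - 2"]) simp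
        have "x ^ ?p = x * x * x ^ c" for x :: "('k, 'm, 'n) KG2_even"
          unfolding c by (simp add: mult.assoc)
        then show "?E (tensor (coord (e i) k) (coord k (e j))) ^ ?p = 0"
          by (simp only: z mult_zero_left)
      qed
    qed auto
    also have "\<dots> = (\<Sum>k\<in>UNIV. (A i k * B k j) ^ ?p)"
    proof -
      have "?E (tensor (coord (e i) (e k)) (coord (e k) (e j))) = A i k * B k j" for k
        by (simp add: Rep_KG2_even_inject[symmetric] RA[OF tc] times_KG2_even.rep_eq RAA RB tensor_times_even[OF disjI1[OF parity_1]])
      then show ?thesis by (simp add: sum.reindex[OF e(1)])
    qed
    finally show ?thesis by (simp add: power_mult_distrib)
  qed
  have "pdet M ^ ?p = pdet A ^ ?p * pdet B ^ ?p"
    using pdet_power_CHAR[OF pr, of M] pdet_power_CHAR[OF pr, of A] pdet_power_CHAR[OF pr, of B]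
    by (simp add: CHAR_KG2_even Mp pdet_mult)
  then have "Rep_KG2_even (pdet M) ^ ?p = Rep_KG2_even (pdet A) ^ ?p * Rep_KG2_even (pdet B) ^ ?p"
    by (simp only: Rep_KG2_even_power[symmetric] times_KG2_even.rep_eq[symmetric])
  moreover have R: "Rep_KG2_even (pdet X) = pdet (\<lambda>i j. Rep_KG2_even (X i j))" for X :: "'i \<Rightarrow> 'i \<Rightarrow> ('k, 'm, 'n) KG2_even"
    by (rule pdet_hom) (simp_all add: one_KG2_even.rep_eq times_KG2_even.rep_eq plus_KG2_even.rep_eq)
  moreover have "pdet (\<lambda>i j. tensor (coord (e i) (e j)) 1) = tensor (pdet (\<lambda>i j. coord (e i) (e j))) (1 :: ('k, 'm, 'n) KG)"
    by (rule pdet_hom[of "\<lambda>x. tensor x 1", symmetric])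
      (simp_all add: one_KG2_def tensor_add_left tensor_times_even[OF disjI1[OF parity_1]])
  moreover have "pdet (\<lambda>i j. tensor 1 (coord (e i) (e j))) = tensor (1 :: ('k, 'm, 'n) KG) (pdet (\<lambda>i j. coord (e i) (e j)))"
    by (rule pdet_hom[of "\<lambda>x. tensor 1 x", symmetric])
      (simp_all add: one_KG2_def tensor_add_right tensor_times_even[OF disjI2[OF parity_1]])
  ultimately show ?thesis
    by (simp add: RM RAA RB tensor_power_even parity_1 parity_pdet[OF par] tensor_times_even)
qed

lemma pdet_parity2:
  fixes A :: "'i::{finite,linorder} \<Rightarrow> 'i \<Rightarrow> ('k, 'm::{finite,linorder}, 'n::{finite,linorder}) KG2"
  assumes "\<And>i j. A i j \<in> parity2 False"
  shows "pdet A \<in> parity2 False"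
proof -
  have prod: "prod_list xs \<in> parity2 False" if "set xs \<subseteq> parity2 False" for xs :: "('k, 'm, 'n) KG2 list"
    using that parity2_mult[of _ False _ False] by (induction xs) (auto simp: parity2_closed)
  have sgn: "of_int (sign \<pi>) * x \<in> parity2 False" if "x \<in> parity2 False" for x :: "('k, 'm, 'n) KG2" and \<pi> :: "'i \<Rightarrow> 'i"
    using that by (cases \<pi> rule: sign_cases) (simp_all add: parity2_closed)
  show ?thesis unfolding pdet_def
    by (intro parity2_sum sgn prod) (auto simp: assms)
qed

lemma comdet_power:
  "(comdet :: ('k, 'm::{finite,linorder}, 'n::{finite,linorder}) KG2) ^ CHAR('k) = tensor (kdet ^ CHAR('k)) (kdet ^ CHAR('k))"
proof -
  let ?a = "pdet (\<lambda>i j. comat (Inl i) (Inl j)) :: ('k, 'm, 'n) KG2"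
  let ?b = "pdet (\<lambda>i j. comat (Inr i) (Inr j)) :: ('k, 'm, 'n) KG2"
  have even: "?a \<in> parity2 False" "?b \<in> parity2 False"
    by (intro pdet_parity2 parity2_comat_same; simp)+
  then have "?a * ?b = ?b * ?a" using parity2_supercomm[OF even] by (simp add: koszul_def)
  then have "(?a * ?b) ^ CHAR('k) = ?a ^ CHAR('k) * ?b ^ CHAR('k)"
    by (rule power_commuting_mult_distrib)
  moreover have "range Inl = {k :: 'm + 'n. isl k = True}" "range Inr = {k :: 'm + 'n. isl k = False}"
    by (auto simp: isl_def image_iff split: sum.splits) (metis sum.exhaust)
  note e = pdet_comat_power[OF inj_Inl this(1)] pdet_comat_power[OF inj_Inr this(2)]
  have par: "parity False (pdet (\<lambda>i j. coord (Inl i) (Inl j)) :: ('k, 'm, 'n) KG)"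
     "parity False (pdet (\<lambda>i j. coord (Inr i) (Inr j)) :: ('k, 'm, 'n) KG)"
    by (intro parity_pdet parity_coord_same; simp)+
  have "kdet ^ CHAR('k) = (pdet (\<lambda>i j. coord (Inl i) (Inl j)) ^ CHAR('k) :: ('k, 'm, 'n) KG) * pdet (\<lambda>i j. coord (Inr i) (Inr j)) ^ CHAR('k)"
    unfolding kdet_def by (rule power_commuting_mult_distrib[OF even_central[OF par(1)]])
  ultimately show ?thesis
    unfolding comdet_def by (simp add: e tensor_times_even[OF disjI1[OF parity_power[OF par(1)]]])
qed


lemma dinv_kdet: "dinv * kdet ^ CHAR('k) = (1 :: ('k, 'm::{finite,linorder}, 'n::{finite,linorder}) KG)"
proof -
  have "(det_inv * kdet) ^ CHAR('k) = (dinv * kdet ^ CHAR('k) :: ('k, 'm, 'n) KG)"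
    unfolding dinv_def by (rule power_commuting_mult_distrib[OF even_central[OF parity_det_inv]])
  then show ?thesis by (simp add: det_inv_kdet)
qed

lemma parity_dinv: "parity False dinv"
  unfolding dinv_def by (intro parity_power parity_det_inv)

text \<open>\<open>dinv\<close> inverts the p-th power of \<open>kdet\<close>, so the missing p - 1
  factors turn it back into \<open>det_inv\<close>.\<close>

lemma det_inv_conv: "det_inv = (dinv * kdet ^ (CHAR('k) - 1) :: ('k, 'm::{finite,linorder}, 'n::{finite,linorder}) KG)"
proof -
  obtain c where c: "CHAR('k) = Suc c" using char by (intro that[of "CHAR('k) - 1"]) simp
  have "dinv * kdet ^ (CHAR('k) - 1) * kdet = (1 :: ('k, 'm, 'n) KG)"
    using dinv_kdet[where 'm='m and 'n='n] by (simp add: c power_Suc2 mult.assoc del: power_Suc)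
  then have "dinv * kdet ^ (CHAR('k) - 1) * (kdet * det_inv) = (det_inv :: ('k, 'm, 'n) KG)"
    by (simp add: mult.assoc[symmetric])
  then show ?thesis by (simp add: kdet_det_inv)
qed

text \<open>The universal property asks for an inverse of \<open>comdet\<close> as the value at
  \<open>DetInv\<close>. The p-th power of \<open>comdet\<close> is kdet^p \<otimes> kdet^p, with
  inverse dinv \<otimes> dinv; multiplying this inverse by the power p - 1 of \<open>comdet\<close>
  inverts \<open>comdet\<close> itself.\<close>

lemma comult_exists:
  "\<exists>D :: ('k, 'm::{finite,linorder}, 'n::{finite,linorder}) KG \<Rightarrow> ('k, 'm, 'n) KG2.
     Vector_Spaces.linear kg_scale tensor_scale D \<and> D 1 = tensor 1 1 \<and>
     (\<forall>f g. D (f * g) = tensor_mult (D f) (D g)) \<and>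
     (\<forall>i j. D (coord i j) = (\<Sum>k\<in>UNIV. tensor (coord i k) (coord k j)))"
proof -
  define h :: "('m, 'n) gen \<Rightarrow> ('k, 'm, 'n) KG2"
    where "h = case_gen comat (tensor dinv dinv * comdet ^ (CHAR('k) - 1))"
  have h: "h (Coord i j) = comat i j" "h DetInv = tensor dinv dinv * comdet ^ (CHAR('k) - 1)" for i j
    by (simp_all add: h_def)
  have cd: "comdet \<in> (parity2 False :: ('k, 'm, 'n) KG2 set)"
    unfolding comdet_def
    by (intro parity2_mult[of _ False _ False, simplified] pdet_parity2 parity2_comat_same) simp_all
  have cdp: "comdet ^ n \<in> (parity2 False :: ('k, 'm, 'n) KG2 set)" for n
    by (induction n) (use parity2_mult[of _ False _ False] cd in \<open>auto simp: parity2_closed\<close>)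
  have par: "h x \<in> parity2 (gen_parity x)" for x
  proof (cases x)
    case DetInv
    then show ?thesis
      using parity2_mult[OF parity2_tensor[OF parity_dinv parity_dinv refl] cdp] by (simp add: h)
  qed (use parity2_comat in \<open>simp add: h\<close>)
  have sup: "h x * h y = (if gen_parity x \<and> gen_parity y then - (h y * h x) else h y * h x)" for x y
    using parity2_supercomm[OF par par, of x y] by (simp add: koszul_def split: if_splits)
  have "h DetInv * comdet = tensor dinv dinv * comdet ^ Suc (CHAR('k) - 1)"
    unfolding h power_Suc2 by (simp add: mult.assoc)
  also have "Suc (CHAR('k) - 1) = CHAR('k)" using char by simp
  finally have loc: "h DetInv * (pdet (\<lambda>i j. h (Coord (Inl i) (Inl j))) * pdet (\<lambda>i j. h (Coord (Inr i) (Inr j)))) = 1"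
    by (simp add: h comdet_def[symmetric] comdet_power tensor_times_even[OF disjI1[OF parity_dinv]] dinv_kdet one_KG2_def)
  from KG_hom_exists[OF vector_space_KG2 KG2_mult_linear(3,4) sup loc]
  show ?thesis by (auto simp: h one_KG2_def times_KG2_def comat_def)
qed

text \<open>The value at \<open>det_inv\<close> is forced: for \<open>D\<close> it is a left inverse
  of \<open>comdet\<close> and for \<open>D'\<close> a right inverse, and these coincide.\<close>

lemma comult_unique:
  fixes D D' :: "('k, 'm::{finite,linorder}, 'n::{finite,linorder}) KG \<Rightarrow> ('k, 'm, 'n) KG2"
  assumes D: "Vector_Spaces.linear kg_scale tensor_scale D" "D 1 = 1" "\<And>f g. D (f * g) = D f * D g" "\<And>i j. D (coord i j) = comat i j"
    and D': "Vector_Spaces.linear kg_scale tensor_scale D'" "D' 1 = 1" "\<And>f g. D' (f * g) = D' f * D' g" "\<And>i j. D' (coord i j) = comat i j"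
  shows "D = D'"
proof (rule KG_linear_ext[OF D(1) D'(1)])
  have 1: "D kdet = comdet" "D' kdet = comdet"
    unfolding kdet_def comdet_def D(3) D'(3)
    using D D' by (simp_all add: pdet_hom Vector_Spaces.linear_iff)
  have "D det_inv * comdet = 1" "comdet * D' det_inv = 1"
    using arg_cong[OF det_inv_kdet, of D] arg_cong[OF kdet_det_inv, of D'] by (simp_all add: D D' 1)
  then have "D det_inv = D' det_inv" by (rule left_right_inverse_monoid)
  then show "D (det_inv * f) = D' (det_inv * f)" if "D f = D' f" for f
    using that by (simp add: D D')
qed (simp_all add: D D')

lemma
  shows linear_comult: "Vector_Spaces.linear kg_scale tensor_scale (comult :: ('k, 'm::{finite,linorder}, 'n::{finite,linorder}) KG \<Rightarrow> _)"
    and comult_1: "comult (1 :: ('k, 'm, 'n) KG) = 1"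
    and comult_mult: "comult (f * g :: ('k, 'm, 'n) KG) = comult f * comult g"
    and comult_coord: "comult (coord i j :: ('k, 'm, 'n) KG) = comat i j"
proof -
  let ?P = "\<lambda>D :: ('k, 'm, 'n) KG \<Rightarrow> ('k, 'm, 'n) KG2.
     Vector_Spaces.linear kg_scale tensor_scale D \<and> D 1 = tensor 1 1 \<and>
     (\<forall>f g. D (f * g) = tensor_mult (D f) (D g)) \<and>
     (\<forall>i j. D (coord i j) = (\<Sum>k\<in>UNIV. tensor (coord i k) (coord k j)))"
  have "?P comult" unfolding comult_def
  proof (rule theI'[of ?P])
    show "\<exists>!D. ?P D"
    proof (rule ex_ex1I[OF comult_exists])
      fix D D' assume "?P D" "?P D'"
      then show "D = D'"
        by (intro comult_unique) (simp_all add: one_KG2_def times_KG2_def comat_def)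
    qed
  qed
  then show "Vector_Spaces.linear kg_scale tensor_scale (comult :: ('k, 'm, 'n) KG \<Rightarrow> _)"
    "comult (1 :: ('k, 'm, 'n) KG) = 1" "comult (f * g :: ('k, 'm, 'n) KG) = comult f * comult g"
    "comult (coord i j :: ('k, 'm, 'n) KG) = comat i j"
    by (simp_all add: one_KG2_def times_KG2_def comat_def)
qed

lemma comult_add: "comult (f + g :: ('k, 'm::{finite,linorder}, 'n::{finite,linorder}) KG) = comult f + comult g"
  and comult_scale: "comult (kg_scale r f :: ('k, 'm, 'n) KG) = tensor_scale r (comult f)"
  using linear_comult[where 'm='m and 'n='n] by (simp_all add: Vector_Spaces.linear_iff)

text \<open>Both sides invert kdet^p \<otimes> kdet^p, one from the left and one from the
  right.\<close>

lemma comult_dinv: "comult dinv = (tensor dinv dinv :: ('k, 'm::{finite,linorder}, 'n::{finite,linorder}) KG2)"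
proof -
  have 1: "comult kdet = (comdet :: ('k, 'm, 'n) KG2)"
    unfolding kdet_def comdet_def comult_mult
    by (simp add: pdet_hom comult_add comult_1 comult_mult comult_coord)
  have pow: "comult (f ^ n) = comult f ^ n" for f :: "('k, 'm, 'n) KG" and n
    by (induction n) (simp_all add: comult_1 comult_mult)
  have "comult dinv * tensor (kdet ^ CHAR('k)) (kdet ^ CHAR('k)) = (1 :: ('k, 'm, 'n) KG2)"
    using arg_cong[OF dinv_kdet, of "comult :: ('k, 'm, 'n) KG \<Rightarrow> _"] by (simp add: comult_1 comult_mult pow 1 comdet_power)
  moreover have "tensor (kdet ^ CHAR('k)) (kdet ^ CHAR('k)) * tensor dinv dinv = (1 :: ('k, 'm, 'n) KG2)"
    using dinv_kdet[where 'm='m and 'n='n]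
    by (simp add: tensor_times_even[OF disjI2[OF parity_dinv]] one_KG2_def
        even_central[OF parity_dinv, of "kdet ^ CHAR('k)", symmetric])
  ultimately show ?thesis by (rule left_right_inverse_monoid)
qed

text \<open>\<open>kdet\<close> is a polynomial in the coordinates, so it inherits every linear
  closure property under left multiplication by coordinates.\<close>

lemma kdet_mult_closed:
  fixes g :: "('k, 'm::{finite,linorder}, 'n::{finite,linorder}) KG"
  assumes add: "\<And>f g. P f \<Longrightarrow> P g \<Longrightarrow> P (f + g)" and scale: "\<And>r f. P f \<Longrightarrow> P (kg_scale r f)"
    and coord: "\<And>i j f. P f \<Longrightarrow> P (coord i j * f)" and g: "P g"
  shows "P (kdet * g)"
proof -
  have minus: "P (- f)" if "P f" for f using scale[OF that, of "- 1"] by (simp add:)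
  have sum: "P (sum h S)" if "\<And>x. x \<in> S \<Longrightarrow> P (h x)" for h and S :: "('i \<Rightarrow> 'i) set"
    using that scale[OF g, of 0] by (induction S rule: infinite_finite_induct) (simp_all add: add)
  have prod: "P (prod_list (map (\<lambda>i. coord (a i) (b i)) xs) * g)" if "P g" for g a b and xs :: "'i list"
    using that by (induction xs) (simp_all add: mult.assoc coord)
  have pdet: "P (pdet (\<lambda>i j. coord (e i) (e j)) * g)" if "P g" for g and e :: "'i::{finite,linorder} \<Rightarrow> 'm + 'n"
  proof -
    have "P (of_int (sign \<pi>) * x)" if "P x" for x and \<pi> :: "'i \<Rightarrow> 'i"
      using that by (cases \<pi> rule: sign_cases) (simp_all add: minus)
    then show ?thesis using that
      unfolding pdet_def sum_distrib_right by (intro sum) (simp add: mult.assoc prod)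
  qed
  show ?thesis using g by (simp add: kdet_def mult.assoc pdet)
qed

text \<open>Induction with the group-like generator \<open>dinv\<close> in place of
  \<open>det_inv\<close>, whose comultiplication is the less handy expression found above. The case
  of \<open>det_inv\<close> is recovered as \<open>dinv\<close> times a power of
  \<open>kdet\<close>.\<close>

lemma KG_induct [consumes 0, case_names one add scale coord dinv]:
  fixes f :: "('k, 'm::{finite,linorder}, 'n::{finite,linorder}) KG"
  assumes one: "P 1" and add: "\<And>f g. P f \<Longrightarrow> P g \<Longrightarrow> P (f + g)"
    and scale: "\<And>r f. P f \<Longrightarrow> P (kg_scale r f)"
    and coord: "\<And>i j f. P f \<Longrightarrow> P (coord i j * f)" and dinv: "\<And>f. P f \<Longrightarrow> P (dinv * f)"
  shows "P f"
proof (induction f rule: KG_span_induct)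
  case (det_inv f)
  have "P (kdet * g)" if "P g" for g
    by (rule kdet_mult_closed) (use that in \<open>auto intro: add scale coord\<close>)
  then have "P (kdet ^ n * g)" if "P g" for g n using that by (induction n) (simp_all add: mult.assoc)
  then show ?case using det_inv by (simp add: det_inv_conv mult.assoc dinv)
qed (auto intro: one add scale coord)

end

section \<open>Contractions with functionals, and coassociativity in operator form\<close>

section \<open>Contractions\<close>

definition klin :: "('k::field, 'm::{finite,linorder}, 'n::{finite,linorder}) functional \<Rightarrow> bool" where
  "klin \<gamma> \<longleftrightarrow> (\<forall>f g. \<gamma> (f + g) = \<gamma> f + \<gamma> g) \<and> (\<forall>r f. \<gamma> (kg_scale r f) = r * \<gamma> f)"

definition kend :: "(('k::field, 'm::{finite,linorder}, 'n::{finite,linorder}) KG \<Rightarrow> ('k, 'm, 'n) KG) \<Rightarrow> bool" where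
  "kend \<phi> \<longleftrightarrow> (\<forall>f g. \<phi> (f + g) = \<phi> f + \<phi> g) \<and> (\<forall>r f. \<phi> (kg_scale r f) = kg_scale r (\<phi> f))"

lemma klin_iff_linear: "klin \<gamma> \<longleftrightarrow> Vector_Spaces.linear kg_scale (*) \<gamma>"
  by (simp add: klin_def Vector_Spaces.linear_iff vector_space_KG vector_space_field)

lemma kend_iff_linear: "kend \<phi> \<longleftrightarrow> Vector_Spaces.linear kg_scale kg_scale \<phi>"
  by (simp add: kend_def Vector_Spaces.linear_iff vector_space_KG)

lemma klinD: "klin \<gamma> \<Longrightarrow> \<gamma> (f + g) = \<gamma> f + \<gamma> g" "klin \<gamma> \<Longrightarrow> \<gamma> (kg_scale r f) = r * \<gamma> f"
  by (simp_all add: klin_def)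

lemma kendD: "kend \<phi> \<Longrightarrow> \<phi> (f + g) = \<phi> f + \<phi> g" "kend \<phi> \<Longrightarrow> \<phi> (kg_scale r f) = kg_scale r (\<phi> f)"
  by (simp_all add: kend_def)

lemma klin_0: "klin \<gamma> \<Longrightarrow> \<gamma> 0 = 0" using klinD(2)[of \<gamma> 0 0] by simp
lemma kend_0: "kend \<phi> \<Longrightarrow> \<phi> 0 = 0" using kendD(2)[of \<phi> 0 0] by simp

lemma klin_sum: "klin \<gamma> \<Longrightarrow> \<gamma> (sum f A) = (\<Sum>x\<in>A. \<gamma> (f x))"
  by (induction A rule: infinite_finite_induct) (simp_all add: klin_0 klinD)

lemma kend_sum: "kend \<phi> \<Longrightarrow> \<phi> (sum f A) = (\<Sum>x\<in>A. \<phi> (f x))"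
  by (induction A rule: infinite_finite_induct) (simp_all add: kend_0 kendD)

lemma klin_diff: "klin \<gamma> \<Longrightarrow> \<gamma> (f - g) = \<gamma> f - \<gamma> g"
  using klinD(1)[of \<gamma> "f - g" g] by simp

lemma kend_diff: "kend \<phi> \<Longrightarrow> \<phi> (f - g) = \<phi> f - \<phi> g"
  using kendD(1)[of \<phi> "f - g" g] by simp

lemma klin_closed:
  "klin counit" "klin \<gamma> \<Longrightarrow> kend \<phi> \<Longrightarrow> klin (\<lambda>y. \<gamma> (\<phi> y))" "klin \<gamma> \<Longrightarrow> klin (\<lambda>y. r * \<gamma> y)"
  "klin \<gamma> \<Longrightarrow> klin (\<lambda>y. \<gamma> (a * y))"
  by (auto simp: klin_def kend_def distrib_left kg_scale_mult mult.left_commute)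

lemma kend_closed:
  "kend (\<lambda>y. y)" "kend \<phi> \<Longrightarrow> kend \<psi> \<Longrightarrow> kend (\<lambda>y. \<phi> (\<psi> y))" "kend (part p)" "kend \<phi> \<Longrightarrow> kend (\<lambda>y. a * \<phi> y)"
  by (auto simp: kend_def distrib_left kg_scale_mult part_add part_scale)

text \<open>The contraction id \<otimes> \<gamma>. Likewise \<open>lc\<close> is \<alpha> \<otimes>
  id and \<open>tmap\<close> is \<phi> \<otimes> \<psi>. None of the three carries a Koszul sign,
  even for odd maps.\<close>

definition rc :: "('k::field, 'm::{finite,linorder}, 'n::{finite,linorder}) functional \<Rightarrow> ('k, 'm, 'n) KG2 \<Rightarrow> ('k, 'm, 'n) KG" where
  "rc \<gamma> = tensor_lift kg_scale (\<lambda>a b. kg_scale (\<gamma> b) a)"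

definition lc :: "('k::field, 'm::{finite,linorder}, 'n::{finite,linorder}) functional \<Rightarrow> ('k, 'm, 'n) KG2 \<Rightarrow> ('k, 'm, 'n) KG" where
  "lc \<alpha> = tensor_lift kg_scale (\<lambda>a b. kg_scale (\<alpha> a) b)"

definition tmap :: "(('k::field, 'm::{finite,linorder}, 'n::{finite,linorder}) KG \<Rightarrow> ('k, 'm, 'n) KG) \<Rightarrow>
    (('k, 'm, 'n) KG \<Rightarrow> ('k, 'm, 'n) KG) \<Rightarrow> ('k, 'm, 'n) KG2 \<Rightarrow> ('k, 'm, 'n) KG2" where
  "tmap \<phi> \<psi> = tensor_lift tensor_scale (\<lambda>a b. tensor (\<phi> a) (\<psi> b))"

lemma
  assumes "klin \<gamma>"
  shows rc_tensor: "rc \<gamma> (tensor a b) = kg_scale (\<gamma> b) a" and rc_add: "rc \<gamma> (x + y) = rc \<gamma> x + rc \<gamma> y"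
    and rc_scale: "rc \<gamma> (tensor_scale r x) = kg_scale r (rc \<gamma> x)"
proof -
  have "bilinear_map kg_scale (\<lambda>a b. kg_scale (\<gamma> b) a)"
    by (rule bilinear_mapI[OF vector_space_KG])
      (simp_all add: klinD[OF assms] KG.scale_right_distrib KG.scale_left_distrib mult.commute)
  note b = vector_space_KG this
  show "rc \<gamma> (tensor a b) = kg_scale (\<gamma> b) a" "rc \<gamma> (x + y) = rc \<gamma> x + rc \<gamma> y"
    "rc \<gamma> (tensor_scale r x) = kg_scale r (rc \<gamma> x)"
    unfolding rc_def by (rule tensor_lift_tensor[OF b] tensor_lift_add[OF b] tensor_lift_scale[OF b])+
qed

lemma
  assumes "klin \<alpha>"
  shows lc_tensor: "lc \<alpha> (tensor a b) = kg_scale (\<alpha> a) b" and lc_add: "lc \<alpha> (x + y) = lc \<alpha> x + lc \<alpha> y"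
    and lc_scale: "lc \<alpha> (tensor_scale r x) = kg_scale r (lc \<alpha> x)"
proof -
  have "bilinear_map kg_scale (\<lambda>a b. kg_scale (\<alpha> a) b)"
    by (rule bilinear_mapI[OF vector_space_KG])
      (simp_all add: klinD[OF assms] KG.scale_right_distrib KG.scale_left_distrib mult.commute)
  note b = vector_space_KG this
  show "lc \<alpha> (tensor a b) = kg_scale (\<alpha> a) b" "lc \<alpha> (x + y) = lc \<alpha> x + lc \<alpha> y"
    "lc \<alpha> (tensor_scale r x) = kg_scale r (lc \<alpha> x)"
    unfolding lc_def by (rule tensor_lift_tensor[OF b] tensor_lift_add[OF b] tensor_lift_scale[OF b])+
qed

lemma
  assumes "kend \<phi>" "kend \<psi>"
  shows tmap_tensor: "tmap \<phi> \<psi> (tensor a b) = tensor (\<phi> a) (\<psi> b)"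
    and tmap_add: "tmap \<phi> \<psi> (x + y) = tmap \<phi> \<psi> x + tmap \<phi> \<psi> y"
    and tmap_scale: "tmap \<phi> \<psi> (tensor_scale r x) = tensor_scale r (tmap \<phi> \<psi> x)"
proof -
  have "bilinear_map tensor_scale (\<lambda>a b. tensor (\<phi> a) (\<psi> b))"
    by (rule bilinear_mapI[OF vector_space_KG2])
      (simp_all add: kendD[OF assms(1)] kendD[OF assms(2)] tensor_add_left tensor_add_right tensor_scale_left tensor_scale_right)
  note b = vector_space_KG2 this
  show "tmap \<phi> \<psi> (tensor a b) = tensor (\<phi> a) (\<psi> b)" "tmap \<phi> \<psi> (x + y) = tmap \<phi> \<psi> x + tmap \<phi> \<psi> y"
    "tmap \<phi> \<psi> (tensor_scale r x) = tensor_scale r (tmap \<phi> \<psi> x)"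
    unfolding tmap_def by (rule tensor_lift_tensor[OF b] tensor_lift_add[OF b] tensor_lift_scale[OF b])+
qed

lemma rc_0: "klin \<gamma> \<Longrightarrow> rc \<gamma> 0 = 0" using rc_scale[of \<gamma> 0 0] by simp
lemma lc_0: "klin \<gamma> \<Longrightarrow> lc \<gamma> 0 = 0" using lc_scale[of \<gamma> 0 0] by simp
lemma tmap_0: "kend \<phi> \<Longrightarrow> kend \<psi> \<Longrightarrow> tmap \<phi> \<psi> 0 = 0" using tmap_scale[of \<phi> \<psi> 0 0] by simp

lemma rc_sum: "klin \<gamma> \<Longrightarrow> rc \<gamma> (sum f A) = (\<Sum>x\<in>A. rc \<gamma> (f x))"
  by (induction A rule: infinite_finite_induct) (simp_all add: rc_add rc_0)
lemma lc_sum: "klin \<gamma> \<Longrightarrow> lc \<gamma> (sum f A) = (\<Sum>x\<in>A. lc \<gamma> (f x))"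
  by (induction A rule: infinite_finite_induct) (simp_all add: lc_add lc_0)
lemma tmap_sum: "kend \<phi> \<Longrightarrow> kend \<psi> \<Longrightarrow> tmap \<phi> \<psi> (sum f A) = (\<Sum>x\<in>A. tmap \<phi> \<psi> (f x))"
  by (induction A rule: infinite_finite_induct) (simp_all add: tmap_add tmap_0)

lemma rc_fun_scale: "rc (\<lambda>y. r * \<gamma> y) x = kg_scale r (rc \<gamma> x)"
  unfolding rc_def KG.scale_scale[symmetric] by (rule tensor_lift_fun_scale[OF vector_space_KG])

lemma lc_fun_scale: "lc (\<lambda>y. r * \<gamma> y) x = kg_scale r (lc \<gamma> x)"
  unfolding lc_def KG.scale_scale[symmetric] by (rule tensor_lift_fun_scale[OF vector_space_KG])

lemma rc_fun_add: "rc (\<lambda>y. \<gamma> y + \<gamma>' y) x = rc \<gamma> x + rc \<gamma>' x"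
  unfolding rc_def KG.scale_left_distrib by (rule tensor_lift_fun_add[OF vector_space_KG])

lemma rc_tmap:
  assumes "klin \<gamma>" "kend \<phi>" "kend \<psi>"
  shows "rc \<gamma> (tmap \<phi> \<psi> x) = \<phi> (rc (\<lambda>y. \<gamma> (\<psi> y)) x)"
  by (induction x rule: KG2_tensor_induct)
    (simp_all add: tmap_tensor tmap_add rc_tensor rc_add klin_closed(2) kendD assms)

lemma lc_tmap:
  assumes "klin \<gamma>" "kend \<phi>" "kend \<psi>"
  shows "lc \<gamma> (tmap \<phi> \<psi> x) = \<psi> (lc (\<lambda>y. \<gamma> (\<phi> y)) x)"
  by (induction x rule: KG2_tensor_induct)
    (simp_all add: tmap_tensor tmap_add lc_tensor lc_add klin_closed(2) kendD assms)

lemma apply_rc_lc: "klin \<alpha> \<Longrightarrow> klin \<gamma> \<Longrightarrow> \<alpha> (rc \<gamma> x) = \<gamma> (lc \<alpha> x)"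
  by (induction x rule: KG2_tensor_induct) (simp_all add: rc_tensor lc_tensor rc_add lc_add klinD)

subsection \<open>Coordinates with respect to a basis\<close>

definition kbasis :: "('k::field, 'm::{finite,linorder}, 'n::{finite,linorder}) KG set" where
  "kbasis = KG.extend_basis {}"

definition kcoef :: "('k::field, 'm::{finite,linorder}, 'n::{finite,linorder}) KG \<Rightarrow> ('k, 'm, 'n) functional" where
  "kcoef b f = KG.representation kbasis f b"

lemma kbasis: "KG.independent kbasis" "KG.span kbasis = UNIV"
  unfolding kbasis_def by (simp_all add: KG.independent_extend_basis KG.span_extend_basis KG.independent_empty)

lemma klin_kcoef: "klin (kcoef b)"
  by (simp add: klin_def kcoef_def KG.representation_add[OF kbasis(1)] KG.representation_scale[OF kbasis(1)] kbasis(2))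

lemma kcoef_expansion:
  "\<exists>B. finite B \<and> (\<forall>B'. finite B' \<longrightarrow> B \<subseteq> B' \<longrightarrow> (\<Sum>b\<in>B'. kg_scale (kcoef b f) b) = f)"
proof (intro exI[of _ "{b. KG.representation kbasis f b \<noteq> 0}"] conjI allI impI)
  fix B' assume B': "finite B'" "{b. KG.representation kbasis f b \<noteq> 0} \<subseteq> B'"
  have "(\<Sum>b\<in>B'. kg_scale (kcoef b f) b) = (\<Sum>b | KG.representation kbasis f b \<noteq> 0. kg_scale (kcoef b f) b)"
    by (rule sum.mono_neutral_right) (use B' in \<open>auto simp: kcoef_def\<close>)
  then show "(\<Sum>b\<in>B'. kg_scale (kcoef b f) b) = f"
    using KG.sum_nonzero_representation_eq[OF kbasis(1), of f] by (simp add: kcoef_def kbasis(2))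
qed (rule KG.finite_representation)

text \<open>Right tensor factors are expanded in a fixed basis; the left coefficients are the
  contractions with the coordinate functionals.\<close>

lemma KG2_expansion:
  "\<exists>B. finite B \<and> x = (\<Sum>b\<in>B. tensor (rc (kcoef b) x) b)"
proof -
  \<comment> \<open>The induction asserts the expansion over every finite set containing
    \<open>B\<close>, so that two summands can be expanded over a common set.\<close>
  have "\<exists>B. finite B \<and> (\<forall>B'. finite B' \<longrightarrow> B \<subseteq> B' \<longrightarrow> (\<Sum>b\<in>B'. tensor (rc (kcoef b) x) b) = x)"
  proof (induction x rule: KG2_tensor_induct)
    case (tensor a c)
    obtain B where B: "finite B" "\<And>B'. finite B' \<Longrightarrow> B \<subseteq> B' \<Longrightarrow> (\<Sum>b\<in>B'. kg_scale (kcoef b c) b) = c"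
      using kcoef_expansion by blast
    have "(\<Sum>b\<in>B'. tensor (rc (kcoef b) (tensor a c)) b) = tensor a c" if "finite B'" "B \<subseteq> B'" for B'
    proof -
      have "(\<Sum>b\<in>B'. tensor (rc (kcoef b) (tensor a c)) b) = tensor a (\<Sum>b\<in>B'. kg_scale (kcoef b c) b)"
        by (simp add: rc_tensor klin_kcoef tensor_sum_right tensor_scale_left tensor_scale_right)
      then show ?thesis using B(2)[OF that] by simp
    qed
    then show ?case using B(1) by blast
  next
    case (add x y)
    from add.IH(1) obtain B where
      "finite B" "\<forall>B'. finite B' \<longrightarrow> B \<subseteq> B' \<longrightarrow> (\<Sum>b\<in>B'. tensor (rc (kcoef b) x) b) = x" by (elim exE conjE)
    moreover from add.IH(2) obtain C where
      "finite C" "\<forall>B'. finite B' \<longrightarrow> C \<subseteq> B' \<longrightarrow> (\<Sum>b\<in>B'. tensor (rc (kcoef b) y) b) = y" by (elim exE conjE)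
    ultimately show ?case
      by (intro exI[of _ "B \<union> C"]) (simp add: rc_add klin_kcoef tensor_add_left sum.distrib)
  qed
  then obtain B where "finite B" "\<forall>B'. finite B' \<longrightarrow> B \<subseteq> B' \<longrightarrow> (\<Sum>b\<in>B'. tensor (rc (kcoef b) x) b) = x"
    by (elim exE conjE)
  then show ?thesis by (intro exI[of _ B]) simp
qed

text \<open>Coordinate functionals already recover a tensor, so identities in the tensor square may
  be checked after contraction.\<close>

lemma KG2_eqI:
  assumes "\<And>\<gamma>. klin \<gamma> \<Longrightarrow> rc \<gamma> x = rc \<gamma> y"
  shows "x = y"
proof -
  have "rc (kcoef b) (x - y) = 0" for b
    using assms[OF klin_kcoef[of b]] rc_add[OF klin_kcoef[of b], of "x - y" y] by simp
  then show ?thesis using KG2_expansion[of "x - y"] by simp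
qed

lemma KG_eqI:
  assumes "\<And>\<alpha>. klin \<alpha> \<Longrightarrow> \<alpha> f = \<alpha> g"
  shows "f = g"
proof -
  have "kcoef b (f - g) = 0" for b
    using assms[OF klin_kcoef[of b]] klin_diff[OF klin_kcoef[of b]] by simp
  then show ?thesis using kcoef_expansion[of "f - g"] by (auto dest!: spec)
qed

text \<open>Translates the two conditions stated with V \<otimes> K[G], that of a subsupermodule and
  that defining \<open>H0_minus\<close>, into conditions on elements of K[G].\<close>

lemma tensor_sub_UNIV_iff:
  fixes x :: "('k::field, 'm::{finite,linorder}, 'n::{finite,linorder}) KG2"
  assumes "KG.subspace (V :: ('k, 'm, 'n) KG set)"
  shows "x \<in> tensor_sub V UNIV \<longleftrightarrow> (\<forall>\<gamma>. klin \<gamma> \<longrightarrow> rc \<gamma> x \<in> V)"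
proof safe
  fix \<gamma> :: "('k, 'm, 'n) functional" assume x: "x \<in> tensor_sub V UNIV" and \<gamma>: "klin \<gamma>"
  show "rc \<gamma> x \<in> V" using x unfolding tensor_sub_def
    by (induction rule: KG2.span_induct_alt)
      (auto simp: rc_0 rc_add rc_scale rc_tensor \<gamma> intro!: KG.subspace_0 KG.subspace_add KG.subspace_scale assms)
next
  assume *: "\<forall>\<gamma>. klin \<gamma> \<longrightarrow> rc \<gamma> x \<in> V"
  obtain B where "finite B" "x = (\<Sum>b\<in>B. tensor (rc (kcoef b) x) b)" using KG2_expansion by blast
  moreover have "(\<Sum>b\<in>B. tensor (rc (kcoef b) x) b) \<in> tensor_sub V UNIV"
    unfolding tensor_sub_def using * klin_kcoef by (intro KG2.span_sum KG2.span_base) blast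
  ultimately show "x \<in> tensor_sub V UNIV" by simp
qed

subsection \<open>The sign automorphism\<close>

text \<open>The Koszul sign of moving an element of parity \<open>p\<close> past the argument: the
  parity automorphism if \<open>p\<close> is odd, the identity otherwise.\<close>

definition sg :: "bool \<Rightarrow> ('k::field, 'm::{finite,linorder}, 'n::{finite,linorder}) KG \<Rightarrow> ('k, 'm, 'n) KG" where
  "sg p f = part False f + kg_scale (koszul p True) (part True f)"

lemma kend_sg: "kend (sg p)"
  by (simp add: kend_def sg_def part_add part_scale KG.scale_right_distrib mult.commute)

lemma sg_parity: "parity q f \<Longrightarrow> sg p f = kg_scale (koszul p q) f"
  by (cases q) (simp_all add: sg_def part_parity koszul_def)

lemma sg_False [simp]: "sg False f = f"
  using part_split[of f] by (simp add: sg_def koszul_def add.commute)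

lemma sg_sg: "sg p (sg q f) = sg (p \<noteq> q) f"
  by (cases p; cases q) (simp_all add: sg_def koszul_def part_add part_scale part_part part_uminus part_diff)

lemma sg_mult: "parity q a \<Longrightarrow> sg p (a * f) = kg_scale (koszul p q) (a * sg p f)"
  by (cases p; cases q)
    (simp_all add: sg_def koszul_def part_mult_left algebra_simps)

text \<open>In the product, \<open>b\<close> passes the left tensor factor of \<open>x\<close>, and
  \<open>sg p\<close> records the resulting sign; \<open>\<gamma>\<close> then sees \<open>b\<close>
  times the right factor.\<close>

lemma rc_mult:
  assumes \<gamma>: "klin \<gamma>" and b: "parity p b"
  shows "rc \<gamma> (tensor a b * x) = a * sg p (rc (\<lambda>y. \<gamma> (b * y)) x)"
proof (induction x rule: KG2_induct)
  case (tensor c d q r)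
  then show ?case
    by (simp add: tensor_times_tensor[OF b tensor(1)] rc_scale \<gamma> rc_tensor klin_closed kendD[OF kend_sg]
        sg_parity[OF tensor(1)] kg_scale_mult mult.commute)
next
  case (add x y)
  then show ?case by (simp add: distrib_left rc_add \<gamma> klin_closed kendD[OF kend_sg])
qed

lemma lc_mult:
  assumes \<alpha>: "klin \<alpha>" and b: "parity p b"
  shows "lc \<alpha> (tensor a b * x) = b * lc (\<lambda>y. \<alpha> (a * sg p y)) x"
proof -
  have 1: "klin (\<lambda>y. \<alpha> (a * sg p y))" by (intro klin_closed(2)[OF \<alpha>] kend_closed(4) kend_sg)
  show ?thesis
  proof (induction x rule: KG2_induct)
    case (tensor c d q r)
    then show ?case
      by (simp add: tensor_times_tensor[OF b tensor(1)] lc_scale \<alpha> lc_tensor 1 klinD(2)[OF \<alpha>]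
          sg_parity[OF tensor(1)] kg_scale_mult mult.commute)
  next
    case (add x y)
    then show ?case by (simp add: distrib_left lc_add \<alpha> 1)
  qed
qed

text \<open>The maps may change when a \<otimes> b is pulled out: projections onto weights or
  parities reappear with a shifted index. As \<open>\<phi>'\<close> preserves parities, the Koszul
  sign is the same on both sides.\<close>

lemma tmap_mult:
  assumes k: "kend \<phi>" "kend \<psi>" "kend \<phi>'" "kend \<psi>'"
    and b: "parity p b" and \<phi>: "\<And>y. \<phi> (a * y) = a * \<phi>' y" "\<And>y. \<psi> (b * y) = b * \<psi>' y"
    "\<And>q y. part q (\<phi>' y) = \<phi>' (part q y)"
  shows "tmap \<phi> \<psi> (tensor a b * x) = tensor a b * tmap \<phi>' \<psi>' x"
proof (induction x rule: KG2_induct)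
  case (tensor c d q r)
  then have "parity q (\<phi>' c)" by (simp add: parity_def \<phi>(3))
  then show ?case by (simp add: tensor_times_tensor[OF b tensor(1)] tensor_times_tensor[OF b, of q "\<phi>' c"] tmap_scale tmap_tensor k \<phi>)
next
  case (add x y)
  then show ?case by (simp add: distrib_left tmap_add k)
qed

section \<open>The regular operators and coassociativity\<close>

text \<open>The operator (id \<otimes> \<gamma>) \<Delta>. All \<open>Rop\<close> together encode
  the supercomodule structure of K[G], and the operators \<open>Lop\<close> commute with them, so
  they are comodule maps of K[G].\<close>

definition Rop :: "('k::field, 'm::{finite,linorder}, 'n::{finite,linorder}) functional \<Rightarrow> ('k, 'm, 'n) KG \<Rightarrow> ('k, 'm, 'n) KG" where
  "Rop \<gamma> f = rc \<gamma> (comult f)"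

definition Lop :: "('k::field, 'm::{finite,linorder}, 'n::{finite,linorder}) functional \<Rightarrow> ('k, 'm, 'n) KG \<Rightarrow> ('k, 'm, 'n) KG" where
  "Lop \<alpha> f = lc \<alpha> (comult f)"

lemma Rop_fun_scale: "Rop (\<lambda>y. r * \<gamma> y) f = kg_scale r (Rop \<gamma> f)" by (simp add: Rop_def rc_fun_scale)
lemma Lop_fun_scale: "Lop (\<lambda>y. r * \<gamma> y) f = kg_scale r (Lop \<gamma> f)" by (simp add: Lop_def lc_fun_scale)
lemma Rop_fun_add: "Rop (\<lambda>y. \<gamma> y + \<gamma>' y) f = Rop \<gamma> f + Rop \<gamma>' f" by (simp add: Rop_def rc_fun_add)
text \<open>Both sides are (\<alpha> \<otimes> \<gamma>)(\<Delta> f).\<close>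

lemma apply_Rop: "klin \<alpha> \<Longrightarrow> klin \<gamma> \<Longrightarrow> \<alpha> (Rop \<gamma> f) = \<gamma> (Lop \<alpha> f)"
  unfolding Rop_def Lop_def by (rule apply_rc_lc)

context
  assumes char: "CHAR('k::field) > 2"
begin

lemma kend_Rop: "klin \<gamma> \<Longrightarrow> kend (Rop \<gamma> :: ('k, 'm::{finite,linorder}, 'n::{finite,linorder}) KG \<Rightarrow> _)"
  by (simp add: kend_def Rop_def rc_add rc_scale comult_add[OF char] comult_scale[OF char])

lemma kend_Lop: "klin \<gamma> \<Longrightarrow> kend (Lop \<gamma> :: ('k, 'm::{finite,linorder}, 'n::{finite,linorder}) KG \<Rightarrow> _)"
  by (simp add: kend_def Lop_def lc_add lc_scale comult_add[OF char] comult_scale[OF char])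

lemma Rop_1: "klin \<gamma> \<Longrightarrow> Rop \<gamma> (1 :: ('k, 'm::{finite,linorder}, 'n::{finite,linorder}) KG) = kg_scale (\<gamma> 1) 1"
  by (simp add: Rop_def comult_1[OF char] one_KG2_def rc_tensor)

lemma Lop_1: "klin \<gamma> \<Longrightarrow> Lop \<gamma> (1 :: ('k, 'm::{finite,linorder}, 'n::{finite,linorder}) KG) = kg_scale (\<gamma> 1) 1"
  by (simp add: Lop_def comult_1[OF char] one_KG2_def lc_tensor)

lemma Rop_coord:
  fixes f :: "('k, 'm::{finite,linorder}, 'n::{finite,linorder}) KG"
  assumes "klin \<gamma>"
  shows "Rop \<gamma> (coord i j * f) = (\<Sum>k\<in>UNIV. coord i k * sg (isl k \<noteq> isl j) (Rop (\<lambda>y. \<gamma> (coord k j * y)) f))"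
  by (simp add: Rop_def comult_mult[OF char] comult_coord[OF char] comat_def sum_distrib_right rc_sum rc_mult[OF _ parity_coord] assms)

lemma Lop_coord:
  fixes f :: "('k, 'm::{finite,linorder}, 'n::{finite,linorder}) KG"
  assumes "klin \<gamma>"
  shows "Lop \<gamma> (coord i j * f) = (\<Sum>k\<in>UNIV. coord k j * Lop (\<lambda>y. \<gamma> (coord i k * sg (isl k \<noteq> isl j) y)) f)"
  by (simp add: Lop_def comult_mult[OF char] comult_coord[OF char] comat_def sum_distrib_right lc_sum lc_mult[OF _ parity_coord] assms)

lemma Rop_dinv:
  fixes f :: "('k, 'm::{finite,linorder}, 'n::{finite,linorder}) KG"
  assumes "klin \<gamma>"
  shows "Rop \<gamma> (dinv * f) = dinv * Rop (\<lambda>y. \<gamma> (dinv * y)) f"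
  by (simp add: Rop_def comult_mult[OF char] comult_dinv[OF char] rc_mult[OF assms parity_dinv[OF char]])

lemma Lop_dinv:
  fixes f :: "('k, 'm::{finite,linorder}, 'n::{finite,linorder}) KG"
  assumes "klin \<gamma>"
  shows "Lop \<gamma> (dinv * f) = dinv * Lop (\<lambda>y. \<gamma> (dinv * y)) f"
  by (simp add: Lop_def comult_mult[OF char] comult_dinv[OF char] lc_mult[OF assms parity_dinv[OF char]])

lemma klin_coord_sg: "klin \<gamma> \<Longrightarrow> klin (\<lambda>y. \<gamma> (a * sg p y))"
  by (rule klin_closed(2)[OF _ kend_closed(4)[OF kend_sg]])

lemma counit_dinv: "counit (dinv :: ('k, 'm::{finite,linorder}, 'n::{finite,linorder}) KG) = 1"
  by (simp add: dinv_def)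

lemma counit_sg: "counit (sg p f) = counit f"
  by (simp add: sg_def counit_part)

lemma Rop_counit: "Rop counit f = (f :: ('k, 'm::{finite,linorder}, 'n::{finite,linorder}) KG)"
proof (induction f rule: KG_induct[OF char, case_names one add scale coord dinv])
  case (coord i j f)
  have "coord i k * sg (isl k \<noteq> isl j) (Rop (\<lambda>y. counit (coord k j * y)) f) = (if k = j then coord i j * f else 0)" for k
    using coord by (simp add: Rop_fun_scale kendD[OF kend_sg])
  then show ?case by (simp add: Rop_coord klin_closed)
qed (simp_all add: Rop_1 Rop_dinv counit_dinv klin_closed kendD[OF kend_Rop])

lemma Lop_counit: "Lop counit f = (f :: ('k, 'm::{finite,linorder}, 'n::{finite,linorder}) KG)"
proof (induction f rule: KG_induct[OF char, case_names one add scale coord dinv])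
  case (coord i j f)
  have "coord k j * Lop (\<lambda>y. counit (coord i k * sg (isl k \<noteq> isl j) y)) f = (if k = i then coord i j * f else 0)" for k
    using coord by (simp add: Lop_fun_scale counit_sg)
  then show ?case by (simp add: Lop_coord klin_closed)
qed (simp_all add: Lop_1 Lop_dinv counit_dinv klin_closed kendD[OF kend_Lop])

text \<open>The parity automorphism respects the comultiplication: the signs of
  \<open>coord i k\<close> and \<open>coord k j\<close> multiply to that of
  \<open>coord i j\<close>, whatever the index k. The coordinate step of the commutation of
  \<open>Lop\<close> and \<open>Rop\<close> depends on this.\<close>

lemma Lop_sg:
  fixes f :: "('k, 'm::{finite,linorder}, 'n::{finite,linorder}) KG"
  shows "klin \<alpha> \<Longrightarrow> Lop \<alpha> (sg p f) = sg p (Lop (\<lambda>y. \<alpha> (sg p y)) f)"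
proof (induction f arbitrary: \<alpha> rule: KG_induct[OF char, case_names one add scale coord dinv])
  case one
  then show ?case
    by (simp add: sg_parity[OF parity_1] koszul_def Lop_1 klin_closed(2) kend_sg kendD[OF kend_sg])
next
  case (coord i j f)
  note \<alpha> = coord(2)
  have t: "koszul p (isl k = (\<not> isl j)) * koszul p (isl i = (\<not> isl k)) = (koszul p (isl i = (\<not> isl j)) :: 'k)" for k
    by (auto simp: koszul_def)
  have e: "sg p (sg q y) = sg q (sg p y)" for q and y :: "('k, 'm, 'n) KG" by (cases p; cases q) (simp_all add: sg_sg)
  have "Lop (\<lambda>y. \<alpha> (sg p (coord i k * sg (isl k \<noteq> isl j) y))) f =
      kg_scale (koszul p (isl i \<noteq> isl k)) (Lop (\<lambda>y. \<alpha> (coord i k * sg (isl k \<noteq> isl j) (sg p y))) f)" for k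
    by (simp only: sg_mult[OF parity_coord] klinD(2)[OF \<alpha>] Lop_fun_scale e)
  moreover have "Lop \<alpha> (sg p (coord i j * f)) = kg_scale (koszul p (isl i \<noteq> isl j))
      (\<Sum>k\<in>UNIV. coord k j * sg p (Lop (\<lambda>y. \<alpha> (coord i k * sg (isl k \<noteq> isl j) (sg p y))) f))"
    by (simp add: sg_mult[OF parity_coord] kendD[OF kend_Lop[OF \<alpha>]] Lop_coord[OF \<alpha>] coord(1)[OF klin_coord_sg[OF \<alpha>]])
  ultimately show ?case
    by (simp add: Lop_coord klin_closed(2)[OF \<alpha> kend_sg] kend_sum[OF kend_sg] kendD[OF kend_sg] sg_mult[OF parity_coord]
        kg_scale_mult KG.scale_sum_right t mult.commute)
next
  case (dinv f)
  then show ?case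
    by (simp add: sg_mult[OF parity_dinv[OF char]] koszul_def Lop_dinv klin_closed kend_sg)
qed (simp_all add: kendD[OF kend_Lop] kendD[OF kend_sg] klin_closed(2) kend_sg)

text \<open>Coassociativity, in the form that left and right contractions of the comultiplication commute.\<close>

lemma Lop_Rop:
  fixes f :: "('k, 'm::{finite,linorder}, 'n::{finite,linorder}) KG"
  shows "klin \<alpha> \<Longrightarrow> klin \<gamma> \<Longrightarrow> Lop \<alpha> (Rop \<gamma> f) = Rop \<gamma> (Lop \<alpha> f)"
proof (induction f arbitrary: \<alpha> \<gamma> rule: KG_induct[OF char, case_names one add scale coord dinv])
  case one
  then show ?case by (simp add: Lop_1 Rop_1 kendD[OF kend_Lop] kendD[OF kend_Rop] mult.commute)
next
  case (coord i j f)
  note \<alpha> = coord(2) and \<gamma> = coord(3)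
  \<comment> \<open>The two parity differences add up to that of k and j, so the sign no longer
    depends on the intermediate index l, and the double sum becomes symmetric.\<close>
  have sg: "sg (isl k \<noteq> isl l) (sg (isl l \<noteq> isl j) y) = sg (isl k \<noteq> isl j) y" for k l and y :: "('k, 'm, 'n) KG"
    by (auto simp: sg_sg intro!: arg_cong[of _ _ "\<lambda>p. sg p y"])
  have "Lop \<alpha> (Rop \<gamma> (coord i j * f)) =
      (\<Sum>l\<in>UNIV. \<Sum>k\<in>UNIV. coord k l * Lop (\<lambda>y. \<alpha> (coord i k * sg (isl k \<noteq> isl l) y)) (sg (isl l \<noteq> isl j) (Rop (\<lambda>y. \<gamma> (coord l j * y)) f)))"
    by (simp add: Rop_coord \<gamma> kend_sum[OF kend_Lop[OF \<alpha>]] Lop_coord[OF \<alpha>])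
  also have "\<dots> = (\<Sum>l\<in>UNIV. \<Sum>k\<in>UNIV. coord k l * sg (isl l \<noteq> isl j) (Rop (\<lambda>y. \<gamma> (coord l j * y)) (Lop (\<lambda>y. \<alpha> (coord i k * sg (isl k \<noteq> isl j) y)) f)))"
    by (simp only: Lop_sg[OF klin_coord_sg[OF \<alpha>]] sg coord(1)[OF klin_coord_sg[OF \<alpha>] klin_closed(4)[OF \<gamma>]])
  also have "\<dots> = Rop \<gamma> (Lop \<alpha> (coord i j * f))"
    by (subst sum.swap) (simp add: Lop_coord \<alpha> kend_sum[OF kend_Rop[OF \<gamma>]] Rop_coord[OF \<gamma>])
  finally show ?case .
next
  case (dinv f)
  then show ?case by (simp add: Lop_dinv Rop_dinv klin_closed(4))
qed (simp_all add: kendD[OF kend_Lop] kendD[OF kend_Rop])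

text \<open>Tested against functionals, this is the commutation of \<open>Lop\<close> and
  \<open>Rop\<close>. It shows that the set of all \<open>Rop \<gamma> w\<close> is stable under
  every \<open>Rop\<close>.\<close>

lemma Rop_Rop:
  fixes f :: "('k, 'm::{finite,linorder}, 'n::{finite,linorder}) KG"
  assumes "klin \<gamma>" "klin \<gamma>'"
  shows "Rop \<gamma> (Rop \<gamma>' f) = Rop (\<lambda>y. \<gamma> (Rop \<gamma>' y)) f"
proof (rule KG_eqI)
  fix \<alpha> :: "('k, 'm, 'n) functional" assume \<alpha>: "klin \<alpha>"
  show "\<alpha> (Rop \<gamma> (Rop \<gamma>' f)) = \<alpha> (Rop (\<lambda>y. \<gamma> (Rop \<gamma>' y)) f)"
    by (simp only: apply_Rop[OF \<alpha>] assms klin_closed(2)[OF assms(1) kend_Rop[OF assms(2)]] Lop_Rop[OF \<alpha>])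
qed

end

section \<open>The grading of K[G] by left and right torus weights\<close>

section \<open>The weight bigrading\<close>

type_synonym ('m, 'n) biweight = "('m, 'n) weight \<times> ('m, 'n) weight"

definition unit_weight :: "'m + 'n \<Rightarrow> ('m, 'n) weight" where
  "unit_weight i = (\<lambda>k. if k = i then 1 else 0)"

text \<open>The left weight of an entry is its row, the right weight its column. The product of the
  two determinants involves every row and every column once, so \<open>DetInv\<close> has the
  constant weight -1 on both sides.\<close>

fun gen_deg :: "('m, 'n) gen \<Rightarrow> ('m, 'n) biweight" where
  "gen_deg (Coord i j) = (unit_weight i, unit_weight j)"
| "gen_deg DetInv = (- 1, - 1)"

definition word_deg :: "('m, 'n) gen word \<Rightarrow> ('m, 'n) biweight" where
  "word_deg w = sum_list (map gen_deg (letters w))"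

lemma word_deg_0 [simp]: "word_deg 0 = 0"
  by (simp add: word_deg_def zero_word_def)

lemma word_deg_plus: "word_deg (u + v) = word_deg u + word_deg v"
  by (simp add: word_deg_def plus_word_def)

text \<open>A projection for every predicate on biweights: multiplication by a homogeneous element
  then merely shifts the predicate, and total degrees as well as congruence classes of degrees are
  covered by the same operator.\<close>

lift_definition free_comp :: "(('m, 'n) biweight \<Rightarrow> bool) \<Rightarrow> ('k::field, 'm, 'n) free_alg \<Rightarrow> ('k, 'm, 'n) free_alg"
  is "\<lambda>P F w. if P (word_deg w) then F w else 0"
  by (erule finite_subset[rotated]) auto

lemma free_comp_lookup:
  "Poly_Mapping.lookup (free_comp P F) w = (if P (word_deg w) then Poly_Mapping.lookup F w else 0)"
  by transfer simp

lemma free_comp_add: "free_comp P (F + H) = free_comp P F + free_comp P H"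
  by (rule poly_mapping_eqI) (simp add: free_comp_lookup lookup_add)

lemma free_comp_diff: "free_comp P (F - H) = free_comp P F - free_comp P H"
  by (rule poly_mapping_eqI) (simp add: free_comp_lookup lookup_minus)

lemma free_comp_0: "free_comp P 0 = 0"
  by (rule poly_mapping_eqI) (simp add: free_comp_lookup)

lemma free_comp_sum: "free_comp P (sum f A) = (\<Sum>x\<in>A. free_comp P (f x))"
  by (induction A rule: infinite_finite_induct) (simp_all add: free_comp_add free_comp_0)

lemma free_comp_single: "free_comp P (Poly_Mapping.single w r) = (if P (word_deg w) then Poly_Mapping.single w r else 0)"
  by (rule poly_mapping_eqI) (simp add: free_comp_lookup lookup_single when_def)

lemma free_comp_single_mult:
  "free_comp P (Poly_Mapping.single u r * F) = Poly_Mapping.single u r * free_comp (\<lambda>g. P (word_deg u + g)) F"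
  "free_comp P (F * Poly_Mapping.single u r) = free_comp (\<lambda>g. P (g + word_deg u)) F * Poly_Mapping.single u r"
proof -
  have 1: "free_comp P (Poly_Mapping.single u r * (\<Sum>v\<in>A. Poly_Mapping.single v (Poly_Mapping.lookup F v))) =
    Poly_Mapping.single u r * free_comp (\<lambda>g. P (word_deg u + g)) (\<Sum>v\<in>A. Poly_Mapping.single v (Poly_Mapping.lookup F v))" for A
    by (simp add: sum_distrib_left free_comp_sum mult_single free_comp_single word_deg_plus)
      (intro sum.cong refl, simp add: mult_single)
  have 2: "free_comp P ((\<Sum>v\<in>A. Poly_Mapping.single v (Poly_Mapping.lookup F v)) * Poly_Mapping.single u r) =
    free_comp (\<lambda>g. P (g + word_deg u)) (\<Sum>v\<in>A. Poly_Mapping.single v (Poly_Mapping.lookup F v)) * Poly_Mapping.single u r" for A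
    by (simp add: sum_distrib_right free_comp_sum mult_single free_comp_single word_deg_plus)
      (intro sum.cong refl, simp add: mult_single)
  show "free_comp P (Poly_Mapping.single u r * F) = Poly_Mapping.single u r * free_comp (\<lambda>g. P (word_deg u + g)) F"
    "free_comp P (F * Poly_Mapping.single u r) = free_comp (\<lambda>g. P (g + word_deg u)) F * Poly_Mapping.single u r"
    using 1[of "Poly_Mapping.keys F"] 2[of "Poly_Mapping.keys F"] by (simp_all only: sum_singles)
qed

definition free_bihom :: "('m, 'n) biweight \<Rightarrow> ('k::field, 'm, 'n) free_alg \<Rightarrow> bool" where
  "free_bihom g F \<longleftrightarrow> (\<forall>w\<in>Poly_Mapping.keys F. word_deg w = g)"

lemma free_comp_bihom: "free_bihom g F \<Longrightarrow> free_comp P F = (if P g then F else 0)"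
  by (rule poly_mapping_eqI) (auto simp: free_comp_lookup free_bihom_def in_keys_iff)

lemma free_bihom_0: "free_bihom g 0" by (simp add: free_bihom_def)

lemma free_bihom_add: "free_bihom g F \<Longrightarrow> free_bihom g H \<Longrightarrow> free_bihom g (F + H)"
  unfolding free_bihom_def using Poly_Mapping.keys_add[of F H] by auto

lemma free_bihom_uminus: "free_bihom g F \<Longrightarrow> free_bihom g (- F)"
  by (simp add: free_bihom_def)

lemma free_bihom_diff: "free_bihom g F \<Longrightarrow> free_bihom g H \<Longrightarrow> free_bihom g (F - H)"
  using free_bihom_add[of g F "- H"] by (simp add: free_bihom_uminus)

lemma free_bihom_sum: "(\<And>a. a \<in> A \<Longrightarrow> free_bihom g (f a)) \<Longrightarrow> free_bihom g (sum f A)"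
  by (induction A rule: infinite_finite_induct) (simp_all add: free_bihom_0 free_bihom_add)

lemma free_bihom_mult: "free_bihom g F \<Longrightarrow> free_bihom h H \<Longrightarrow> free_bihom (g + h) (F * H)"
  unfolding free_bihom_def using keys_mult[of F H] by (force simp: word_deg_plus)

lemma free_bihom_gen: "free_bihom (gen_deg x) (free_gen x)"
  by (simp add: free_bihom_def free_gen_def word_deg_def)

lemma free_bihom_1: "free_bihom 0 1"
  unfolding free_bihom_def single_one[symmetric] by (simp del: single_one)

lemma free_bihom_sign: "free_bihom g F \<Longrightarrow> free_bihom g (of_int (sign \<pi>) * F)"
  by (cases \<pi> rule: sign_cases) (simp_all add: free_bihom_uminus)

lemma free_bihom_prod_list:
  "free_bihom (sum_list (map (\<lambda>i. gen_deg (Coord (a i) (b i))) xs)) (prod_list (map (\<lambda>i. free_gen (Coord (a i) (b i))) xs))"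
proof (induction xs)
  case (Cons x xs)
  show ?case using free_bihom_mult[OF free_bihom_gen Cons, of "Coord (a x) (b x)"] by simp
qed (simp add: free_bihom_1)

lemma sum_list_sorted: "sum_list (map f (sorted_list_of_set (UNIV :: 'i::{finite,linorder} set))) = (sum f UNIV :: 'b::comm_monoid_add)"
  by (simp add: sum_list_distinct_conv_sum_set)

lemma det_deg:
  fixes e :: "'i::{finite,linorder} \<Rightarrow> 'm + 'n"
  assumes "\<pi> permutes UNIV"
  shows "sum_list (map (\<lambda>i. gen_deg (Coord (e i) (e (\<pi> i)))) (sorted_list_of_set UNIV)) =
    (\<Sum>i\<in>UNIV. unit_weight (e i), \<Sum>i\<in>UNIV. unit_weight (e i))"
proof -
  have "(\<Sum>i\<in>UNIV. unit_weight (e (\<pi> i))) = (\<Sum>i\<in>UNIV. unit_weight (e i))"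
    using sum.permute[OF assms, of "\<lambda>i. unit_weight (e i)"] by (simp add: comp_def)
  then show ?thesis by (simp add: sum_list_sorted sum_prod)
qed

lemma free_bihom_prod_permuted:
  fixes e :: "'i::{finite,linorder} \<Rightarrow> 'b + 'c"
  assumes "\<pi> permutes UNIV"
  shows "free_bihom (\<Sum>i\<in>UNIV. unit_weight (e i), \<Sum>i\<in>UNIV. unit_weight (e i))
    (prod_list (map (\<lambda>i. free_gen (Coord (e i) (e (\<pi> i)))) (sorted_list_of_set UNIV)))"
  using free_bihom_prod_list[of e "\<lambda>i. e (\<pi> i)" "sorted_list_of_set UNIV"] unfolding det_deg[OF assms] .

lemma free_bihom_det:
  "free_bihom (\<Sum>i\<in>UNIV. unit_weight (Inl i), \<Sum>i\<in>UNIV. unit_weight (Inl i)) free_det0"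
  "free_bihom (\<Sum>i\<in>UNIV. unit_weight (Inr i), \<Sum>i\<in>UNIV. unit_weight (Inr i)) free_det1"
  unfolding free_det0_def free_det1_def
  by (intro free_bihom_sum free_bihom_sign, rule free_bihom_prod_permuted, simp)+

lemma sum_fun_apply: "(\<Sum>i\<in>A. f i) k = (\<Sum>i\<in>A. f i k :: 'b::comm_monoid_add)"
  by (induction A rule: infinite_finite_induct) simp_all

lemma sum_unit_weight:
  "(\<Sum>i\<in>UNIV. unit_weight (Inl i)) + (\<Sum>i\<in>UNIV. unit_weight (Inr i)) = (1 :: ('m::finite, 'n::finite) weight)"
proof
  fix k :: "'m + 'n"
  show "((\<Sum>i\<in>UNIV. unit_weight (Inl i)) + (\<Sum>i\<in>UNIV. unit_weight (Inr i))) k = (1 :: ('m, 'n) weight) k"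
    by (cases k) (simp_all add: unit_weight_def sum_fun_apply)
qed

text \<open>The defining relations are homogeneous. For the closure under products the arbitrary
  factor is split into monomials; each of them shifts the predicate, which is why \<open>P\<close>
  varies in the induction.\<close>

lemma free_comp_rel_ideal:
  fixes F :: "('a::field, 'b::{finite,linorder}, 'c::{finite,linorder}) free_alg"
  shows "F \<in> rel_ideal \<Longrightarrow> free_comp P F \<in> rel_ideal"
proof (induction arbitrary: P rule: rel_ideal.induct)
  case (supercomm x y)
  have "free_bihom (gen_deg x + gen_deg y) (free_gen y * free_gen x)"
    using free_bihom_mult[OF free_bihom_gen free_bihom_gen, of y x] by (simp add: add.commute)
  then have "free_bihom (gen_deg x + gen_deg y) (koszul (gen_parity x) (gen_parity y) * (free_gen y * free_gen x))"
    by (auto simp: koszul_def dest: free_bihom_uminus)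
  then have "free_bihom (gen_deg x + gen_deg y) (free_gen x * free_gen y -
      koszul (gen_parity x) (gen_parity y) * (free_gen y * free_gen x))"
    by (intro free_bihom_diff free_bihom_mult[OF free_bihom_gen free_bihom_gen])
  note eq = free_comp_bihom[OF this]
  show ?case unfolding eq using rel_ideal.supercomm[of x y] rel_ideal.zero by metis
next
  case localize
  have "free_bihom (1, 1) (free_det0 * free_det1)"
    using free_bihom_mult[OF free_bihom_det] by (simp add: sum_unit_weight)
  then have "free_bihom 0 (free_gen DetInv * (free_det0 * free_det1))"
    using free_bihom_mult[OF free_bihom_gen[of DetInv]] by (fastforce simp: zero_prod_def)
  then have "free_bihom 0 (free_gen DetInv * (free_det0 * free_det1) - 1)"
    by (intro free_bihom_diff free_bihom_1)
  note eq = free_comp_bihom[OF this]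
  show ?case unfolding eq using rel_ideal.localize rel_ideal.zero by metis
next
  case (left F H)
  have sum: "(\<And>x. x \<in> A \<Longrightarrow> f x \<in> rel_ideal) \<Longrightarrow> sum f A \<in> rel_ideal" for f :: "_ \<Rightarrow> ('a, 'b, 'c) free_alg" and A
    by (induction A rule: infinite_finite_induct) (simp_all add: rel_ideal.zero rel_ideal.add)
  have "free_comp P ((\<Sum>u\<in>Poly_Mapping.keys H. Poly_Mapping.single u (Poly_Mapping.lookup H u)) * F) \<in> rel_ideal"
    unfolding sum_distrib_right free_comp_sum free_comp_single_mult by (intro sum rel_ideal.left left.IH)
  then show ?case by (simp only: sum_singles)
next
  case (right F H)
  have sum: "(\<And>x. x \<in> A \<Longrightarrow> f x \<in> rel_ideal) \<Longrightarrow> sum f A \<in> rel_ideal" for f :: "_ \<Rightarrow> ('a, 'b, 'c) free_alg" and A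
    by (induction A rule: infinite_finite_induct) (simp_all add: rel_ideal.zero rel_ideal.add)
  have "free_comp P (F * (\<Sum>u\<in>Poly_Mapping.keys H. Poly_Mapping.single u (Poly_Mapping.lookup H u))) \<in> rel_ideal"
    unfolding sum_distrib_left free_comp_sum free_comp_single_mult by (intro sum rel_ideal.right right.IH)
  then show ?case by (simp only: sum_singles)
qed (simp_all add: free_comp_add free_comp_0 rel_ideal.zero rel_ideal.add)

lift_definition wcomp :: "(('m, 'n) biweight \<Rightarrow> bool) \<Rightarrow>
    ('k::field, 'm::{finite,linorder}, 'n::{finite,linorder}) KG \<Rightarrow> ('k, 'm, 'n) KG"
  is free_comp
  unfolding free_comp_diff[symmetric] by (rule free_comp_rel_ideal)

lemma wcomp_add: "wcomp P (f + g) = wcomp P f + wcomp P g"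
  by transfer (simp add: free_comp_add rel_ideal.zero)

lemma wcomp_scale: "wcomp P (kg_scale r f) = kg_scale r (wcomp P f)"
  by transfer (simp add: free_scalar_def free_comp_single_mult rel_ideal.zero)

lemma kend_wcomp: "kend (wcomp P)" by (simp add: kend_def wcomp_add wcomp_scale)

lemma wcomp_1: "wcomp P 1 = (if P 0 then 1 else 0)"
proof -
  have "wcomp P (1 :: ('a, 'b, 'c) KG) = abs_KG (free_comp P 1)" unfolding one_KG_def by (rule wcomp.abs_eq)
  then show ?thesis by (simp add: free_comp_bihom[OF free_bihom_1] one_KG_def zero_KG_def)
qed

text \<open>Homogeneity is stated through left multiplication, the form in which inductions over
  generators use it; the case f = 1 says that \<open>a\<close> lies in the component of
  \<open>g\<close>.\<close>

definition bihom :: "('m, 'n) biweight \<Rightarrow> ('k::field, 'm::{finite,linorder}, 'n::{finite,linorder}) KG \<Rightarrow> bool" where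
  "bihom g a \<longleftrightarrow> (\<forall>P f. wcomp P (a * f) = a * wcomp (\<lambda>x. P (g + x)) f)"

lemma bihomD: "bihom g a \<Longrightarrow> wcomp P (a * f) = a * wcomp (\<lambda>x. P (g + x)) f"
  by (simp add: bihom_def)

lemma wcomp_bihom: "bihom g a \<Longrightarrow> wcomp P a = (if P g then a else 0)"
  using bihomD[of g a P 1] by (simp add: wcomp_1)

lemma bihom_1: "bihom 0 1" by (simp add: bihom_def)

lemma bihom_mult: "bihom g a \<Longrightarrow> bihom h b \<Longrightarrow> bihom (g + h) (a * b)"
  by (simp add: bihom_def mult.assoc add.assoc)

lemma bihom_coord:
  "bihom (unit_weight i, unit_weight j) (coord i j :: ('a::field, 'b::{finite,linorder}, 'c::{finite,linorder}) KG)"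
proof -
  have "wcomp P (abs_KG (free_gen (Coord i j)) * abs_KG F) = abs_KG (free_gen (Coord i j)) * wcomp (\<lambda>x. P (gen_deg (Coord i j) + x)) (abs_KG F)"
    for P and F :: "('a, 'b, 'c) free_alg"
    by (simp add: times_KG.abs_eq wcomp.abs_eq free_gen_def free_comp_single_mult word_deg_def)
  then show ?thesis unfolding bihom_def abs_KG_gen by (metis KG_cases gen_deg.simps(1))
qed

lemma bihom_det_inv: "bihom (- 1, - 1) (det_inv :: ('a::field, 'b::{finite,linorder}, 'c::{finite,linorder}) KG)"
proof -
  have "wcomp P (abs_KG (free_gen DetInv) * abs_KG F) = abs_KG (free_gen DetInv) * wcomp (\<lambda>x. P (gen_deg DetInv + x)) (abs_KG F)"
    for P and F :: "('a, 'b, 'c) free_alg"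
    by (simp add: times_KG.abs_eq wcomp.abs_eq free_gen_def free_comp_single_mult word_deg_def)
  then show ?thesis unfolding bihom_def abs_KG_gen by (metis KG_cases gen_deg.simps(2))
qed

lemma wcomp_coord: "wcomp P (coord i j * f) = coord i j * wcomp (\<lambda>x. P ((unit_weight i, unit_weight j) + x)) f"
  by (rule bihomD[OF bihom_coord])

definition dinv_weight :: "'k::field itself \<Rightarrow> ('m, 'n) weight" where
  "dinv_weight _ = (\<lambda>_. - int CHAR('k))"

lemma bihom_dinv: "bihom (dinv_weight TYPE('k), dinv_weight TYPE('k)) (dinv :: ('k::field, 'm::{finite,linorder}, 'n::{finite,linorder}) KG)"
proof -
  have "bihom (\<lambda>_. - int n, \<lambda>_. - int n) (det_inv ^ n :: ('k, 'm, 'n) KG)" for n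
  proof (induction n)
    case 0
    then show ?case using bihom_1 by (simp add: zero_prod_def zero_fun_def)
  next
    case (Suc n)
    have "((- 1, - 1) :: ('m, 'n) biweight) + (\<lambda>_. - int n, \<lambda>_. - int n) = (\<lambda>_. - int (Suc n), \<lambda>_. - int (Suc n))"
      by (simp add: fun_eq_iff)
    then show ?case using bihom_mult[OF bihom_det_inv Suc] by simp
  qed
  then show ?thesis by (simp add: dinv_def dinv_weight_def)
qed

lemma wcomp_dinv: "wcomp P (dinv * f) = dinv * wcomp (\<lambda>x. P ((dinv_weight TYPE('k), dinv_weight TYPE('k)) + x)) (f :: ('k::field, 'm::{finite,linorder}, 'n::{finite,linorder}) KG)"
  by (rule bihomD[OF bihom_dinv])

lemma wcomp_wcomp: "wcomp P (wcomp Q f) = wcomp (\<lambda>g. P g \<and> Q g) f"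
proof (cases f)
  case (abs_KG F)
  have "free_comp P (free_comp Q F) = free_comp (\<lambda>g. P g \<and> Q g) F"
    by (rule poly_mapping_eqI) (simp add: free_comp_lookup)
  then show ?thesis by (simp add: abs_KG wcomp.abs_eq)
qed

lemma wcomp_True: "wcomp (\<lambda>_. True) f = f"
proof (cases f)
  case (abs_KG F)
  have "free_comp (\<lambda>_. True) F = F"
    by (rule poly_mapping_eqI) (simp add: free_comp_lookup)
  then show ?thesis by (simp add: abs_KG wcomp.abs_eq)
qed

lemma wcomp_split: "wcomp P f + wcomp (\<lambda>g. \<not> P g) f = f"
proof (cases f)
  case (abs_KG F)
  have "free_comp P F + free_comp (\<lambda>g. \<not> P g) F = F"
    by (rule poly_mapping_eqI) (simp add: free_comp_lookup lookup_add)
  then show ?thesis by (simp add: abs_KG wcomp.abs_eq plus_KG.abs_eq)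
qed

lemma wcomp_finite:
  obtains D where "finite D" "\<And>P. (\<And>g. g \<in> D \<Longrightarrow> \<not> P g) \<Longrightarrow> wcomp P f = 0"
proof (cases f)
  case (abs_KG F)
  have "wcomp P f = 0" if "\<And>g. g \<in> word_deg ` Poly_Mapping.keys F \<Longrightarrow> \<not> P g" for P
  proof -
    have "free_comp P F = 0"
    proof (rule poly_mapping_eqI)
      fix w
      have "w \<in> Poly_Mapping.keys F \<Longrightarrow> \<not> P (word_deg w)" by (rule that[OF imageI])
      then show "Poly_Mapping.lookup (free_comp P F) w = Poly_Mapping.lookup 0 w"
        by (auto simp: free_comp_lookup in_keys_iff)
    qed
    then show ?thesis by (simp add: abs_KG wcomp.abs_eq zero_KG_def)
  qed
  note z = this
  show ?thesis by (rule that[of "word_deg ` Poly_Mapping.keys F"]) (simp, rule z, blast)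
qed

lemma wcomp_disj: "(\<And>g. \<not> (P g \<and> Q g)) \<Longrightarrow> wcomp (\<lambda>g. P g \<or> Q g) f = wcomp P f + wcomp Q f"
proof (cases f)
  case (abs_KG F)
  assume "\<And>g. \<not> (P g \<and> Q g)"
  then have "free_comp (\<lambda>g. P g \<or> Q g) F = free_comp P F + free_comp Q F"
    by (intro poly_mapping_eqI) (auto simp: free_comp_lookup lookup_add)
  then show ?thesis by (simp add: abs_KG wcomp.abs_eq plus_KG.abs_eq)
qed

lemma wcomp_False: "wcomp (\<lambda>_. False) f = 0"
  using wcomp_finite[of f] by metis

text \<open>The function \<open>d\<close> coarsens the biweight, for instance to its right weight or
  to the degree. Only finitely many values occur, because a representative in the free algebra has
  finite support.\<close>

lemma wcomp_sum:
  obtains D where "finite D" "f = (\<Sum>x\<in>D. wcomp (\<lambda>g. d g = x) f)" "\<And>x. x \<notin> D \<Longrightarrow> wcomp (\<lambda>g. d g = x) f = 0"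
proof -
  obtain D where D: "finite D" "\<And>P. (\<And>g. g \<in> D \<Longrightarrow> \<not> P g) \<Longrightarrow> wcomp P f = 0"
    using wcomp_finite by blast
  have "wcomp (\<lambda>g. d g \<in> E) f = (\<Sum>x\<in>E. wcomp (\<lambda>g. d g = x) f)" if "finite E" for E
    using that
  proof induction
    case (insert x E)
    then have "wcomp (\<lambda>g. d g = x \<or> d g \<in> E) f = wcomp (\<lambda>g. d g = x) f + wcomp (\<lambda>g. d g \<in> E) f"
      by (intro wcomp_disj) auto
    then show ?case using insert by simp
  qed (simp add: wcomp_False)
  from this[of "d ` D"] have "wcomp (\<lambda>g. d g \<in> d ` D) f = (\<Sum>x\<in>d ` D. wcomp (\<lambda>g. d g = x) f)" using D(1) by simp
  moreover have "wcomp (\<lambda>g. \<not> (d g \<in> d ` D)) f = 0" by (rule D(2)) auto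
  ultimately have sum: "f = (\<Sum>x\<in>d ` D. wcomp (\<lambda>g. d g = x) f)" using wcomp_split[of "\<lambda>g. d g \<in> d ` D" f] by simp
  show ?thesis
  proof (rule that[OF _ sum])
    show "wcomp (\<lambda>g. d g = x) f = 0" if "x \<notin> d ` D" for x by (rule D(2)) (use that in blast)
  qed (use D(1) in simp)
qed

lemma part_wcomp: "part p (wcomp P f) = wcomp P (part p f)"
proof -
  have "\<forall>p P. part p (wcomp P f) = wcomp P (part p f)"
  proof (induction f rule: KG_span_induct)
    case (coord i j f)
    then show ?case by (simp add: wcomp_coord part_coord_mult)
  next
    case (det_inv f)
    then show ?case by (simp add: bihomD[OF bihom_det_inv] part_det_inv_mult)
  qed (simp_all add: part_1 wcomp_1 kend_0[OF kend_wcomp] part_add part_scale wcomp_add wcomp_scale)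
  then show ?thesis by blast
qed

text \<open>Off-diagonal coordinates vanish at the identity matrix, so only biweights with equal
  components contribute.\<close>

lemma counit_wcomp: "counit (wcomp P f) = counit (wcomp (\<lambda>g. P g \<and> fst g = snd g) f)"
proof -
  have "\<forall>P. counit (wcomp P f) = counit (wcomp (\<lambda>g. P g \<and> fst g = snd g) f)"
  proof (induction f rule: KG_span_induct)
    case (coord i j f)
    show ?case
    proof (cases "i = j")
      case True
      then show ?thesis using coord by (auto simp: wcomp_coord)
    qed (simp add: wcomp_coord)
  next
    case (det_inv f)
    then show ?case by (simp add: bihomD[OF bihom_det_inv])
  qed (simp_all add: wcomp_1 wcomp_add wcomp_scale)
  then show ?thesis by blast
qed

abbreviation compL :: "(('m, 'n) weight \<Rightarrow> bool) \<Rightarrow> ('k::field, 'm::{finite,linorder}, 'n::{finite,linorder}) KG \<Rightarrow> ('k, 'm, 'n) KG" where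
  "compL Q \<equiv> wcomp (\<lambda>g. Q (fst g))"

abbreviation compR :: "(('m, 'n) weight \<Rightarrow> bool) \<Rightarrow> ('k::field, 'm::{finite,linorder}, 'n::{finite,linorder}) KG \<Rightarrow> ('k, 'm, 'n) KG" where
  "compR Q \<equiv> wcomp (\<lambda>g. Q (snd g))"

lemma counit_compL: "counit (compL Q f) = counit (compR Q f)"
proof -
  have "(\<lambda>g :: ('b, 'c) biweight. Q (fst g) \<and> fst g = snd g) = (\<lambda>g. Q (snd g) \<and> fst g = snd g)" by auto
  then show ?thesis
    using counit_wcomp[of "\<lambda>g. Q (fst g)" f] counit_wcomp[of "\<lambda>g. Q (snd g)" f] by simp
qed

lemma tmap_wcomp_mult:
  assumes "bihom g a" "bihom h b" "parity p b"
  shows "tmap (wcomp P) (wcomp Q) (tensor a b * x) = tensor a b * tmap (wcomp (\<lambda>y. P (g + y))) (wcomp (\<lambda>y. Q (h + y))) x"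
  by (rule tmap_mult[OF kend_wcomp kend_wcomp kend_wcomp kend_wcomp assms(3) bihomD[OF assms(1)] bihomD[OF assms(2)] part_wcomp])

lemma tmap_part_mult:
  assumes "parity q a" "parity r b"
  shows "tmap (part p) (part p') (tensor a b * x) = tensor a b * tmap (part (p \<noteq> q)) (part (p' \<noteq> r)) x"
  by (rule tmap_mult[OF kend_closed(3) kend_closed(3) kend_closed(3) kend_closed(3) assms(2) part_mult_left[OF assms(1)] part_mult_left[OF assms(2)]])
    (auto simp: part_part)

lemma tmap_split:
  assumes "kend \<phi>"
  shows "tmap \<phi> (\<lambda>y. y) x = tmap \<phi> (part True) x + tmap \<phi> (part False) x"
    "tmap (\<lambda>y. y) \<phi> x = tmap (part True) \<phi> x + tmap (part False) \<phi> x"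
proof -
  note k = assms kend_closed(1) kend_closed(3)[of True] kend_closed(3)[of False]
  show "tmap \<phi> (\<lambda>y. y) x = tmap \<phi> (part True) x + tmap \<phi> (part False) x"
    by (induction x rule: KG2_tensor_induct)
      (simp_all add: tmap_tensor tmap_add k tensor_add_right[symmetric] part_split)
  show "tmap (\<lambda>y. y) \<phi> x = tmap (part True) \<phi> x + tmap (part False) \<phi> x"
    by (induction x rule: KG2_tensor_induct)
      (simp_all add: tmap_tensor tmap_add k tensor_add_left[symmetric] part_split)
qed

context
  assumes char: "CHAR('k::field) > 2"
begin

lemma comult_coord_mult:
  "comult (coord i j * f :: ('k, 'm::{finite,linorder}, 'n::{finite,linorder}) KG) = (\<Sum>k\<in>UNIV. tensor (coord i k) (coord k j) * comult f)"
  by (simp add: comult_mult[OF char] comult_coord[OF char] comat_def sum_distrib_right)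

lemma tmap_wcomp_coord:
  "tmap (wcomp P) (wcomp Q) (comult (coord i j * f :: ('k, 'm::{finite,linorder}, 'n::{finite,linorder}) KG)) =
    (\<Sum>k\<in>UNIV. tensor (coord i k) (coord k j) *
      tmap (wcomp (\<lambda>y. P ((unit_weight i, unit_weight k) + y))) (wcomp (\<lambda>y. Q ((unit_weight k, unit_weight j) + y))) (comult f))"
  by (simp add: comult_coord_mult tmap_sum kend_wcomp tmap_wcomp_mult[OF bihom_coord bihom_coord parity_coord])

lemma tmap_wcomp_dinv:
  "tmap (wcomp P) (wcomp Q) (comult (dinv * f :: ('k, 'm::{finite,linorder}, 'n::{finite,linorder}) KG)) =
    tensor dinv dinv * tmap (wcomp (\<lambda>y. P ((dinv_weight TYPE('k), dinv_weight TYPE('k)) + y)))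
      (wcomp (\<lambda>y. Q ((dinv_weight TYPE('k), dinv_weight TYPE('k)) + y))) (comult f)"
  by (simp add: comult_mult[OF char] comult_dinv[OF char] tmap_wcomp_mult[OF bihom_dinv bihom_dinv parity_dinv[OF char]])

text \<open>\<Delta> maps biweight (\<kappa>, \<nu>) to sums over \<lambda> of (\<kappa>, \<lambda>)
  \<otimes> (\<lambda>, \<nu>): outer weights are preserved and inner weights agree. The identity is
  written as the projection of a constantly true predicate, so that a single product rule covers
  both tensor factors.\<close>

lemma
  fixes f :: "('k, 'm::{finite,linorder}, 'n::{finite,linorder}) KG"
  shows comult_compR: "comult (compR Q f) = tmap (wcomp (\<lambda>_. True)) (compR Q) (comult f)"
    and comult_compL: "comult (compL Q f) = tmap (compL Q) (wcomp (\<lambda>_. True)) (comult f)"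
    and comult_mid: "tmap (compR Q) (wcomp (\<lambda>_. True)) (comult f) = tmap (wcomp (\<lambda>_. True)) (compL Q) (comult f)"
proof -
  have z: "comult (0 :: ('k, 'm, 'n) KG) = 0" using comult_scale[OF char, of 0 "0 :: ('k, 'm, 'n) KG"] by simp
  note s = comult_add[OF char] comult_scale[OF char] tmap_add kend_wcomp tmap_scale wcomp_add wcomp_scale
  note o = wcomp_1 comult_1[OF char] z one_KG2_def tmap_tensor kend_wcomp
  have "\<forall>Q. comult (compR Q f) = tmap (wcomp (\<lambda>_. True)) (compR Q) (comult f)"
  proof (induction f rule: KG_induct[OF char, case_names one add scale coord dinv])
    case (coord i j f)
    have "comult (compR Q (coord i j * f)) = tmap (wcomp (\<lambda>_. True)) (compR Q) (comult (coord i j * f))" for Q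
      using spec[OF coord, of "\<lambda>y. Q (unit_weight j + y)"] by (simp only: tmap_wcomp_coord, simp only: wcomp_coord comult_coord_mult snd_add snd_conv)
    then show ?case by blast
  next
    case (dinv f)
    have "comult (compR Q (dinv * f)) = tmap (wcomp (\<lambda>_. True)) (compR Q) (comult (dinv * f))" for Q
      using spec[OF dinv, of "\<lambda>y. Q (dinv_weight TYPE('k) + y)"] by (simp only: tmap_wcomp_dinv, simp only: wcomp_dinv comult_mult[OF char] comult_dinv[OF char] snd_add snd_conv)
    then show ?case by blast
  qed (simp_all add: o s)
  then show "comult (compR Q f) = tmap (wcomp (\<lambda>_. True)) (compR Q) (comult f)" by blast
  have "\<forall>Q. comult (compL Q f) = tmap (compL Q) (wcomp (\<lambda>_. True)) (comult f)"
  proof (induction f rule: KG_induct[OF char, case_names one add scale coord dinv])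
    case (coord i j f)
    have "comult (compL Q (coord i j * f)) = tmap (compL Q) (wcomp (\<lambda>_. True)) (comult (coord i j * f))" for Q
      using spec[OF coord, of "\<lambda>y. Q (unit_weight i + y)"] by (simp only: tmap_wcomp_coord, simp only: wcomp_coord comult_coord_mult fst_add fst_conv)
    then show ?case by blast
  next
    case (dinv f)
    have "comult (compL Q (dinv * f)) = tmap (compL Q) (wcomp (\<lambda>_. True)) (comult (dinv * f))" for Q
      using spec[OF dinv, of "\<lambda>y. Q (dinv_weight TYPE('k) + y)"] by (simp only: tmap_wcomp_dinv, simp only: wcomp_dinv comult_mult[OF char] comult_dinv[OF char] fst_add fst_conv)
    then show ?case by blast
  qed (simp_all add: o s)
  then show "comult (compL Q f) = tmap (compL Q) (wcomp (\<lambda>_. True)) (comult f)" by blast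
  have "\<forall>Q. tmap (compR Q) (wcomp (\<lambda>_. True)) (comult f) = tmap (wcomp (\<lambda>_. True)) (compL Q) (comult f)"
  proof (induction f rule: KG_induct[OF char, case_names one add scale coord dinv])
    case (coord i j f)
    have "tmap (compR Q) (wcomp (\<lambda>_. True)) (comult (coord i j * f)) = tmap (wcomp (\<lambda>_. True)) (compL Q) (comult (coord i j * f))" for Q
      using spec[OF coord, of "\<lambda>y. Q (unit_weight _ + y)"] by (simp only: tmap_wcomp_coord fst_add fst_conv snd_add snd_conv)
    then show ?case by blast
  next
    case (dinv f)
    have "tmap (compR Q) (wcomp (\<lambda>_. True)) (comult (dinv * f)) = tmap (wcomp (\<lambda>_. True)) (compL Q) (comult (dinv * f))" for Q
      using spec[OF dinv, of "\<lambda>y. Q (dinv_weight TYPE('k) + y)"] by (simp only: tmap_wcomp_dinv fst_add fst_conv snd_add snd_conv)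
    then show ?case by blast
  qed (simp_all add: o s)
  then show "tmap (compR Q) (wcomp (\<lambda>_. True)) (comult f) = tmap (wcomp (\<lambda>_. True)) (compL Q) (comult f)" by blast
qed

text \<open>The same three facts after contraction. The last two express the agreement of inner
  weights: restricting the functional to a weight on one inner side projects the result onto that
  weight on the other.\<close>

lemma
  fixes f :: "('k, 'm::{finite,linorder}, 'n::{finite,linorder}) KG"
  assumes "klin \<gamma>"
  shows Rop_compR: "Rop \<gamma> (compR Q f) = Rop (\<lambda>y. \<gamma> (compR Q y)) f"
    and Lop_compR: "Lop \<gamma> (compR Q f) = compR Q (Lop \<gamma> f)"
    and Rop_compL: "Rop \<gamma> (compL Q f) = compL Q (Rop \<gamma> f)"
    and Lop_compL: "Lop \<gamma> (compL Q f) = Lop (\<lambda>y. \<gamma> (compL Q y)) f"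
    and compR_Rop: "compR Q (Rop \<gamma> f) = Rop (\<lambda>y. \<gamma> (compL Q y)) f"
    and compL_Lop: "compL Q (Lop \<gamma> f) = Lop (\<lambda>y. \<gamma> (compR Q y)) f"
proof -
  note r = rc_tmap[OF assms kend_wcomp kend_wcomp] lc_tmap[OF assms kend_wcomp kend_wcomp]
  show "Rop \<gamma> (compR Q f) = Rop (\<lambda>y. \<gamma> (compR Q y)) f" "Lop \<gamma> (compR Q f) = compR Q (Lop \<gamma> f)"
    "Rop \<gamma> (compL Q f) = compL Q (Rop \<gamma> f)" "Lop \<gamma> (compL Q f) = Lop (\<lambda>y. \<gamma> (compL Q y)) f"
    by (simp_all add: Rop_def Lop_def comult_compR comult_compL r wcomp_True)
  show "compR Q (Rop \<gamma> f) = Rop (\<lambda>y. \<gamma> (compL Q y)) f"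
    using arg_cong[OF comult_mid[of Q f], of "rc \<gamma>"] by (simp add: r wcomp_True Rop_def)
  show "compL Q (Lop \<gamma> f) = Lop (\<lambda>y. \<gamma> (compR Q y)) f"
    using arg_cong[OF comult_mid[of Q f], of "lc \<gamma>"] by (simp add: r wcomp_True Lop_def)
qed

text \<open>\<Delta> is even: the parity of an element is the sum of the parities of the two tensor
  factors. Hence contraction with a homogeneous functional shifts parity by a fixed amount.\<close>

lemma
  fixes f :: "('k, 'm::{finite,linorder}, 'n::{finite,linorder}) KG"
  shows comult_part_left: "tmap (part p) (\<lambda>y. y) (comult (part q f)) = tmap (part p) (part (p \<noteq> q)) (comult f)"
    and comult_part_right: "tmap (\<lambda>y. y) (part p) (comult (part q f)) = tmap (part (p \<noteq> q)) (part p) (comult f)"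
proof -
  have z: "comult (0 :: ('k, 'm, 'n) KG) = 0" using comult_scale[OF char, of 0 "0 :: ('k, 'm, 'n) KG"] by simp
  have "\<forall>p q r. tmap (part p) (part r) (comult (part q f)) = (if r = (p \<noteq> q) then tmap (part p) (part r) (comult f) else 0)"
  proof (induction f rule: KG_induct[OF char, case_names one add scale coord dinv])
    case (coord i j f)
    show ?case
    proof (intro allI)
      fix p q r
      have "tmap (part p) (part r) (comult (part q (coord i j * f))) =
        (\<Sum>k\<in>UNIV. tensor (coord i k) (coord k j) * tmap (part (p \<noteq> (isl i \<noteq> isl k))) (part (r \<noteq> (isl k \<noteq> isl j))) (comult (part (q \<noteq> (isl i \<noteq> isl j)) f)))"
        by (simp add: part_coord_mult comult_coord_mult tmap_sum kend_closed(3) tmap_part_mult[OF parity_coord parity_coord])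
      also have "\<dots> = (\<Sum>k\<in>UNIV. tensor (coord i k) (coord k j) *
         (if r = (p \<noteq> q) then tmap (part (p \<noteq> (isl i \<noteq> isl k))) (part (r \<noteq> (isl k \<noteq> isl j))) (comult f) else 0))"
        by (rule sum.cong[OF refl], subst coord[rule_format]) auto
      also have "\<dots> = (if r = (p \<noteq> q) then tmap (part p) (part r) (comult (coord i j * f)) else 0)"
        by (cases p; cases q; cases r) (simp_all add: comult_coord_mult tmap_sum kend_closed(3) tmap_part_mult[OF parity_coord parity_coord])
      finally show "tmap (part p) (part r) (comult (part q (coord i j * f))) =
        (if r = (p \<noteq> q) then tmap (part p) (part r) (comult (coord i j * f)) else 0)" .
    qed
  next
    case (dinv f)
    have "part q (dinv * f) = dinv * part q f" for q using part_mult_left[OF parity_dinv[OF char], of q f] by simp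
    then have "tmap (part p) (part r) (comult (part q (dinv * f))) = (if r = (p \<noteq> q) then tmap (part p) (part r) (comult (dinv * f)) else 0)" for p q r
      using dinv[rule_format, of p r q]
      by (cases p; cases q; cases r) (simp_all add: comult_mult[OF char] comult_dinv[OF char] tmap_part_mult[OF parity_dinv[OF char] parity_dinv[OF char]])
    then show ?case by blast
  qed (auto simp: part_1 comult_1[OF char] z one_KG2_def tmap_tensor kend_closed(3) tmap_0 part_add part_scale
      comult_add[OF char] comult_scale[OF char] tmap_add tmap_scale)
  note * = this[rule_format]
  show "tmap (part p) (\<lambda>y. y) (comult (part q f)) = tmap (part p) (part (p \<noteq> q)) (comult f)"
    by (subst tmap_split(1)[OF kend_closed(3)], cases p; cases q) (simp_all add: *)
  show "tmap (\<lambda>y. y) (part p) (comult (part q f)) = tmap (part (p \<noteq> q)) (part p) (comult f)"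
    by (subst tmap_split(2)[OF kend_closed(3)], cases p; cases q) (simp_all add: *)
qed

lemma
  fixes f :: "('k, 'm::{finite,linorder}, 'n::{finite,linorder}) KG"
  assumes "klin \<gamma>"
  shows Lop_part: "Lop (\<lambda>y. \<gamma> (part p y)) (part q f) = part (p \<noteq> q) (Lop (\<lambda>y. \<gamma> (part p y)) f)"
    and Rop_part: "Rop (\<lambda>y. \<gamma> (part p y)) (part q f) = part (p \<noteq> q) (Rop (\<lambda>y. \<gamma> (part p y)) f)"
  using arg_cong[OF comult_part_left[of p q f], of "lc \<gamma>"] arg_cong[OF comult_part_right[of p q f], of "rc \<gamma>"]
  by (simp_all add: lc_tmap rc_tmap assms kend_closed Lop_def Rop_def)

end

section \<open>The big cell: functions are determined on products of triangular matrices\<close>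

section \<open>A ring of operators\<close>

text \<open>Linear endomorphisms of a space of functions form a ring with room for noncommuting
  variables and inverses; generic triangular matrices get their entries in this ring, and
  coefficients are read off by evaluating at an exponent.\<close>

typedef (overloaded) ('k, 'x) oper = "{T :: ('x \<Rightarrow> 'k::field) \<Rightarrow> 'x \<Rightarrow> 'k.
    (\<forall>f g. T (\<lambda>e. f e + g e) = (\<lambda>e. T f e + T g e)) \<and> (\<forall>r f. T (\<lambda>e. r * f e) = (\<lambda>e. r * T f e))}"
  morphisms app Oper
  by (rule exI[of _ "\<lambda>f. f"]) simp

setup_lifting type_definition_oper

instantiation oper :: (field, type) ring_1
begin

lift_definition zero_oper :: "('a, 'b) oper" is "\<lambda>_ _. 0" by simp
lift_definition one_oper :: "('a, 'b) oper" is "\<lambda>f. f" by simp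
lift_definition plus_oper :: "('a, 'b) oper \<Rightarrow> ('a, 'b) oper \<Rightarrow> ('a, 'b) oper" is "\<lambda>T U f e. T f e + U f e"
  by (simp add: algebra_simps)
lift_definition uminus_oper :: "('a, 'b) oper \<Rightarrow> ('a, 'b) oper" is "\<lambda>T f e. - T f e"
  by simp
lift_definition minus_oper :: "('a, 'b) oper \<Rightarrow> ('a, 'b) oper \<Rightarrow> ('a, 'b) oper" is "\<lambda>T U f e. T f e - U f e"
  by (simp add: algebra_simps)
lift_definition times_oper :: "('a, 'b) oper \<Rightarrow> ('a, 'b) oper \<Rightarrow> ('a, 'b) oper" is "\<lambda>T U f. T (U f)"
  by simp

instance
proof
  fix a b c :: "('a, 'b) oper"
  show "(0 :: ('a, 'b) oper) \<noteq> 1" by transfer (auto simp: fun_eq_iff intro!: exI[of _ "\<lambda>_. 1"])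
qed (transfer; simp add: fun_eq_iff add.assoc add.commute)+

end

lift_definition op_scale :: "'k::field \<Rightarrow> ('k, 'x) oper \<Rightarrow> ('k, 'x) oper" is "\<lambda>r T f e. r * T f e"
  by (simp add: algebra_simps)

lemma vector_space_oper: "vector_space (op_scale :: 'k::field \<Rightarrow> ('k, 'x) oper \<Rightarrow> _)"
  by standard (transfer; simp add: fun_eq_iff algebra_simps)+

lemma op_scale_mult: "op_scale r S * T = op_scale r (S * T)" "S * op_scale r T = op_scale r (S * T)"
  by (transfer; simp)+

lemma op_scale_simps [simp]: "op_scale 1 T = T" "op_scale (- 1) T = - T" "op_scale r 0 = 0"
    "op_scale r (op_scale s T) = op_scale (r * s) T" "op_scale 0 T = 0"
  by (transfer; simp add: fun_eq_iff)+

lemma app_simps: "app 0 f = (\<lambda>_. 0)" "app 1 f = f" "app (S + T) f = (\<lambda>e. app S f e + app T f e)"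
    "app (S * T) f = app S (app T f)" "app (op_scale r T) f = (\<lambda>e. r * app T f e)"
  by (transfer; simp)+

lemma app_sum: "app (sum F A) f e = (\<Sum>x\<in>A. app (F x) f e)"
  by (induction A rule: infinite_finite_induct) (simp_all add: app_simps)

section \<open>Generic triangular matrices\<close>

type_synonym ('m, 'n) expo = "('m + 'n) \<times> ('m + 'n) \<Rightarrow> int"

definition odd_var :: "('m + 'n) \<times> ('m + 'n) \<Rightarrow> bool" where
  "odd_var v \<longleftrightarrow> isl (fst v) \<noteq> isl (snd v)"

definition odd_count :: "('m::finite + 'n::finite) \<times> ('m + 'n) \<Rightarrow> ('m, 'n) expo \<Rightarrow> int" where
  "odd_count v e = (\<Sum>w | odd_var w \<and> to_nat w < to_nat v. e w)"

text \<open>A Jordan-Wigner sign: a new odd variable is moved past the odd variables that precede it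
  in the enumeration \<open>to_nat\<close>, which makes multiplications by distinct odd variables
  anticommute.\<close>

definition var_sign :: "('m::finite + 'n::finite) \<times> ('m + 'n) \<Rightarrow> ('m, 'n) expo \<Rightarrow> 'k::field" where
  "var_sign v e = (if odd_var v \<and> odd (odd_count v e) then - 1 else 1)"

text \<open>Multiplication by the variable \<open>v\<close> of a generic supermatrix, on series in monomials with exponents
  \<open>e\<close>: the exponents of the odd variables are effectively 0 or 1, those of the even variables are integers,
  so that the even variables are invertible.\<close>

lift_definition Z :: "('m::finite + 'n::finite) \<times> ('m + 'n) \<Rightarrow> ('k::field, ('m, 'n) expo) oper"
  is "\<lambda>v g e. if odd_var v \<and> e v \<noteq> 1 then 0 else var_sign v e * g (e(v := e v - 1))"
  by (auto simp: fun_eq_iff algebra_simps)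

lift_definition Zinv :: "'m + 'n \<Rightarrow> ('k::field, ('m, 'n) expo) oper"
  is "\<lambda>i g e. g (e((i, i) := e (i, i) + 1))"
  by auto

lemma var_sign_upd:
  assumes "v \<noteq> w"
  shows "var_sign w (e(v := x)) =
    (if odd_var v \<and> odd_var w \<and> to_nat v < to_nat w \<and> odd (e v - x) then - var_sign w e else (var_sign w e :: 'k::field))"
proof -
  let ?A = "{u. odd_var u \<and> to_nat u < to_nat w}"
  have "(\<Sum>u\<in>?A. (e(v := x)) u) = (\<Sum>u\<in>?A. e u - (if u = v then e v - x else 0))"
    by (intro sum.cong) auto
  also have "\<dots> = (\<Sum>u\<in>?A. e u) - (if v \<in> ?A then e v - x else 0)"
    by (simp add: sum_subtractf)
  finally show ?thesis by (auto simp: var_sign_def odd_count_def)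
qed

lemma Z_Z: "Z v * Z w = (if odd_var v \<and> odd_var w then - (Z w * Z v) else Z w * (Z v :: ('k::field, ('m::finite, 'n::finite) expo) oper))"
proof (cases "v = w")
  case True
  have "odd_var v \<Longrightarrow> Z v * Z v = (0 :: ('k, ('m, 'n) expo) oper)"
    by transfer (auto simp: fun_eq_iff)
  then show ?thesis using True by simp
next
  case False
  then have "to_nat v \<noteq> to_nat w" by simp
  then have lt: "to_nat v < to_nat w \<longleftrightarrow> \<not> to_nat w < to_nat v" by linarith
  have tw: "e(v := a, w := b) = e(w := b, v := a)" for e :: "('m, 'n) expo" and a b
    using False by (rule fun_upd_twist)
  have "app (Z v * Z w) g e = app (if odd_var v \<and> odd_var w then - (Z w * Z v) else Z w * Z v) g e"
    for g and e :: "('m, 'n) expo"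
    using False not_sym[OF False] lt
    by (simp add: times_oper.rep_eq uminus_oper.rep_eq Z.rep_eq var_sign_upd tw)
  then show ?thesis by (intro app_inject[THEN iffD1] ext)
qed

lemma Zinv_Z: "Zinv i * Z (i, i) = (1 :: ('k::field, ('m::finite, 'n::finite) expo) oper)"
  "Z (i, i) * Zinv i = (1 :: ('k::field, ('m::finite, 'n::finite) expo) oper)"
  by (transfer; simp add: fun_eq_iff odd_var_def var_sign_def)+

lemma Zinv_commute:
  assumes "Z (i, i) * T = T * Z (i, i)"
  shows "Zinv i * T = T * (Zinv i :: ('k::field, ('m::finite, 'n::finite) expo) oper)"
proof -
  have "Zinv i * T = Zinv i * (T * Z (i, i)) * Zinv i" by (simp add: mult.assoc Zinv_Z)
  also have "\<dots> = Zinv i * Z (i, i) * T * Zinv i" by (simp add: assms[symmetric] mult.assoc)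
  finally show ?thesis by (simp add: Zinv_Z)
qed

lemma Zinv_Z_commute: "Zinv i * Z v = Z v * (Zinv i :: ('k::field, ('m::finite, 'n::finite) expo) oper)"
  by (rule Zinv_commute) (simp add: Z_Z[of "(i, i)"] odd_var_def)

lemma Zinv_Zinv_commute: "Zinv i * Zinv j = Zinv j * (Zinv i :: ('k::field, ('m::finite, 'n::finite) expo) oper)"
  by (rule Zinv_commute) (simp add: Zinv_Z_commute)

lemma prod_list_commute:
  fixes T :: "'r::monoid_mult"
  assumes "\<And>x. x \<in> set xs \<Longrightarrow> x * T = T * x"
  shows "prod_list xs * T = T * prod_list xs"
  using assms by (induction xs) (simp_all add: mult.assoc, simp add: mult.assoc[symmetric])

lemma prod_list_rev_inverse:
  fixes u z :: "'i \<Rightarrow> 'r::monoid_mult"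
  assumes "\<And>i. u i * z i = 1"
  shows "prod_list (map u (rev xs)) * prod_list (map z xs) = 1"
proof (induction xs)
  case (Cons x xs)
  have "prod_list (map u (rev (x # xs))) * prod_list (map z (x # xs)) =
      prod_list (map u (rev xs)) * (u x * z x) * prod_list (map z xs)" by (simp add: mult.assoc)
  then show ?case using Cons assms by simp
qed simp

text \<open>The generic lower triangular matrix. Its block determinants multiply to the product of
  the diagonal variables; listing their inverses in reverse order lets neighbouring factors cancel
  one after the other.\<close>

fun lower_gen :: "('m::{finite,linorder}, 'n::{finite,linorder}) gen \<Rightarrow> ('k::field, ('m, 'n) expo) oper" where
  "lower_gen (Coord i j) = (if idx_less i j then 0 else Z (i, j))"
| "lower_gen DetInv = prod_list (map Zinv (rev idx_list))"

text \<open>A generic unipotent upper triangular matrix. The factor \<open>Zinv i\<close> is a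
  normalisation: it cancels the diagonal variable in the leading summand of the product with the
  lower matrix, so that this summand is \<open>Z (i, j)\<close>.\<close>

fun upper_gen :: "('m::{finite,linorder}, 'n::{finite,linorder}) gen \<Rightarrow> ('k::field, ('m, 'n) expo) oper" where
  "upper_gen (Coord i j) = (if i = j then 1 else if idx_less i j then Zinv i * Z (i, j) else 0)"
| "upper_gen DetInv = 1"

definition op_hom :: "(('m::{finite,linorder}, 'n::{finite,linorder}) gen \<Rightarrow> ('k::field, 'x) oper) \<Rightarrow>
    (('k, 'm, 'n) KG \<Rightarrow> ('k, 'x) oper) \<Rightarrow> bool" where
  "op_hom h H \<longleftrightarrow> Vector_Spaces.linear kg_scale op_scale H \<and> H 1 = 1 \<and> (\<forall>f g. H (f * g) = H f * H g) \<and>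
     (\<forall>i j. H (coord i j) = h (Coord i j)) \<and> H det_inv = h DetInv"

lemma op_homD:
  assumes "op_hom h H"
  shows "H (f + g) = H f + H g" "H (kg_scale r f) = op_scale r (H f)" "H 1 = 1" "H (f * g) = H f * H g"
    "H (coord i j) = h (Coord i j)" "H det_inv = h DetInv"
  using assms by (simp_all add: op_hom_def Vector_Spaces.linear_iff)

lemma lower_gen_DetInv_commute:
  "lower_gen DetInv * Z v = Z v * (lower_gen DetInv :: ('k::field, ('m::{finite,linorder}, 'n::{finite,linorder}) expo) oper)"
  by (simp, rule prod_list_commute) (auto simp: Zinv_Z_commute)

lemma lower_gen_exists: "\<exists>H. op_hom (lower_gen :: ('m::{finite,linorder}, 'n::{finite,linorder}) gen \<Rightarrow> ('k::field, ('m, 'n) expo) oper) H"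
  unfolding op_hom_def
proof (rule KG_hom_exists[OF vector_space_oper op_scale_mult])
  fix x y :: "('m, 'n) gen"
  show "lower_gen x * lower_gen y = (if gen_parity x \<and> gen_parity y then - (lower_gen y * lower_gen x) else lower_gen y * (lower_gen x :: ('k, ('m, 'n) expo) oper))"
  proof (cases x; cases y)
    fix i j k l assume "x = Coord i j" "y = Coord k l"
    then show ?thesis using Z_Z[of "(i, j)" "(k, l)", where 'k = 'k] by (simp add: odd_var_def)
  next
    fix i j assume "x = Coord i j" "y = DetInv"
    then show ?thesis using lower_gen_DetInv_commute[of "(i, j)", where 'k = 'k] by (simp del: lower_gen.simps(2))
  next
    fix i j assume "y = Coord i j" "x = DetInv"
    then show ?thesis using lower_gen_DetInv_commute[of "(i, j)", where 'k = 'k] by (simp del: lower_gen.simps(2))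
  qed simp
next
  have "pdet (\<lambda>i j. lower_gen (Coord (Inl i) (Inl j))) = (prod_list (map (\<lambda>i. Z (Inl i, Inl i)) (sorted_list_of_set UNIV)) :: ('k, ('m, 'n) expo) oper)"
    by (subst pdet_triangular) simp_all
  moreover have "pdet (\<lambda>i j. lower_gen (Coord (Inr i) (Inr j))) = (prod_list (map (\<lambda>i. Z (Inr i, Inr i)) (sorted_list_of_set UNIV)) :: ('k, ('m, 'n) expo) oper)"
    by (subst pdet_triangular) simp_all
  moreover have "prod_list (map (\<lambda>i. Z (i, i)) idx_list) =
     prod_list (map (\<lambda>i. Z (Inl i, Inl i)) (sorted_list_of_set UNIV)) * (prod_list (map (\<lambda>i. Z (Inr i, Inr i)) (sorted_list_of_set UNIV)) :: ('k, ('m, 'n) expo) oper)"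
    by (simp add: idx_list_def comp_def)
  ultimately show "lower_gen DetInv * (pdet (\<lambda>i j. lower_gen (Coord (Inl i) (Inl j))) * pdet (\<lambda>i j. lower_gen (Coord (Inr i) (Inr j)))) =
      (1 :: ('k, ('m, 'n) expo) oper)"
    using prod_list_rev_inverse[of "Zinv :: 'm + 'n \<Rightarrow> ('k, ('m, 'n) expo) oper" "\<lambda>i. Z (i, i)" idx_list, OF Zinv_Z(1)] by simp
qed

lemma prod_list_ones: "prod_list (map (\<lambda>i. 1 :: 'r::monoid_mult) xs) = 1"
  by (induction xs) simp_all

lemma upper_gen_exists: "\<exists>H. op_hom (upper_gen :: ('m::{finite,linorder}, 'n::{finite,linorder}) gen \<Rightarrow> ('k::field, ('m, 'n) expo) oper) H"
  unfolding op_hom_def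
proof (rule KG_hom_exists[OF vector_space_oper op_scale_mult])
  have ZZ: "Zinv i * Z v * (Zinv j * Z w) = (if odd_var v \<and> odd_var w then - (Zinv j * Z w * (Zinv i * Z v)) else Zinv j * Z w * (Zinv i * (Z v :: ('k, ('m, 'n) expo) oper)))" for i j v w
  proof -
    have "Zinv i * Z v * (Zinv j * Z w) = Zinv i * Zinv j * (Z v * (Z w :: ('k, ('m, 'n) expo) oper))" for i j v w
    proof -
      have "Zinv i * Z v * (Zinv j * Z w) = Zinv i * (Z v * Zinv j) * (Z w :: ('k, ('m, 'n) expo) oper)" by (simp add: mult.assoc)
      also have "\<dots> = Zinv i * (Zinv j * Z v) * Z w" by (simp only: Zinv_Z_commute)
      finally show ?thesis by (simp add: mult.assoc)
    qed
    note eq = this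
    show ?thesis unfolding eq by (subst Zinv_Zinv_commute[of i j], subst Z_Z[of v w], simp)
  qed
  fix x y :: "('m, 'n) gen"
  show "upper_gen x * upper_gen y = (if gen_parity x \<and> gen_parity y then - (upper_gen y * upper_gen x) else upper_gen y * (upper_gen x :: ('k, ('m, 'n) expo) oper))"
  proof (cases x; cases y)
    fix i j k l assume xy: "x = Coord i j" "y = Coord k l"
    consider "i = j" | "k = l" | "i \<noteq> j" "k \<noteq> l" by blast
    then show ?thesis
    proof cases
      case 3
      then show ?thesis using ZZ[of i "(i, j)" k "(k, l)"] xy by (simp add: odd_var_def)
    qed (simp_all add: xy)
  qed simp_all
next
  have "pdet (\<lambda>i j. upper_gen (Coord (Inl i) (Inl j))) = (1 :: ('k, ('m, 'n) expo) oper)"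
    by (subst pdet_triangular) (auto simp: prod_list_ones)
  moreover have "pdet (\<lambda>i j. upper_gen (Coord (Inr i) (Inr j))) = (1 :: ('k, ('m, 'n) expo) oper)"
    by (subst pdet_triangular) (auto simp: prod_list_ones)
  ultimately show "upper_gen DetInv * (pdet (\<lambda>i j. upper_gen (Coord (Inl i) (Inl j))) * pdet (\<lambda>i j. upper_gen (Coord (Inr i) (Inr j)))) =
      (1 :: ('k, ('m, 'n) expo) oper)" by simp
qed

definition piL :: "('k::field, 'm::{finite,linorder}, 'n::{finite,linorder}) KG \<Rightarrow> ('k, ('m, 'n) expo) oper" where
  "piL = (SOME H. op_hom lower_gen H)"

definition piU :: "('k::field, 'm::{finite,linorder}, 'n::{finite,linorder}) KG \<Rightarrow> ('k, ('m, 'n) expo) oper" where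
  "piU = (SOME H. op_hom upper_gen H)"

lemmas piL = op_homD[OF someI_ex[OF lower_gen_exists, folded piL_def]]
lemmas piU = op_homD[OF someI_ex[OF upper_gen_exists, folded piU_def]]

text \<open>Composed with \<open>comult\<close>, this is the restriction of functions on G to
  products of a lower triangular and a unipotent upper triangular matrix.\<close>

definition piLU :: "('k::field, 'm::{finite,linorder}, 'n::{finite,linorder}) KG2 \<Rightarrow> ('k, ('m, 'n) expo) oper" where
  "piLU = tensor_lift op_scale (\<lambda>a b. piL a * piU b)"

lemma
  shows piLU_tensor: "piLU (tensor a b) = piL a * piU b"
    and piLU_add: "piLU (x + y) = piLU x + piLU y"
    and piLU_scale: "piLU (tensor_scale r x) = op_scale r (piLU x)"
proof -
  have "bilinear_map op_scale (\<lambda>a b. piL a * piU b)"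
    by (rule bilinear_mapI[OF vector_space_oper]) (simp_all add: piL piU op_scale_mult algebra_simps)
  note b = vector_space_oper this
  show "piLU (tensor a b) = piL a * piU b" "piLU (x + y) = piLU x + piLU y"
    "piLU (tensor_scale r x) = op_scale r (piLU x)"
    unfolding piLU_def by (rule tensor_lift_tensor[OF b] tensor_lift_add[OF b] tensor_lift_scale[OF b])+
qed

lemma piLU_0: "piLU 0 = 0"
  using piLU_scale[of 0 0] by simp

text \<open>The propagation of \<open>supercomm_generators\<close>, repeated inside the operator
  ring, because an entry of the upper matrix has to be moved past all values of
  \<open>piL\<close>.\<close>

lemma piL_supercomm:
  fixes g :: "('k::field, 'm::{finite,linorder}, 'n::{finite,linorder}) KG"
  assumes step: "\<And>k l. x * piL (coord k l) = op_scale (koszul p (isl k \<noteq> isl l)) (piL (coord k l) * x)" "x * piL det_inv = piL det_inv * x"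
    and "parity q g"
  shows "x * piL g = op_scale (koszul p q) (piL g * x)"
proof -
  interpret V: vector_space op_scale by (rule vector_space_oper)
  have "\<forall>q. x * piL (part q g) = op_scale (koszul p q) (piL (part q g) * x)"
  proof (induction g rule: KG_span_induct)
    case one
    have "piL (0 :: ('k, 'm, 'n) KG) = 0" using piL(2)[of 0 "0 :: ('k, 'm, 'n) KG"] V.scale_zero_left by simp
    then show ?case by (auto simp: part_1 koszul_def piL(3))
  next
    case (add f g)
    then show ?case by (simp add: part_add distrib_left distrib_right V.scale_right_distrib piL(1))
  next
    case (scale r f)
    then show ?case by (simp add: part_scale piL(2) op_scale_mult mult.commute)
  next
    case (coord i j f)
    show ?case
    proof
      fix q
      let ?c = "piL (coord i j)" let ?p = "isl i \<noteq> isl j" let ?f = "piL (part (q \<noteq> ?p) f)"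
      have "x * piL (part q (coord i j * f)) = x * ?c * ?f"
        by (simp add: part_coord_mult mult.assoc piL(4))
      also have "\<dots> = op_scale (koszul p ?p) (?c * (x * ?f))"
        by (simp only: step op_scale_mult mult.assoc)
      also have "\<dots> = op_scale (koszul p ?p * koszul p (q \<noteq> ?p)) (?c * (?f * x))"
        using coord by (simp add: op_scale_mult)
      also have "koszul p ?p * koszul p (q \<noteq> ?p) = koszul p q"
        by (auto simp: koszul_def)
      also have "?c * (?f * x) = piL (part q (coord i j * f)) * x"
        by (simp add: part_coord_mult mult.assoc piL(4))
      finally show "x * piL (part q (coord i j * f)) = op_scale (koszul p q) (piL (part q (coord i j * f)) * x)" .
    qed
  next
    case (det_inv f)
    have "x * (piL det_inv * piL (part q f)) = piL det_inv * (x * piL (part q f))" for q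
      by (simp only: mult.assoc[symmetric] step)
    then show ?case using det_inv by (simp add: part_det_inv_mult op_scale_mult mult.assoc piL(4))
  qed
  then show ?thesis using assms(3) by (metis parity_def)
qed

lemma piU_piL_supercomm:
  fixes g :: "('k::field, 'm::{finite,linorder}, 'n::{finite,linorder}) KG"
  assumes "parity q g"
  shows "piU (coord i j) * piL g = op_scale (koszul (isl i \<noteq> isl j) q) (piL g * piU (coord i j))"
proof (rule piL_supercomm[OF _ _ assms])
  fix k l
  show "piU (coord i j) * piL (coord k l) = op_scale (koszul (isl i \<noteq> isl j) (isl k \<noteq> isl l)) (piL (coord k l) * (piU (coord i j) :: ('k, ('m, 'n) expo) oper))"
  proof (cases "i = j")
    case True
    then show ?thesis by (simp add: piL piU koszul_def)
  next
    case False
    have "Zinv i * Z (i, j) * Z (k, l) = op_scale (koszul (isl i \<noteq> isl j) (isl k \<noteq> isl l)) (Z (k, l) * (Zinv i * (Z (i, j) :: ('k, ('m, 'n) expo) oper)))"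
    proof -
      have "Zinv i * Z (i, j) * Z (k, l) = Zinv i * op_scale (koszul (isl i \<noteq> isl j) (isl k \<noteq> isl l)) (Z (k, l) * (Z (i, j) :: ('k, ('m, 'n) expo) oper))"
        using Z_Z[of "(i, j)" "(k, l)", where 'k = 'k] by (simp add: odd_var_def koszul_def mult.assoc)
      also have "\<dots> = op_scale (koszul (isl i \<noteq> isl j) (isl k \<noteq> isl l)) (Zinv i * Z (k, l) * Z (i, j))"
        by (simp add: op_scale_mult mult.assoc)
      also have "\<dots> = op_scale (koszul (isl i \<noteq> isl j) (isl k \<noteq> isl l)) (Z (k, l) * Zinv i * Z (i, j))"
        by (simp only: Zinv_Z_commute[of i "(k, l)"])
      finally show ?thesis by (simp only: mult.assoc)
    qed
    then show ?thesis using False by (simp add: piL piU)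
  qed
  have "lower_gen DetInv * (Zinv i * Z (i, j)) = Zinv i * Z (i, j) * (lower_gen DetInv :: ('k, ('m, 'n) expo) oper)"
    by (simp, rule prod_list_commute) (auto simp: Zinv_Z_commute Zinv_Zinv_commute mult.assoc[symmetric], simp add: mult.assoc Zinv_Z_commute Zinv_Zinv_commute)
  then show "piU (coord i j) * piL det_inv = piL det_inv * (piU (coord i j) :: ('k, ('m, 'n) expo) oper)"
    by (auto simp: piL piU simp del: lower_gen.simps(2))
qed


section \<open>Density of the big cell\<close>

definition rk :: "'m::{finite,linorder} + 'n::{finite,linorder} \<Rightarrow> nat" where
  "rk i = card {j. idx_less j i}"

lemma idx_less_trans: "idx_less i j \<Longrightarrow> idx_less j k \<Longrightarrow> idx_less i k"
  by (cases i; cases j; cases k) auto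

lemma idx_less_irrefl [simp]: "\<not> idx_less i i"
  by (cases i) auto

lemma idx_less_linear: "idx_less i j \<or> i = j \<or> idx_less j i"
  by (cases i; cases j) auto

lemma idx_less_asym: "idx_less i j \<Longrightarrow> \<not> idx_less j i"
  using idx_less_trans idx_less_irrefl by blast

lemma rk_less: "idx_less i j \<Longrightarrow> rk i < rk j"
  unfolding rk_def
proof (rule psubset_card_mono)
  assume ij: "idx_less i j"
  have "i \<in> {k. idx_less k j}" "i \<notin> {k. idx_less k i}" using ij by simp_all
  moreover have "{k. idx_less k i} \<subseteq> {k. idx_less k j}" using idx_less_trans[OF _ ij] by blast
  ultimately show "{k. idx_less k i} \<subset> {k. idx_less k j}" by blast
qed simp

text \<open>The weights rk(i) rk(j) are chosen so that, for k below both i and j, the inequality (rk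
  i - rk k)(rk j - rk k) > 0 makes the variable (i, j) heavier than the correction term with
  exponents (i, k) - (k, k) + (k, j).\<close>

definition expo_weight :: "('m::{finite,linorder}, 'n::{finite,linorder}) expo \<Rightarrow> int" where
  "expo_weight e = (\<Sum>v\<in>UNIV. int (rk (fst v) * rk (snd v)) * e v)"

lemma expo_weight_diff: "expo_weight (\<lambda>v. e v - d v) = expo_weight e - expo_weight d"
  by (simp add: expo_weight_def right_diff_distrib sum_subtractf)

definition shift_by :: "('m, 'n) expo \<Rightarrow> ('k::field, ('m, 'n) expo) oper \<Rightarrow> bool" where
  "shift_by d T \<longleftrightarrow> (\<forall>g e. \<exists>s. app T g e = s * g (\<lambda>v. e v - d v))"

lemma shift_by_mult: "shift_by d T \<Longrightarrow> shift_by d' T' \<Longrightarrow> shift_by (\<lambda>v. d v + d' v) (T * T')"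
  unfolding shift_by_def app_simps
proof (intro allI)
  fix g e
  assume 1: "\<forall>g e. \<exists>s. app T g e = s * g (\<lambda>v. e v - d v)" and 2: "\<forall>g e. \<exists>s. app T' g e = s * g (\<lambda>v. e v - d' v)"
  obtain s where "app T (app T' g) e = s * app T' g (\<lambda>v. e v - d v)" using 1 by blast
  moreover obtain s' where "app T' g (\<lambda>v. e v - d v) = s' * g (\<lambda>v. (\<lambda>v. e v - d v) v - d' v)" using 2 by blast
  ultimately show "\<exists>s. app T (app T' g) e = s * g (\<lambda>v. e v - (d v + d' v))"
    by (intro exI[of _ "s * s'"]) (simp add: diff_diff_eq)
qed

lemma shift_by_Z: "shift_by (\<lambda>w. if w = v then 1 else 0) (Z v)"
  unfolding shift_by_def
proof (intro allI)
  fix g :: "('a, 'b) expo \<Rightarrow> 'c" and e :: "('a, 'b) expo"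
  have "e(v := e v - 1) = (\<lambda>w. e w - (if w = v then 1 else 0))" by (simp add: fun_eq_iff)
  then show "\<exists>s. app (Z v) g e = s * g (\<lambda>w. e w - (if w = v then 1 else 0))"
    by (intro exI[of _ "if odd_var v \<and> e v \<noteq> 1 then 0 else var_sign v e"]) (simp add: Z.rep_eq)
qed

lemma shift_by_Zinv: "shift_by (\<lambda>w. if w = (i, i) then - 1 else 0) (Zinv i)"
  unfolding shift_by_def
proof (intro allI)
  fix g :: "('a, 'b) expo \<Rightarrow> 'c" and e :: "('a, 'b) expo"
  have "e((i, i) := e (i, i) + 1) = (\<lambda>w. e w - (if w = (i, i) then - 1 else 0))" by (simp add: fun_eq_iff)
  then show "\<exists>s. app (Zinv i) g e = s * g (\<lambda>w. e w - (if w = (i, i) then - 1 else 0))"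
    by (intro exI[of _ 1]) (simp add: Zinv.rep_eq)
qed

definition lu_entry :: "('m::{finite,linorder} + 'n::{finite,linorder}) \<times> ('m + 'n) \<Rightarrow> ('k::field, ('m, 'n) expo) oper" where
  "lu_entry v = (\<Sum>k\<in>UNIV. piL (coord (fst v) k) * piU (coord k (snd v)))"

text \<open>The summand whose middle index is the smaller of i and j gives \<open>Z (i, j)\<close>
  by the normalisation of \<open>upper_gen\<close>; larger middle indices are excluded by
  triangularity.\<close>

lemma lu_entry_eq:
  "lu_entry (i, j) = Z (i, j) + (\<Sum>k | idx_less k i \<and> idx_less k j. Z (i, k) * (Zinv k * Z (k, j)))"
proof -
  define m where "m = (if idx_less i j then i else j)"
  have t: "piL (coord i m) * piU (coord m j) = Z (i, j)"
    by (auto simp: m_def piL piU mult.assoc[symmetric] Zinv_Z(2))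
  have "lu_entry (i, j) = piL (coord i m) * piU (coord m j) + (\<Sum>k\<in>UNIV - {m}. piL (coord i k) * piU (coord k j))"
    unfolding lu_entry_def by (simp add: sum.remove[of UNIV m])
  also have "(\<Sum>k\<in>UNIV - {m}. piL (coord i k) * piU (coord k j)) = (\<Sum>k | idx_less k i \<and> idx_less k j. piL (coord i k) * piU (coord k j))"
  proof (rule sum.mono_neutral_right)
    show "{k. idx_less k i \<and> idx_less k j} \<subseteq> UNIV - {m}" by (auto simp: m_def)
    show "\<forall>k\<in>UNIV - {m} - {k. idx_less k i \<and> idx_less k j}. piL (coord i k) * piU (coord k j) = 0"
    proof
      fix k assume k: "k \<in> UNIV - {m} - {k. idx_less k i \<and> idx_less k j}"
      show "piL (coord i k) * piU (coord k j) = 0"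
      proof (cases "idx_less i k")
        case False
        have "k \<noteq> j" "\<not> idx_less k j"
          using k False idx_less_linear[of i k] idx_less_linear[of k j] idx_less_linear[of i j] by (auto simp: m_def split: if_splits)
        then show ?thesis by (simp add: piU)
      qed (simp add: piL)
    qed
  qed simp
  also have "\<dots> = (\<Sum>k | idx_less k i \<and> idx_less k j. Z (i, k) * (Zinv k * Z (k, j)))"
    by (rule sum.cong) (auto simp: piL piU dest: idx_less_asym)
  finally show ?thesis by (simp add: t)
qed

text \<open>Other exponents of the same weight are excluded too, so \<open>E\<close> is the only top
  exponent even though \<open>expo_weight\<close> does not separate exponents.\<close>

definition leads :: "('m::{finite,linorder}, 'n::{finite,linorder}) expo \<Rightarrow> 'k \<Rightarrow> (('m, 'n) expo \<Rightarrow> 'k::field) \<Rightarrow> bool" where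
  "leads E c g \<longleftrightarrow> g E = c \<and> (\<forall>e. e \<noteq> E \<longrightarrow> expo_weight E \<le> expo_weight e \<longrightarrow> g e = 0)"

text \<open>\<open>Z v\<close> shifts the top exponent and multiplies the top coefficient by a sign;
  all corrections shift by exponents of smaller weight and stay below. For odd \<open>v\<close> the
  variable must be absent before, since its square is zero.\<close>

lemma leads_lu_entry:
  fixes g :: "('b::{finite,linorder}, 'c::{finite,linorder}) expo \<Rightarrow> 'a::field"
  assumes g: "leads E c g" "c \<noteq> 0" and v: "odd_var v \<Longrightarrow> E v = 0"
  shows "\<exists>c'. c' \<noteq> 0 \<and> leads (E(v := E v + 1)) c' (app (lu_entry v) g)"
proof -
  obtain i j where ij: "v = (i, j)" by (cases v)
  let ?E = "E(v := E v + 1)"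
  have upd: "expo_weight (e(v := e v + x)) = expo_weight e + int (rk i * rk j) * x" for e x
  proof -
    have "e(v := e v + x) = (\<lambda>w. e w - (if w = v then - x else 0))" by auto
    then show ?thesis by (simp only: expo_weight_diff) (simp add: expo_weight_def ij if_distrib cong: if_cong)
  qed
  have low: "app (Z (i, k) * (Zinv k * Z (k, j))) g e = 0"
    if k: "idx_less k i" "idx_less k j" and e: "expo_weight ?E \<le> expo_weight e" for k e
  proof -
    define d where "d = (\<lambda>w. (if w = (i, k) then 1 else 0) + ((if w = (k, k) then - 1 else 0) + (if w = (k, j) then 1 else 0) :: int))"
    have "shift_by d (Z (i, k) * (Zinv k * (Z (k, j) :: ('a, ('b, 'c) expo) oper)))"
      unfolding d_def by (intro shift_by_mult shift_by_Z shift_by_Zinv)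
    then obtain s where s: "app (Z (i, k) * (Zinv k * Z (k, j))) g e = s * g (\<lambda>v. e v - d v)"
      unfolding shift_by_def by blast
    have "expo_weight d = int (rk i * rk k) - int (rk k * rk k) + int (rk k * rk j)"
      unfolding expo_weight_def d_def distrib_left sum.distrib by (simp add: if_distrib cong: if_cong)
    also have "\<dots> < int (rk i * rk j)"
    proof -
      have "0 < (int (rk i) - int (rk k)) * (int (rk j) - int (rk k))"
        using rk_less[OF k(1)] rk_less[OF k(2)] by simp
      then show ?thesis by (simp add: algebra_simps)
    qed
    finally have "expo_weight E < expo_weight (\<lambda>v. e v - d v)"
      using e upd[of E 1] by (simp add: expo_weight_diff)
    then have "g (\<lambda>v. e v - d v) = 0" using g(1) by (auto simp: leads_def)
    then show ?thesis using s by simp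
  qed
  have val: "app (lu_entry v) g e = app (Z v) g e" if "expo_weight ?E \<le> expo_weight e" for e
    using low[OF _ _ that] by (simp add: ij lu_entry_eq app_simps(3) app_sum)
  have "app (Z v) g ?E = var_sign v ?E * c" using g(1) v by (auto simp: Z.rep_eq leads_def)
  then have 1: "app (lu_entry v) g ?E = var_sign v ?E * c" by (simp add: val)
  have 2: "app (lu_entry v) g e = 0" if e: "e \<noteq> ?E" "expo_weight ?E \<le> expo_weight e" for e
  proof -
    have "g (e(v := e v - 1)) = 0"
    proof -
      have "e(v := e v - 1) \<noteq> E" using e(1) by auto
      moreover have "expo_weight E \<le> expo_weight (e(v := e v - 1))"
        using e(2) upd[of E 1] upd[of e "- 1"] by simp
      ultimately show ?thesis using g(1) by (simp add: leads_def)
    qed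
    then show ?thesis by (simp add: val[OF e(2)] Z.rep_eq)
  qed
  show ?thesis
    by (intro exI[of _ "var_sign v ?E * c"] conjI) (use g(2) 1 2 in \<open>auto simp: var_sign_def leads_def\<close>)
qed

lemma leads_lu_entry_power:
  assumes "leads E c g" "c \<noteq> 0" and "odd_var v \<Longrightarrow> E v = 0 \<and> n \<le> 1"
  shows "\<exists>c'. c' \<noteq> 0 \<and> leads (E(v := E v + int n)) c' (app (lu_entry v ^ n) g)"
  using assms(3)
proof (induction n)
  case 0
  then show ?case using assms by (auto simp: app_simps)
next
  case (Suc n)
  have "\<exists>c'. c' \<noteq> 0 \<and> leads (E(v := E v + int n)) c' (app (lu_entry v ^ n) g)"
    by (rule Suc.IH) (use Suc.prems in auto)
  then obtain c' where c: "c' \<noteq> 0" "leads (E(v := E v + int n)) c' (app (lu_entry v ^ n) g)" by blast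
  have "\<exists>c''. c'' \<noteq> 0 \<and> leads ((E(v := E v + int n))(v := (E(v := E v + int n)) v + 1)) c'' (app (lu_entry v) (app (lu_entry v ^ n) g))"
    by (rule leads_lu_entry[OF c(2,1)]) (use Suc.prems in auto)
  moreover have "(E(v := E v + int n))(v := (E(v := E v + int n)) v + 1) = E(v := E v + int (Suc n))" by auto
  ultimately show ?case by (simp only: app_simps power_Suc)
qed

text \<open>The variables are applied one after the other. Distinctness ensures that the exponent of
  each is still 0 when its turn comes, as odd variables require.\<close>

lemma leads_monomial:
  assumes "distinct vs" "leads (\<lambda>_. 0) c g" "c \<noteq> 0" and adm: "\<And>v. odd_var v \<Longrightarrow> E v \<le> 1"
  shows "\<exists>c'. c' \<noteq> 0 \<and> leads (\<lambda>v. if v \<in> set vs then int (E v) else 0) c' (app (prod_list (map (\<lambda>v. lu_entry v ^ E v) vs)) g)"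
  using assms(1)
proof (induction vs)
  case Nil
  then show ?case using assms by (auto simp: app_simps)
next
  case (Cons v vs)
  let ?E = "\<lambda>v. if v \<in> set vs then int (E v) else 0"
  obtain c' where c: "c' \<noteq> 0" "leads ?E c' (app (prod_list (map (\<lambda>v. lu_entry v ^ E v) vs)) g)" using Cons by auto
  have "\<exists>c''. c'' \<noteq> 0 \<and> leads (?E(v := ?E v + int (E v))) c'' (app (lu_entry v ^ E v) (app (prod_list (map (\<lambda>v. lu_entry v ^ E v) vs)) g))"
    by (rule leads_lu_entry_power[OF c(2,1)]) (use adm Cons.prems in auto)
  moreover have "?E(v := ?E v + int (E v)) = (\<lambda>w. if w \<in> set (v # vs) then int (E w) else 0)"
    using Cons.prems by auto
  ultimately show ?case by (simp add: app_simps)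
qed

subsection \<open>Ordered monomials\<close>

abbreviation cvar :: "('m + 'n) \<times> ('m + 'n) \<Rightarrow> ('k::field, 'm::{finite,linorder}, 'n::{finite,linorder}) KG" where
  "cvar v \<equiv> coord (fst v) (snd v)"

definition monl :: "(('m + 'n) \<times> ('m + 'n)) list \<Rightarrow> (('m + 'n) \<times> ('m + 'n) \<Rightarrow> nat) \<Rightarrow> ('k::field, 'm::{finite,linorder}, 'n::{finite,linorder}) KG" where
  "monl vs E = prod_list (map (\<lambda>v. cvar v ^ E v) vs)"

lemma parity_cvar: "parity (odd_var v) (cvar v)"
  using parity_coord[of "fst v" "snd v"] by (simp add: odd_var_def)

text \<open>Moving the new factor to its place in the list costs only signs, because powers of
  coordinates are homogeneous.\<close>

lemma cvar_monl:
  fixes vs :: "(('b::{finite,linorder} + 'c::{finite,linorder}) \<times> ('b + 'c)) list"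
  assumes "distinct vs" "v \<in> set vs"
  shows "\<exists>c. cvar v * monl vs E = kg_scale c (monl vs (E(v := Suc (E v))) :: ('a::field, 'b, 'c) KG)"
  using assms
proof (induction vs)
  case (Cons u vs)
  show ?case
  proof (cases "u = v")
    case True
    then have "prod_list (map (\<lambda>w. cvar w ^ (E(v := Suc (E v))) w) vs) = (prod_list (map (\<lambda>w. cvar w ^ E w) vs) :: ('a, 'b, 'c) KG)"
      using Cons.prems by (intro arg_cong[of _ _ prod_list] map_cong) auto
    then have "cvar v * monl (u # vs) E = (kg_scale 1 (monl (u # vs) (E(v := Suc (E v)))) :: ('a, 'b, 'c) KG)"
      using True by (simp add: monl_def mult.assoc)
    then show ?thesis by blast
  next
    case False
    have "\<exists>c. cvar v * monl vs E = kg_scale c (monl vs (E(v := Suc (E v))) :: ('a, 'b, 'c) KG)"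
      by (rule Cons.IH) (use Cons.prems False in auto)
    then obtain c where c: "cvar v * monl vs E = kg_scale c (monl vs (E(v := Suc (E v))) :: ('a, 'b, 'c) KG)" by blast
    have "\<exists>q. parity q (cvar u ^ n :: ('a, 'b, 'c) KG)" for n
    proof (induction n)
      case (Suc n)
      then obtain q where "parity q (cvar u ^ n :: ('a, 'b, 'c) KG)" by blast
      from parity_mult[OF parity_cvar this] show ?case unfolding power_Suc by blast
    qed (use parity_1 in auto)
    then obtain q where q: "parity q (cvar u ^ E u :: ('a, 'b, 'c) KG)" by blast
    have "cvar v * monl (u # vs) E = cvar v * cvar u ^ E u * (monl vs E :: ('a, 'b, 'c) KG)" by (simp add: monl_def mult.assoc)
    also have "\<dots> = kg_scale (koszul (odd_var v) q) (cvar u ^ E u * (cvar v * monl vs E))"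
      by (simp only: supercomm[OF parity_cvar q] kg_scale_mult) (simp only: mult.assoc)
    also have "\<dots> = kg_scale (koszul (odd_var v) q * c) (monl (u # vs) (E(v := Suc (E v))))"
      using False by (simp add: c kg_scale_mult) (simp add: monl_def)
    finally show ?thesis by blast
  qed
qed simp

definition adm :: "(('m + 'n) \<times> ('m + 'n) \<Rightarrow> nat) set" where
  "adm = {E. \<forall>v. odd_var v \<longrightarrow> E v \<le> 1}"

definition coord_polys :: "(('m + 'n) \<times> ('m + 'n)) list \<Rightarrow> ('k::field, 'm::{finite,linorder}, 'n::{finite,linorder}) KG set" where
  "coord_polys vs = KG.span (monl vs ` adm)"

lemma monl_not_adm:
  fixes vs :: "(('m::{finite,linorder} + 'n::{finite,linorder}) \<times> ('m + 'n)) list"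
  assumes "CHAR('k::field) \<noteq> 2" "v \<in> set vs" "odd_var v" "2 \<le> E v"
  shows "monl vs E = (0 :: ('k, 'm, 'n) KG)"
proof -
  obtain c where c: "E v = Suc (Suc c)" using assms(4) by (intro that[of "E v - 2"]) simp
  have "cvar v ^ E v = cvar v * cvar v * (cvar v ^ c :: ('k, 'm, 'n) KG)"
    by (simp add: c mult.assoc)
  also have "\<dots> = 0"
  proof -
    have "parity (odd_var v) (cvar v :: ('k, 'm, 'n) KG)" by (rule parity_cvar)
    then have "parity True (cvar v :: ('k, 'm, 'n) KG)" using assms(3) by simp
    from odd_square[OF assms(1) this] show ?thesis by simp
  qed
  finally have "cvar v ^ E v = (0 :: ('k, 'm, 'n) KG)" .
  then show ?thesis unfolding monl_def using assms(2) by (induction vs) auto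
qed

context
  assumes char: "CHAR('k::field) > 2"
begin

lemma coord_polys_coord:
  fixes vs :: "(('m::{finite,linorder} + 'n::{finite,linorder}) \<times> ('m + 'n)) list"
  assumes vs: "distinct vs" "set vs = UNIV"
  shows "f \<in> coord_polys vs \<Longrightarrow> coord i j * f \<in> (coord_polys vs :: ('k, 'm, 'n) KG set)"
  unfolding coord_polys_def
proof (induction rule: KG.span_induct_alt)
  case (step c x y)
  then obtain E where E: "E \<in> adm" "x = monl vs E" by blast
  obtain c' where c: "cvar (i, j) * monl vs E = kg_scale c' (monl vs (E((i, j) := Suc (E (i, j)))) :: ('k, 'm, 'n) KG)"
    using cvar_monl[OF vs(1)] vs(2) by blast
  have "monl vs (E((i, j) := Suc (E (i, j)))) \<in> KG.span (monl vs ` adm :: ('k, 'm, 'n) KG set)"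
  proof (cases "E((i, j) := Suc (E (i, j))) \<in> adm")
    case False
    then have o: "odd_var (i, j)" "2 \<le> Suc (E (i, j))" using E(1) by (auto simp: adm_def split: if_splits)
    have "monl vs (E((i, j) := Suc (E (i, j)))) = (0 :: ('k, 'm, 'n) KG)"
      by (rule monl_not_adm[of "(i, j)"]) (use o char vs in auto)
    then show ?thesis by (simp add: KG.span_zero)
  qed (auto intro: KG.span_base)
  then have "coord i j * x \<in> KG.span (monl vs ` adm)" using c E(2) by (simp add: KG.span_scale)
  then show ?case using step by (simp add: distrib_left kg_scale_mult KG.span_add KG.span_scale)
qed (simp add: KG.span_zero)

text \<open>Denominators are cleared: each \<open>dinv\<close> is cancelled by one factor kdet^p,
  which is even and hence central.\<close>

lemma coord_polys_localization:
  fixes vs :: "(('m::{finite,linorder} + 'n::{finite,linorder}) \<times> ('m + 'n)) list"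
    and f :: "('k, 'm, 'n) KG"
  assumes vs: "distinct vs" "set vs = UNIV"
  shows "\<exists>N. (kdet ^ CHAR('k)) ^ N * f \<in> coord_polys vs"
proof -
  let ?P = "coord_polys vs :: ('k, 'm, 'n) KG set" and ?D = "kdet ^ CHAR('k) :: ('k, 'm, 'n) KG"
  have padd: "f \<in> ?P \<Longrightarrow> g \<in> ?P \<Longrightarrow> f + g \<in> ?P" and pscale: "f \<in> ?P \<Longrightarrow> kg_scale r f \<in> ?P" for f g r
    by (auto simp: coord_polys_def KG.span_add KG.span_scale)
  have "kdet * f \<in> ?P" if "f \<in> ?P" for f
    by (rule kdet_mult_closed[OF char, of "\<lambda>f. f \<in> ?P"]) (auto intro: padd pscale coord_polys_coord[OF vs] that)
  then have kp: "kdet ^ n * f \<in> ?P" if "f \<in> ?P" for f n using that by (induction n) (simp_all add: mult.assoc)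
  have D: "?D ^ n * f \<in> ?P" if "f \<in> ?P" for f n using kp[OF that, of "CHAR('k) * n"] by (simp add: power_mult)
  have par: "parity False (?D ^ N)" for N by (intro parity_power parity_kdet)
  show ?thesis
  proof (induction f rule: KG_induct[OF char, case_names one add scale coord dinv])
    case one
    have "monl vs (\<lambda>_. 0) \<in> ?P" unfolding coord_polys_def by (intro KG.span_base imageI) (simp add: adm_def)
    moreover have "monl vs (\<lambda>_. 0) = (1 :: ('k, 'm, 'n) KG)" by (simp add: monl_def prod_list_ones)
    ultimately show ?case by (intro exI[of _ 0]) simp
  next
    case (add f g)
    then obtain N M where "?D ^ N * f \<in> ?P" "?D ^ M * g \<in> ?P" by blast
    then have "?D ^ M * (?D ^ N * f) + ?D ^ N * (?D ^ M * g) \<in> ?P" by (intro padd D[of "_ * _"])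
    moreover have "?D ^ M * ?D ^ N = ?D ^ (N + M)" "?D ^ N * ?D ^ M = ?D ^ (N + M)"
      by (simp_all only: power_add[symmetric] add.commute)
    then have "?D ^ M * (?D ^ N * f) + ?D ^ N * (?D ^ M * g) = ?D ^ (N + M) * (f + g)"
      by (simp only: distrib_left mult.assoc[symmetric])
    ultimately show ?case by (intro exI[of _ "N + M"]) simp
  next
    case (scale r f)
    then show ?case using pscale by (auto simp: kg_scale_mult)
  next
    case (coord i j f)
    then obtain N where "?D ^ N * f \<in> ?P" by blast
    then have "coord i j * (?D ^ N * f) \<in> ?P" by (rule coord_polys_coord[OF vs])
    moreover have "?D ^ N * (coord i j * f) = coord i j * (?D ^ N * f)"
      by (simp only: mult.assoc[symmetric] even_central[OF par, of N "coord i j"])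
    ultimately have "?D ^ N * (coord i j * f) \<in> ?P" by simp
    then show ?case by blast
  next
    case (dinv f)
    then obtain N where N: "?D ^ N * f \<in> ?P" by blast
    have "?D ^ Suc N * (dinv * f) = ?D ^ N * (dinv * ?D) * f"
      unfolding even_central[OF parity_dinv[OF char], of ?D] by (simp only: power_Suc2 mult.assoc)
    then have "?D ^ Suc N * (dinv * f) \<in> ?P" using N dinv_kdet[OF char, where 'm = 'm and 'n = 'n] by simp
    then show ?case by blast
  qed
qed

text \<open>Multiplicativity on one coordinate at a time: the Koszul sign in the product of tensors
  is the one created when an entry of the upper matrix passes a value of \<open>piL\<close>.\<close>

lemma piLU_coord:
  fixes f :: "('k, 'm::{finite,linorder}, 'n::{finite,linorder}) KG"
  shows "piLU (comult (coord i j * f)) = lu_entry (i, j) * piLU (comult f)"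
proof -
  have t: "piLU (tensor (coord i k) (coord k j) * x) = piL (coord i k) * piU (coord k j) * piLU x" for k and x :: "('k, 'm, 'n) KG2"
  proof (induction x rule: KG2_induct)
    case (tensor c d q r)
    let ?p = "isl k \<noteq> isl j"
    have "piL (coord i k) * piU (coord k j) * (piL c * piU d) = piL (coord i k) * (piU (coord k j) * piL c) * piU d" by (simp add: mult.assoc)
    also have "\<dots> = op_scale (koszul ?p q) (piL (coord i k) * piL c * (piU (coord k j) * piU d))"
      by (simp only: piU_piL_supercomm[OF tensor(1)] op_scale_mult mult.assoc)
    finally show ?case
      by (simp add: tensor_times_tensor[OF parity_coord tensor(1)] piLU_scale piLU_tensor piL(4) piU(4))
  qed (simp_all add: distrib_left piLU_add)
  have sum: "piLU (sum F A) = (\<Sum>x\<in>A. piLU (F x))" for F :: "'m + 'n \<Rightarrow> ('k, 'm, 'n) KG2" and A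
    by (induction A rule: infinite_finite_induct) (simp_all add: piLU_add piLU_0)
  show ?thesis by (simp add: comult_coord_mult[OF char] sum t lu_entry_def sum_distrib_right)
qed

lemma piU_dinv: "piU (dinv :: ('k, 'm::{finite,linorder}, 'n::{finite,linorder}) KG) = 1"
proof -
  have "piU (det_inv ^ n :: ('k, 'm, 'n) KG) = 1" for n by (induction n) (simp_all add: piU)
  then show ?thesis by (simp add: dinv_def)
qed

lemma piLU_dinv:
  fixes f :: "('k, 'm::{finite,linorder}, 'n::{finite,linorder}) KG"
  shows "piLU (comult (dinv * f)) = piL dinv * piLU (comult f)"
proof -
  have "piLU (tensor dinv dinv * x) = piL dinv * piLU x" for x :: "('k, 'm, 'n) KG2"
    by (induction x rule: KG2_tensor_induct)
      (simp_all add: tensor_times_even[OF disjI1[OF parity_dinv[OF char]]] piLU_tensor piL(4) piU(4) piU_dinv distrib_left piLU_add mult.assoc)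
  then show ?thesis by (simp add: comult_mult[OF char] comult_dinv[OF char])
qed

lemma piLU_monl:
  "piLU (comult (monl vs E :: ('k, 'm::{finite,linorder}, 'n::{finite,linorder}) KG)) = prod_list (map (\<lambda>v. lu_entry v ^ E v) vs)"
proof (induction vs)
  case Nil
  then show ?case by (simp add: monl_def comult_1[OF char] one_KG2_def piLU_tensor piL piU)
next
  case (Cons v vs)
  have "piLU (comult (cvar v ^ n * f)) = lu_entry v ^ n * piLU (comult f)" for n and f :: "('k, 'm, 'n) KG"
    by (induction n) (simp_all add: mult.assoc piLU_coord)
  then show ?case using Cons by (simp add: monl_def)
qed

text \<open>The multiplication map from the product of the opposite Borel subsupergroups is dominant.\<close>

theorem big_cell_dense:
  fixes f :: "('k, 'm::{finite,linorder}, 'n::{finite,linorder}) KG"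
  assumes "piLU (comult f) = 0"
  shows "f = 0"
proof -
  obtain vs :: "(('m + 'n) \<times> ('m + 'n)) list" where vs: "distinct vs" "set vs = UNIV"
    using finite_distinct_list[OF finite] by blast
  have piLU_add': "piLU (comult (f + g)) = piLU (comult f) + piLU (comult g)" and
    piLU_scale': "piLU (comult (kg_scale r f)) = op_scale r (piLU (comult f))" for f g :: "('k, 'm, 'n) KG" and r
    by (simp_all add: comult_add[OF char] comult_scale[OF char] piLU_add piLU_scale)
  have poly: "g = 0" if g: "g \<in> coord_polys vs" "piLU (comult g) = 0" for g :: "('k, 'm, 'n) KG"
  proof (rule ccontr)
    assume ne: "g \<noteq> 0"
    obtain t r where t: "finite t" "t \<subseteq> monl vs ` adm" "g = (\<Sum>x\<in>t. kg_scale (r x) x)"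
      using g(1) unfolding coord_polys_def KG.span_explicit by blast
    obtain F where F: "F \<subseteq> adm" "inj_on (monl vs :: _ \<Rightarrow> ('k, 'm, 'n) KG) F" "t = monl vs ` F"
      using t(2) unfolding subset_image_inj by blast
    have finF: "finite F" using t(1) F by (simp add: finite_image_iff)
    have g_eq: "g = (\<Sum>E\<in>F. kg_scale (r (monl vs E)) (monl vs E))"
      using t(3) F(2,3) by (simp add: sum.reindex)
    define F' where "F' = {E \<in> F. r (monl vs E) \<noteq> 0}"
    have "F' \<noteq> {}"
    proof
      assume "F' = {}"
      then have "g = 0" unfolding g_eq by (intro sum.neutral) (auto simp: F'_def)
      then show False using ne by simp
    qed
    moreover have finF': "finite F'" using finF by (simp add: F'_def)
    ultimately have "Max ((\<lambda>E. expo_weight (int \<circ> E)) ` F') \<in> (\<lambda>E. expo_weight (int \<circ> E)) ` F'"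
      by (intro Max_in) auto
    then obtain E0 where E0: "E0 \<in> F'" "expo_weight (int \<circ> E0) = Max ((\<lambda>E. expo_weight (int \<circ> E)) ` F')" by force
    have max: "expo_weight (int \<circ> E) \<le> expo_weight (int \<circ> E0)" if "E \<in> F'" for E
      unfolding E0(2) using finF' that by (intro Max_ge) auto
    \<comment> \<open>Applied to the indicator of the zero exponent, an operator displays its
      expansion in monomials. \<open>E0\<close> has maximal weight among the exponents with nonzero
      coefficient, so at \<open>E0\<close> the contributions of all the others vanish.\<close>
    let ?vac = "\<lambda>e :: ('m, 'n) expo. if e = (\<lambda>_. 0) then 1 else (0 :: 'k)"
    let ?T = "\<lambda>E. prod_list (map (\<lambda>v. lu_entry v ^ E v) vs) :: ('k, ('m, 'n) expo) oper"
    have lead: "\<exists>c. c \<noteq> 0 \<and> leads (int \<circ> E) c (app (?T E) ?vac)" if "E \<in> F" for E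
    proof -
      have "leads (\<lambda>_. 0) 1 ?vac" by (simp add: leads_def)
      moreover have "odd_var v \<Longrightarrow> E v \<le> 1" for v using subsetD[OF F(1) that] by (simp add: adm_def del: split_paired_All)
      ultimately show ?thesis using leads_monomial[OF vs(1), of 1 ?vac E] vs(2) by (simp add: comp_def)
    qed
    have "piLU (comult (sum G A)) = (\<Sum>x\<in>A. piLU (comult (G x)))" for G :: "_ \<Rightarrow> ('k, 'm, 'n) KG" and A :: "(('m + 'n) \<times> ('m + 'n) \<Rightarrow> nat) set"
      using piLU_scale'[of 0 0] by (induction A rule: infinite_finite_induct) (simp_all add: piLU_add')
    then have "0 = app (\<Sum>E\<in>F. op_scale (r (monl vs E)) (?T E)) ?vac (int \<circ> E0)"
      using g(2) by (simp add: g_eq piLU_scale' piLU_monl app_simps)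
    also have "\<dots> = (\<Sum>E\<in>F. r (monl vs E) * app (?T E) ?vac (int \<circ> E0))"
      by (simp add: app_sum app_simps)
    also have "\<dots> = (\<Sum>E\<in>{E0}. r (monl vs E) * app (?T E) ?vac (int \<circ> E0))"
    proof (rule sum.mono_neutral_right[OF finF])
      show "{E0} \<subseteq> F" using E0(1) by (simp add: F'_def)
      show "\<forall>E\<in>F - {E0}. r (monl vs E) * app (?T E) ?vac (int \<circ> E0) = 0"
      proof
        fix E assume E: "E \<in> F - {E0}"
        show "r (monl vs E) * app (?T E) ?vac (int \<circ> E0) = 0"
        proof (cases "r (monl vs E) = 0")
          case False
          then have "expo_weight (int \<circ> E) \<le> expo_weight (int \<circ> E0)" using E by (intro max) (simp add: F'_def)
          moreover have "int \<circ> E0 \<noteq> int \<circ> E"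
          proof
            assume eq: "int \<circ> E0 = int \<circ> E"
            have "E0 v = E v" for v using fun_cong[OF eq, of v] by simp
            then have "E0 = E" by (rule ext)
            then show False using E by simp
          qed
          ultimately show ?thesis using lead[of E] E by (auto simp: leads_def)
        qed simp
      qed
    qed
    also have "\<dots> \<noteq> 0" using lead[of E0] E0(1) by (auto simp: leads_def F'_def)
    finally show False by simp
  qed
  obtain N where N: "(kdet ^ CHAR('k)) ^ N * f \<in> coord_polys vs" using coord_polys_localization[OF vs] by blast
  \<comment> \<open>Passing from f to its multiple by kdet^p multiplies the restriction by the value
    of \<open>piL\<close> at kdet^p, because \<open>dinv\<close> is group-like and
    \<open>piU\<close> sends it to 1; thus vanishing is preserved.\<close>
  have "piLU (comult ((kdet ^ CHAR('k)) ^ N * f)) = 0"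
    using assms
  proof (induction N)
    case (Suc N)
    let ?D = "kdet ^ CHAR('k) :: ('k, 'm, 'n) KG"
    have 1: "piL ?D * piL dinv = 1"
      using dinv_kdet[OF char, where 'm = 'm and 'n = 'n] even_central[OF parity_dinv[OF char], of ?D]
      by (simp only: piL(3,4)[symmetric])
    have "piL dinv * piLU (comult (?D ^ Suc N * f)) = piLU (comult (dinv * ?D * (?D ^ N * f)))"
      by (simp add: piLU_dinv mult.assoc)
    also have "\<dots> = piLU (comult (?D ^ N * f))"
      using dinv_kdet[OF char, where 'm = 'm and 'n = 'n] by simp
    finally have "piL ?D * piL dinv * piLU (comult (?D ^ Suc N * f)) = piL ?D * piLU (comult (?D ^ N * f))"
      by (simp only: mult.assoc)
    then have "piLU (comult (?D ^ Suc N * f)) = piL ?D * piLU (comult (?D ^ N * f))"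
      by (simp only: 1 mult_1_left)
    then show ?case using Suc by simp
  qed simp
  then have "(kdet ^ CHAR('k)) ^ N * f = 0" by (rule poly[OF N])
  moreover have "dinv ^ N * ((kdet ^ CHAR('k)) ^ N * f) = f"
  proof (induction N)
    case (Suc N)
    let ?D = "kdet ^ CHAR('k) :: ('k, 'm, 'n) KG"
    have "dinv ^ Suc N * (?D ^ Suc N * f) = dinv ^ N * (dinv * ?D * (?D ^ N * f))"
      by (simp only: power_Suc2[of dinv] power_Suc[of ?D] mult.assoc)
    then show ?case using Suc dinv_kdet[OF char, where 'm = 'm and 'n = 'n] by simp
  qed simp
  ultimately show ?thesis by simp
qed

end

section \<open>Restriction to the Borel and unipotent subsupergroups\<close>

section \<open>Heights and the ideals of the Borel subsupergroup and of the torus\<close>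

text \<open>A linear functional with the positive value rk(j) - rk(i) on \<epsilon>_i - \<epsilon>_j
  for i before j. Being integral, it attains a maximum on a finite set of weights.\<close>

definition height :: "('m::{finite,linorder}, 'n::{finite,linorder}) weight \<Rightarrow> int" where
  "height \<mu> = - (\<Sum>i\<in>UNIV. int (rk i) * \<mu> i)"

lemma height_add: "height (\<mu> + \<nu>) = height \<mu> + height \<nu>"
  by (simp add: height_def distrib_left sum.distrib)

lemma height_diff: "height (\<mu> - \<nu>) = height \<mu> - height \<nu>"
  using height_add[of "\<mu> - \<nu>" \<nu>] by simp

lemma height_unit: "height (unit_weight i) = - int (rk i)"
  by (simp add: height_def unit_weight_def if_distrib cong: if_cong)

lemma two_sided_ideal_props:
  fixes S :: "('k::field, 'm::{finite,linorder}, 'n::{finite,linorder}) KG set"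
  shows two_sided_ideal_subspace: "KG.subspace (two_sided_ideal S)"
    and two_sided_ideal_base: "f \<in> S \<Longrightarrow> f \<in> two_sided_ideal S"
    and two_sided_ideal_left: "f \<in> two_sided_ideal S \<Longrightarrow> y * f \<in> two_sided_ideal S"
    and two_sided_ideal_right: "f \<in> two_sided_ideal S \<Longrightarrow> f * y \<in> two_sided_ideal S"
proof -
  show "KG.subspace (two_sided_ideal S)" by (simp add: two_sided_ideal_def KG.subspace_span)
  show "f \<in> S \<Longrightarrow> f \<in> two_sided_ideal S"
    unfolding two_sided_ideal_def by (intro KG.span_base CollectI exI[of _ 1] exI[of _ f]) auto
  show "y * f \<in> two_sided_ideal S" if "f \<in> two_sided_ideal S"
    using that unfolding two_sided_ideal_def
  proof (induction rule: KG.span_induct_alt)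
    case (step c x z)
    then obtain a g b where x: "x = a * g * b" "g \<in> S" by blast
    have "y * x \<in> KG.span {a * f * b |a f b. f \<in> S}"
      using x by (intro KG.span_base CollectI exI[of _ "y * a"] exI[of _ g] exI[of _ b]) (simp add: mult.assoc)
    then show ?case using step by (simp add: distrib_left kg_scale_mult KG.span_add KG.span_scale)
  qed (simp add: KG.span_zero)
  show "f * y \<in> two_sided_ideal S" if "f \<in> two_sided_ideal S"
    using that unfolding two_sided_ideal_def
  proof (induction rule: KG.span_induct_alt)
    case (step c x z)
    then obtain a g b where x: "x = a * g * b" "g \<in> S" by blast
    have "x * y \<in> KG.span {a * f * b |a f b. f \<in> S}"
      using x by (intro KG.span_base CollectI exI[of _ a] exI[of _ g] exI[of _ "b * y"]) (simp add: mult.assoc)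
    then show ?case using step by (simp add: distrib_right kg_scale_mult KG.span_add KG.span_scale)
  qed (simp add: KG.span_zero)
qed

lemma two_sided_ideal_induct [consumes 1, case_names zero base add scale]:
  assumes "x \<in> two_sided_ideal S" "P 0" and "\<And>a f b. f \<in> S \<Longrightarrow> P (a * f * b)"
    and "\<And>x y. P x \<Longrightarrow> P y \<Longrightarrow> P (x + y)" "\<And>r x. P x \<Longrightarrow> P (kg_scale r x)"
  shows "P x"
  using assms(1) unfolding two_sided_ideal_def
  by (induction rule: KG.span_induct_alt) (auto intro: assms)

lemmas borel_subspace = two_sided_ideal_subspace[of "{coord i j | i j. idx_less i j}", folded borel_ideal_def]
lemmas borel_left = two_sided_ideal_left[of _ "{coord i j | i j. idx_less i j}", folded borel_ideal_def]
lemmas borel_right = two_sided_ideal_right[of _ "{coord i j | i j. idx_less i j}", folded borel_ideal_def]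
lemmas borel_add = KG.subspace_add[OF borel_subspace]
lemmas borel_diff = KG.subspace_diff[OF borel_subspace]
lemmas borel_scale = KG.subspace_scale[OF borel_subspace]
lemmas borel_0 = KG.subspace_0[OF borel_subspace]

lemma borel_base: "idx_less i j \<Longrightarrow> coord i j \<in> borel_ideal"
  unfolding borel_ideal_def by (rule two_sided_ideal_base) blast

lemma piL_borel: "x \<in> borel_ideal \<Longrightarrow> piL x = 0"
  unfolding borel_ideal_def
proof (induction rule: two_sided_ideal_induct)
  case zero
  then show ?case using piL(2)[of 0 0] by simp
qed (auto simp: piL)

text \<open>Stated for every weight component at once, so that functionals of the form counit after
  a projection vanish on both the Borel ideal and the torus ideal.\<close>

lemma counit_wcomp_offdiag:
  assumes "i \<noteq> j"
  shows "counit (wcomp P (a * (coord i j * b))) = 0"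
proof -
  have "\<forall>P. counit (wcomp P (a * (coord i j * b))) = 0"
    by (induction a rule: KG_span_induct)
      (simp_all add: assms wcomp_coord bihomD[OF bihom_det_inv] mult.assoc distrib_right wcomp_add kg_scale_mult wcomp_scale)
  then show ?thesis by blast
qed

lemma counit_compL_borel: "x \<in> borel_ideal \<Longrightarrow> counit (compL Q x) = 0"
  unfolding borel_ideal_def
proof (induction rule: two_sided_ideal_induct)
  case (base a f b)
  then show ?case by (auto simp: mult.assoc intro!: counit_wcomp_offdiag)
qed (simp_all add: kend_0[OF kend_wcomp] wcomp_add wcomp_scale)

lemma counit_borel: "x \<in> borel_ideal \<Longrightarrow> counit x = 0"
  using counit_compL_borel[of x "\<lambda>_. True"] by (simp add: wcomp_True)

text \<open>Equality of the restrictions to the lower triangular Borel subsupergroup.\<close>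

definition beq :: "('k::field, 'm::{finite,linorder}, 'n::{finite,linorder}) KG \<Rightarrow> ('k, 'm, 'n) KG \<Rightarrow> bool" where
  "beq f g \<longleftrightarrow> f - g \<in> borel_ideal"

lemma beq_refl: "beq f f" by (simp add: beq_def borel_0)

lemma beq_sym: "beq f g \<Longrightarrow> beq g f"
  unfolding beq_def using borel_diff[OF borel_0] by fastforce

lemma beq_trans: "beq f g \<Longrightarrow> beq g h \<Longrightarrow> beq f h"
  unfolding beq_def using borel_add by fastforce

lemma beq_mult: "beq f g \<Longrightarrow> beq f' g' \<Longrightarrow> beq (f * f') (g * g')"
  unfolding beq_def
proof -
  assume "f - g \<in> borel_ideal" "f' - g' \<in> borel_ideal"
  then have "(f - g) * f' + g * (f' - g') \<in> borel_ideal"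
    by (intro borel_add borel_left borel_right)
  then show "f * f' - g * g' \<in> borel_ideal" by (simp add: algebra_simps)
qed

lemma idx_list: "distinct (idx_list :: ('m::{finite,linorder} + 'n::{finite,linorder}) list)"
  "set (idx_list :: ('m + 'n) list) = UNIV"
  using UNIV_sum by (auto simp: idx_list_def distinct_map)

definition diag :: "('k::field, 'm::{finite,linorder}, 'n::{finite,linorder}) KG" where
  "diag = prod_list (map (\<lambda>j. coord j j) idx_list)"

lemma parity_diag: "parity False (coord j j)" by (rule parity_coord_same) simp

lemma beq_diag: "beq kdet (diag :: ('k::field, 'm::{finite,linorder}, 'n::{finite,linorder}) KG)"
proof -
  note I = borel_0 borel_add borel_left borel_right
  have "beq (pdet (\<lambda>i j. coord (Inl i) (Inl j))) (prod_list (map (\<lambda>i. coord (Inl i) (Inl i)) (sorted_list_of_set UNIV)) :: ('k, 'm, 'n) KG)"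
    unfolding beq_def by (rule pdet_triangular_mod[OF I]) (auto intro: borel_base)
  moreover have "beq (pdet (\<lambda>i j. coord (Inr i) (Inr j))) (prod_list (map (\<lambda>i. coord (Inr i) (Inr i)) (sorted_list_of_set UNIV)) :: ('k, 'm, 'n) KG)"
    unfolding beq_def by (rule pdet_triangular_mod[OF I]) (auto intro: borel_base)
  ultimately show ?thesis unfolding kdet_def diag_def idx_list_def
    by (simp add: comp_def beq_mult)
qed

lemma beq_det_inv_diag: "beq (det_inv * diag) (1 :: ('k::field, 'm::{finite,linorder}, 'n::{finite,linorder}) KG)"
proof -
  have "beq (det_inv * kdet) (det_inv * diag :: ('k, 'm, 'n) KG)" by (intro beq_mult beq_refl beq_diag)
  then have "beq 1 (det_inv * diag :: ('k, 'm, 'n) KG)" by (simp only: det_inv_kdet)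
  then show ?thesis by (rule beq_sym)
qed

lemma prod_list_remove:
  fixes F :: "'i \<Rightarrow> ('k::field, 'm::{finite,linorder}, 'n::{finite,linorder}) KG"
  assumes "distinct xs" "i \<in> set xs" "parity False (F i)"
  shows "F i * prod_list (map F (filter (\<lambda>j. j \<noteq> i) xs)) = prod_list (map F xs)"
  using assms(1,2)
proof (induction xs)
  case (Cons x xs)
  show ?case
  proof (cases "x = i")
    case True
    then have "filter (\<lambda>j. j \<noteq> i) xs = xs" using Cons.prems by (auto simp: filter_id_conv)
    then show ?thesis using True by simp
  next
    case False
    have "F i * (F x * y) = F x * (F i * y)" for y
      using even_central[OF assms(3), of "F x"] by (metis mult.assoc)
    then show ?thesis using Cons False by simp
  qed
qed simp

text \<open>\<open>coord i i\<close> is even, so it can be moved into the gap that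
  \<open>diag_inv i\<close> leaves in the product of the diagonal entries; the completed product is
  cancelled by \<open>det_inv\<close> on the Borel subsupergroup.\<close>

lemma beq_coord_diag_inv: "beq (coord i i * diag_inv i) (1 :: ('k::field, 'm::{finite,linorder}, 'n::{finite,linorder}) KG)"
proof -
  have "coord i i * diag_inv i = (det_inv :: ('k, 'm, 'n) KG) * (coord i i * prod_list (map (\<lambda>j. coord j j) (filter (\<lambda>j. j \<noteq> i) idx_list)))"
    unfolding diag_inv_def by (simp add: mult.assoc[symmetric] even_central[OF parity_diag, of i det_inv])
  also have "\<dots> = det_inv * diag"
    using prod_list_remove[OF idx_list(1), of i "\<lambda>j. coord j j :: ('k, 'm, 'n) KG"] by (simp add: parity_diag diag_def idx_list)
  finally show ?thesis by (simp add: beq_det_inv_diag)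
qed

definition chi_factor :: "'m + 'n \<Rightarrow> int \<Rightarrow> ('k::field, 'm::{finite,linorder}, 'n::{finite,linorder}) KG" where
  "chi_factor i k = (if k \<ge> 0 then coord i i ^ nat k else diag_inv i ^ nat (- k))"

lemma character_eq: "character \<mu> = prod_list (map (\<lambda>i. chi_factor i (\<mu> i)) idx_list)"
  by (simp add: character_def chi_factor_def)

lemma beq_chi_factor: "beq (coord i i * chi_factor i k) (chi_factor i (k + 1) :: ('k::field, 'm::{finite,linorder}, 'n::{finite,linorder}) KG)"
proof (cases "k \<ge> 0")
  case True
  then have "nat (k + 1) = Suc (nat k)" by simp
  then show ?thesis using True by (simp add: chi_factor_def beq_refl)
next
  case False
  then obtain n where n: "k = - int (Suc n)" by (intro that[of "nat (- k - 1)"]) simp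
  have "beq (coord i i * diag_inv i * diag_inv i ^ n) (1 * diag_inv i ^ n :: ('k, 'm, 'n) KG)"
    by (intro beq_mult beq_coord_diag_inv beq_refl)
  moreover have "chi_factor i (k + 1) = (diag_inv i ^ n :: ('k, 'm, 'n) KG)"
    by (cases n) (simp_all add: chi_factor_def n nat_add_distrib)
  ultimately show ?thesis by (simp add: chi_factor_def n mult.assoc nat_add_distrib)
qed

lemma beq_coord_prod_list:
  fixes F F' :: "'i \<Rightarrow> ('k::field, 'm::{finite,linorder}, 'n::{finite,linorder}) KG"
  assumes "distinct xs" "i \<in> set xs" "parity False c" "beq (c * F i) (F' i)" "\<And>j. j \<noteq> i \<Longrightarrow> F j = F' j"
  shows "beq (c * prod_list (map F xs)) (prod_list (map F' xs))"
  using assms(1,2)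
proof (induction xs)
  case (Cons x xs)
  show ?case
  proof (cases "x = i")
    case True
    then have "prod_list (map F xs) = prod_list (map F' xs)"
      using Cons.prems by (intro arg_cong[of _ _ prod_list] map_cong assms(5)) auto
    then show ?thesis using True beq_mult[OF assms(4) beq_refl] by (simp add: mult.assoc[symmetric])
  next
    case False
    have "c * (F x * y) = F x * (c * y)" for y
      using even_central[OF assms(3), of "F x"] by (metis mult.assoc)
    then show ?thesis using Cons False beq_mult[OF beq_refl] assms(5)[OF False] by simp
  qed
qed simp

lemma beq_coord_character: "beq (coord i i * character \<mu>) (character (unit_weight i + \<mu>) :: ('k::field, 'm::{finite,linorder}, 'n::{finite,linorder}) KG)"
  unfolding character_eq
proof (rule beq_coord_prod_list[OF idx_list(1) _ parity_diag])
  have "(unit_weight i + \<mu>) i = \<mu> i + 1" by (simp add: unit_weight_def)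
  then show "beq (coord i i * chi_factor i (\<mu> i)) (chi_factor i ((unit_weight i + \<mu>) i) :: ('k, 'm, 'n) KG)"
    by (simp only: beq_chi_factor)
qed (simp_all add: idx_list unit_weight_def)

lemma beq_prod_character:
  "beq (prod_list (map (\<lambda>i. coord i i) xs) * character \<mu>) (character (sum_list (map unit_weight xs) + \<mu>) :: ('k::field, 'm::{finite,linorder}, 'n::{finite,linorder}) KG)"
proof (induction xs)
  case (Cons x xs)
  have "beq (coord x x * (prod_list (map (\<lambda>i. coord i i) xs) * character \<mu>)) (coord x x * character (sum_list (map unit_weight xs) + \<mu>) :: ('k, 'm, 'n) KG)"
    by (rule beq_mult[OF beq_refl Cons])
  from beq_trans[OF this beq_coord_character] show ?case
    by (simp only: list.map sum_list.Cons prod_list.Cons mult.assoc add.assoc)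
qed (simp add: beq_refl)

lemma sum_list_unit_weight: "distinct xs \<Longrightarrow> sum_list (map unit_weight xs) = (\<lambda>k. if k \<in> set xs then 1 else 0)"
  by (induction xs) (auto simp: unit_weight_def fun_eq_iff)

text \<open>Multiplying by all diagonal entries raises every exponent by 1, and on the Borel
  subsupergroup \<open>det_inv\<close> undoes this multiplication.\<close>

lemma beq_det_inv_character: "beq (det_inv * character \<mu>) (character (- 1 + \<mu>) :: ('k::field, 'm::{finite,linorder}, 'n::{finite,linorder}) KG)"
proof -
  have "sum_list (map unit_weight idx_list) = (1 :: ('m, 'n) weight)"
    by (simp add: sum_list_unit_weight idx_list one_fun_def)
  then have "beq (diag * character (- 1 + \<mu>)) (character \<mu> :: ('k, 'm, 'n) KG)"
    using beq_prod_character[of idx_list "- 1 + \<mu>", where 'k = 'k] by (simp add: diag_def)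
  then have "beq (det_inv * (diag * character (- 1 + \<mu>))) (det_inv * character \<mu> :: ('k, 'm, 'n) KG)" by (rule beq_mult[OF beq_refl])
  then have 1: "beq (det_inv * diag * character (- 1 + \<mu>)) (det_inv * character \<mu> :: ('k, 'm, 'n) KG)" by (simp add: mult.assoc)
  have 2: "beq (det_inv * diag * character (- 1 + \<mu>)) (1 * character (- 1 + \<mu>) :: ('k, 'm, 'n) KG)"
    by (intro beq_mult beq_det_inv_diag beq_refl)
  show ?thesis using beq_trans[OF beq_sym[OF 1] 2] by simp
qed

lemma bihom_prod_list: "(\<And>x. x \<in> set xs \<Longrightarrow> bihom (g x) (F x)) \<Longrightarrow> bihom (sum_list (map g xs)) (prod_list (map F xs))"
  by (induction xs) (simp_all add: bihom_1 bihom_mult)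

lemma bihom_power: "bihom (\<lambda>k. g k, \<lambda>k. g k) a \<Longrightarrow> bihom (\<lambda>k. int n * g k, \<lambda>k. int n * g k) (a ^ n)"
proof (induction n)
  case 0
  then show ?case using bihom_1 by (simp add: zero_prod_def zero_fun_def)
next
  case (Suc n)
  have "(\<lambda>k. g k, \<lambda>k. g k) + (\<lambda>k. int n * g k, \<lambda>k. int n * g k) = (\<lambda>k. int (Suc n) * g k, \<lambda>k. int (Suc n) * g k)"
    by (simp add: fun_eq_iff algebra_simps)
  then show ?case using bihom_mult[OF Suc(2) Suc(1)[OF Suc(2)]] by simp
qed

lemma sum_list_pair: "sum_list (map (\<lambda>x. (f x, g x)) xs) = (sum_list (map f xs), sum_list (map g xs))"
  by (induction xs) (simp_all add: zero_prod_def)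

lemma bihom_diag_inv: "bihom (\<lambda>k. - unit_weight i k, \<lambda>k. - unit_weight i k) (diag_inv i)"
proof -
  have "bihom ((- 1, - 1) + sum_list (map (\<lambda>j. (unit_weight j, unit_weight j)) (filter (\<lambda>j. j \<noteq> i) idx_list))) (diag_inv i)"
    unfolding diag_inv_def by (intro bihom_mult bihom_det_inv bihom_prod_list bihom_coord)
  moreover have "sum_list (map (\<lambda>j. (unit_weight j, unit_weight j)) (filter (\<lambda>j. j \<noteq> i) idx_list)) =
      ((\<lambda>k. if k \<noteq> i then 1 else 0), (\<lambda>k. if k \<noteq> i then 1 else 0))"
    by (simp add: sum_list_pair sum_list_unit_weight idx_list)
  moreover have "- 1 + (\<lambda>k. if k \<noteq> i then 1 else 0) = (\<lambda>k. - unit_weight i k)"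
    by (auto simp: fun_eq_iff unit_weight_def)
  ultimately show ?thesis by simp
qed

lemma bihom_character: "bihom (\<mu>, \<mu>) (character \<mu>)"
proof -
  have "bihom (\<lambda>k. \<mu> i * unit_weight i k, \<lambda>k. \<mu> i * unit_weight i k) (chi_factor i (\<mu> i))" for i
  proof (cases "\<mu> i \<ge> 0")
    case True
    then show ?thesis using bihom_power[OF bihom_coord[of i i], of "nat (\<mu> i)"] by (simp add: chi_factor_def)
  next
    case False
    then show ?thesis using bihom_power[OF bihom_diag_inv[of i], of "nat (- \<mu> i)"] by (simp add: chi_factor_def)
  qed
  then have "bihom (sum_list (map (\<lambda>i. (\<lambda>k. \<mu> i * unit_weight i k, \<lambda>k. \<mu> i * unit_weight i k)) idx_list)) (character \<mu>)"
    unfolding character_eq by (intro bihom_prod_list)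
  moreover have "sum_list (map (\<lambda>i k. \<mu> i * unit_weight i k) xs) = (\<lambda>k. if k \<in> set xs then \<mu> k else 0)" if "distinct xs" for xs
    using that by (induction xs) (auto simp: fun_eq_iff unit_weight_def)
  ultimately show ?thesis by (simp add: sum_list_pair idx_list)
qed

lemma counit_character: "counit (character \<mu> :: ('k::field, 'm::{finite,linorder}, 'n::{finite,linorder}) KG) = 1"
proof -
  have p: "counit (prod_list xs) = prod_list (map counit xs)" for xs :: "('k, 'm, 'n) KG list"
    by (induction xs) simp_all
  have "counit (diag_inv i :: ('k, 'm, 'n) KG) = 1" for i
    by (simp add: diag_inv_def p comp_def prod_list_ones)
  then have "counit (chi_factor i k :: ('k, 'm, 'n) KG) = 1" for i k by (simp add: chi_factor_def)
  then show ?thesis by (simp add: character_eq p comp_def prod_list_ones)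
qed

text \<open>Reduction modulo \<open>borel_ideal\<close> is restriction to the lower triangular Borel subsupergroup, on which
  only biweights \<open>(\<kappa>, \<nu>)\<close> with \<open>\<kappa>\<close> below \<open>\<nu>\<close> occur.\<close>

lemma wcomp_mod_borel:
  fixes f :: "('k::field, 'm::{finite,linorder}, 'n::{finite,linorder}) KG"
  shows "let g = wcomp (\<lambda>x. x = (\<kappa>, \<nu>)) f in
     g \<in> borel_ideal \<or> height \<kappa> < height \<nu> \<or> \<kappa> = \<nu> \<and> beq g (kg_scale (counit g) (character \<kappa>))"
  (is "?Q \<kappa> \<nu> f")
proof -
  let ?R = "\<lambda>\<kappa> \<nu> g. g \<in> borel_ideal \<or> height \<kappa> < height \<nu> \<or> \<kappa> = \<nu> \<and> beq g (kg_scale (counit g) (character \<kappa>))"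
  have scale: "?R \<kappa> \<nu> (kg_scale r g)" if "?R \<kappa> \<nu> g" for r \<kappa> \<nu> and g :: "('k, 'm, 'n) KG"
    using that borel_scale[of _ r] by (auto simp: beq_def KG.scale_right_diff_distrib[symmetric] simp flip: KG.scale_scale)
  have add: "?R \<kappa> \<nu> (g + h)" if "?R \<kappa> \<nu> g" "?R \<kappa> \<nu> h" for \<kappa> \<nu> and g h :: "('k, 'm, 'n) KG"
  proof -
    have eq: "g + h - kg_scale (counit (g + h)) (character \<kappa>) =
        (g - kg_scale (counit g) (character \<kappa>)) + (h - kg_scale (counit h) (character \<kappa>))"
      by (simp add: KG.scale_left_distrib)
    \<comment> \<open>Elements of the ideal have counit 0 and therefore also satisfy the congruence
      of the third alternative; this settles sums whose summands fall under different
      alternatives.\<close>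
    have z: "beq x (kg_scale (counit x) (character \<kappa>))" if "x \<in> borel_ideal" for x :: "('k, 'm, 'n) KG"
      using that by (simp add: beq_def counit_borel)
    show ?thesis
      using that z[of g] z[of h] borel_add unfolding beq_def eq by blast
  qed
  have "\<forall>\<kappa> \<nu>. ?R \<kappa> \<nu> (wcomp (\<lambda>x. x = (\<kappa>, \<nu>)) f)"
  proof (induction f rule: KG_span_induct)
    case one
    have "beq (1 :: ('k, 'm, 'n) KG) (character 0)"
      by (simp add: character_eq chi_factor_def prod_list_ones beq_refl)
    then have "?R \<kappa> \<nu> (wcomp (\<lambda>x. x = (\<kappa>, \<nu>)) (1 :: ('k, 'm, 'n) KG))" for \<kappa> \<nu>
      by (cases "(\<kappa>, \<nu>) = 0") (simp_all only: wcomp_1 prod_eq_iff fst_zero snd_zero fst_conv snd_conv if_True counit_simps KG.scale_one simp_thms, auto simp: borel_0)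
    then show ?case by blast
  next
    case (add f g)
    then show ?case using \<open>\<And>\<kappa> \<nu> g h. ?R \<kappa> \<nu> g \<Longrightarrow> ?R \<kappa> \<nu> h \<Longrightarrow> ?R \<kappa> \<nu> (g + h)\<close> by (simp only: wcomp_add) blast
  next
    case (scale r f)
    then show ?case using \<open>\<And>\<kappa> \<nu> g r. ?R \<kappa> \<nu> g \<Longrightarrow> ?R \<kappa> \<nu> (kg_scale r g)\<close> by (simp only: wcomp_scale) blast
  next
    case (coord i j f)
    show ?case
    proof (intro allI)
      fix \<kappa> \<nu> :: "('m, 'n) weight"
      define \<kappa>' \<nu>' where "\<kappa>' = \<kappa> - unit_weight i" and "\<nu>' = \<nu> - unit_weight j"
      let ?g = "wcomp (\<lambda>x. x = (\<kappa>', \<nu>')) f"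
      have l: "\<kappa> = unit_weight i + \<kappa>'" "\<nu> = unit_weight j + \<nu>'" by (simp_all add: \<kappa>'_def \<nu>'_def)
      have eq: "wcomp (\<lambda>x. x = (\<kappa>, \<nu>)) (coord i j * f) = coord i j * ?g"
      proof -
        have "(\<lambda>x. (unit_weight i, unit_weight j) + x = (\<kappa>, \<nu>)) = (\<lambda>x. x = (\<kappa>', \<nu>'))"
          by (auto simp: l fun_eq_iff)
        then show ?thesis by (simp only: wcomp_coord)
      qed
      have IH: "?R \<kappa>' \<nu>' ?g" using coord by blast
      consider "idx_less i j" | "i = j" | "idx_less j i" using idx_less_linear by blast
      then show "?R \<kappa> \<nu> (wcomp (\<lambda>x. x = (\<kappa>, \<nu>)) (coord i j * f))"
        unfolding eq
      proof cases
        case 1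
        then show "?R \<kappa> \<nu> (coord i j * ?g)" by (simp add: borel_right borel_base)
      next
        case 2
        have "beq (coord i i * ?g) (kg_scale (counit (coord i i * ?g)) (character \<kappa>))" if "beq ?g (kg_scale (counit ?g) (character \<kappa>'))"
        proof -
          have "beq (coord i i * ?g) (coord i i * kg_scale (counit ?g) (character \<kappa>'))" by (rule beq_mult[OF beq_refl that])
          moreover have "beq (kg_scale (counit ?g) (coord i i * character \<kappa>')) (kg_scale (counit ?g) (character \<kappa>))"
            using borel_scale[of _ "counit ?g"] beq_coord_character[of i \<kappa>'] by (simp add: beq_def l KG.scale_right_diff_distrib[symmetric])
          ultimately show ?thesis using beq_trans by (simp add: kg_scale_mult) blast
        qed
        then show "?R \<kappa> \<nu> (coord i j * ?g)" using IH 2 borel_left[of ?g "coord i i"] by (auto simp: l height_add)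
      next
        case 3
        \<comment> \<open>An entry strictly below the diagonal separates the two heights strictly,
          so equal heights before it lead to the second alternative.\<close>
        from IH show "?R \<kappa> \<nu> (coord i j * ?g)"
        proof (elim disjE)
          assume "?g \<in> borel_ideal"
          then show ?thesis by (simp add: borel_left)
        next
          assume "height \<kappa>' < height \<nu>'"
          then show ?thesis using rk_less[OF 3] by (simp add: l height_add height_unit)
        next
          assume "\<kappa>' = \<nu>' \<and> beq ?g (kg_scale (counit ?g) (character \<kappa>'))"
          then show ?thesis using rk_less[OF 3] by (simp add: l height_add height_unit)
        qed
      qed
    qed
  next
    case (det_inv f)
    show ?case
    proof (intro allI)
      fix \<kappa> \<nu> :: "('m, 'n) weight"
      define \<kappa>' \<nu>' where "\<kappa>' = \<kappa> - (- 1)" and "\<nu>' = \<nu> - (- 1)"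
      let ?g = "wcomp (\<lambda>x. x = (\<kappa>', \<nu>')) f"
      have l: "\<kappa> = - 1 + \<kappa>'" "\<nu> = - 1 + \<nu>'" by (simp_all add: \<kappa>'_def \<nu>'_def)
      have eq: "wcomp (\<lambda>x. x = (\<kappa>, \<nu>)) (det_inv * f) = det_inv * ?g"
      proof -
        have "(\<lambda>x. (- 1, - 1) + x = (\<kappa>, \<nu>)) = (\<lambda>x. x = (\<kappa>', \<nu>'))"
          by (auto simp: l fun_eq_iff)
        then show ?thesis by (simp only: bihomD[OF bihom_det_inv])
      qed
      have IH: "?R \<kappa>' \<nu>' ?g" using det_inv by blast
      have "beq (det_inv * ?g) (kg_scale (counit (det_inv * ?g)) (character \<kappa>))" if "beq ?g (kg_scale (counit ?g) (character \<kappa>'))"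
      proof -
        have "beq (det_inv * ?g) (det_inv * kg_scale (counit ?g) (character \<kappa>'))" by (rule beq_mult[OF beq_refl that])
        moreover have "beq (kg_scale (counit ?g) (det_inv * character \<kappa>')) (kg_scale (counit ?g) (character \<kappa>))"
          using borel_scale[of _ "counit ?g"] beq_det_inv_character[of \<kappa>'] by (simp add: beq_def l KG.scale_right_diff_distrib[symmetric])
        ultimately show ?thesis using beq_trans by (simp add: kg_scale_mult) blast
      qed
      then show "?R \<kappa> \<nu> (wcomp (\<lambda>x. x = (\<kappa>, \<nu>)) (det_inv * f))"
        unfolding eq using IH borel_left[of ?g det_inv] by (auto simp: l height_add height_diff)
    qed
  qed
  then show ?thesis unfolding Let_def by blast
qed

text \<open>\<open>piU\<close> is restriction to the unipotent upper triangular matrices.\<close>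

lemma piU_wcomp:
  fixes f :: "('k::field, 'm::{finite,linorder}, 'n::{finite,linorder}) KG"
  shows "piU (wcomp (\<lambda>x. x = (\<kappa>, \<kappa>)) f) = op_scale (counit (wcomp (\<lambda>x. x = (\<kappa>, \<kappa>)) f)) 1"
proof -
  \<comment> \<open>The induction needs all biweights: the factors above the diagonal make the left
    height exceed the right one, and otherwise only a scalar remains, which is zero unless the
    weights are equal.\<close>
  let ?R = "\<lambda>\<kappa> \<nu> g. height \<nu> < height \<kappa> \<or> piU g = op_scale (counit g) 1 \<and> (\<kappa> \<noteq> \<nu> \<longrightarrow> piU g = 0)"
  have 0: "piU 0 = 0" using piU(2)[of 0 0] by simp
  have "\<forall>\<kappa> \<nu>. ?R \<kappa> \<nu> (wcomp (\<lambda>x. x = (\<kappa>, \<nu>)) f)"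
  proof (induction f rule: KG_span_induct)
    case one
    then show ?case by (auto simp: wcomp_1 zero_prod_def 0 piU)
  next
    case (add f g)
    have d: "op_scale (r + s) T = op_scale r T + op_scale s T" for r s and T :: "('k, ('m, 'n) expo) oper"
      by transfer (simp add: fun_eq_iff distrib_right)
    show ?case
    proof (intro allI)
      fix \<kappa> \<nu> show "?R \<kappa> \<nu> (wcomp (\<lambda>x. x = (\<kappa>, \<nu>)) (f + g))"
        using add(1)[rule_format, of \<nu> \<kappa>] add(2)[rule_format, of \<nu> \<kappa>] by (auto simp: wcomp_add piU d)
    qed
  next
    case (scale r f)
    show ?case
    proof (intro allI)
      fix \<kappa> \<nu> show "?R \<kappa> \<nu> (wcomp (\<lambda>x. x = (\<kappa>, \<nu>)) (kg_scale r f))"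
        using scale[rule_format, of \<nu> \<kappa>] by (auto simp: wcomp_scale piU op_scale_simps(4)[symmetric] simp del: op_scale_simps(4))
    qed
  next
    case (coord i j f)
    show ?case
    proof (intro allI)
      fix \<kappa> \<nu> :: "('m, 'n) weight"
      define \<kappa>' \<nu>' where "\<kappa>' = \<kappa> - unit_weight i" and "\<nu>' = \<nu> - unit_weight j"
      let ?g = "wcomp (\<lambda>x. x = (\<kappa>', \<nu>')) f"
      have l: "\<kappa> = unit_weight i + \<kappa>'" "\<nu> = unit_weight j + \<nu>'" by (simp_all add: \<kappa>'_def \<nu>'_def)
      have eq: "wcomp (\<lambda>x. x = (\<kappa>, \<nu>)) (coord i j * f) = coord i j * ?g"
      proof -
        have "(\<lambda>x. (unit_weight i, unit_weight j) + x = (\<kappa>, \<nu>)) = (\<lambda>x. x = (\<kappa>', \<nu>'))"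
          by (auto simp: l fun_eq_iff)
        then show ?thesis by (simp only: wcomp_coord)
      qed
      have IH: "?R \<kappa>' \<nu>' ?g" using coord by blast
      consider "idx_less i j" | "i = j" | "idx_less j i" using idx_less_linear by blast
      then show "?R \<kappa> \<nu> (wcomp (\<lambda>x. x = (\<kappa>, \<nu>)) (coord i j * f))"
        unfolding eq
      proof cases
        case 1
        then show "?R \<kappa> \<nu> (coord i j * ?g)"
          using IH rk_less[OF 1] by (cases "\<kappa>' = \<nu>'") (auto simp: l height_add height_unit piU)
      next
        case 2
        then show "?R \<kappa> \<nu> (coord i j * ?g)" using IH by (auto simp: l height_add piU)
      next
        case 3
        then have "\<not> idx_less i j" "i \<noteq> j" using idx_less_asym by auto
        then show "?R \<kappa> \<nu> (coord i j * ?g)" by (simp add: piU)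
      qed
    qed
  next
    case (det_inv f)
    show ?case
    proof (intro allI)
      fix \<kappa> \<nu> :: "('m, 'n) weight"
      define \<kappa>' \<nu>' where "\<kappa>' = \<kappa> - (- 1)" and "\<nu>' = \<nu> - (- 1)"
      have l: "\<kappa> = - 1 + \<kappa>'" "\<nu> = - 1 + \<nu>'" by (simp_all add: \<kappa>'_def \<nu>'_def)
      have "(\<lambda>x. (- 1, - 1) + x = (\<kappa>, \<nu>)) = (\<lambda>x. x = (\<kappa>', \<nu>'))" by (auto simp: l fun_eq_iff)
      then have eq: "wcomp (\<lambda>x. x = (\<kappa>, \<nu>)) (det_inv * f) = det_inv * wcomp (\<lambda>x. x = (\<kappa>', \<nu>')) f"
        by (simp only: bihomD[OF bihom_det_inv])
      show "?R \<kappa> \<nu> (wcomp (\<lambda>x. x = (\<kappa>, \<nu>)) (det_inv * f))"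
        unfolding eq using det_inv[rule_format, of \<nu>' \<kappa>'] by (auto simp: l height_add height_diff piU)
    qed
  qed
  then show ?thesis by force
qed

section \<open>Simple subsupermodules and the socles of induced supermodules\<close>

section \<open>Subsupermodules\<close>

text \<open>In this form, images and preimages under homogeneous linear maps that commute with every
  \<open>Rop\<close> are seen at once to be subsupermodules.\<close>

lemma subsupermodule_iff:
  "subsupermodule V \<longleftrightarrow> KG.subspace V \<and> (\<forall>f\<in>V. \<forall>p. part p f \<in> V) \<and> (\<forall>f\<in>V. \<forall>\<gamma>. klin \<gamma> \<longrightarrow> Rop \<gamma> f \<in> V)"
  by (auto simp: subsupermodule_def tensor_sub_UNIV_iff Rop_def)

lemma klin_add: "klin \<gamma> \<Longrightarrow> klin \<gamma>' \<Longrightarrow> klin (\<lambda>y. \<gamma> y + \<gamma>' y)"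
  by (simp add: klin_def algebra_simps)

lemma klin_zero: "klin (\<lambda>_. 0)" by (simp add: klin_def)

definition gen_sub :: "('k::field, 'm::{finite,linorder}, 'n::{finite,linorder}) KG \<Rightarrow> ('k, 'm, 'n) KG set" where
  "gen_sub w = {Rop \<gamma> w | \<gamma>. klin \<gamma>}"

text \<open>Local finiteness of supercomodules: \<Delta> w is a finite sum of pure tensors, and
  every contraction is a combination of their left factors.\<close>

lemma gen_sub_finite:
  fixes w :: "('k::field, 'm::{finite,linorder}, 'n::{finite,linorder}) KG"
  obtains A where "finite A" "gen_sub w \<subseteq> KG.span A"
proof -
  obtain B where B: "finite B" "comult w = (\<Sum>b\<in>B. tensor (rc (kcoef b) (comult w)) b)"
    using KG2_expansion by blast
  let ?a = "\<lambda>b. rc (kcoef b) (comult w)"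
  have "Rop \<gamma> w \<in> KG.span (?a ` B)" if "klin \<gamma>" for \<gamma> :: "('k, 'm, 'n) functional"
  proof -
    have "Rop \<gamma> w = (\<Sum>b\<in>B. kg_scale (\<gamma> b) (?a b))"
      unfolding Rop_def by (subst B(2)) (simp add: rc_sum rc_tensor that)
    then show ?thesis by (simp only:) (intro KG.span_sum KG.span_scale KG.span_base imageI)
  qed
  then show ?thesis using B(1) by (intro that[of "?a ` B"]) (auto simp: gen_sub_def)
qed

lemma span_weights_finite:
  fixes A :: "('k::field, 'm::{finite,linorder}, 'n::{finite,linorder}) KG set"
  assumes "finite A"
  obtains F where "finite F" "\<And>x \<kappa>. x \<in> KG.span A \<Longrightarrow> \<kappa> \<notin> F \<Longrightarrow> compR (\<lambda>\<nu>. \<nu> = \<kappa>) x = 0"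
proof -
  have "\<exists>D. finite D \<and> (\<forall>\<kappa>. \<kappa> \<notin> D \<longrightarrow> compR (\<lambda>\<nu>. \<nu> = \<kappa>) a = 0)" for a :: "('k, 'm, 'n) KG"
  proof -
    obtain D where "finite D" "a = (\<Sum>x\<in>D. wcomp (\<lambda>g. snd g = x) a)" "\<And>x. x \<notin> D \<Longrightarrow> wcomp (\<lambda>g. snd g = x) a = 0"
      using wcomp_sum[of a snd] by metis
    then show ?thesis by blast
  qed
  then obtain D where D: "\<And>a :: ('k, 'm, 'n) KG. finite (D a)" "\<And>a \<kappa>. \<kappa> \<notin> D a \<Longrightarrow> compR (\<lambda>\<nu>. \<nu> = \<kappa>) a = 0"
    by metis
  have "compR (\<lambda>\<nu>. \<nu> = \<kappa>) x = 0" if "x \<in> KG.span A" "\<kappa> \<notin> (\<Union>a\<in>A. D a)" for x \<kappa>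
    using that(1)
    by (induction rule: KG.span_induct_alt) (use that(2) D(2) in \<open>auto simp: kend_0[OF kend_wcomp] wcomp_add wcomp_scale\<close>)
  then show ?thesis using assms D(1) by (intro that[of "\<Union>a\<in>A. D a"]) auto
qed

lemma dim_psubset:
  fixes U N :: "('k::field, 'm::{finite,linorder}, 'n::{finite,linorder}) KG set"
  assumes A: "finite A" "N \<subseteq> KG.span A" and U: "KG.subspace U" "U \<subset> N"
  shows "KG.dim U < KG.dim N"
proof -
  obtain B where B: "B \<subseteq> U" "KG.independent B" "U \<subseteq> KG.span B" "card B = KG.dim U"
    using KG.basis_exists by metis
  obtain C where C: "C \<subseteq> N" "KG.independent C" "N \<subseteq> KG.span C" "card C = KG.dim N"
    using KG.basis_exists by metis
  have finC: "finite C" using KG.independent_span_bound[OF A(1) C(2)] C(1) A(2) by blast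
  have finB: "finite B" using KG.independent_span_bound[OF A(1) B(2)] B(1) U(2) A(2) by blast
  obtain x where x: "x \<in> N" "x \<notin> U" using U(2) by blast
  have "KG.span B = U" using B(1,3) U(1) by (simp add: KG.span_eq_iff KG.span_minimal subset_antisym)
  then have "x \<notin> KG.span B" using x(2) by simp
  then have "KG.independent (insert x B)" using B(2) by (simp add: KG.independent_insertI)
  moreover have "insert x B \<subseteq> KG.span C" using x(1) B(1) U(2) C(3) by blast
  ultimately have "card (insert x B) \<le> card C" using KG.independent_span_bound[OF finC] by blast
  moreover have "x \<notin> B" using x(2) B(1) by blast
  ultimately show ?thesis using finB B(4) C(4) by simp
qed

text \<open>Descent on the dimension, which strictly decreases inside the span of a finite
  set.\<close>

lemma exists_simple:
  fixes N :: "('k::field, 'm::{finite,linorder}, 'n::{finite,linorder}) KG set"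
  assumes A: "finite A"
  shows "subsupermodule N \<Longrightarrow> N \<noteq> {0} \<Longrightarrow> N \<subseteq> KG.span A \<Longrightarrow> \<exists>S. simple_supermodule S \<and> S \<subseteq> N"
proof (induction "KG.dim N" arbitrary: N rule: less_induct)
  case less
  show ?case
  proof (cases "simple_supermodule N")
    case False
    then obtain U where U: "subsupermodule U" "U \<subseteq> N" "U \<noteq> {0}" "U \<noteq> N"
      using less.prems(1,2) unfolding simple_supermodule_def by blast
    have "KG.dim U < KG.dim N"
      using U by (intro dim_psubset[OF A less.prems(3)]) (auto simp: subsupermodule_def)
    from less.hyps[OF this U(1,3)] show ?thesis using U(2) less.prems(3) by blast
  qed blast
qed

lemma exists_functional:
  fixes V :: "('k::field, 'm::{finite,linorder}, 'n::{finite,linorder}) KG set"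
  assumes V: "KG.subspace V" "a \<notin> V"
  obtains \<theta> where "klin \<theta>" "\<theta> a = 1" "\<And>v. v \<in> V \<Longrightarrow> \<theta> v = 0"
proof -
  interpret P: vector_space_pair kg_scale "(*) :: 'k \<Rightarrow> 'k \<Rightarrow> 'k"
    by (intro vector_space_pair.intro vector_space_KG vector_space_field)
  obtain B where B: "B \<subseteq> V" "KG.independent B" "V \<subseteq> KG.span B"
    using KG.basis_exists by metis
  have sp: "KG.span B = V" using B(1,3) V(1) by (simp add: KG.span_eq_iff KG.span_minimal subset_antisym)
  then have "KG.independent (insert a B)" using B(2) V(2) by (simp add: KG.independent_insertI)
  from P.linear_independent_extend[OF this, of "\<lambda>x. if x = a then 1 else 0"]
  obtain g where g: "Vector_Spaces.linear kg_scale (*) g" "\<And>x. x \<in> insert a B \<Longrightarrow> g x = (if x = a then 1 else 0)"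
    by blast
  have k: "klin g" using g(1) by (simp add: klin_iff_linear)
  have z: "g x = 0" if "x \<in> B" for x using g(2)[of x] that B(1) V(2) by auto
  have "g v = 0" if "v \<in> V" for v
    using that unfolding sp[symmetric]
    by (induction rule: KG.span_induct_alt) (simp_all add: klin_0[OF k] klinD[OF k] z)
  then show ?thesis using k g(2)[of a] by (intro that[of g]) auto
qed

section \<open>Induced supermodules and their socles\<close>

lemma tensor_sub_vanish:
  fixes H :: "('k::field, 'm::{finite,linorder}, 'n::{finite,linorder}) KG2 \<Rightarrow> 'v::ab_group_add"
  assumes x: "x \<in> tensor_sub V W" and add: "\<And>x y. H (x + y) = H x + H y"
    and scale: "\<And>r x. H x = 0 \<Longrightarrow> H (tensor_scale r x) = 0" and base: "\<And>v w. v \<in> V \<Longrightarrow> w \<in> W \<Longrightarrow> H (tensor v w) = 0"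
  shows "H x = 0"
proof -
  have H0: "H 0 = 0" using add[of 0 0] by simp
  show ?thesis
    using x unfolding tensor_sub_def by (induction rule: KG2.span_induct_alt) (auto simp: H0 add scale base)
qed

context
  assumes char: "CHAR('k::field) > 2"
begin

text \<open>A projection onto right weights is itself an operator \<open>Rop\<close>, namely that of
  the counit after the corresponding projection onto left weights.\<close>

lemma compR_mem:
  fixes V :: "('k, 'm::{finite,linorder}, 'n::{finite,linorder}) KG set"
  assumes "subsupermodule V" "f \<in> V"
  shows "compR Q f \<in> V"
proof -
  have "compR Q f = Rop (\<lambda>y. counit (compL Q y)) f"
    using compR_Rop[OF char klin_closed(1), of Q f] by (simp add: Rop_counit[OF char])
  moreover have "klin (\<lambda>y. counit (compL Q y))" by (rule klin_closed(2)[OF klin_closed(1) kend_wcomp])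
  then have "Rop (\<lambda>y. counit (compL Q y)) f \<in> V" using assms unfolding subsupermodule_iff by blast
  ultimately show ?thesis by simp
qed

text \<open>By the adjunction \<open>apply_Rop\<close>, every functional vanishes at
  \<open>Lop \<theta> f\<close>. Consequently, if \<theta> is zero on a subsupermodule, so is
  \<open>Lop \<theta>\<close>.\<close>

lemma Lop_vanish:
  fixes f :: "('k, 'm::{finite,linorder}, 'n::{finite,linorder}) KG"
  assumes "klin \<theta>" "\<And>\<gamma>. klin \<gamma> \<Longrightarrow> \<theta> (Rop \<gamma> f) = 0"
  shows "Lop \<theta> f = 0"
proof (rule KG_eqI)
  fix \<gamma> :: "('k, 'm, 'n) functional" assume \<gamma>: "klin \<gamma>"
  then show "\<gamma> (Lop \<theta> f) = \<gamma> 0" using apply_Rop[OF assms(1) \<gamma>, of f] assms(2)[OF \<gamma>] by (simp add: klin_0)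
qed

text \<open>Homogeneity of \<open>w\<close> gives stability under parity: a functional splits into
  an even and an odd part, and contraction with either one sends \<open>w\<close> to a homogeneous
  element.\<close>

lemma subsupermodule_gen_sub:
  fixes w :: "('k, 'm::{finite,linorder}, 'n::{finite,linorder}) KG"
  assumes "parity r w"
  shows "subsupermodule (gen_sub w)" "w \<in> gen_sub w"
proof -
  show "w \<in> gen_sub w" unfolding gen_sub_def
    using Rop_counit[OF char, of w] klin_closed(1) by (intro CollectI exI[of _ counit]) simp
  have R: "Rop \<gamma> w \<in> gen_sub w" if "klin \<gamma>" for \<gamma> using that by (auto simp: gen_sub_def)
  have sub: "KG.subspace (gen_sub w)"
    unfolding KG.subspace_def
  proof (intro conjI ballI allI)
    show "0 \<in> gen_sub w" using R[OF klin_zero] Rop_fun_scale[of 0 "\<lambda>_. 0" w] by simp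
    fix x y assume "x \<in> gen_sub w" "y \<in> gen_sub w"
    then obtain \<gamma> \<gamma>' where "klin \<gamma>" "x = Rop \<gamma> w" "klin \<gamma>'" "y = Rop \<gamma>' w" by (auto simp: gen_sub_def)
    then show "x + y \<in> gen_sub w" using R[OF klin_add[of \<gamma> \<gamma>']] by (simp add: Rop_fun_add)
  next
    fix c x assume "x \<in> gen_sub w"
    then obtain \<gamma> where "klin \<gamma>" "x = Rop \<gamma> w" by (auto simp: gen_sub_def)
    then show "kg_scale c x \<in> gen_sub w" using R[OF klin_closed(3)[of \<gamma> c]] by (simp add: Rop_fun_scale)
  qed
  have "part p (Rop \<gamma> w) \<in> gen_sub w" if \<gamma>: "klin \<gamma>" for p \<gamma>
  proof -
    let ?q = "p \<noteq> r"
    have kq: "klin (\<lambda>y. \<gamma> (part q y))" for q by (rule klin_closed(2)[OF \<gamma> kend_closed(3)])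
    have "\<gamma> = (\<lambda>y. \<gamma> (part True y) + \<gamma> (part False y))"
      by (simp add: part_split flip: klinD(1)[OF \<gamma>])
    then have "Rop \<gamma> w = Rop (\<lambda>y. \<gamma> (part True y) + \<gamma> (part False y)) w"
      by (rule arg_cong[of _ _ "\<lambda>\<gamma>. Rop \<gamma> w"])
    then have s: "Rop \<gamma> w = Rop (\<lambda>y. \<gamma> (part True y)) w + Rop (\<lambda>y. \<gamma> (part False y)) w"
      by (rule trans[OF _ Rop_fun_add])
    have "part p (Rop (\<lambda>y. \<gamma> (part q y)) w) = Rop (\<lambda>y. \<gamma> (part q y)) (part (p \<noteq> q) w)" for q
      using Rop_part[OF char \<gamma>, of q "p \<noteq> q" w] by (cases q) simp_all
    moreover have "Rop (\<lambda>y. \<gamma> (part q y)) (part (p \<noteq> q) w) \<in> gen_sub w" for q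
      using R[OF kq[of q]] R[OF klin_zero] kend_0[OF kend_Rop[OF char kq[of q]]] part_parity[OF assms, of "p \<noteq> q"] KG.subspace_0[OF sub] by simp
    ultimately have mem: "part p (Rop (\<lambda>y. \<gamma> (part q y)) w) \<in> gen_sub w" for q by (simp only:)
    show ?thesis unfolding s part_add by (intro KG.subspace_add[OF sub] mem)
  qed
  moreover have "Rop \<gamma>' (Rop \<gamma> w) \<in> gen_sub w" if "klin \<gamma>" "klin \<gamma>'" for \<gamma> \<gamma>'
    using R[OF klin_closed(2)[OF that(2) kend_Rop[OF char that(1)]]] Rop_Rop[OF char that(2,1), of w] by simp
  ultimately show "subsupermodule (gen_sub w)" unfolding subsupermodule_iff using sub by (auto simp: gen_sub_def)
qed

text \<open>The defining tensor lies in borel_ideal \<otimes> K[G] and is therefore killed by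
  contraction with the counit of a left weight component, as well as by \<open>piLU\<close>. The
  former gives the left weight, the latter the restriction to the big cell.\<close>

lemma H0_minusD:
  fixes f :: "('k, 'm::{finite,linorder}, 'n::{finite,linorder}) KG"
  assumes "f \<in> H0_minus \<mu>"
  shows "compL Q f = (if Q \<mu> then f else 0)" "piLU (comult f) = piL (character \<mu>) * piU f"
proof -
  let ?x = "comult f - tensor (character \<mu>) f"
  have x: "?x \<in> tensor_sub borel_ideal UNIV" using assms by (simp add: H0_minus_def)
  let ?a = "\<lambda>y :: ('k, 'm, 'n) KG. counit (compL Q y)"
  have a: "klin ?a" by (rule klin_closed(2)[OF klin_closed(1) kend_wcomp])
  have "lc ?a ?x = 0"
    by (rule tensor_sub_vanish[OF x]) (simp_all add: lc_add lc_scale lc_tensor a counit_compL_borel)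
  then have "lc ?a (comult f) = lc ?a (tensor (character \<mu>) f)"
    using lc_add[OF a, of ?x "tensor (character \<mu>) f"] by simp
  then have "Lop ?a f = kg_scale (counit (compL Q (character \<mu>))) f" by (simp add: Lop_def lc_tensor a)
  moreover have "Lop ?a f = compL Q f"
    using Lop_compL[OF char klin_closed(1), of Q f] by (simp add: Lop_counit[OF char])
  ultimately show "compL Q f = (if Q \<mu> then f else 0)"
    by (simp add: wcomp_bihom[OF bihom_character] counit_character)
  have "piLU ?x = 0"
    by (rule tensor_sub_vanish[OF x]) (simp_all add: piLU_add piLU_scale piLU_tensor piL_borel)
  then show "piLU (comult f) = piL (character \<mu>) * piU f"
    using piLU_add[of ?x "tensor (character \<mu>) f"] by (simp add: piLU_tensor)
qed

text \<open>Such an f has biweight (\<mu>, \<mu>), so it is constant on unipotent upper triangular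
  matrices, with value \<open>counit f\<close> = 0. Hence it vanishes on the big cell. In other
  words, the weight space of \<mu> in \<open>H0_minus \<mu>\<close> has dimension at most
  one.\<close>

lemma H0_minus_unique:
  fixes f :: "('k, 'm::{finite,linorder}, 'n::{finite,linorder}) KG"
  assumes "f \<in> H0_minus \<mu>" "compR (\<lambda>\<nu>. \<nu> = \<mu>) f = f" "counit f = 0"
  shows "f = 0"
proof -
  have "compL (\<lambda>\<nu>. \<nu> = \<mu>) (compR (\<lambda>\<nu>. \<nu> = \<mu>) f) = f"
    using assms(2) H0_minusD(1)[OF assms(1), of "\<lambda>\<nu>. \<nu> = \<mu>"] by simp
  moreover have "(\<lambda>g. fst g = \<mu> \<and> snd g = \<mu>) = (\<lambda>g. g = (\<mu>, \<mu>))" by (simp add: prod_eq_iff fun_eq_iff)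
  ultimately have "wcomp (\<lambda>g. g = (\<mu>, \<mu>)) f = f" by (simp add: wcomp_wcomp)
  then have "piU f = op_scale (counit f) 1" using piU_wcomp[of \<mu> f] by simp
  then have "piU f = 0" using assms(3) by simp
  then have "piLU (comult f) = 0" using H0_minusD(2)[OF assms(1)] by simp
  then show ?thesis by (rule big_cell_dense[OF char])
qed

lemma H0_minus_subspace: "KG.subspace (H0_minus \<mu> :: ('k, 'm::{finite,linorder}, 'n::{finite,linorder}) KG set)"
proof -
  have ts: "KG2.subspace (tensor_sub borel_ideal UNIV :: ('k, 'm, 'n) KG2 set)"
    by (simp add: tensor_sub_def KG2.subspace_span)
  show ?thesis unfolding KG.subspace_def
  proof (intro conjI ballI allI)
    have "comult (0 :: ('k, 'm, 'n) KG) = 0" using comult_scale[OF char, of 0 "0 :: ('k, 'm, 'n) KG"] by simp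
    then show "(0 :: ('k, 'm, 'n) KG) \<in> H0_minus \<mu>" by (simp add: H0_minus_def KG2.subspace_0[OF ts])
    fix x y :: "('k, 'm, 'n) KG" assume "x \<in> H0_minus \<mu>" "y \<in> H0_minus \<mu>"
    then have "comult x - tensor (character \<mu>) x + (comult y - tensor (character \<mu>) y) \<in> tensor_sub borel_ideal UNIV"
      unfolding H0_minus_def by (intro KG2.subspace_add[OF ts]) auto
    then show "x + y \<in> H0_minus \<mu>" by (simp add: H0_minus_def comult_add[OF char] tensor_add_right algebra_simps)
  next
    fix c and x :: "('k, 'm, 'n) KG" assume "x \<in> H0_minus \<mu>"
    then have "tensor_scale c (comult x - tensor (character \<mu>) x) \<in> tensor_sub borel_ideal UNIV"
      unfolding H0_minus_def by (intro KG2.subspace_scale[OF ts]) auto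
    then show "kg_scale c x \<in> H0_minus \<mu>"
      by (simp add: H0_minus_def comult_scale[OF char] tensor_scale_right KG2.scale_right_diff_distrib)
  qed
qed

text \<open>Frobenius reciprocity.\<close>

lemma H0_minus_vector:
  fixes S :: "('k, 'm::{finite,linorder}, 'n::{finite,linorder}) KG set"
  assumes S: "subsupermodule S" "S \<noteq> {0}" "S \<subseteq> H0_minus \<mu>"
  obtains g where "g \<in> S" "compR (\<lambda>\<nu>. \<nu> = \<mu>) g = g" "counit g = 1"
proof -
  have sub: "KG.subspace S" using S(1) by (simp add: subsupermodule_def)
  obtain f where f: "f \<in> S" "f \<noteq> 0" using S(2) KG.subspace_0[OF sub] by blast
  then obtain \<gamma> :: "('k, 'm, 'n) functional" where \<gamma>: "klin \<gamma>" "\<gamma> f \<noteq> 0" using KG_eqI[of f 0] klin_0 by metis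
  \<comment> \<open>Any \<gamma> with nonzero value at f works: f has left weight \<mu> and the
    counit does not distinguish left from right weights, so the weight \<mu> part of
    \<open>Rop \<gamma> f\<close> has counit \<gamma>(f).\<close>
  define h where "h = compR (\<lambda>\<nu>. \<nu> = \<mu>) (Rop \<gamma> f)"
  have "Rop \<gamma> f \<in> S" using S(1) f(1) \<gamma>(1) by (simp add: subsupermodule_iff)
  then have hS: "h \<in> S" unfolding h_def by (rule compR_mem[OF S(1)])
  have "counit h = counit (compL (\<lambda>\<nu>. \<nu> = \<mu>) (Rop \<gamma> f))"
    unfolding h_def by (rule counit_compL[of "\<lambda>\<nu>. \<nu> = \<mu>", symmetric])
  also have "\<dots> = counit (Rop \<gamma> (compL (\<lambda>\<nu>. \<nu> = \<mu>) f))" by (simp only: Rop_compL[OF char \<gamma>(1), of "\<lambda>\<nu>. \<nu> = \<mu>"])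
  also have "\<dots> = counit (Rop \<gamma> f)" using H0_minusD(1)[of f \<mu> "\<lambda>\<nu>. \<nu> = \<mu>"] f(1) S(3) by auto
  also have "\<dots> = \<gamma> f" using apply_Rop[OF klin_closed(1) \<gamma>(1), of f] by (simp add: Lop_counit[OF char])
  finally have c: "counit h = \<gamma> f" .
  show ?thesis
  proof (rule that[of "kg_scale (1 / \<gamma> f) h"])
    show "kg_scale (1 / \<gamma> f) h \<in> S" by (rule KG.subspace_scale[OF sub hS])
    show "compR (\<lambda>\<nu>. \<nu> = \<mu>) (kg_scale (1 / \<gamma> f) h) = kg_scale (1 / \<gamma> f) h"
      by (simp add: wcomp_scale h_def wcomp_wcomp)
    show "counit (kg_scale (1 / \<gamma> f) h) = 1" using c \<gamma>(2) by simp
  qed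
qed

text \<open>The vectors of weight \<mu> with counit 1 in the two supermodules coincide, so the
  supermodules intersect nontrivially.\<close>

lemma H0_minus_simple_unique:
  fixes S S' :: "('k, 'm::{finite,linorder}, 'n::{finite,linorder}) KG set"
  assumes S: "simple_supermodule S" "S \<subseteq> H0_minus \<mu>" and S': "simple_supermodule S'" "S' \<subseteq> H0_minus \<mu>"
  shows "S = S'"
proof -
  have s: "subsupermodule S" "S \<noteq> {0}" "subsupermodule S'" "S' \<noteq> {0}" using S(1) S'(1) by (auto simp: simple_supermodule_def)
  obtain g where g: "g \<in> S" "compR (\<lambda>\<nu>. \<nu> = \<mu>) g = g" "counit g = 1" using H0_minus_vector[OF s(1,2) S(2)] by blast
  obtain g' where g': "g' \<in> S'" "compR (\<lambda>\<nu>. \<nu> = \<mu>) g' = g'" "counit g' = 1" using H0_minus_vector[OF s(3,4) S'(2)] by blast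
  have "g - g' = 0"
  proof (rule H0_minus_unique[of _ \<mu>])
    show "g - g' \<in> H0_minus \<mu>" using g(1) g'(1) S(2) S'(2) by (intro KG.subspace_diff[OF H0_minus_subspace]) auto
  qed (simp_all add: kend_diff[OF kend_wcomp] g g')
  then have gg: "g = g'" by simp
  have "subsupermodule (S \<inter> S')" using s(1,3) by (auto simp: subsupermodule_iff KG.subspace_inter)
  moreover have "S \<inter> S' \<noteq> {0}"
  proof
    assume "S \<inter> S' = {0}"
    then have "g = 0" using gg g(1) g'(1) by blast
    then show False using g(3) by simp
  qed
  ultimately have "S \<inter> S' = S" "S \<inter> S' = S'" using S(1) S'(1) by (auto simp: simple_supermodule_def)
  then show ?thesis by simp
qed

text \<open>The sum defining the socle has a single summand, so exhibiting one simple subsupermodule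
  of \<open>H0_minus \<mu>\<close> identifies \<open>L_minus \<mu>\<close>.\<close>

lemma L_minus_eq:
  fixes S :: "('k, 'm::{finite,linorder}, 'n::{finite,linorder}) KG set"
  assumes "simple_supermodule S" "S \<subseteq> H0_minus \<mu>"
  shows "L_minus \<mu> = S"
proof -
  have "\<Union>{V. simple_supermodule V \<and> V \<subseteq> H0_minus \<mu>} = S"
    using H0_minus_simple_unique[OF _ _ assms] assms by blast
  moreover have "KG.span S = S" using assms(1) by (simp add: simple_supermodule_def subsupermodule_def KG.span_eq_iff)
  ultimately show ?thesis by (simp add: L_minus_def socle_def)
qed

lemma L_minus_subset: "L_minus \<mu> \<subseteq> (H0_minus \<mu> :: ('k, 'm::{finite,linorder}, 'n::{finite,linorder}) KG set)"
  unfolding L_minus_def socle_def by (rule KG.span_minimal[OF _ H0_minus_subspace]) blast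

section \<open>Translations by permutation matrices: symmetry of weights in each even block\<close>

section \<open>Permutation matrices\<close>

text \<open>Evaluation at a block permutation matrix: odd coordinates vanish there and the block
  determinants are the signs. The value at \<open>det_inv\<close> is a sign, of which only the
  square is recorded.\<close>

lemma permutation_point:
  fixes \<sigma> :: "'m::{finite,linorder} \<Rightarrow> 'm" and \<tau> :: "'n::{finite,linorder} \<Rightarrow> 'n"
  assumes p: "\<sigma> permutes UNIV" "\<tau> permutes UNIV"
  obtains ev :: "('k, 'm, 'n) functional" where "klin ev" "ev 1 = 1" "\<And>f g. ev (f * g) = ev f * ev g"
    "\<And>i j. ev (coord i j) = (if j = map_sum \<sigma> \<tau> i then 1 else 0)" "ev det_inv * ev det_inv = 1"
proof -
  define h :: "('m, 'n) gen \<Rightarrow> 'k" where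
    "h = case_gen (\<lambda>i j. if j = map_sum \<sigma> \<tau> i then 1 else 0) (of_int (sign \<sigma> * sign \<tau>))"
  have h: "h (Coord i j) = (if j = map_sum \<sigma> \<tau> i then 1 else 0)" "h DetInv = of_int (sign \<sigma> * sign \<tau>)" for i j
    by (simp_all add: h_def)
  have sq: "of_int (sign \<pi>) * of_int (sign \<pi>) = (1 :: 'k)" for \<pi> :: "'n \<Rightarrow> 'n"
    by (cases \<pi> rule: sign_cases) simp_all
  have sq': "of_int (sign \<pi>) * of_int (sign \<pi>) = (1 :: 'k)" for \<pi> :: "'m \<Rightarrow> 'm"
    by (cases \<pi> rule: sign_cases) simp_all
  have odd: "h x = 0" if "gen_parity x" for x
  proof (cases x)
    case (Coord i j)
    then show ?thesis using that by (cases i; cases j) (simp_all add: h)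
  qed (use that in simp)
  have "\<exists>H :: ('k, 'm, 'n) KG \<Rightarrow> 'k. Vector_Spaces.linear kg_scale (*) H \<and> H 1 = 1 \<and> (\<forall>f g. H (f * g) = H f * H g) \<and>
     (\<forall>i j. H (coord i j) = h (Coord i j)) \<and> H det_inv = h DetInv"
  proof (rule KG_hom_exists[OF vector_space_field])
    show "h x * h y = (if gen_parity x \<and> gen_parity y then - (h y * h x) else h y * h x)" for x y
      using odd by simp
    have "pdet (\<lambda>i j. h (Coord (Inl i) (Inl j))) = of_int (sign \<sigma>)" "pdet (\<lambda>i j. h (Coord (Inr i) (Inr j))) = of_int (sign \<tau>)"
      by (simp_all add: h pdet_permutation p)
    then show "h DetInv * (pdet (\<lambda>i j. h (Coord (Inl i) (Inl j))) * pdet (\<lambda>i j. h (Coord (Inr i) (Inr j)))) = 1"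
      using sq[of \<tau>] sq'[of \<sigma>] by (simp add: h algebra_simps)
  qed simp_all
  then obtain H :: "('k, 'm, 'n) KG \<Rightarrow> 'k" where H: "Vector_Spaces.linear kg_scale (*) H" "H 1 = 1" "\<And>f g. H (f * g) = H f * H g"
    "\<And>i j. H (coord i j) = h (Coord i j)" "H det_inv = h DetInv" by blast
  show ?thesis
    by (rule that[of H]) (use H sq[of \<tau>] sq'[of \<sigma>] in \<open>auto simp: klin_iff_linear h algebra_simps\<close>)
qed

text \<open>Right translation by an involutive permutation matrix.\<close>

lemma permutation_translate:
  fixes \<sigma> :: "'m::{finite,linorder} \<Rightarrow> 'm" and \<tau> :: "'n::{finite,linorder} \<Rightarrow> 'n"
  assumes p: "\<sigma> permutes UNIV" "\<tau> permutes UNIV" and inv: "\<And>i. \<sigma> (\<sigma> i) = i" "\<And>i. \<tau> (\<tau> i) = i"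
  obtains ev :: "('k, 'm, 'n) functional" where "klin ev" "\<And>f. Rop ev (Rop ev f) = f"
    "\<And>Q f. Rop ev (compR Q f) = compR (\<lambda>\<kappa>. Q (\<lambda>i. \<kappa> (map_sum \<sigma> \<tau> i))) (Rop ev f)"
proof -
  define s where "s = map_sum \<sigma> \<tau>"
  have ss: "s (s i) = i" for i by (cases i) (simp_all add: s_def inv)
  have isl: "isl (s i) = isl i" for i by (cases i) (simp_all add: s_def)
  obtain ev :: "('k, 'm, 'n) functional" where ev: "klin ev" "ev 1 = 1" "\<And>f g. ev (f * g) = ev f * ev g"
    "\<And>i j. ev (coord i j) = (if j = s i then 1 else 0)" "ev det_inv * ev det_inv = 1"
    using permutation_point[OF p] unfolding s_def by metis
  have dinv2: "ev dinv * ev dinv = 1"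
  proof -
    have "ev (det_inv ^ n) * ev (det_inv ^ n) = 1" for n
    proof (induction n)
      case (Suc n)
      have "ev (det_inv ^ Suc n) * ev (det_inv ^ Suc n) = (ev det_inv * ev det_inv) * (ev (det_inv ^ n) * ev (det_inv ^ n))"
        by (simp add: ev(3) algebra_simps)
      then show ?case using Suc ev(5) by simp
    qed (simp add: ev(2))
    then show ?thesis by (simp add: dinv_def)
  qed
  have coord: "Rop ev (coord i j * f) = coord i (s j) * Rop ev f" for i j f
  proof -
    have "coord i k * sg (isl k \<noteq> isl j) (Rop (\<lambda>y. ev (coord k j * y)) f) = (if k = s j then coord i (s j) * Rop ev f else 0)" for k
      using ss[of k] ss[of j] isl[of j] by (auto simp: ev(3,4) Rop_fun_scale kendD[OF kend_sg] kend_0[OF kend_sg])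
    then show ?thesis by (simp add: Rop_coord[OF char ev(1)])
  qed
  have dinv: "Rop ev (dinv * f) = kg_scale (ev dinv) (dinv * Rop ev f)" for f
    by (simp add: Rop_dinv[OF char ev(1)] ev(3) Rop_fun_scale kg_scale_mult)
  note lin = kendD[OF kend_Rop[OF char ev(1)]]
  have 1: "Rop ev (Rop ev f) = f" for f
    by (induction f rule: KG_induct[OF char, case_names one add scale coord dinv])
      (simp_all add: coord dinv lin ss dinv2 Rop_1[OF char ev(1)] ev(2))
  have unit: "(\<lambda>k. unit_weight (s i) (s k)) = unit_weight i" for i
  proof
    fix k
    have "s k = s i \<longleftrightarrow> k = i" using ss[of k] ss[of i] by metis
    then show "unit_weight (s i) (s k) = unit_weight i k" by (simp add: unit_weight_def)
  qed
  \<comment> \<open>The analogue of \<open>counit_wcomp\<close>: only biweights whose left component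
    is the permuted right component survive evaluation at this matrix.\<close>
  have "\<forall>P. ev (wcomp P f) = ev (wcomp (\<lambda>g. P g \<and> fst g = (\<lambda>k. snd g (s k))) f)" for f
  proof (induction f rule: KG_span_induct)
    case one
    show ?case by (simp add: wcomp_1 klin_0[OF ev(1)] zero_fun_def)
  next
    case (coord i j f)
    show ?case
    proof (cases "j = s i")
      case True
      have "(unit_weight i + fst x = (\<lambda>k. (unit_weight j + snd x) (s k))) = (fst x = (\<lambda>k. snd x (s k)))" for x :: "('m, 'n) biweight"
        using unit[of i] by (auto simp: True fun_eq_iff)
      then show ?thesis using coord by (simp add: wcomp_coord ev(3,4))
    next
      case False
      then show ?thesis by (simp add: wcomp_coord ev(3,4))
    qed
  next
    case (det_inv f)
    have "(- 1 + fst x = (\<lambda>k. (- 1 + snd x) (s k))) = (fst x = (\<lambda>k. snd x (s k)))" for x :: "('m, 'n) biweight"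
      by (auto simp: fun_eq_iff)
    then show ?case using det_inv by (simp add: bihomD[OF bihom_det_inv] ev(3))
  qed (simp_all add: wcomp_1 wcomp_add wcomp_scale klinD[OF ev(1)] klin_0[OF ev(1)])
  then have evw: "ev (wcomp P f) = ev (wcomp (\<lambda>g. P g \<and> fst g = (\<lambda>k. snd g (s k))) f)" for P f by blast
  have evLR: "ev (compR Q f) = ev (compL (\<lambda>\<kappa>. Q (\<lambda>i. \<kappa> (s i))) f)" for Q f
  proof -
    have "(\<lambda>g. Q (snd g) \<and> fst g = (\<lambda>k. snd g (s k))) = (\<lambda>g :: ('m, 'n) biweight. Q (\<lambda>i. fst g (s i)) \<and> fst g = (\<lambda>k. snd g (s k)))"
      using ss by (auto simp: fun_eq_iff)
    then show ?thesis using evw[of "\<lambda>g. Q (snd g)" f] evw[of "\<lambda>g. Q (\<lambda>i. fst g (s i))" f] by simp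
  qed
  have 2: "Rop ev (compR Q f) = compR (\<lambda>\<kappa>. Q (\<lambda>i. \<kappa> (s i))) (Rop ev f)" for Q f
    by (simp only: Rop_compR[OF char ev(1)] evLR compR_Rop[OF char ev(1), of "\<lambda>\<kappa>. Q (\<lambda>i. \<kappa> (s i))"])
  show ?thesis using that[of ev] ev(1) 1 2 unfolding s_def by blast
qed

end

section \<open>Classification of the simple subquotients in a given degree, and the identification
  of \<open>C_Gamma\<close>\<close>

section \<open>The homogeneous components of the coordinate superalgebra\<close>

definition has_degree :: "int \<Rightarrow> ('m::finite, 'n::finite) weight \<Rightarrow> bool" where
  "has_degree l \<mu> \<longleftrightarrow> (\<Sum>i\<in>UNIV. \<mu> i) = l"

definition Kdeg :: "int \<Rightarrow> ('k::field, 'm::{finite,linorder}, 'n::{finite,linorder}) KG set" where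
  "Kdeg l = {f. compR (has_degree l) f = f}"

lemma sum_unit_weight_1: "(\<Sum>i\<in>UNIV. unit_weight (j :: 'm::finite + 'n::finite) i) = 1"
  by (simp add: unit_weight_def)

text \<open>Every coordinate adds 1 to both the left and the right degree, and
  \<open>det_inv\<close> subtracts m + n from both. Hence the decomposition by degree is compatible
  with contractions on either side.\<close>

lemma wcomp_deg:
  "wcomp (\<lambda>g. P (\<Sum>i\<in>UNIV. fst g i)) f = wcomp (\<lambda>g. P (\<Sum>i\<in>UNIV. snd g i)) f"
proof -
  have "\<forall>P. wcomp (\<lambda>g. P (\<Sum>i\<in>UNIV. fst g i)) f = wcomp (\<lambda>g. P (\<Sum>i\<in>UNIV. snd g i)) f"
  proof (induction f rule: KG_span_induct)
    case (coord i j f)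
    show ?case
    proof
      fix P
      show "wcomp (\<lambda>g. P (\<Sum>i\<in>UNIV. fst g i)) (coord i j * f) = wcomp (\<lambda>g. P (\<Sum>i\<in>UNIV. snd g i)) (coord i j * f)"
        using spec[OF coord, of "\<lambda>d. P (1 + d)"] by (simp add: wcomp_coord sum.distrib sum_unit_weight_1)
    qed
  next
    case (det_inv f)
    show ?case
    proof
      fix P
      show "wcomp (\<lambda>g. P (\<Sum>i\<in>UNIV. fst g i)) (det_inv * f) = wcomp (\<lambda>g. P (\<Sum>i\<in>UNIV. snd g i)) (det_inv * f)"
        using spec[OF det_inv, of "\<lambda>d. P (d - int CARD('b + 'c))"]
        by (simp add: bihomD[OF bihom_det_inv] sum_subtractf)
    qed
  qed (simp_all add: wcomp_1 wcomp_add wcomp_scale)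
  then show ?thesis by blast
qed

lemma compL_has_degree: "compL (has_degree l) f = compR (has_degree l) f"
  unfolding has_degree_def by (rule wcomp_deg)

lemma Kdeg_subspace: "KG.subspace (Kdeg l)"
  by (auto simp: KG.subspace_def Kdeg_def kend_0[OF kend_wcomp] wcomp_add wcomp_scale)

text \<open>The transposition changes the height by (rk j - rk i)(\<mu> j - \<mu> i).\<close>

lemma dominant_transpose:
  assumes le: "idx_less i j" and h: "height (\<lambda>k. \<mu> (Transposition.transpose i j k)) \<le> height \<mu>"
  shows "\<mu> j \<le> \<mu> i"
proof -
  let ?t = "Transposition.transpose i j"
  have ij: "i \<noteq> j" using le by auto
  have "(\<Sum>k\<in>UNIV. int (rk k) * (\<mu> k - \<mu> (?t k))) = (\<Sum>k\<in>{i, j}. int (rk k) * (\<mu> k - \<mu> (?t k)))"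
    by (rule sum.mono_neutral_right) (auto simp: Transposition.transpose_def)
  also have "\<dots> = (int (rk j) - int (rk i)) * (\<mu> j - \<mu> i)"
    using ij by (simp add: algebra_simps)
  finally have "(int (rk j) - int (rk i)) * (\<mu> j - \<mu> i) = height (\<lambda>k. \<mu> (?t k)) - height \<mu>"
    by (simp add: height_def right_diff_distrib sum_subtractf)
  then have "(int (rk j) - int (rk i)) * (\<mu> j - \<mu> i) \<le> 0" using h by simp
  then show ?thesis using rk_less[OF le] by (simp add: mult_le_0_iff)
qed

context
  assumes char: "CHAR('k::field) > 2"
begin

text \<open>\<open>Rop \<gamma>\<close> commutes with projections onto left weights, and the left
  degree equals the right degree.\<close>

lemma subsupermodule_Kdeg: "subsupermodule (Kdeg l :: ('k, 'm::{finite,linorder}, 'n::{finite,linorder}) KG set)"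
  unfolding subsupermodule_iff
proof (intro conjI ballI allI impI Kdeg_subspace)
  fix f :: "('k, 'm, 'n) KG" and p and \<gamma> :: "('k, 'm, 'n) functional"
  assume f: "f \<in> Kdeg l"
  then have e: "compR (has_degree l) f = f" by (simp add: Kdeg_def)
  show "part p f \<in> Kdeg l" using part_wcomp[of p "\<lambda>g. has_degree l (snd g)" f] e by (simp add: Kdeg_def)
  assume \<gamma>: "klin \<gamma>"
  have "compR (has_degree l) (Rop \<gamma> f) = compL (has_degree l) (Rop \<gamma> f)" by (rule compL_has_degree[symmetric])
  also have "\<dots> = Rop \<gamma> (compL (has_degree l) f)" by (rule Rop_compL[OF char \<gamma>, symmetric])
  also have "\<dots> = Rop \<gamma> f" by (simp only: compL_has_degree e)
  finally show "Rop \<gamma> f \<in> Kdeg l" by (simp add: Kdeg_def)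
qed

lemma L_minus_Kdeg:
  assumes "(\<Sum>i\<in>UNIV. \<mu> i) = l"
  shows "L_minus \<mu> \<subseteq> (Kdeg l :: ('k, 'm::{finite,linorder}, 'n::{finite,linorder}) KG set)"
proof
  fix f :: "('k, 'm, 'n) KG" assume "f \<in> L_minus \<mu>"
  then have "f \<in> H0_minus \<mu>" using L_minus_subset[OF char] by blast
  moreover have "has_degree l \<mu>" using assms by (simp add: has_degree_def)
  ultimately have "compL (has_degree l) f = f" using H0_minusD(1)[OF char, of f \<mu> "has_degree l"] by simp
  then show "f \<in> Kdeg l" by (simp add: Kdeg_def compL_has_degree)
qed

text \<open>For y of right weight \<kappa>, the restriction of \<open>Lop \<theta> y\<close> to the
  Borel subsupergroup has biweight (\<mu>, \<kappa>): it is zero, or a multiple of the character if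
  \<kappa> = \<mu>, or \<kappa> is higher than \<mu>, and then y lies in \<open>V\<close> and its
  image is zero. So on all of \<open>W\<close> the restriction is \<theta>(y) times the character,
  which is Frobenius reciprocity in the other direction.\<close>

lemma highest_weight_embedding:
  fixes W V :: "('k, 'm::{finite,linorder}, 'n::{finite,linorder}) KG set"
  assumes W: "subsupermodule W" and V: "subsupermodule V"
    and \<theta>: "klin \<theta>" "\<And>v. v \<in> V \<Longrightarrow> \<theta> v = 0" "\<And>y. \<theta> (compR (\<lambda>\<nu>. \<nu> = \<mu>) y) = \<theta> y"
    and max: "\<And>\<kappa> x. x \<in> W \<Longrightarrow> height \<mu> < height \<kappa> \<Longrightarrow> compR (\<lambda>\<nu>. \<nu> = \<kappa>) x \<in> V"
    and y: "y \<in> W"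
  shows "Lop \<theta> y \<in> H0_minus \<mu>"
proof -
  have kL: "kend (Lop \<theta>)" by (rule kend_Lop[OF char \<theta>(1)])
  have LV: "Lop \<theta> v = 0" if "v \<in> V" for v
    by (rule Lop_vanish[OF char \<theta>(1)]) (use \<theta>(2) V that in \<open>auto simp: subsupermodule_iff\<close>)
  have ceq: "counit (Lop \<theta> z) = \<theta> z" for z
    using apply_Rop[OF \<theta>(1) klin_closed(1), of z] by (simp add: Rop_counit[OF char])
  have wt: "compL (\<lambda>\<nu>. \<nu> = \<mu>) (Lop \<theta> z) = Lop \<theta> z" for z
    using compL_Lop[OF char \<theta>(1), of "\<lambda>\<nu>. \<nu> = \<mu>" z] by (simp add: \<theta>(3))
  have key: "Lop \<theta> z - kg_scale (\<theta> z) (character \<mu>) \<in> borel_ideal"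
    if z: "z \<in> W" "compR (\<lambda>\<nu>. \<nu> = \<kappa>) z = z" for z \<kappa>
  proof -
    have "compL (\<lambda>\<nu>. \<nu> = \<mu>) (compR (\<lambda>\<nu>. \<nu> = \<kappa>) (Lop \<theta> z)) = Lop \<theta> z"
      using Lop_compR[OF char \<theta>(1), of "\<lambda>\<nu>. \<nu> = \<kappa>" z] wt[of z] z(2) by simp
    moreover have "(\<lambda>g. fst g = \<mu> \<and> snd g = \<kappa>) = (\<lambda>g. g = (\<mu>, \<kappa>))" by (simp add: prod_eq_iff fun_eq_iff)
    ultimately have g: "wcomp (\<lambda>g. g = (\<mu>, \<kappa>)) (Lop \<theta> z) = Lop \<theta> z" by (simp add: wcomp_wcomp)
    have "Lop \<theta> z \<in> borel_ideal \<or> height \<mu> < height \<kappa> \<or> \<mu> = \<kappa> \<and> beq (Lop \<theta> z) (kg_scale (\<theta> z) (character \<mu>))"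
      using wcomp_mod_borel[of \<mu> \<kappa> "Lop \<theta> z"] by (simp add: g ceq Let_def)
    then show ?thesis
    proof (elim disjE)
      assume b: "Lop \<theta> z \<in> borel_ideal"
      then have "\<theta> z = 0" using counit_borel ceq by metis
      then show ?thesis using b by simp
    next
      assume "height \<mu> < height \<kappa>"
      then have "z \<in> V" using max[OF z(1), of \<kappa>] z(2) by simp
      then show ?thesis using LV \<theta>(2) by (simp add: borel_0)
    qed (auto simp: beq_def)
  qed
  have all: "Lop \<theta> z - kg_scale (\<theta> z) (character \<mu>) \<in> borel_ideal" if z: "z \<in> W" for z
  proof -
    obtain D where D: "z = (\<Sum>\<kappa>\<in>D. compR (\<lambda>\<nu>. \<nu> = \<kappa>) z)" using wcomp_sum[of z snd] by metis
    let ?z = "\<lambda>\<kappa>. compR (\<lambda>\<nu>. \<nu> = \<kappa>) z"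
    have "(\<Sum>\<kappa>\<in>D. Lop \<theta> (?z \<kappa>) - kg_scale (\<theta> (?z \<kappa>)) (character \<mu>)) \<in> borel_ideal"
    proof (rule KG.subspace_sum[OF borel_subspace])
      fix \<kappa> show "Lop \<theta> (?z \<kappa>) - kg_scale (\<theta> (?z \<kappa>)) (character \<mu>) \<in> borel_ideal"
        by (rule key[of _ \<kappa>]) (rule compR_mem[OF char W z], simp add: wcomp_wcomp)
    qed
    moreover have "(\<Sum>\<kappa>\<in>D. Lop \<theta> (?z \<kappa>) - kg_scale (\<theta> (?z \<kappa>)) (character \<mu>)) =
        Lop \<theta> (\<Sum>\<kappa>\<in>D. ?z \<kappa>) - kg_scale (\<theta> (\<Sum>\<kappa>\<in>D. ?z \<kappa>)) (character \<mu>)"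
      by (simp add: sum_subtractf kend_sum[OF kL] klin_sum[OF \<theta>(1)] KG.scale_sum_left)
    ultimately show ?thesis using D by simp
  qed
  \<comment> \<open>Contraction with \<gamma> commutes with \<open>Lop \<theta>\<close> and so
    replaces y by \<open>Rop \<gamma> y\<close>, again an element of \<open>W\<close>.\<close>
  have "rc \<gamma> (comult (Lop \<theta> y) - tensor (character \<mu>) (Lop \<theta> y)) \<in> borel_ideal" if \<gamma>: "klin \<gamma>" for \<gamma> :: "('k, 'm, 'n) functional"
  proof -
    have "rc \<gamma> (comult (Lop \<theta> y) - tensor (character \<mu>) (Lop \<theta> y)) = Rop \<gamma> (Lop \<theta> y) - kg_scale (\<gamma> (Lop \<theta> y)) (character \<mu>)"
      using rc_add[OF \<gamma>, of "comult (Lop \<theta> y) - tensor (character \<mu>) (Lop \<theta> y)" "tensor (character \<mu>) (Lop \<theta> y)"]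
      by (simp add: Rop_def rc_tensor[OF \<gamma>])
    also have "\<dots> = Lop \<theta> (Rop \<gamma> y) - kg_scale (\<theta> (Rop \<gamma> y)) (character \<mu>)"
      by (simp add: Lop_Rop[OF char \<theta>(1) \<gamma>] apply_Rop[OF \<theta>(1) \<gamma>])
    also have "\<dots> \<in> borel_ideal" using W y \<gamma> by (intro all) (simp add: subsupermodule_iff)
    finally show ?thesis .
  qed
  then show ?thesis by (simp add: H0_minus_def tensor_sub_UNIV_iff[OF borel_subspace])
qed

lemma subsupermodule_sum:
  fixes V N :: "('k, 'm::{finite,linorder}, 'n::{finite,linorder}) KG set"
  assumes "subsupermodule V" "subsupermodule N"
  shows "subsupermodule {x + y | x y. x \<in> V \<and> y \<in> N}"
  unfolding subsupermodule_iff
proof (intro conjI ballI allI impI)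
  show "KG.subspace {x + y | x y. x \<in> V \<and> y \<in> N}"
    using assms by (intro KG.subspace_sums) (simp_all add: subsupermodule_iff)
  fix f p and \<gamma> :: "('k, 'm, 'n) functional" assume "f \<in> {x + y | x y. x \<in> V \<and> y \<in> N}"
  then obtain x y where f: "f = x + y" "x \<in> V" "y \<in> N" by blast
  show "part p f \<in> {x + y | x y. x \<in> V \<and> y \<in> N}"
    using assms f by (intro CollectI exI[of _ "part p x"] exI[of _ "part p y"]) (simp add: part_add subsupermodule_iff)
  assume \<gamma>: "klin \<gamma>"
  then show "Rop \<gamma> f \<in> {x + y | x y. x \<in> V \<and> y \<in> N}"
    using assms f by (intro CollectI exI[of _ "Rop \<gamma> x"] exI[of _ "Rop \<gamma> y"])
      (simp add: kendD[OF kend_Rop[OF char \<gamma>]] subsupermodule_iff)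
qed

lemma nonzero_part:
  fixes V :: "('k, 'm::{finite,linorder}, 'n::{finite,linorder}) KG set"
  assumes "KG.subspace V" "f \<notin> V"
  shows "\<exists>p. part p f \<notin> V"
  using KG.subspace_add[OF assms(1), of "part True f" "part False f"] assms(2) by (metis part_split)

text \<open>A simple subquotient is generated by a vector of maximal height, so it has finitely many weights.\<close>

lemma factor_highest_weight:
  fixes W V :: "('k, 'm::{finite,linorder}, 'n::{finite,linorder}) KG set"
  assumes W: "subsupermodule W" and V: "subsupermodule V" and VW: "V \<subset> W"
    and simple: "\<And>U. subsupermodule U \<Longrightarrow> V \<subseteq> U \<Longrightarrow> U \<subseteq> W \<Longrightarrow> U = V \<or> U = W"
  obtains \<mu> a p where "a \<in> W" "a \<notin> V" "compR (\<lambda>\<nu>. \<nu> = \<mu>) a = a" "parity p a"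
    "\<And>\<kappa> x. x \<in> W \<Longrightarrow> height \<mu> < height \<kappa> \<Longrightarrow> compR (\<lambda>\<nu>. \<nu> = \<kappa>) x \<in> V"
proof -
  have sV: "KG.subspace V" using V by (simp add: subsupermodule_iff)
  obtain w0 where "w0 \<in> W" "w0 \<notin> V" using VW by blast
  moreover obtain r where "part r w0 \<notin> V" using nonzero_part[OF sV \<open>w0 \<notin> V\<close>] by blast
  ultimately obtain w where w: "w \<in> W" "w \<notin> V" "parity r w"
    using W parity_part[of r w0] by (auto simp: subsupermodule_iff)
  note N = subsupermodule_gen_sub[OF char w(3)]
  have "gen_sub w \<subseteq> W" using W w(1) by (auto simp: subsupermodule_iff gen_sub_def)
  let ?U = "{x + y | x y. x \<in> V \<and> y \<in> gen_sub w}"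
  have "V \<subseteq> ?U"
  proof
    fix v assume "v \<in> V"
    moreover have "0 \<in> gen_sub w" using N(1) KG.subspace_0 by (auto simp: subsupermodule_iff)
    ultimately show "v \<in> ?U" by force
  qed
  moreover have "w \<in> ?U" using N(2) KG.subspace_0[OF sV] by force
  moreover have "?U \<subseteq> W"
    using VW \<open>gen_sub w \<subseteq> W\<close> KG.subspace_add[of W] W by (auto simp: subsupermodule_iff)
  ultimately have UW: "?U = W" using simple[OF subsupermodule_sum[OF V N(1)]] w(2) by blast
  obtain A where A: "finite A" "gen_sub w \<subseteq> KG.span A" by (rule gen_sub_finite)
  obtain F where F: "finite F" "\<And>x \<kappa>. x \<in> KG.span A \<Longrightarrow> \<kappa> \<notin> F \<Longrightarrow> compR (\<lambda>\<nu>. \<nu> = \<kappa>) x = 0"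
    by (rule span_weights_finite[OF A(1)], rule that)
  \<comment> \<open>The weights of W / V. By simplicity W is the sum of V and the finite-dimensional
    \<open>gen_sub w\<close>, so all of them are weights of \<open>gen_sub w\<close>.\<close>
  define M where "M = {\<kappa>. \<exists>x\<in>W. compR (\<lambda>\<nu>. \<nu> = \<kappa>) x \<notin> V}"
  have "M \<subseteq> F"
  proof
    fix \<kappa> assume "\<kappa> \<in> M"
    then obtain x where x: "x \<in> W" "compR (\<lambda>\<nu>. \<nu> = \<kappa>) x \<notin> V" by (auto simp: M_def)
    then obtain v n where vn: "x = v + n" "v \<in> V" "n \<in> gen_sub w" using UW by blast
    have "compR (\<lambda>\<nu>. \<nu> = \<kappa>) v \<in> V" by (rule compR_mem[OF char V vn(2)])
    then have "compR (\<lambda>\<nu>. \<nu> = \<kappa>) n \<noteq> 0" using x(2) vn(1) by (auto simp: wcomp_add)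
    then show "\<kappa> \<in> F" using F(2) A(2) vn(3) by blast
  qed
  then have fM: "finite M" using F(1) finite_subset by blast
  have "M \<noteq> {}"
  proof
    assume "M = {}"
    then have "compR (\<lambda>\<nu>. \<nu> = \<kappa>) w \<in> V" for \<kappa> using w(1) by (auto simp: M_def)
    moreover obtain D where D: "w = (\<Sum>\<kappa>\<in>D. compR (\<lambda>\<nu>. \<nu> = \<kappa>) w)" using wcomp_sum[of w snd] by metis
    ultimately have "(\<Sum>\<kappa>\<in>D. compR (\<lambda>\<nu>. \<nu> = \<kappa>) w) \<in> V" by (intro KG.subspace_sum[OF sV])
    then show False using D w(2) by simp
  qed
  then have "Max (height ` M) \<in> height ` M" using fM by (intro Max_in) auto
  then obtain \<mu> where \<mu>: "\<mu> \<in> M" "height \<mu> = Max (height ` M)" by force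
  have max: "height \<kappa> \<le> height \<mu>" if "\<kappa> \<in> M" for \<kappa> unfolding \<mu>(2) using fM that by (intro Max_ge) auto
  obtain x0 where x0: "x0 \<in> W" "compR (\<lambda>\<nu>. \<nu> = \<mu>) x0 \<notin> V" using \<mu>(1) by (auto simp: M_def)
  obtain p where p: "part p (compR (\<lambda>\<nu>. \<nu> = \<mu>) x0) \<notin> V" using nonzero_part[OF sV x0(2)] by blast
  show ?thesis
  proof (rule that[of "part p (compR (\<lambda>\<nu>. \<nu> = \<mu>) x0)" \<mu> p])
    show "part p (compR (\<lambda>\<nu>. \<nu> = \<mu>) x0) \<in> W"
    proof -
      have "compR (\<lambda>\<nu>. \<nu> = \<mu>) x0 \<in> W" by (rule compR_mem[OF char W x0(1)])
      then show ?thesis using W by (simp add: subsupermodule_iff)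
    qed
    show "compR (\<lambda>\<nu>. \<nu> = \<mu>) (part p (compR (\<lambda>\<nu>. \<nu> = \<mu>) x0)) = part p (compR (\<lambda>\<nu>. \<nu> = \<mu>) x0)"
      by (simp add: part_wcomp[symmetric] wcomp_wcomp)
    show "compR (\<lambda>\<nu>. \<nu> = \<kappa>) x \<in> V" if "x \<in> W" "height \<mu> < height \<kappa>" for \<kappa> x
      using max[of \<kappa>] that by (force simp: M_def)
  qed (use p parity_part in auto)
qed

text \<open>Translation by a permutation matrix preserves W and V and permutes weights. If it raised
  the height of \<mu>, the translate of \<open>a\<close> would lie in V, and translating back, which
  is the same operator for an involution, so would \<open>a\<close>.\<close>

lemma factor_dominant:
  fixes W V :: "('k, 'm::{finite,linorder}, 'n::{finite,linorder}) KG set"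
  assumes W: "subsupermodule W" and V: "subsupermodule V"
    and a: "a \<in> W" "a \<notin> V" "compR (\<lambda>\<nu>. \<nu> = \<mu>) a = a"
    and max: "\<And>\<kappa> x. x \<in> W \<Longrightarrow> height \<mu> < height \<kappa> \<Longrightarrow> compR (\<lambda>\<nu>. \<nu> = \<kappa>) x \<in> V"
  shows "dominant \<mu>"
proof -
  have *: "height (\<lambda>i. \<mu> (map_sum \<sigma> \<tau> i)) \<le> height \<mu>"
    if p: "\<sigma> permutes UNIV" "\<tau> permutes UNIV" and inv: "\<And>i. \<sigma> (\<sigma> i) = i" "\<And>i. \<tau> (\<tau> i) = i" for \<sigma> :: "'m \<Rightarrow> 'm" and \<tau> :: "'n \<Rightarrow> 'n"
  proof (rule ccontr)
    let ?s = "map_sum \<sigma> \<tau>"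
    have ss: "?s (?s i) = i" for i by (cases i) (simp_all add: inv)
    obtain ev :: "('k, 'm, 'n) functional" where ev: "klin ev" "\<And>f. Rop ev (Rop ev f) = f"
      "\<And>Q f. Rop ev (compR Q f) = compR (\<lambda>\<kappa>. Q (\<lambda>i. \<kappa> (?s i))) (Rop ev f)"
      using permutation_translate[OF char p inv] by metis
    assume "\<not> height (\<lambda>i. \<mu> (?s i)) \<le> height \<mu>"
    then have "compR (\<lambda>\<nu>. \<nu> = (\<lambda>i. \<mu> (?s i))) (Rop ev a) \<in> V"
      using W a(1) ev(1) by (intro max) (auto simp: subsupermodule_iff)
    moreover have "compR (\<lambda>\<nu>. \<nu> = (\<lambda>i. \<mu> (?s i))) (Rop ev a) = Rop ev a"
    proof -
      have "((\<lambda>i. \<kappa> (?s i)) = \<mu>) = (\<kappa> = (\<lambda>i. \<mu> (?s i)))" for \<kappa> :: "('m, 'n) weight"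
      proof
        assume eq: "(\<lambda>i. \<kappa> (?s i)) = \<mu>"
        show "\<kappa> = (\<lambda>i. \<mu> (?s i))" unfolding eq[symmetric] by (simp add: ss)
      qed (simp add: ss)
      then show ?thesis using ev(3)[of "\<lambda>\<nu>. \<nu> = \<mu>" a] a(3) by (simp only:)
    qed
    ultimately have "Rop ev (Rop ev a) \<in> V" using V ev(1) by (simp add: subsupermodule_iff)
    then show False using a(2) ev(2) by simp
  qed
  have l: "map_sum (Transposition.transpose i j) id = Transposition.transpose (Inl i) (Inl j :: 'm + 'n)" for i j
    by (rule ext, case_tac x) (auto simp: Transposition.transpose_def)
  have r: "map_sum id (Transposition.transpose i j) = Transposition.transpose (Inr i) (Inr j :: 'm + 'n)" for i j
    by (rule ext, case_tac x) (auto simp: Transposition.transpose_def)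
  have "\<mu> (Inl j) \<le> \<mu> (Inl i)" if "i \<le> j" for i j
  proof (cases "i = j")
    case False
    then show ?thesis using that *[of "Transposition.transpose i j" id]
      by (intro dominant_transpose) (auto simp: l permutes_swap_id permutes_id)
  qed simp
  moreover have "\<mu> (Inr j) \<le> \<mu> (Inr i)" if "i \<le> j" for i j
  proof (cases "i = j")
    case False
    then show ?thesis using that *[of id "Transposition.transpose i j"]
      by (intro dominant_transpose) (auto simp: r permutes_swap_id permutes_id)
  qed simp
  ultimately show ?thesis by (simp add: dominant_def)
qed

text \<open>Let \<theta> be a functional dual to a highest weight vector \<open>a\<close>.
  \<open>Lop \<theta>\<close> is a comodule map, on W its kernel is V by simplicity, and its image
  is a simple subsupermodule of \<open>H0_minus \<mu>\<close>, hence \<open>L_minus \<mu>\<close>.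
  The parity of \<open>a\<close> decides between \<open>L_minus \<mu>\<close> and its parity
  shift.\<close>

theorem factor_classification:
  fixes W V :: "('k, 'm::{finite,linorder}, 'n::{finite,linorder}) KG set"
  assumes W: "subsupermodule W" and V: "subsupermodule V" and VW: "V \<subset> W" and deg: "W \<subseteq> Kdeg l"
    and simple: "\<And>U. subsupermodule U \<Longrightarrow> V \<subseteq> U \<Longrightarrow> U \<subseteq> W \<Longrightarrow> U = V \<or> U = W"
  shows "\<exists>\<mu>\<in>dominant_weights l. \<exists>flip. quotient_iso W V (L_minus \<mu>) flip"
proof -
  have sV: "KG.subspace V" and sW: "KG.subspace W" using V W by (simp_all add: subsupermodule_iff)
  obtain \<mu> a p where a: "a \<in> W" "a \<notin> V" "compR (\<lambda>\<nu>. \<nu> = \<mu>) a = a" "parity p a"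
    and max: "\<And>\<kappa> x. x \<in> W \<Longrightarrow> height \<mu> < height \<kappa> \<Longrightarrow> compR (\<lambda>\<nu>. \<nu> = \<kappa>) x \<in> V"
    by (rule factor_highest_weight[OF W V VW simple]) blast+
  have "(\<Sum>i\<in>UNIV. \<mu> i) = l"
  proof (rule ccontr)
    assume "(\<Sum>i\<in>UNIV. \<mu> i) \<noteq> l"
    then have "(\<lambda>g. has_degree l (snd g) \<and> snd g = \<mu>) = (\<lambda>g :: ('m, 'n) biweight. False)" by (intro ext) (auto simp: has_degree_def)
    then have "compR (has_degree l) (compR (\<lambda>\<nu>. \<nu> = \<mu>) a) = 0" by (simp add: wcomp_wcomp wcomp_False)
    moreover have "compR (has_degree l) a = a" using deg a(1) by (auto simp: Kdeg_def)
    ultimately show False using a(2,3) KG.subspace_0[OF sV] by simp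
  qed
  then have \<mu>: "\<mu> \<in> dominant_weights l"
    using factor_dominant[OF W V a(1-3) max] by (simp add: dominant_weights_def)
  obtain \<theta>0 where \<theta>0: "klin \<theta>0" "\<theta>0 a = 1" "\<And>v. v \<in> V \<Longrightarrow> \<theta>0 v = 0"
    by (rule exists_functional[OF sV a(2)], rule that)
  \<comment> \<open>The projections make \<theta> homogeneous of weight \<mu> and of parity p. They
    keep its value 1 at \<open>a\<close>, and its vanishing on V because V is stable under
    them.\<close>
  define \<theta> where "\<theta> y = \<theta>0 (part p (compR (\<lambda>\<nu>. \<nu> = \<mu>) y))" for y
  have \<theta>: "klin \<theta>" unfolding \<theta>_def
    by (rule klin_closed(2)[OF \<theta>0(1) kend_closed(2)[OF kend_closed(3) kend_wcomp]])
  have \<theta>a: "\<theta> a = 1" using a \<theta>0(2) by (simp add: \<theta>_def parity_def)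
  have \<theta>V: "\<theta> v = 0" if "v \<in> V" for v
  proof -
    have "compR (\<lambda>\<nu>. \<nu> = \<mu>) v \<in> V" by (rule compR_mem[OF char V that])
    then show ?thesis using V \<theta>0(3) by (simp add: \<theta>_def subsupermodule_iff)
  qed
  have \<theta>\<mu>: "\<theta> (compR (\<lambda>\<nu>. \<nu> = \<mu>) y) = \<theta> y" for y by (simp add: \<theta>_def wcomp_wcomp)
  have \<theta>p: "\<theta> (part p y) = \<theta> y" for y by (simp add: \<theta>_def part_wcomp[symmetric] part_part)
  let ?\<phi> = "Lop \<theta>"
  have k: "kend ?\<phi>" by (rule kend_Lop[OF char \<theta>])
  have ph: "?\<phi> (part q y) = part (q \<noteq> p) (?\<phi> y)" for q y
    using Lop_part[OF char \<theta>, of p q y] unfolding \<theta>p by (cases p; cases q) simp_all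
  have R: "?\<phi> (Rop \<gamma> y) = Rop \<gamma> (?\<phi> y)" if "klin \<gamma>" for \<gamma> y by (rule Lop_Rop[OF char \<theta> that])
  \<comment> \<open>Used with U = {0} to compute the kernel, and with arbitrary U to carry the
    simplicity of W / V over to the image.\<close>
  have pre: "subsupermodule {x \<in> W. ?\<phi> x \<in> U}" if U: "subsupermodule U" for U
    unfolding subsupermodule_iff
  proof (intro conjI ballI allI impI)
    show "KG.subspace {x \<in> W. ?\<phi> x \<in> U}"
      using U W by (auto simp: subsupermodule_iff KG.subspace_def kend_0[OF k] kendD[OF k])
  qed (use U W in \<open>auto simp: subsupermodule_iff ph R\<close>)
  have sub0: "subsupermodule {0 :: ('k, 'm, 'n) KG}"
    by (auto simp: subsupermodule_iff KG.subspace_def kend_0[OF kend_Rop[OF char]])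
  have V0: "?\<phi> v = 0" if "v \<in> V" for v
    by (rule Lop_vanish[OF char \<theta>]) (use \<theta>V V that in \<open>auto simp: subsupermodule_iff\<close>)
  have a0: "?\<phi> a \<noteq> 0"
  proof
    assume "?\<phi> a = 0"
    then have "counit (?\<phi> a) = 0" by simp
    then show False using apply_Rop[OF \<theta> klin_closed(1), of a] \<theta>a by (simp add: Rop_counit[OF char])
  qed
  have ker: "{w \<in> W. ?\<phi> w = 0} = V"
    using simple[OF pre[OF sub0]] V0 VW a(1) a0 by auto
  have img: "subsupermodule (?\<phi> ` W)"
    unfolding subsupermodule_iff
  proof (intro conjI ballI allI impI)
    show "KG.subspace (?\<phi> ` W)"
      unfolding KG.subspace_def
    proof (intro conjI ballI allI)
      show "0 \<in> ?\<phi> ` W" using KG.subspace_0[OF sW] kend_0[OF k] by force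
      show "x + y \<in> ?\<phi> ` W" if "x \<in> ?\<phi> ` W" "y \<in> ?\<phi> ` W" for x y
        using that KG.subspace_add[OF sW] by (auto simp flip: kendD(1)[OF k])
      show "kg_scale c x \<in> ?\<phi> ` W" if "x \<in> ?\<phi> ` W" for x c
        using that KG.subspace_scale[OF sW] by (auto simp flip: kendD(2)[OF k])
    qed
    fix f q and \<gamma> :: "('k, 'm, 'n) functional" assume "f \<in> ?\<phi> ` W"
    then obtain x where x: "f = ?\<phi> x" "x \<in> W" by blast
    have "part q f = ?\<phi> (part (q \<noteq> p) x)" by (cases p; cases q) (simp_all add: ph x(1))
    then show "part q f \<in> ?\<phi> ` W" using W x(2) by (auto simp: subsupermodule_iff)
    assume "klin \<gamma>"
    then show "Rop \<gamma> f \<in> ?\<phi> ` W" using W x by (auto simp: subsupermodule_iff simp flip: R)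
  qed
  have "simple_supermodule (?\<phi> ` W)"
    unfolding simple_supermodule_def
  proof (intro conjI allI impI img)
    show "?\<phi> ` W \<noteq> {0}" using a(1) a0 by blast
    fix U assume U: "subsupermodule U \<and> U \<subseteq> ?\<phi> ` W"
    have U0: "0 \<in> U" using U KG.subspace_0 by (auto simp: subsupermodule_iff)
    have "{x \<in> W. ?\<phi> x \<in> U} = V \<or> {x \<in> W. ?\<phi> x \<in> U} = W"
      using U by (intro simple pre) (use V0 U0 VW in auto)
    then show "U = {0} \<or> U = ?\<phi> ` W"
    proof
      assume "{x \<in> W. ?\<phi> x \<in> U} = V"
      then have "U \<subseteq> {0}" using U V0 by blast
      then show ?thesis using U0 by blast
    next
      assume "{x \<in> W. ?\<phi> x \<in> U} = W"
      then show ?thesis using U by blast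
    qed
  qed
  moreover have "?\<phi> ` W \<subseteq> H0_minus \<mu>"
    using highest_weight_embedding[OF W V \<theta> \<theta>V \<theta>\<mu> max] by blast
  ultimately have L: "L_minus \<mu> = ?\<phi> ` W" by (rule L_minus_eq[OF char])
  have "quotient_iso W V (L_minus \<mu>) p"
    unfolding quotient_iso_def
  proof (intro exI[of _ ?\<phi>] conjI ballI allI)
    show "Vector_Spaces.linear kg_scale kg_scale ?\<phi>" using k by (simp add: kend_iff_linear)
    show "?\<phi> ` W = L_minus \<mu>" by (simp add: L)
    show "{w \<in> W. ?\<phi> w = 0} = V" by (rule ker)
    fix w assume "w \<in> W"
    show "comult (?\<phi> w) = tensor_lift tensor_scale (\<lambda>a b. tensor (?\<phi> a) b) (comult w)"
    proof (rule KG2_eqI)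
      fix \<gamma> :: "('k, 'm, 'n) functional" assume \<gamma>: "klin \<gamma>"
      show "rc \<gamma> (comult (?\<phi> w)) = rc \<gamma> (tensor_lift tensor_scale (\<lambda>a b. tensor (?\<phi> a) b) (comult w))"
        using rc_tmap[OF \<gamma> k kend_closed(1), of "comult w"] R[OF \<gamma>, of w] by (simp add: tmap_def Rop_def)
    qed
    show "part (q \<noteq> p) (?\<phi> w) = ?\<phi> (part q w)" for q by (simp add: ph)
  qed
  then show ?thesis using \<mu> by blast
qed

text \<open>If M had an element outside degree l, a component of it would generate a
  finite-dimensional subsupermodule without part of degree l. A simple subsupermodule S of that is a
  composition factor of M, so it is isomorphic to some \<open>L_minus \<mu>\<close> in degree l. But
  the projection onto degree l is an operator \<open>Rop\<close>, and an isomorphism of comodules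
  commutes with it: it is zero on S and the identity on the image.\<close>

theorem C_Gamma_dominant_weights:
  "C_Gamma (dominant_weights l) = (Kdeg l :: ('k, 'm::{finite,linorder}, 'n::{finite,linorder}) KG set)"
proof
  have "belongs_to (Kdeg l :: ('k, 'm, 'n) KG set) (dominant_weights l)"
    unfolding belongs_to_def composition_factor_def
  proof (intro allI impI, elim conjE)
    fix W V :: "('k, 'm, 'n) KG set"
    assume 1: "subsupermodule V" "subsupermodule W" "V \<subset> W" "W \<subseteq> Kdeg l"
      and 2: "\<nexists>U. subsupermodule U \<and> V \<subset> U \<and> U \<subset> W"
    show "\<exists>\<mu>\<in>dominant_weights l. \<exists>flip. quotient_iso W V (L_minus \<mu>) flip"
      using 2 by (intro factor_classification[OF 1(2,1,3,4)]) blast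
  qed
  then show "(Kdeg l :: ('k, 'm, 'n) KG set) \<subseteq> C_Gamma (dominant_weights l)"
    unfolding C_Gamma_def using subsupermodule_Kdeg by (auto intro!: KG.span_base)
next
  have "f \<in> Kdeg l" if M: "subsupermodule M" "belongs_to M (dominant_weights l)" "f \<in> M" for M and f :: "('k, 'm, 'n) KG"
  proof (rule ccontr)
    assume nf: "f \<notin> Kdeg l"
    have "compR (\<lambda>\<nu>. \<not> has_degree l \<nu>) f \<noteq> 0"
      using wcomp_split[of "\<lambda>g. has_degree l (snd g)" f] nf by (auto simp: Kdeg_def)
    then have "compR (\<lambda>\<nu>. \<not> has_degree l \<nu>) f \<notin> {0}" by simp
    then obtain p where p: "part p (compR (\<lambda>\<nu>. \<not> has_degree l \<nu>) f) \<noteq> 0"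
      using nonzero_part[OF KG.subspace_single_0] by blast
    define w where "w = part p (compR (\<lambda>\<nu>. \<not> has_degree l \<nu>) f)"
    have "compR (\<lambda>\<nu>. \<not> has_degree l \<nu>) f \<in> M" by (rule compR_mem[OF char M(1,3)])
    then have w: "w \<in> M" "w \<noteq> 0" "parity p w"
      using M(1) p by (simp_all add: w_def subsupermodule_iff parity_part)
    have wl: "compR (has_degree l) w = 0"
      by (simp add: w_def part_wcomp[symmetric] wcomp_wcomp wcomp_False)
    note N = subsupermodule_gen_sub[OF char w(3)]
    obtain A where A: "finite A" "gen_sub w \<subseteq> KG.span A" by (rule gen_sub_finite)
    have "gen_sub w \<noteq> {0}" using N(2) w(2) by auto
    from exists_simple[OF A(1) N(1) this A(2)] obtain S where S: "simple_supermodule S" "S \<subseteq> gen_sub w" by blast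
    have "gen_sub w \<subseteq> M" using M(1) w(1) by (auto simp: subsupermodule_iff gen_sub_def)
    have sS: "subsupermodule S" using S(1) by (simp add: simple_supermodule_def)
    have S0: "0 \<in> S" using sS KG.subspace_0 by (auto simp: subsupermodule_iff)
    have Sl: "compR (has_degree l) x = 0" if xS: "x \<in> S" for x
    proof -
      obtain \<gamma> :: "('k, 'm, 'n) functional" where \<gamma>: "klin \<gamma>" "x = Rop \<gamma> w" using S(2) xS by (auto simp: gen_sub_def)
      have "compR (has_degree l) x = Rop \<gamma> (compL (has_degree l) w)"
        unfolding \<gamma>(2) compL_has_degree[symmetric] by (rule Rop_compL[OF char \<gamma>(1), symmetric])
      then show ?thesis by (simp add: compL_has_degree wl kend_0[OF kend_Rop[OF char \<gamma>(1)]])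
    qed
    have "composition_factor M S {0}"
      unfolding composition_factor_def
    proof (intro conjI)
      show "subsupermodule {0 :: ('k, 'm, 'n) KG}"
        by (auto simp: subsupermodule_iff KG.subspace_def kend_0[OF kend_Rop[OF char]])
      show "\<nexists>U. subsupermodule U \<and> {0} \<subset> U \<and> U \<subset> S" using S(1) by (auto simp: simple_supermodule_def)
    qed (use sS S0 S \<open>gen_sub w \<subseteq> M\<close> in \<open>auto simp: simple_supermodule_def\<close>)
    then obtain \<mu> flip where \<mu>: "\<mu> \<in> dominant_weights l" and "quotient_iso S {0} (L_minus \<mu>) flip"
      using M(2) unfolding belongs_to_def by blast
    then obtain \<phi> where \<phi>: "kend \<phi>" "\<phi> ` S = L_minus \<mu>" "{w \<in> S. \<phi> w = 0} = {0}"
      "\<And>w. w \<in> S \<Longrightarrow> comult (\<phi> w) = tensor_lift tensor_scale (\<lambda>a b. tensor (\<phi> a) b) (comult w)"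
      unfolding quotient_iso_def kend_iff_linear by blast
    obtain x where x: "x \<in> S" "x \<noteq> 0" using S(1) S0 by (auto simp: simple_supermodule_def)
    let ?\<gamma> = "\<lambda>y :: ('k, 'm, 'n) KG. counit (compL (has_degree l) y)"
    have \<gamma>: "klin ?\<gamma>" by (rule klin_closed(2)[OF klin_closed(1) kend_wcomp])
    have Rg: "Rop ?\<gamma> y = compR (has_degree l) y" for y :: "('k, 'm, 'n) KG"
      using compR_Rop[OF char klin_closed(1), of "has_degree l" y] by (simp add: Rop_counit[OF char])
    have "\<phi> x \<in> Kdeg l"
      using L_minus_Kdeg[of \<mu> l] \<mu> x(1) \<phi>(2) by (auto simp: dominant_weights_def)
    then have "\<phi> x = Rop ?\<gamma> (\<phi> x)" by (simp add: Rg Kdeg_def)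
    also have "\<dots> = \<phi> (Rop ?\<gamma> x)"
      using rc_tmap[OF \<gamma> \<phi>(1) kend_closed(1), of "comult x"] \<phi>(4)[OF x(1)] by (simp add: Rop_def tmap_def)
    also have "\<dots> = 0" by (simp add: Rg Sl[OF x(1)] kend_0[OF \<phi>(1)])
    finally show False using x \<phi>(3) by blast
  qed
  then show "C_Gamma (dominant_weights l) \<subseteq> (Kdeg l :: ('k, 'm, 'n) KG set)"
    unfolding C_Gamma_def by (intro KG.span_minimal Kdeg_subspace) blast
qed

end

section \<open>The filtration by powers of the augmentation ideal and the algebra of
  distributions\<close>

section \<open>Powers of the augmentation ideal\<close>

abbreviation mpow :: "nat \<Rightarrow> ('k::field, 'm::{finite,linorder}, 'n::{finite,linorder}) KG set" where
  "mpow n \<equiv> ideal_power augmentation_ideal n"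

lemma mpow_subspace: "KG.subspace (mpow n)"
  by (cases n) (simp_all add: KG.subspace_span)

lemma mpow_induct [consumes 1, case_names zero mult add scale]:
  assumes "f \<in> mpow (Suc n)" "P 0" "\<And>g h. counit g = 0 \<Longrightarrow> h \<in> mpow n \<Longrightarrow> P (g * h)"
    "\<And>x y. P x \<Longrightarrow> P y \<Longrightarrow> P (x + y)" "\<And>r x. P x \<Longrightarrow> P (kg_scale r x)"
  shows "P f"
  using assms(1) unfolding ideal_power.simps
proof (induction rule: KG.span_induct_alt)
  case (step c x y)
  then show ?case by (intro assms(4,5)) (auto intro: assms(3) simp: augmentation_ideal_def)
qed (rule assms(2))

lemma mpow_mult_left: "counit g = 0 \<Longrightarrow> h \<in> mpow n \<Longrightarrow> g * h \<in> mpow (Suc n)"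
  by (auto simp: augmentation_ideal_def intro!: KG.span_base)

lemma mpow_ideal: "f \<in> mpow n \<Longrightarrow> y * f \<in> mpow n"
proof (cases n)
  case (Suc k)
  assume "f \<in> mpow n"
  then show ?thesis unfolding Suc
  proof (induction rule: mpow_induct)
    case (mult g h)
    then show ?case using mpow_mult_left[of "y * g" h k] by (simp add: mult.assoc del: ideal_power.simps)
  qed (simp_all add: distrib_left kg_scale_mult KG.subspace_0[OF mpow_subspace]
      KG.subspace_add[OF mpow_subspace] KG.subspace_scale[OF mpow_subspace] del: ideal_power.simps)
qed simp

lemma mpow_mult: "f \<in> mpow i \<Longrightarrow> g \<in> mpow j \<Longrightarrow> f * g \<in> mpow (i + j)"
proof (induction i arbitrary: f)
  case 0
  then show ?case by (simp add: mpow_ideal)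
next
  case (Suc i)
  from Suc.prems(1) show ?case
  proof (induction rule: mpow_induct)
    case (mult a h)
    then show ?case using mpow_mult_left[OF mult(1) Suc.IH[OF mult(2) Suc.prems(2)]] by (simp add: mult.assoc del: ideal_power.simps)
  qed (simp_all add: distrib_right kg_scale_mult KG.subspace_0[OF mpow_subspace]
      KG.subspace_add[OF mpow_subspace] KG.subspace_scale[OF mpow_subspace] del: ideal_power.simps)
qed

lemma mpow_decreasing: "i \<le> j \<Longrightarrow> f \<in> mpow j \<Longrightarrow> f \<in> mpow i"
proof -
  have step: "f \<in> mpow (Suc n) \<Longrightarrow> f \<in> mpow n" for f :: "('a, 'b, 'c) KG" and n
    by (induction rule: mpow_induct)
      (simp_all add: mpow_ideal KG.subspace_0[OF mpow_subspace] KG.subspace_add[OF mpow_subspace] KG.subspace_scale[OF mpow_subspace])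
  show "i \<le> j \<Longrightarrow> f \<in> mpow j \<Longrightarrow> f \<in> mpow i"
    by (induction rule: dec_induct) (simp_all add: step del: ideal_power.simps)
qed

lemma mpow_part: "f \<in> mpow n \<Longrightarrow> part p f \<in> mpow n"
proof (induction n arbitrary: f p)
  case (Suc n)
  from Suc.prems show ?case
  proof (induction rule: mpow_induct)
    case (mult g h)
    have "part q g * part r h \<in> mpow (Suc n)" for q r
      by (rule mpow_mult_left) (simp_all add: counit_part mult(1) Suc.IH[OF mult(2)])
    then show ?case unfolding part_mult by (intro KG.subspace_add[OF mpow_subspace])
  qed (simp_all add: part_add part_scale KG.subspace_0[OF mpow_subspace]
      KG.subspace_add[OF mpow_subspace] KG.subspace_scale[OF mpow_subspace] del: ideal_power.simps)
qed simp

lemma mpow_power: "counit g = 0 \<Longrightarrow> g ^ n \<in> mpow n"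
  by (induction n) (simp_all add: mpow_mult_left del: ideal_power.simps(2))

text \<open>The tensor product filtration, in the role of the powers of the augmentation ideal of
  the tensor square.\<close>

definition mfilt :: "nat \<Rightarrow> ('k::field, 'm::{finite,linorder}, 'n::{finite,linorder}) KG2 set" where
  "mfilt n = KG2.span {tensor a b | a b i j. a \<in> mpow i \<and> b \<in> mpow j \<and> i + j = n}"

lemma mfilt_subspace: "KG2.subspace (mfilt n)" by (simp add: mfilt_def KG2.subspace_span)

lemma mfilt_tensor: "a \<in> mpow i \<Longrightarrow> b \<in> mpow j \<Longrightarrow> i + j = n \<Longrightarrow> tensor a b \<in> mfilt n"
  unfolding mfilt_def by (intro KG2.span_base) blast

lemma mfilt_induct [consumes 1, case_names zero tensor add scale]:
  assumes "x \<in> mfilt n" "P 0" "\<And>a b i j. a \<in> mpow i \<Longrightarrow> b \<in> mpow j \<Longrightarrow> i + j = n \<Longrightarrow> P (tensor a b)"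
    "\<And>x y. P x \<Longrightarrow> P y \<Longrightarrow> P (x + y)" "\<And>r x. P x \<Longrightarrow> P (tensor_scale r x)"
  shows "P x"
  using assms(1) unfolding mfilt_def
proof (induction rule: KG2.span_induct_alt)
  case (step c x y)
  then show ?case by (intro assms(4,5)) (auto intro: assms(3))
qed (rule assms(2))

lemma mfilt_mult: "x \<in> mfilt m \<Longrightarrow> y \<in> mfilt n \<Longrightarrow> x * y \<in> mfilt (m + n)"
proof (induction rule: mfilt_induct)
  case (tensor a b i j)
  note x = tensor(1-3)
  from tensor(4) show ?case
  proof (induction rule: mfilt_induct)
    case (tensor c d k l)
    have "tensor (a * part q c) (part p b * d) \<in> mfilt (m + n)" for p q
      using x tensor by (intro mfilt_tensor[of _ "i + k" _ "j + l"] mpow_mult mpow_part) auto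
    then show ?case unfolding times_KG2_def tensor_mult_tensor
      by (intro KG2.subspace_sum[OF mfilt_subspace] KG2.subspace_scale[OF mfilt_subspace])
  qed (simp_all add: KG2_mult_linear KG2.subspace_0[OF mfilt_subspace] KG2.subspace_add[OF mfilt_subspace] KG2.subspace_scale[OF mfilt_subspace])
qed (simp_all add: KG2_mult_linear KG2.subspace_0[OF mfilt_subspace] KG2.subspace_add[OF mfilt_subspace] KG2.subspace_scale[OF mfilt_subspace])

text \<open>The scalar is the value of the tensor square of the counit. On a pure tensor the factors
  are replaced one at a time by their counits, each replacement costing an element of the
  augmentation ideal.\<close>

lemma mfilt_1:
  fixes x :: "('k::field, 'm::{finite,linorder}, 'n::{finite,linorder}) KG2"
  shows "x - tensor_scale (counit (rc counit x)) 1 \<in> mfilt 1"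
proof (induction x rule: KG2_tensor_induct)
  case (tensor a b)
  let ?a = "kg_scale (counit a) 1" and ?b = "kg_scale (counit b) 1"
  have "tensor (a - ?a) b \<in> mfilt 1"
    by (rule mfilt_tensor[of _ 1 _ 0]) (use mpow_mult_left[of "a - ?a" 1 0] in simp_all)
  moreover have "tensor ?a (b - ?b) \<in> mfilt 1"
    by (rule mfilt_tensor[of _ 0 _ 1]) (use mpow_mult_left[of "b - ?b" 1 0] in simp_all)
  ultimately have "tensor (a - ?a) b + tensor ?a (b - ?b) \<in> mfilt 1" by (rule KG2.subspace_add[OF mfilt_subspace])
  then show ?case
    by (simp add: tensor_minus rc_tensor klin_closed(1) one_KG2_def tensor_scale_left tensor_scale_right mult.commute)
next
  case (add x y)
  from KG2.subspace_add[OF mfilt_subspace add] show ?case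
    by (simp add: rc_add klin_closed(1) KG2.scale_left_distrib algebra_simps)
qed

section \<open>Products of distributions\<close>

lemma Dist_G_iff: "\<xi> \<in> Dist_G \<longleftrightarrow> klin \<xi> \<and> (\<exists>t. \<forall>f\<in>mpow (Suc t). \<xi> f = 0)"
  by (simp add: Dist_G_def klin_iff_linear del: ideal_power.simps)

lemma Dist_GI: "klin \<xi> \<Longrightarrow> (\<And>f. f \<in> mpow n \<Longrightarrow> \<xi> f = 0) \<Longrightarrow> \<xi> \<in> Dist_G"
  unfolding Dist_G_iff using mpow_decreasing[of n "Suc n"] by (auto simp del: ideal_power.simps)

text \<open>Contracting the right tensor factor with the homogeneous components of \<psi> expresses
  the product by values of \<phi> on \<open>Rop\<close>, so that facts about operators
  apply.\<close>

lemma dist_mult_eq: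
  assumes "klin \<phi>" "klin \<psi>"
  shows "dist_mult \<phi> \<psi> f = (\<Sum>p\<in>UNIV. \<Sum>q\<in>UNIV. koszul q p * \<phi> (part p (Rop (\<lambda>y. \<psi> (part q y)) f)))"
proof -
  define B where "B a b = (\<Sum>p\<in>UNIV. \<Sum>q\<in>UNIV. koszul q p * \<phi> (part p a) * \<psi> (part q b))" for a b
  have "bilinear_map (*) B"
    by (rule bilinear_mapI[OF vector_space_field])
      (simp_all add: B_def part_add part_scale klinD[OF assms(1)] klinD[OF assms(2)] algebra_simps sum.distrib sum_distrib_left)
  note b = vector_space_field this
  have k: "klin (\<lambda>y. \<psi> (part q y))" for q by (rule klin_closed(2)[OF assms(2) kend_closed(3)])
  have "tensor_lift (*) B x = (\<Sum>p\<in>UNIV. \<Sum>q\<in>UNIV. koszul q p * \<phi> (part p (rc (\<lambda>y. \<psi> (part q y)) x)))" for x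
  proof (induction x rule: KG2_tensor_induct)
    case (tensor a c)
    show ?case unfolding tensor_lift_tensor[OF b] rc_tensor[OF k] by (simp add: B_def part_scale klinD[OF assms(1)] mult_ac)
  next
    case (add x y)
    then show ?case unfolding tensor_lift_add[OF b] rc_add[OF k]
      by (simp add: part_add klinD[OF assms(1)] distrib_left sum.distrib)
  qed
  then show ?thesis by (simp add: dist_mult_def Rop_def B_def[abs_def])
qed

context
  assumes char: "CHAR('k::field) > 2"
begin

text \<open>\<Delta> is multiplicative, the filtration is multiplicative, and the kernel of the
  counit goes to the first step by the counit axiom.\<close>

lemma comult_mpow:
  fixes f :: "('k, 'm::{finite,linorder}, 'n::{finite,linorder}) KG"
  shows "f \<in> mpow n \<Longrightarrow> comult f \<in> mfilt n"
proof (induction n arbitrary: f)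
  case 0
  have "x \<in> mfilt 0" for x :: "('k, 'm, 'n) KG2"
    by (induction x rule: KG2_tensor_induct) (auto intro: mfilt_tensor[of _ 0 _ 0] KG2.subspace_add[OF mfilt_subspace])
  then show ?case .
next
  case (Suc n)
  from Suc.prems show ?case
  proof (induction rule: mpow_induct)
    case zero
    then show ?case using comult_scale[OF char, of 0 "0 :: ('k, 'm, 'n) KG"] by (simp add: KG2.subspace_0[OF mfilt_subspace])
  next
    case (mult g h)
    have "counit (rc counit (comult g)) = 0" using Rop_counit[OF char, of g] mult(1) by (simp add: Rop_def)
    then have "comult g \<in> mfilt 1" using mfilt_1[of "comult g"] by simp
    then show ?case using mfilt_mult[of "comult g" 1 "comult h" n] Suc.IH[OF mult(2)] by (simp add: comult_mult[OF char])
  qed (simp_all add: comult_add[OF char] comult_scale[OF char] KG2.subspace_add[OF mfilt_subspace] KG2.subspace_scale[OF mfilt_subspace])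
qed

text \<open>If i + j = t + s, then either j is at least s and \<gamma> kills the right factor, or i
  exceeds t and the left factor is already deep enough.\<close>

lemma Rop_mpow:
  fixes f :: "('k, 'm::{finite,linorder}, 'n::{finite,linorder}) KG"
  assumes \<gamma>: "klin \<gamma>" "\<And>y. y \<in> mpow s \<Longrightarrow> \<gamma> y = 0" and f: "f \<in> mpow (t + s)"
  shows "Rop \<gamma> f \<in> mpow t"
  using comult_mpow[OF f] unfolding Rop_def
proof (induction rule: mfilt_induct)
  case (tensor a b i j)
  show ?case
  proof (cases "s \<le> j")
    case True
    then have "\<gamma> b = 0" using \<gamma>(2) mpow_decreasing tensor(2) by blast
    then show ?thesis by (simp add: rc_tensor[OF \<gamma>(1)] KG.subspace_0[OF mpow_subspace])
  next
    case False
    then have "a \<in> mpow t" using tensor(1,3) by (intro mpow_decreasing[of t i]) auto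
    then show ?thesis by (simp add: rc_tensor[OF \<gamma>(1)] KG.subspace_scale[OF mpow_subspace])
  qed
qed (simp_all add: rc_0[OF \<gamma>(1)] rc_add[OF \<gamma>(1)] rc_scale[OF \<gamma>(1)] KG.subspace_0[OF mpow_subspace]
    KG.subspace_add[OF mpow_subspace] KG.subspace_scale[OF mpow_subspace])

lemma dist_mult_Dist_G:
  fixes \<phi> \<psi> :: "('k, 'm::{finite,linorder}, 'n::{finite,linorder}) functional"
  assumes "\<phi> \<in> Dist_G" "\<psi> \<in> Dist_G"
  shows "dist_mult \<phi> \<psi> \<in> Dist_G"
proof -
  obtain t where \<phi>: "klin \<phi>" "\<And>f. f \<in> mpow (Suc t) \<Longrightarrow> \<phi> f = 0" using assms(1) unfolding Dist_G_iff by blast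
  obtain s where \<psi>: "klin \<psi>" "\<And>f. f \<in> mpow (Suc s) \<Longrightarrow> \<psi> f = 0" using assms(2) unfolding Dist_G_iff by blast
  note eq = dist_mult_eq[OF \<phi>(1) \<psi>(1)]
  have k: "klin (\<lambda>y. \<psi> (part q y))" for q by (rule klin_closed(2)[OF \<psi>(1) kend_closed(3)])
  note R = kendD[OF kend_Rop[OF char k]]
  show ?thesis
  proof (rule Dist_GI)
    show "klin (dist_mult \<phi> \<psi>)"
      by (simp add: klin_def eq R part_add part_scale klinD[OF \<phi>(1)] distrib_left sum.distrib sum_distrib_left mult.left_commute)
    fix f :: "('k, 'm, 'n) KG" assume f: "f \<in> mpow (Suc t + Suc s)"
    have "part p (Rop (\<lambda>y. \<psi> (part q y)) f) \<in> mpow (Suc t)" for p q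
      by (intro mpow_part Rop_mpow[OF k _ f] \<psi>(2))
    then show "dist_mult \<phi> \<psi> f = 0" by (simp only: eq \<phi>(2) mult_zero_right sum.neutral_const)
  qed
qed

lemma ker_pi_iff:
  fixes \<xi> :: "('k, 'm::{finite,linorder}, 'n::{finite,linorder}) functional"
  shows "\<xi> \<in> ker_pi (dominant_weights l) \<longleftrightarrow> \<xi> \<in> Dist_G \<and> (\<forall>f\<in>Kdeg l. \<xi> f = 0)"
  by (auto simp: ker_pi_def pi_Gamma_def schur_zero_def C_Gamma_dominant_weights[OF char] restrict_def fun_eq_iff split: if_splits)

text \<open>\<open>Kdeg l\<close> is stable under all \<open>Rop\<close> and all \<open>Lop\<close>,
  hence it is a subsupercoalgebra, and its annihilator absorbs products on both sides.\<close>

lemma superideal_ker_pi: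
  "superideal (ker_pi (dominant_weights l) :: ('k, 'm::{finite,linorder}, 'n::{finite,linorder}) functional set)"
  unfolding superideal_def
proof (intro conjI ballI allI)
  show "(ker_pi (dominant_weights l) :: ('k, 'm, 'n) functional set) \<subseteq> Dist_G" by (auto simp: ker_pi_iff)
  show "(\<lambda>f. 0) \<in> (ker_pi (dominant_weights l) :: ('k, 'm, 'n) functional set)"
    by (auto simp: ker_pi_iff Dist_G_iff klin_zero)
  fix \<xi> :: "('k, 'm, 'n) functional" assume \<xi>: "\<xi> \<in> ker_pi (dominant_weights l)"
  then obtain t where t: "klin \<xi>" "\<And>f. f \<in> mpow (Suc t) \<Longrightarrow> \<xi> f = 0" "\<And>f. f \<in> Kdeg l \<Longrightarrow> \<xi> f = 0"
    unfolding ker_pi_iff Dist_G_iff by blast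
  show "(\<lambda>f. r * \<xi> f) \<in> ker_pi (dominant_weights l)" for r
    unfolding ker_pi_iff by (auto intro!: Dist_GI[of _ "Suc t"] klin_closed(3) t(1) simp: t(2,3) simp del: ideal_power.simps)
  show "(\<lambda>f. \<xi> (part p f)) \<in> ker_pi (dominant_weights l)" for p
    unfolding ker_pi_iff
  proof
    show "(\<lambda>f. \<xi> (part p f)) \<in> Dist_G"
      by (rule Dist_GI[OF klin_closed(2)[OF t(1) kend_closed(3)]]) (intro t(2) mpow_part)
    show "\<forall>f\<in>Kdeg l. \<xi> (part p f) = 0"
      using subsupermodule_Kdeg[OF char, of l, where 'm = 'm and 'n = 'n] t(3) by (simp add: subsupermodule_iff)
  qed
  fix \<eta> :: "('k, 'm, 'n) functional"
  {
    assume "\<eta> \<in> ker_pi (dominant_weights l)"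
    then obtain s where s: "klin \<eta>" "\<And>f. f \<in> mpow (Suc s) \<Longrightarrow> \<eta> f = 0" "\<And>f. f \<in> Kdeg l \<Longrightarrow> \<eta> f = 0"
      unfolding ker_pi_iff Dist_G_iff by blast
    have "\<xi> f + \<eta> f = 0" if "f \<in> mpow (Suc t + Suc s)" for f
      using that t(2)[OF mpow_decreasing[of "Suc t" "Suc t + Suc s" f]] s(2)[OF mpow_decreasing[of "Suc s" "Suc t + Suc s" f]]
      by (simp del: ideal_power.simps)
    then show "(\<lambda>f. \<xi> f + \<eta> f) \<in> ker_pi (dominant_weights l)"
      unfolding ker_pi_iff using t(3) s(3) Dist_GI[OF klin_add[OF t(1) s(1)], of "Suc t + Suc s"]
      by (simp del: ideal_power.simps add_Suc add_Suc_right)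
  }
  assume \<eta>: "\<eta> \<in> Dist_G"
  then have k\<eta>: "klin \<eta>" by (simp add: Dist_G_iff)
  have kp: "klin (\<lambda>y. \<psi> (part q y))" if "klin \<psi>" for \<psi> :: "('k, 'm, 'n) functional" and q
    by (rule klin_closed(2)[OF that kend_closed(3)])
  have sub: "subsupermodule (Kdeg l :: ('k, 'm, 'n) KG set)" by (rule subsupermodule_Kdeg[OF char])
  have D: "\<xi> \<in> Dist_G" using \<xi> by (simp add: ker_pi_iff)
  have "dist_mult \<eta> \<xi> f = 0" if f: "f \<in> Kdeg l" for f
  proof -
    \<comment> \<open>Tested by \<alpha>, this contraction becomes the value of \<xi> on a component
      of \<open>Lop \<alpha> f\<close>, which again lies in \<open>Kdeg l\<close>.\<close>
    have "Rop (\<lambda>y. \<xi> (part q y)) f = 0" for q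
    proof (rule KG_eqI)
      fix \<alpha> :: "('k, 'm, 'n) functional" assume \<alpha>: "klin \<alpha>"
      have "Lop \<alpha> f \<in> Kdeg l" using Lop_compR[OF char \<alpha>, of "has_degree l" f] f by (simp add: Kdeg_def)
      then have "\<xi> (part q (Lop \<alpha> f)) = 0" using sub t(3) by (simp add: subsupermodule_iff)
      then show "\<alpha> (Rop (\<lambda>y. \<xi> (part q y)) f) = \<alpha> 0" using apply_Rop[OF \<alpha> kp[OF t(1)], of q f] by (simp add: klin_0[OF \<alpha>])
    qed
    then show ?thesis by (simp add: dist_mult_eq[OF k\<eta> t(1)] klin_0[OF k\<eta>])
  qed
  then show "dist_mult \<eta> \<xi> \<in> ker_pi (dominant_weights l)"
    using dist_mult_Dist_G[OF \<eta> D] by (simp add: ker_pi_iff)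
  have "dist_mult \<xi> \<eta> f = 0" if f: "f \<in> Kdeg l" for f
  proof -
    have "part p (Rop (\<lambda>y. \<eta> (part q y)) f) \<in> Kdeg l" for p q
      using sub f kp[OF k\<eta>] by (simp add: subsupermodule_iff)
    then show ?thesis by (simp add: dist_mult_eq[OF t(1) k\<eta>] t(3))
  qed
  then show "dist_mult \<xi> \<eta> \<in> ker_pi (dominant_weights l)"
    using dist_mult_Dist_G[OF D \<eta>] by (simp add: ker_pi_iff)
qed

end

section \<open>Degrees modulo powers of the characteristic and the generation of the kernel\<close>

section \<open>Degrees modulo a power of the characteristic\<close>

text \<open>The value at t = 1 of the part of a Laurent polynomial in the degrees selected by
  \<open>P\<close>.\<close>

definition psum :: "(int \<Rightarrow> bool) \<Rightarrow> (int \<Rightarrow>\<^sub>0 'k::comm_ring_1) \<Rightarrow> 'k" where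
  "psum P x = (\<Sum>d\<in>Poly_Mapping.keys x. if P d then Poly_Mapping.lookup x d else 0)"

lemma psum_superset:
  "finite A \<Longrightarrow> Poly_Mapping.keys x \<subseteq> A \<Longrightarrow> psum P x = (\<Sum>d\<in>A. if P d then Poly_Mapping.lookup x d else 0)"
  unfolding psum_def by (rule sum.mono_neutral_left) (auto simp: in_keys_iff)

lemma psum_add: "psum P (x + y) = psum P x + psum P y"
proof -
  let ?A = "Poly_Mapping.keys x \<union> Poly_Mapping.keys y"
  have "psum P (x + y) = (\<Sum>d\<in>?A. if P d then Poly_Mapping.lookup (x + y) d else 0)"
    by (rule psum_superset) (simp_all add: Poly_Mapping.keys_add)
  also have "\<dots> = (\<Sum>d\<in>?A. (if P d then Poly_Mapping.lookup x d else 0) + (if P d then Poly_Mapping.lookup y d else 0))"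
    by (intro sum.cong) (simp_all add: lookup_add)
  finally show ?thesis by (simp add: psum_superset[of ?A] sum.distrib)
qed

lemma psum_0 [simp]: "psum P 0 = 0" by (simp add: psum_def)

lemma psum_diff: "psum P (x - y) = psum P x - psum P y"
  using psum_add[of P "x - y" y] by simp

lemma psum_single: "psum P (Poly_Mapping.single d r) = (if P d then r else 0)"
  by (simp add: psum_def)

lemma psum_sum: "psum P (sum f A) = (\<Sum>a\<in>A. psum P (f a))"
  by (induction A rule: infinite_finite_induct) (simp_all add: psum_add)

lemma psum_single_mult: "psum P (Poly_Mapping.single d r * x) = r * psum (\<lambda>e. P (d + e)) x"
proof -
  have x: "(\<Sum>e\<in>Poly_Mapping.keys x. Poly_Mapping.single e (Poly_Mapping.lookup x e)) = x"
    by (rule poly_mapping_eqI) (simp add: lookup_sum lookup_single when_def in_keys_iff)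
  have "psum P (Poly_Mapping.single d r * (\<Sum>e\<in>A. Poly_Mapping.single e (Poly_Mapping.lookup x e))) =
      r * psum (\<lambda>e. P (d + e)) (\<Sum>e\<in>A. Poly_Mapping.single e (Poly_Mapping.lookup x e))" for A
    unfolding sum_distrib_left psum_sum by (intro sum.cong) (simp_all add: mult_single psum_single)
  from this[of "Poly_Mapping.keys x"] show ?thesis by (simp only: x)
qed

text \<open>Restriction to the subgroup of scalar matrices.\<close>

lemma scalar_restriction:
  obtains H :: "('k::field, 'm::{finite,linorder}, 'n::{finite,linorder}) KG \<Rightarrow> (int \<Rightarrow>\<^sub>0 'k)" where
    "\<And>f g. H (f + g) = H f + H g" "\<And>r f. H (kg_scale r f) = Poly_Mapping.single 0 r * H f" "H 1 = 1"
    "\<And>f g. H (f * g) = H f * H g" "\<And>i j. H (coord i j) = (if i = j then Poly_Mapping.single 1 1 else 0)"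
    "H det_inv = Poly_Mapping.single (- int CARD('m + 'n)) 1"
proof -
  let ?s = "\<lambda>r x. Poly_Mapping.single 0 r * x :: int \<Rightarrow>\<^sub>0 'k"
  define h :: "('m, 'n) gen \<Rightarrow> (int \<Rightarrow>\<^sub>0 'k)" where
    "h = case_gen (\<lambda>i j. if i = j then Poly_Mapping.single 1 1 else 0) (Poly_Mapping.single (- int CARD('m + 'n)) 1)"
  have h: "h (Coord i j) = (if i = j then Poly_Mapping.single 1 1 else 0)" "h DetInv = Poly_Mapping.single (- int CARD('m + 'n)) 1" for i j
    by (simp_all add: h_def)
  have pm: "prod_list (map (\<lambda>i. Poly_Mapping.single 1 1) xs) = (Poly_Mapping.single (int (length xs)) 1 :: int \<Rightarrow>\<^sub>0 'k)" for xs :: "'m list"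
    by (induction xs) (simp_all add: mult_single)
  have pn: "prod_list (map (\<lambda>i. Poly_Mapping.single 1 1) xs) = (Poly_Mapping.single (int (length xs)) 1 :: int \<Rightarrow>\<^sub>0 'k)" for xs :: "'n list"
    by (induction xs) (simp_all add: mult_single)
  have vs: "vector_space ?s"
    by standard (simp_all add: distrib_left distrib_right single_add mult.assoc[symmetric] mult_single)
  have odd: "h x = 0" if "gen_parity x" for x
    using that by (cases x) (auto simp: h)
  have "\<exists>H :: ('k, 'm, 'n) KG \<Rightarrow> _. Vector_Spaces.linear kg_scale ?s H \<and> H 1 = 1 \<and> (\<forall>f g. H (f * g) = H f * H g) \<and>
     (\<forall>i j. H (coord i j) = h (Coord i j)) \<and> H det_inv = h DetInv"
  proof (rule KG_hom_exists[OF vs])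
    show "h x * h y = (if gen_parity x \<and> gen_parity y then - (h y * h x) else h y * h x)" for x y
      using odd by (simp add: mult.commute)
    have "pdet (\<lambda>i j. h (Coord (Inl i) (Inl j))) = Poly_Mapping.single (int CARD('m)) 1"
      by (subst pdet_triangular) (simp_all add: h pm)
    moreover have "pdet (\<lambda>i j. h (Coord (Inr i) (Inr j))) = Poly_Mapping.single (int CARD('n)) 1"
      by (subst pdet_triangular) (simp_all add: h pn)
    ultimately show "h DetInv * (pdet (\<lambda>i j. h (Coord (Inl i) (Inl j))) * pdet (\<lambda>i j. h (Coord (Inr i) (Inr j)))) = 1"
      by (simp add: h mult_single flip: single_one)
  qed (simp_all add: mult.assoc mult.left_commute)
  then obtain H :: "('k, 'm, 'n) KG \<Rightarrow> (int \<Rightarrow>\<^sub>0 'k)" where H: "Vector_Spaces.linear kg_scale ?s H" "H 1 = 1"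
    "\<And>f g. H (f * g) = H f * H g" "\<And>i j. H (coord i j) = h (Coord i j)" "H det_inv = h DetInv" by blast
  show ?thesis by (rule that[of H]) (use H in \<open>auto simp: Vector_Spaces.linear_iff h\<close>)
qed

text \<open>The kernel of the counit restricts to the ideal generated by \<open>t - 1\<close> in the Laurent polynomials, and
  \<open>(t - 1) ^ q = t ^ q - 1\<close> for a power \<open>q\<close> of the characteristic.\<close>

lemma mod_degree_vanishes:
  fixes f :: "('k::field, 'm::{finite,linorder}, 'n::{finite,linorder}) KG"
  assumes p: "prime CHAR('k)" and f: "f \<in> mpow (CHAR('k) ^ s)"
  shows "counit (compR (\<lambda>\<nu>. int (CHAR('k) ^ s) dvd (\<Sum>i\<in>UNIV. \<nu> i) - l) f) = 0"
proof -
  let ?q = "CHAR('k) ^ s"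
  obtain H :: "('k, 'm, 'n) KG \<Rightarrow> (int \<Rightarrow>\<^sub>0 'k)" where H:
    "\<And>f g. H (f + g) = H f + H g" "\<And>r f. H (kg_scale r f) = Poly_Mapping.single 0 r * H f" "H 1 = 1"
    "\<And>f g. H (f * g) = H f * H g" "\<And>i j. H (coord i j) = (if i = j then Poly_Mapping.single 1 1 else 0)"
    "H det_inv = Poly_Mapping.single (- int CARD('m + 'n)) 1"
    by (rule scalar_restriction, rule that)
  \<comment> \<open>On scalar matrices the degree of a function becomes the exponent of t, and t = 1
    is the identity matrix.\<close>
  have "\<forall>P. psum P (H f) = counit (compR (\<lambda>\<nu>. P (\<Sum>i\<in>UNIV. \<nu> i)) f)"
  proof (induction f rule: KG_span_induct)
    case one
    then show ?case by (simp add: H wcomp_1 psum_single flip: single_one)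
  next
    case (coord i j f)
    show ?case
    proof
      fix P
      show "psum P (H (coord i j * f)) = counit (compR (\<lambda>\<nu>. P (\<Sum>i\<in>UNIV. \<nu> i)) (coord i j * f))"
        using spec[OF coord, of "\<lambda>d. P (1 + d)"]
        by (simp add: H wcomp_coord sum.distrib sum_unit_weight_1 psum_single_mult)
    qed
  next
    case (det_inv f)
    show ?case
    proof
      fix P
      have shift: "- int CARD('m) - int CARD('n) + d = d - (int CARD('m) + int CARD('n))" for d by simp
      show "psum P (H (det_inv * f)) = counit (compR (\<lambda>\<nu>. P (\<Sum>i\<in>UNIV. \<nu> i)) (det_inv * f))"
        using spec[OF det_inv, of "\<lambda>d. P (d - (int CARD('m) + int CARD('n)))"]
        by (simp add: shift H bihomD[OF bihom_det_inv] sum_subtractf psum_single_mult)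
    qed
  qed (simp_all add: H wcomp_add wcomp_scale psum_add psum_single_mult)
  then have ps: "psum P (H f) = counit (compR (\<lambda>\<nu>. P (\<Sum>i\<in>UNIV. \<nu> i)) f)" for P by blast
  let ?t = "Poly_Mapping.single 1 1 :: int \<Rightarrow>\<^sub>0 'k"
  have tn: "?t ^ n = Poly_Mapping.single (int n) 1" for n
    by (induction n) (simp_all add: mult_single flip: single_one)
  have aug: "?t - 1 dvd H g - Poly_Mapping.single 0 (counit g)" for g
  proof (induction g rule: KG_span_induct)
    case (add f g)
    then have "?t - 1 dvd (H f - Poly_Mapping.single 0 (counit f)) + (H g - Poly_Mapping.single 0 (counit g))" by (rule dvd_add)
    then show ?case by (simp add: H single_add algebra_simps)
  next
    case (scale r f)
    then have "?t - 1 dvd Poly_Mapping.single 0 r * (H f - Poly_Mapping.single 0 (counit f))" by (rule dvd_mult)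
    then show ?case by (simp add: H right_diff_distrib mult_single)
  next
    case (coord i j f)
    have "?t - 1 dvd ?t * (H f - Poly_Mapping.single 0 (counit f)) + (?t - 1) * Poly_Mapping.single 0 (counit f)"
      by (rule dvd_add[OF dvd_mult[OF coord] dvd_triv_left])
    then show ?case by (simp add: H algebra_simps)
  next
    case (det_inv f)
    let ?u = "Poly_Mapping.single (- int CARD('m + 'n)) 1 :: int \<Rightarrow>\<^sub>0 'k"
    have "?t - 1 dvd ?t ^ CARD('m + 'n) - 1" by (simp only: power_diff_1_eq dvd_triv_left)
    then have "?t - 1 dvd (- ?u) * (?t ^ CARD('m + 'n) - 1)" by (rule dvd_mult)
    also have "(- ?u) * (?t ^ CARD('m + 'n) - 1) = ?u - 1" by (simp add: tn right_diff_distrib mult_single)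
    finally have u: "?t - 1 dvd ?u - 1" .
    have "?t - 1 dvd ?u * (H f - Poly_Mapping.single 0 (counit f)) + (?u - 1) * Poly_Mapping.single 0 (counit f)"
      by (rule dvd_add[OF dvd_mult[OF det_inv] dvd_mult2[OF u]])
    then show ?case by (simp add: H algebra_simps)
  qed (simp add: H)
  have pow: "g \<in> mpow n \<Longrightarrow> (?t - 1) ^ n dvd H g" for n g
  proof (induction n arbitrary: g)
    case (Suc n)
    from Suc.prems show ?case
    proof (induction rule: mpow_induct)
      case zero
      have "H 0 = 0" using H(2)[of 0 0] by simp
      then show ?case by simp
    next
      case (mult a b)
      have "?t - 1 dvd H a" using aug[of a] mult(1) by simp
      then show ?case using Suc.IH[OF mult(2)] by (simp add: H mult_dvd_mono)
    qed (simp_all add: H)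
  qed simp
  have "of_nat CHAR('k) = (0 :: int \<Rightarrow>\<^sub>0 'k)"
  proof -
    have "of_nat n = (Poly_Mapping.single 0 (of_nat n) :: int \<Rightarrow>\<^sub>0 'k)" for n
      by (induction n) (simp_all add: single_add flip: single_one)
    from this[of "CHAR('k)"] show ?thesis by (simp only: of_nat_CHAR single_zero)
  qed
  then have "(?t - 1) ^ ?q = ?t ^ ?q - 1" by (rule frobenius_minus_1[OF p])
  then obtain y where y: "H f = (Poly_Mapping.single (int ?q) 1 - 1) * y" using pow[OF f] tn[of ?q] by (auto elim!: dvdE)
  have "psum (\<lambda>d. int ?q dvd d - l) (H f) = 0"
  proof -
    \<comment> \<open>A congruence class modulo q is invariant under the shift by q, so the two
      terms of (t^q - 1) y contribute the same sum.\<close>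
    have "(\<lambda>e. int ?q dvd int ?q + e - l) = (\<lambda>d. int ?q dvd d - l)"
      by (simp add: fun_eq_iff add_diff_eq[symmetric])
    then show ?thesis
      unfolding y left_diff_distrib psum_diff psum_single_mult by simp
  qed
  then show ?thesis using ps[of "\<lambda>d. int ?q dvd d - l"] by simp
qed

lemma parity_character: "parity False (character \<mu> :: ('k::field, 'm::{finite,linorder}, 'n::{finite,linorder}) KG)"
proof -
  have "parity False (diag_inv i :: ('k, 'm, 'n) KG)" for i
    unfolding diag_inv_def by (intro parity_even_mult parity_det_inv parity_prod_list) (auto simp: parity_diag)
  then have "parity False (chi_factor i n :: ('k, 'm, 'n) KG)" for i n
    by (simp add: chi_factor_def parity_power parity_diag)
  then show ?thesis unfolding character_eq by (intro parity_prod_list) auto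
qed

context
  assumes char: "CHAR('k::field) > 2"
begin

lemma kills_congruent_degrees:
  fixes \<xi> :: "('k, 'm::{finite,linorder}, 'n::{finite,linorder}) functional"
  assumes \<xi>: "klin \<xi>" "\<And>f. f \<in> mpow (CHAR('k) ^ s) \<Longrightarrow> \<xi> f = 0" "\<And>f. f \<in> Kdeg l \<Longrightarrow> \<xi> f = 0"
    and d: "int (CHAR('k) ^ s) dvd d - l" and f: "f \<in> Kdeg d"
  shows "\<xi> f = 0"
proof -
  let ?q = "CHAR('k) ^ s"
  obtain k where k: "d - l = int ?q * k" using d by (elim dvdE)
  obtain i :: "'m + 'n" where True by blast
  \<comment> \<open>Any index i serves: this character has degree -k, so its q-th power moves degree
    d to degree d - q k = l.\<close>
  define \<mu> where "\<mu> = (\<lambda>j. - k * unit_weight i j)"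
  let ?y = "character \<mu> :: ('k, 'm, 'n) KG"
  have s\<mu>: "(\<Sum>j\<in>UNIV. \<mu> j) = - k" by (simp add: \<mu>_def sum_negf sum_unit_weight_1 flip: sum_distrib_left)
  have b: "bihom (\<lambda>j. int ?q * \<mu> j, \<lambda>j. int ?q * \<mu> j) (?y ^ ?q)" by (rule bihom_power[OF bihom_character])
  have "?y ^ ?q * f \<in> Kdeg l"
  proof -
    have "has_degree l (snd ((\<lambda>j. int ?q * \<mu> j, \<lambda>j. int ?q * \<mu> j) + x)) = has_degree d (snd x)" for x :: "('m, 'n) biweight"
      using k by (auto simp: has_degree_def sum.distrib s\<mu> simp flip: sum_distrib_left)
    then have "compR (has_degree l) (?y ^ ?q * f) = ?y ^ ?q * compR (has_degree d) f" by (simp only: bihomD[OF b])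
    then show ?thesis using f by (simp add: Kdeg_def)
  qed
  then have "\<xi> (?y ^ ?q * f) = 0" by (rule \<xi>(3))
  moreover have "\<xi> ((?y ^ ?q - 1) * f) = 0"
  proof (rule \<xi>(2))
    have "of_nat CHAR('k) = (0 :: ('k, 'm, 'n) KG)" by (simp add: of_nat_KG)
    then have "(?y - 1) ^ ?q = ?y ^ ?q - 1" by (rule frobenius_minus_1[OF prime_char[OF char]])
    moreover have "(?y - 1) ^ ?q \<in> mpow ?q" by (rule mpow_power) (simp add: counit_character)
    ultimately have "f * (?y ^ ?q - 1) \<in> mpow ?q" by (simp add: mpow_ideal)
    moreover have "f * (?y ^ ?q - 1) = (?y ^ ?q - 1) * f"
      using even_central[OF parity_power[OF parity_character], of \<mu> ?q f] by (simp add: algebra_simps)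
    ultimately show "(?y ^ ?q - 1) * f \<in> mpow ?q" by simp
  qed
  moreover have "f = ?y ^ ?q * f - (?y ^ ?q - 1) * f" by (simp add: algebra_simps)
  ultimately show ?thesis using klin_diff[OF \<xi>(1)] by (metis diff_zero)
qed

lemma ker_pi_subset:
  fixes \<xi> :: "('k, 'm::{finite,linorder}, 'n::{finite,linorder}) functional"
  assumes \<xi>: "\<xi> \<in> ker_pi (dominant_weights l)"
  shows "\<exists>e \<in> Dist_T \<inter> ker_pi (dominant_weights l). dist_mult \<xi> e = \<xi>"
proof -
  obtain t where t: "klin \<xi>" "\<And>f. f \<in> mpow (Suc t) \<Longrightarrow> \<xi> f = 0" "\<And>f. f \<in> Kdeg l \<Longrightarrow> \<xi> f = 0"
    using \<xi> unfolding ker_pi_iff[OF char] Dist_G_iff by blast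
  \<comment> \<open>The exponent t + 1 guarantees q > t, so \<xi> vanishes on the power q of the
    augmentation ideal.\<close>
  let ?q = "CHAR('k) ^ Suc t"
  have q: "Suc t \<le> ?q"
  proof -
    have "Suc t < 2 ^ Suc t" by (rule less_exp)
    also have "\<dots> \<le> ?q" using char by (intro power_mono) auto
    finally show ?thesis by simp
  qed
  let ?P = "\<lambda>\<nu> :: ('m, 'n) weight. int ?q dvd (\<Sum>i\<in>UNIV. \<nu> i) - l"
  define e where "e f = counit f - counit (compR ?P f)" for f :: "('k, 'm, 'n) KG"
  have ke: "klin e" by (simp add: klin_def e_def wcomp_add wcomp_scale algebra_simps)
  have "e \<in> Dist_G"
  proof (rule Dist_GI[OF ke])
    fix f :: "('k, 'm, 'n) KG" assume f: "f \<in> mpow ?q"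
    moreover have "Suc 0 \<le> ?q" using q by linarith
    ultimately have "f \<in> mpow (Suc 0)" by (rule mpow_decreasing[rotated])
    then have "counit f = 0" by (induction rule: mpow_induct) simp_all
    then show "e f = 0" using mod_degree_vanishes[OF prime_char[OF char] f, of l] by (simp add: e_def)
  qed
  moreover have "e f = 0" if "f \<in> torus_ideal" for f
    using that unfolding torus_ideal_def
  proof (induction rule: two_sided_ideal_induct)
    case (base a f b)
    then show ?case by (auto simp: e_def mult.assoc counit_wcomp_offdiag)
  qed (simp_all add: klin_0[OF ke] klinD[OF ke])
  moreover have "e f = 0" if f: "f \<in> Kdeg l" for f
  proof -
    have "(\<lambda>g. ?P (snd g) \<and> has_degree l (snd g)) = (\<lambda>g. has_degree l (snd g))" by (auto simp: has_degree_def fun_eq_iff)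
    then have "compR ?P (compR (has_degree l) f) = compR (has_degree l) f"
      unfolding wcomp_wcomp by (rule arg_cong[where f = "\<lambda>Q. wcomp Q f"])
    moreover have "compR (has_degree l) f = f" using f by (simp add: Kdeg_def)
    ultimately show ?thesis by (simp only: e_def diff_self)
  qed
  ultimately have e: "e \<in> Dist_T \<inter> ker_pi (dominant_weights l)" by (simp add: Dist_T_def ker_pi_iff[OF char])
  have "dist_mult \<xi> e f = \<xi> f" for f
  proof -
    \<comment> \<open>The functional e is even, since the counit is and the projection preserves
      parities; hence the signs in the product with \<xi> disappear.\<close>
    have ep: "(\<lambda>y. e (part q y)) = (\<lambda>y. (if q then 0 else 1) * e y)" for q
      by (auto simp: e_def counit_part simp flip: part_wcomp)
    have "dist_mult \<xi> e f = (\<Sum>p\<in>UNIV. \<xi> (part p (Rop e f)))"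
      unfolding dist_mult_eq[OF t(1) ke] ep Rop_fun_scale by (simp add: UNIV_bool koszul_def klin_0[OF t(1)])
    also have "\<dots> = \<xi> (Rop e f)"
      using part_split[of "Rop e f"] by (simp add: UNIV_bool add.commute flip: klinD(1)[OF t(1)])
    \<comment> \<open>\<open>Rop e\<close> is the projection away from the degrees congruent to l
      modulo q.\<close>
    also have "Rop e f = f - compR ?P f"
    proof -
      have "e = (\<lambda>y. counit y + (- 1) * counit (compR ?P y))" by (simp add: e_def fun_eq_iff)
      then have "Rop e f = Rop counit f + kg_scale (- 1) (Rop (\<lambda>y. counit (compR ?P y)) f)"
        by (simp only: Rop_fun_add Rop_fun_scale)
      also have "Rop (\<lambda>y. counit (compR ?P y)) f = Rop counit (compR ?P f)"
        by (rule Rop_compR[OF char klin_closed(1), of ?P, symmetric])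
      finally show ?thesis by (simp add: Rop_counit[OF char])
    qed
    also have "\<xi> (f - compR ?P f) = \<xi> f - \<xi> (compR ?P f)" by (rule klin_diff[OF t(1)])
    also have "\<xi> (compR ?P f) = 0"
    proof -
      \<comment> \<open>The projected element is split by degree: \<xi> kills the parts in degrees
        congruent to l, and there are no other parts.\<close>
      let ?g = "compR ?P f"
      obtain D where D: "?g = (\<Sum>d\<in>D. wcomp (\<lambda>g. (\<Sum>i\<in>UNIV. snd g i) = d) ?g)"
        using wcomp_sum[of ?g "\<lambda>g. \<Sum>i\<in>UNIV. snd g i"] by metis
      have "\<xi> (wcomp (\<lambda>g. (\<Sum>i\<in>UNIV. snd g i) = d) ?g) = 0" for d
      proof (cases "int ?q dvd d - l")
        case True
        show ?thesis
        proof (rule kills_congruent_degrees[OF t(1) _ t(3) True])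
          show "\<xi> y = 0" if "y \<in> mpow ?q" for y using t(2)[OF mpow_decreasing[OF q that]] .
          show "wcomp (\<lambda>g. (\<Sum>i\<in>UNIV. snd g i) = d) ?g \<in> Kdeg d"
            by (simp add: Kdeg_def has_degree_def wcomp_wcomp)
        qed
      next
        case False
        then have "(\<lambda>g. (\<Sum>i\<in>UNIV. snd g i) = d \<and> ?P (snd g)) = (\<lambda>g :: ('m, 'n) biweight. False)" by (intro ext) auto
        then have "wcomp (\<lambda>g. (\<Sum>i\<in>UNIV. snd g i) = d) ?g = 0" by (simp only: wcomp_wcomp wcomp_False)
        then show ?thesis by (simp add: klin_0[OF t(1)])
      qed
      then have "(\<Sum>d\<in>D. \<xi> (wcomp (\<lambda>g. (\<Sum>i\<in>UNIV. snd g i) = d) ?g)) = 0" by (simp only: sum.neutral_const)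
      then show ?thesis using D klin_sum[OF t(1)] by metis
    qed
    finally show ?thesis by simp
  qed
  then show ?thesis using e by blast
qed

end

theorem theorem13p2:
  fixes l :: int
  assumes "CHAR('k::field) > 2"
  shows "(ker_pi (dominant_weights l) :: ('k, 'm::{finite,linorder}, 'n::{finite,linorder}) functional set) =
    superideal_generated (Dist_T \<inter> ker_pi (dominant_weights l))"
proof
  show "ker_pi (dominant_weights l) \<subseteq> (superideal_generated (Dist_T \<inter> ker_pi (dominant_weights l)) :: ('k, 'm, 'n) functional set)"
    unfolding superideal_generated_def
  proof (intro subsetI InterI)
    fix \<xi> :: "('k, 'm, 'n) functional" and I :: "('k, 'm, 'n) functional set"
    assume \<xi>: "\<xi> \<in> ker_pi (dominant_weights l)"
      and "I \<in> {I. superideal I \<and> Dist_T \<inter> ker_pi (dominant_weights l) \<subseteq> I}"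
    then have I: "superideal I" "Dist_T \<inter> ker_pi (dominant_weights l) \<subseteq> I" by simp_all
    obtain e where e: "e \<in> Dist_T \<inter> ker_pi (dominant_weights l)" "dist_mult \<xi> e = \<xi>"
      using ker_pi_subset[OF assms \<xi>] by blast
    have "\<xi> \<in> Dist_G" using \<xi> by (simp add: ker_pi_def)
    then have "dist_mult \<xi> e \<in> I" using I e(1) unfolding superideal_def by blast
    then show "\<xi> \<in> I" by (simp only: e(2))
  qed
  show "(superideal_generated (Dist_T \<inter> ker_pi (dominant_weights l)) :: ('k, 'm, 'n) functional set) \<subseteq> ker_pi (dominant_weights l)"
    unfolding superideal_generated_def using superideal_ker_pi[OF assms, of l] by blast
qed

end
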